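(* The Whitney (B) condition is a $\mathcal{WL}$ condition of class $C^q$ (for $q\ge 1$).
   Context: Fix $q\in\{1,2,\dots\}\cup\{\infty,\omega\}$ and an o-minimal structure $\mathcal{D}$ on the ordered field $\mathbb{R}$ admitting definable $C^q$ cell decompositions; "definable" means definable in $\mathcal{D}$. **Whitney (B).** Let $N,M$ be $C^q$ submanifolds of $\mathbb{R}^n$ with $N\subset\overline M\setminus M$ and $a\in N$. The pair $(M,N)$ satisfies the Whitney (B) condition at $a$ if for any sequences $a_\nu\in N$, $b_\nu\in M$ both converging to $a$ such that the secant lines $\mathbb{R}(a_\nu-b_\nu)$ converge to a line $L$ in $\mathbb{P}_{n-1}$ and the tangent spaces $T_{b_\nu}M$ converge to a subspace $T$ in the Grassmannian $\mathbb{G}_{\dim M,n}$, one has $L\subset T$. **Stratifications.** A $C^q$ stratification of $A\subset\mathbb{R}^n$ is a finite family $\mathfrak{X}_A$ of connected $C^q$ submanifolds of $\mathbb{R}^n$ (strata), pairwise disjoint, with union $A$, such that for each $\Gamma\in\mathfrak{X}_A$ the set $(\overline\Gamma\setminus\Gamma)\cap A$ is a union of strata of dimension $<\dim\Gamma$. **Weakly Lipschitz.** $f:A\to\mathbb{R}^m$ is weakly Lipschitz of class $C^q$ on $\mathfrak{X}_A$ if $f|_\Gamma$ is of class $C^q$ for each $\Gamma\in\mathfrak{X}_A$ and, whenever $\Lambda,\Gamma\in\mathfrak{X}_A$, $\Gamma\subset\overline\Lambda\setminus\Lambda$, $a\in\Gamma$, $a_\nu\in\Gamma$, $b_\nu\in\Lambda$,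 $a_\nu\to a$, $b_\nu\to a$, one has $\limsup_{\nu}\frac{|f(a_\nu)-f(b_\nu)|}{|a_\nu-b_\nu|}<+\infty$. The induced stratification of $\mathrm{graph} f$ is $\mathfrak{X}_{\mathrm{graph} f}(\mathfrak{X}_A)=\{\mathrm{graph} f|_\Gamma:\Gamma\in\mathfrak{X}_A\}$. A map is locally Lipschitz if each point of its domain has a neighbourhood in the domain on which it is Lipschitz. **Regularity conditions.** A (regularity) condition $\mathcal{Q}$ is a condition on pairs $(\Lambda,\Gamma)$ of $C^q$ submanifolds of a Euclidean space (any dimension) with $\Gamma\subset\overline\Lambda\setminus\Lambda$, at points $x\in\Gamma$. $\mathcal{W}^{\mathcal Q}(\Lambda,\Gamma,x)$ means that $\mathcal Q$ is satisfied for $(\Lambda,\Gamma)$ at $x$; $\mathcal{W}^{\mathcal Q}(\Lambda,\Gamma)$ means $\mathcal{W}^{\mathcal Q}(\Lambda,\Gamma,x)$ for all $x\in\Gamma$. Conditions considered are local: for every open neighbourhood $U$ of $x$, $\mathcal{W}^{\mathcal Q}(\Lambda,\Gamma,x)\iff\mathcal{W}^{\mathcal Q}(\Lambda\cap U,\Gamma\cap U,x)$. A stratification $\mathfrak{X}$ is a $\mathcal Q$-stratification if $\mathcal{W}^{\mathcal Q}(\Lambda,\Gamma)$ for all $\Lambda,\Gamma\in\mathfrak{X}$ with $\Gamma\subset\overline\Lambda\setminus\Lambda$. $\mathcal Q$ is a $\mathcal{WL}$ condition of class $C^q$ if: 1. (definable) for all definable $C^q$ submanifolds $\Lambda,\Gamma\subset\mathbb{R}^n$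 with $\Gamma\subset\overline\Lambda\setminus\Lambda$, the set $\{x\in\Gamma:\mathcal{W}^{\mathcal Q}(\Lambda,\Gamma,x)\}$ is definable; 2. (generic) for such $\Lambda,\Gamma$, the set of $x\in\Gamma$ at which $\mathcal{W}^{\mathcal Q}(\Lambda,\Gamma,x)$ fails is nowhere dense in $\Gamma$; 3. (invariant under definable $C^q$ diffeomorphisms) for any definable $C^q$ diffeomorphism $\phi:U\to W$ of open subsets of $\mathbb{R}^n$, any $C^q$ submanifolds $\Lambda,\Gamma\subset U$ with $\Gamma\subset\overline\Lambda\setminus\Lambda$ and any $x\in\Gamma$: $\mathcal{W}^{\mathcal Q}(\Lambda,\Gamma,x)\iff\mathcal{W}^{\mathcal Q}(\phi(\Lambda),\phi(\Gamma),\phi(x))$; 4. (projection property) for any $f:A\to\mathbb{R}^m$ weakly Lipschitz of class $C^q$ on a $C^q$ stratification $\mathfrak{X}_A$ of a set $A\subset\mathbb{R}^n$: if $\mathfrak{X}_{\mathrm{graph} f}(\mathfrak{X}_A)$ is a $\mathcal Q$-stratification, then $\mathfrak{X}_A$ is a $\mathcal Q$-stratification; 5. (lifting property) for any $C^q$ submanifolds $\Lambda,\Gamma\subset\mathbb{R}^n$ with $\Gamma\subset\overline\Lambda\setminus\Lambda$, any locally Lipschitz $f:\Lambda\cup\Gamma\to\mathbb{R}^m$ with $f|_\Lambda,f|_\Gamma$ of class $C^q$, and any $C^q$ submanifolds $M,N\subset\mathbb{R}^n$ with $N\subset\overline M\setminus M$ and each of $M,N$ contained in $\Lambda$ or in $\Gamma$: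 $\mathcal{W}^{\mathcal Q}(M,N)$ and $\mathcal{W}^{\mathcal Q}(\mathrm{graph} f|_\Lambda,\mathrm{graph} f|_\Gamma)$ imply $\mathcal{W}^{\mathcal Q}(\mathrm{graph} f|_M,\mathrm{graph} f|_N)$. *)

theory Defs
  imports "HOL-Analysis.Analysis"
begin

section \<open>The spaces \<open>\<real>\<^sup>n\<close> for varying \<open>n\<close>\<close>

text \<open>
  The dimensions of the Euclidean spaces are quantified over inside the definitions below (in the
  notions of an o-minimal structure and of a WL condition, and in the passage from a map on
  \<open>\<real>\<^sup>n\<close> to its graph in \<open>\<real>\<^sup>n\<^sup>+\<^sup>m\<close>), so they cannot be types. All spaces \<open>\<real>\<^sup>n\<close> are therefore realised
  as the subspaces \<open>Rn n\<close> of the inner product space \<open>evec\<close> of finitely supported real sequences.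
  Inner product, norm and topology of \<open>evec\<close> restrict to the usual ones on each \<open>Rn n\<close>, and \<open>Rn n\<close>
  is closed, so that closures in \<open>evec\<close> of subsets of \<open>Rn n\<close> are their closures in \<open>\<real>\<^sup>n\<close>.
\<close>

typedef evec = "{x :: nat \<Rightarrow> real. finite {i. x i \<noteq> 0}}"
  morphisms coord Abs_evec
  by (rule exI[of _ "\<lambda>_. 0"]) simp

setup_lifting type_definition_evec

lemma finite_coord [simp]: "finite {i. coord x i \<noteq> 0}"
  using coord[of x] by simp

lemma evec_eqI: "(\<And>i. coord x i = coord y i) \<Longrightarrow> x = y"
  by transfer auto

instantiation evec :: real_vector
begin

lift_definition zero_evec :: evec is "\<lambda>_. 0"
  by simp

lift_definition plus_evec :: "evec \<Rightarrow> evec \<Rightarrow> evec" is "\<lambda>x y i. x i + y i"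
  subgoal for x y by (rule finite_subset[of _ "{i. x i \<noteq> 0} \<union> {i. y i \<noteq> 0}"]) auto
  done

lift_definition uminus_evec :: "evec \<Rightarrow> evec" is "\<lambda>x i. - x i"
  by simp

lift_definition minus_evec :: "evec \<Rightarrow> evec \<Rightarrow> evec" is "\<lambda>x y i. x i - y i"
  subgoal for x y by (rule finite_subset[of _ "{i. x i \<noteq> 0} \<union> {i. y i \<noteq> 0}"]) auto
  done

lift_definition scaleR_evec :: "real \<Rightarrow> evec \<Rightarrow> evec" is "\<lambda>r x i. r * x i"
  by (rule finite_subset[of _ "{i. _ i \<noteq> 0}"]) auto

instance
  by standard (transfer; auto simp: algebra_simps)+

end

lemma coord_simps [simp]:
  "coord 0 i = 0"
  "coord (x + y) i = coord x i + coord y i"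
  "coord (x - y) i = coord x i - coord y i"
  "coord (- x) i = - coord x i"
  "coord (r *\<^sub>R x) i = r * coord x i"
  by (transfer; simp)+

instantiation evec :: real_inner
begin

definition inner_evec :: "evec \<Rightarrow> evec \<Rightarrow> real" where
  "inner_evec x y = (\<Sum>i | coord x i \<noteq> 0. coord x i * coord y i)"

definition norm_evec :: "evec \<Rightarrow> real" where
  "norm_evec x = sqrt (inner x x)"

definition sgn_evec :: "evec \<Rightarrow> evec" where
  "sgn_evec x = x /\<^sub>R norm x"

definition dist_evec :: "evec \<Rightarrow> evec \<Rightarrow> real" where
  "dist_evec x y = norm (x - y)"

definition uniformity_evec :: "(evec \<times> evec) filter" where
  "uniformity_evec = (INF e\<in>{0<..}. principal {(x, y). dist x y < e})"

definition open_evec :: "evec set \<Rightarrow> bool" where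
  "open_evec U \<longleftrightarrow> (\<forall>x\<in>U. \<forall>\<^sub>F (x', y) in uniformity. x' = x \<longrightarrow> y \<in> U)"

lemma inner_evec_superset:
  assumes "finite S" "{i. coord x i \<noteq> 0} \<subseteq> S"
  shows "inner x y = (\<Sum>i\<in>S. coord x i * coord y i)"
  unfolding inner_evec_def using assms by (intro sum.mono_neutral_left) auto

instance
proof
  fix x y z :: evec and r :: real
  define S where
    "S = {i. coord x i \<noteq> 0} \<union> {i. coord y i \<noteq> 0} \<union> {i. coord z i \<noteq> 0}"
  have S: "finite S" by (simp add: S_def)
  have eq: "inner u v = (\<Sum>i\<in>S. coord u i * coord v i)"
    if "u \<in> {x, y, z, x + y, r *\<^sub>R x}" for u v :: evec
    using that by (intro inner_evec_superset S) (auto simp: S_def)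
  show "inner x y = inner y x"
    by (simp add: eq mult.commute)
  show "inner (x + y) z = inner x z + inner y z"
    by (simp add: eq algebra_simps sum.distrib)
  show "inner (r *\<^sub>R x) y = r * inner x y"
    by (simp add: eq sum_distrib_left mult.assoc)
  show "0 \<le> inner x x"
    by (simp add: eq sum_nonneg)
  show "inner x x = 0 \<longleftrightarrow> x = 0"
  proof
    assume "inner x x = 0"
    then have "\<forall>i\<in>{i. coord x i \<noteq> 0}. coord x i * coord x i = 0"
      unfolding inner_evec_def by (subst (asm) sum_nonneg_eq_0_iff) auto
    then show "x = 0"
      by (intro evec_eqI) auto
  qed (simp add: inner_evec_def)
qed (simp_all add: norm_evec_def sgn_evec_def dist_evec_def uniformity_evec_def open_evec_def)

end

definition Rn :: "nat \<Rightarrow> evec set" where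
  "Rn n = {x. \<forall>i\<ge>n. coord x i = 0}"

abbreviation open_in_Rn :: "nat \<Rightarrow> evec set \<Rightarrow> bool" where
  "open_in_Rn n U \<equiv> openin (top_of_set (Rn n)) U"

text \<open>The projection \<open>(x\<^sub>0, x\<^sub>1, \<dots>) \<mapsto> (x\<^sub>0, \<dots>, x\<^sub>n\<^sub>-\<^sub>1)\<close>.\<close>

lift_definition vtrunc :: "nat \<Rightarrow> evec \<Rightarrow> evec" is "\<lambda>n x i. if i < n then x i else 0"
  by (rule finite_subset[of _ "{i. _ i \<noteq> 0}"]) auto

text \<open>\<open>vjoin n x y\<close> is the point \<open>(x, y)\<close> of \<open>\<real>\<^sup>n \<times> \<real>\<^sup>m = \<real>\<^sup>n\<^sup>+\<^sup>m\<close>, for \<open>x \<in> \<real>\<^sup>n\<close> and \<open>y \<in> \<real>\<^sup>m\<close>.\<close>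

lift_definition vjoin :: "nat \<Rightarrow> evec \<Rightarrow> evec \<Rightarrow> evec"
  is "\<lambda>n x y i. if i < n then x i else y (i - n)"
proof -
  fix n :: nat and x y :: "nat \<Rightarrow> real"
  assume y: "finite {i. y i \<noteq> 0}"
  have "{i. (if i < n then x i else y (i - n)) \<noteq> 0} \<subseteq> {..<n} \<union> (\<lambda>i. i + n) ` {i. y i \<noteq> 0}"
  proof
    fix i assume "i \<in> {i. (if i < n then x i else y (i - n)) \<noteq> 0}"
    then show "i \<in> {..<n} \<union> (\<lambda>i. i + n) ` {i. y i \<noteq> 0}"
      by (cases "i < n") (auto intro!: image_eqI[of _ _ "i - n"])
  qed
  then show "finite {i. (if i < n then x i else y (i - n)) \<noteq> 0}"
    by (rule finite_subset) (simp add: y)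
qed

text \<open>\<open>vsnoc n x t\<close> is the point \<open>(x, t)\<close> of \<open>\<real>\<^sup>n \<times> \<real> = \<real>\<^sup>n\<^sup>+\<^sup>1\<close>.\<close>

lift_definition vsnoc :: "nat \<Rightarrow> evec \<Rightarrow> real \<Rightarrow> evec"
  is "\<lambda>n x t i. if i < n then x i else if i = n then t else 0"
  by (rule finite_subset[of _ "{.._}"]) (auto split: if_splits)

definition vprod :: "nat \<Rightarrow> evec set \<Rightarrow> evec set \<Rightarrow> evec set" where
  "vprod n A B = {vjoin n x y | x y. x \<in> A \<and> y \<in> B}"

definition graph_on :: "nat \<Rightarrow> (evec \<Rightarrow> evec) \<Rightarrow> evec set \<Rightarrow> evec set" where
  "graph_on n f S = (\<lambda>x. vjoin n x (f x)) ` S"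

definition rgraph_on :: "nat \<Rightarrow> (evec \<Rightarrow> real) \<Rightarrow> evec set \<Rightarrow> evec set" where
  "rgraph_on n f S = (\<lambda>x. vsnoc n x (f x)) ` S"


section \<open>Maps of class \<open>C\<^sup>q\<close>, submanifolds, tangent spaces\<close>

text \<open>The classes \<open>C\<^sup>k\<close> (\<open>k\<close> finite), \<open>C\<^sup>\<infinity>\<close> and \<open>C\<^sup>\<omega>\<close> (real analytic).\<close>

datatype smoothness = C_fin nat | C_inf | C_omega

text \<open>
  \<open>C\<^sup>k\<close> on an open subset \<open>U\<close> of \<open>\<real>\<^sup>n\<close>. The derivative \<open>f' x\<close> is determined by \<open>f\<close> only on
  \<open>Rn n\<close>, which is why only directions \<open>v \<in> Rn n\<close> occur.
\<close>

primrec Ck_on :: "nat \<Rightarrow> nat \<Rightarrow> evec set \<Rightarrow> (evec \<Rightarrow> 'b::real_normed_vector) \<Rightarrow> bool" where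
  "Ck_on 0 n U f \<longleftrightarrow> continuous_on U f"
| "Ck_on (Suc k) n U f \<longleftrightarrow>
     (\<exists>f'. (\<forall>x\<in>U. (f has_derivative f' x) (at x within U)) \<and>
           (\<forall>v\<in>Rn n. Ck_on k n U (\<lambda>x. f' x v)))"

text \<open>Locally the sum of a convergent power series in \<open>n\<close> variables; \<open>\<alpha>\<close> runs over the multi-indices.\<close>

definition real_analytic_on :: "nat \<Rightarrow> evec set \<Rightarrow> (evec \<Rightarrow> 'b::real_normed_vector) \<Rightarrow> bool" where
  "real_analytic_on n U f \<longleftrightarrow>
     (\<forall>a\<in>U. \<exists>r>0. \<exists>c :: (nat \<Rightarrow> nat) \<Rightarrow> 'b. \<forall>x\<in>U \<inter> ball a r.
        ((\<lambda>\<alpha>. (\<Prod>i<n. (coord x i - coord a i) ^ \<alpha> i) *\<^sub>R c \<alpha>) has_sum f x)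
          {\<alpha>. \<forall>i\<ge>n. \<alpha> i = 0})"

fun Cq_on_open ::
  "smoothness \<Rightarrow> nat \<Rightarrow> evec set \<Rightarrow> (evec \<Rightarrow> 'b::real_normed_vector) \<Rightarrow> bool" where
  "Cq_on_open (C_fin k) n U f \<longleftrightarrow> Ck_on k n U f"
| "Cq_on_open C_inf n U f \<longleftrightarrow> (\<forall>k. Ck_on k n U f)"
| "Cq_on_open C_omega n U f \<longleftrightarrow> real_analytic_on n U f"

text \<open>Maps of class \<open>C\<^sup>q\<close> on a submanifold \<open>S\<close> of \<open>\<real>\<^sup>n\<close>, via local extensions.\<close>

definition Cq_on ::
  "smoothness \<Rightarrow> nat \<Rightarrow> evec set \<Rightarrow> (evec \<Rightarrow> 'b::real_normed_vector) \<Rightarrow> bool" where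
  "Cq_on q n S f \<longleftrightarrow>
     (\<forall>x\<in>S. \<exists>U F. open_in_Rn n U \<and> x \<in> U \<and> Cq_on_open q n U F \<and> (\<forall>y\<in>S \<inter> U. F y = f y))"

definition Cq_diffeo ::
  "smoothness \<Rightarrow> nat \<Rightarrow> evec set \<Rightarrow> evec set \<Rightarrow> (evec \<Rightarrow> evec) \<Rightarrow> bool" where
  "Cq_diffeo q n U W \<phi> \<longleftrightarrow>
     open_in_Rn n U \<and> open_in_Rn n W \<and> bij_betw \<phi> U W \<and>
     Cq_on_open q n U \<phi> \<and> Cq_on_open q n W (inv_into U \<phi>)"

text \<open>Embedded submanifolds of pure dimension \<open>d\<close>; note \<open>Rn d = \<real>\<^sup>d \<times> {0} \<subseteq> \<real>\<^sup>n\<close> for \<open>d \<le> n\<close>.\<close>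

definition submanifold :: "smoothness \<Rightarrow> nat \<Rightarrow> nat \<Rightarrow> evec set \<Rightarrow> bool" where
  "submanifold q n d M \<longleftrightarrow>
     d \<le> n \<and> M \<subseteq> Rn n \<and>
     (\<forall>a\<in>M. \<exists>U W \<phi>. a \<in> U \<and> Cq_diffeo q n U W \<phi> \<and> \<phi> ` (M \<inter> U) = W \<inter> Rn d)"

definition is_submanifold :: "smoothness \<Rightarrow> nat \<Rightarrow> evec set \<Rightarrow> bool" where
  "is_submanifold q n M \<longleftrightarrow> (\<exists>d. submanifold q n d M)"

text \<open>The velocities at \<open>b\<close> of curves lying in \<open>M\<close>.\<close>

definition tangent_space :: "evec set \<Rightarrow> evec \<Rightarrow> evec set" where
  "tangent_space M b =
     {v. \<exists>\<gamma> e. 0 < e \<and> (\<forall>t. \<bar>t\<bar> < e \<longrightarrow> \<gamma> t \<in> M) \<and> \<gamma> 0 = b \<and>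
               (\<gamma> has_vector_derivative v) (at (0::real))}"


section \<open>Grassmannians and the Whitney (B) condition\<close>

definition grassmannian :: "nat \<Rightarrow> nat \<Rightarrow> evec set set" where
  "grassmannian d n = {V. subspace V \<and> V \<subseteq> Rn n \<and> dim V = d}"

text \<open>
  The gap metric (equal to the operator norm of the difference of the orthogonal projections),
  which induces the usual topology of the Grassmannian.
\<close>

definition gap :: "evec set \<Rightarrow> evec set \<Rightarrow> real" where
  "gap V W = max (SUP v\<in>V \<inter> cball 0 1. infdist v W) (SUP w\<in>W \<inter> cball 0 1. infdist w V)"

definition grassmannian_lim :: "nat \<Rightarrow> nat \<Rightarrow> (nat \<Rightarrow> evec set) \<Rightarrow> evec set \<Rightarrow> bool" where
  "grassmannian_lim d n V T \<longleftrightarrow>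
     (\<forall>\<nu>. V \<nu> \<in> grassmannian d n) \<and> T \<in> grassmannian d n \<and>
     (\<lambda>\<nu>. gap (V \<nu>) T) \<longlonglongrightarrow> 0"

text \<open>
  The projective space \<open>\<P>\<^sub>n\<^sub>-\<^sub>1\<close> is the Grassmannian of lines. Since \<open>grassmannian_lim d n\<close> refers to
  sequences of \<open>d\<close>-dimensional subspaces, only \<open>d = dim M\<close> contributes to the quantifier over \<open>d\<close>.
\<close>

definition whitney_B :: "nat \<Rightarrow> evec set \<Rightarrow> evec set \<Rightarrow> evec \<Rightarrow> bool" where
  "whitney_B n M N a \<longleftrightarrow>
     (\<forall>a' b' L T d.
        (\<forall>\<nu>. a' \<nu> \<in> N) \<and> (\<forall>\<nu>. b' \<nu> \<in> M) \<and> a' \<longlonglongrightarrow> a \<and> b' \<longlonglongrightarrow> a \<and>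
        grassmannian_lim 1 n (\<lambda>\<nu>. span {a' \<nu> - b' \<nu>}) L \<and>
        grassmannian_lim d n (\<lambda>\<nu>. tangent_space M (b' \<nu>)) T \<longrightarrow> L \<subseteq> T)"


section \<open>O-minimal structures and cell decompositions\<close>

text \<open>\<open>D n\<close> is the collection of the definable subsets of \<open>\<real>\<^sup>n\<close>.\<close>

locale o_minimal_structure =
  fixes D :: "nat \<Rightarrow> evec set set"
  assumes boolean_algebra: "algebra (Rn n) (D n)"
    and prod_right: "A \<in> D n \<Longrightarrow> vprod n A (Rn 1) \<in> D (Suc n)"
    and prod_left: "A \<in> D n \<Longrightarrow> vprod 1 (Rn 1) A \<in> D (Suc n)"
    and diagonal: "i < n \<Longrightarrow> j < n \<Longrightarrow> {x \<in> Rn n. coord x i = coord x j} \<in> D n"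
    and projection: "A \<in> D (Suc n) \<Longrightarrow> vtrunc n ` A \<in> D n"
    and order: "{x \<in> Rn 2. coord x 0 < coord x 1} \<in> D 2"
    and addition: "{x \<in> Rn 3. coord x 0 + coord x 1 = coord x 2} \<in> D 3"
    and multiplication: "{x \<in> Rn 3. coord x 0 * coord x 1 = coord x 2} \<in> D 3"
    and o_minimal: "{x \<in> Rn 1. coord x 0 \<in> S} \<in> D 1 \<longleftrightarrow>
          (\<exists>F. finite F \<and> (\<forall>I\<in>F. is_interval I) \<and> S = \<Union>F)"

text \<open>
  A bound of a band over a cell \<open>C\<close>: a definable real function of class \<open>C\<^sup>q\<close> on \<open>C\<close>, or the
  constant \<open>c\<close>, which will be \<open>-\<infinity>\<close> or \<open>\<infinity>\<close>.
\<close>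

definition cell_bound ::
  "(nat \<Rightarrow> evec set set) \<Rightarrow> smoothness \<Rightarrow> nat \<Rightarrow> evec set \<Rightarrow> ereal \<Rightarrow> (evec \<Rightarrow> ereal) \<Rightarrow> bool" where
  "cell_bound D q n C c h \<longleftrightarrow>
     (\<exists>f. Cq_on q n C f \<and> rgraph_on n f C \<in> D (Suc n) \<and> (\<forall>x\<in>C. h x = ereal (f x))) \<or>
     (\<forall>x\<in>C. h x = c)"

inductive Cq_cell :: "(nat \<Rightarrow> evec set set) \<Rightarrow> smoothness \<Rightarrow> nat \<Rightarrow> evec set \<Rightarrow> bool"
  for D :: "nat \<Rightarrow> evec set set" and q :: smoothness where
  point: "Cq_cell D q 0 (Rn 0)"
| graph: "Cq_cell D q (Suc n) (rgraph_on n f C)"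
    if "Cq_cell D q n C" "Cq_on q n C f" "rgraph_on n f C \<in> D (Suc n)"
| band: "Cq_cell D q (Suc n) {vsnoc n x t | x t. x \<in> C \<and> g x < ereal t \<and> ereal t < h x}"
    if "Cq_cell D q n C" "cell_bound D q n C (-\<infinity>) g" "cell_bound D q n C \<infinity> h"
       "\<forall>x\<in>C. g x < h x"

primrec cell_decomposition ::
  "(nat \<Rightarrow> evec set set) \<Rightarrow> smoothness \<Rightarrow> nat \<Rightarrow> evec set set \<Rightarrow> bool" where
  "cell_decomposition D q 0 \<C> \<longleftrightarrow> \<C> = {Rn 0}"
| "cell_decomposition D q (Suc n) \<C> \<longleftrightarrow>
     finite \<C> \<and> partition_on (Rn (Suc n)) \<C> \<and> (\<forall>C\<in>\<C>. Cq_cell D q (Suc n) C) \<and>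
     cell_decomposition D q n ((\<lambda>C. vtrunc n ` C) ` \<C>)"

definition admits_cell_decompositions :: "(nat \<Rightarrow> evec set set) \<Rightarrow> smoothness \<Rightarrow> bool" where
  "admits_cell_decompositions D q \<longleftrightarrow>
     (\<forall>n \<A>. finite \<A> \<and> \<A> \<subseteq> D n \<longrightarrow>
        (\<exists>\<C>. cell_decomposition D q n \<C> \<and> (\<forall>A\<in>\<A>. \<forall>C\<in>\<C>. C \<subseteq> A \<or> C \<inter> A = {})))"


section \<open>Stratifications and weakly Lipschitz maps\<close>

definition stratification :: "smoothness \<Rightarrow> nat \<Rightarrow> evec set \<Rightarrow> evec set set \<Rightarrow> bool" where
  "stratification q n A X \<longleftrightarrow>
     finite X \<and> partition_on A X \<and>
     (\<forall>\<Gamma>\<in>X. connected \<Gamma> \<and>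
        (\<exists>d. submanifold q n d \<Gamma> \<and>
           (\<exists>Y\<subseteq>X. (closure \<Gamma> - \<Gamma>) \<inter> A = \<Union>Y \<and> (\<forall>\<Sigma>\<in>Y. \<exists>e<d. submanifold q n e \<Sigma>))))"

definition weakly_lipschitz ::
  "smoothness \<Rightarrow> nat \<Rightarrow> nat \<Rightarrow> (evec \<Rightarrow> evec) \<Rightarrow> evec set \<Rightarrow> evec set set \<Rightarrow> bool" where
  "weakly_lipschitz q n m f A X \<longleftrightarrow>
     f ` A \<subseteq> Rn m \<and> (\<forall>\<Gamma>\<in>X. Cq_on q n \<Gamma> f) \<and>
     (\<forall>\<Lambda>\<in>X. \<forall>\<Gamma>\<in>X. \<Gamma> \<subseteq> closure \<Lambda> - \<Lambda> \<longrightarrow>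
        (\<forall>a\<in>\<Gamma>. \<forall>a' b'. (\<forall>\<nu>. a' \<nu> \<in> \<Gamma>) \<and> (\<forall>\<nu>. b' \<nu> \<in> \<Lambda>) \<and> a' \<longlonglongrightarrow> a \<and> b' \<longlonglongrightarrow> a \<longrightarrow>
           limsup (\<lambda>\<nu>. ereal (norm (f (a' \<nu>) - f (b' \<nu>)) / norm (a' \<nu> - b' \<nu>))) < \<infinity>))"

definition graph_stratification ::
  "nat \<Rightarrow> (evec \<Rightarrow> evec) \<Rightarrow> evec set set \<Rightarrow> evec set set" where
  "graph_stratification n f X = graph_on n f ` X"

definition locally_lipschitz_on :: "evec set \<Rightarrow> (evec \<Rightarrow> evec) \<Rightarrow> bool" where
  "locally_lipschitz_on S f \<longleftrightarrow> (\<forall>x\<in>S. \<exists>V C. open V \<and> x \<in> V \<and> C-lipschitz_on (S \<inter> V) f)"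


section \<open>Regularity conditions\<close>

text \<open>
  A condition \<open>Q\<close> is modelled by a predicate such that \<open>Q n \<Lambda> \<Gamma> x\<close> means that \<open>Q\<close> is satisfied for
  the pair \<open>(\<Lambda>, \<Gamma>)\<close> of submanifolds of \<open>\<real>\<^sup>n\<close> at \<open>x\<close>. It is meaningful only if
  \<open>adjacent q n \<Lambda> \<Gamma>\<close> and \<open>x \<in> \<Gamma>\<close>, and only such values are used below.
\<close>

type_synonym condition = "nat \<Rightarrow> evec set \<Rightarrow> evec set \<Rightarrow> evec \<Rightarrow> bool"

definition adjacent :: "smoothness \<Rightarrow> nat \<Rightarrow> evec set \<Rightarrow> evec set \<Rightarrow> bool" where
  "adjacent q n \<Lambda> \<Gamma> \<longleftrightarrow>
     is_submanifold q n \<Lambda> \<and> is_submanifold q n \<Gamma> \<and> \<Gamma> \<subseteq> closure \<Lambda> - \<Lambda>"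

definition satisfied :: "condition \<Rightarrow> nat \<Rightarrow> evec set \<Rightarrow> evec set \<Rightarrow> bool" where
  "satisfied Q n \<Lambda> \<Gamma> \<longleftrightarrow> (\<forall>x\<in>\<Gamma>. Q n \<Lambda> \<Gamma> x)"

definition Q_stratification ::
  "smoothness \<Rightarrow> condition \<Rightarrow> nat \<Rightarrow> evec set \<Rightarrow> evec set set \<Rightarrow> bool" where
  "Q_stratification q Q n A X \<longleftrightarrow>
     stratification q n A X \<and>
     (\<forall>\<Lambda>\<in>X. \<forall>\<Gamma>\<in>X. \<Gamma> \<subseteq> closure \<Lambda> - \<Lambda> \<longrightarrow> satisfied Q n \<Lambda> \<Gamma>)"

definition local_condition :: "smoothness \<Rightarrow> condition \<Rightarrow> bool" where
  "local_condition q Q \<longleftrightarrow>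
     (\<forall>n \<Lambda> \<Gamma> x U. adjacent q n \<Lambda> \<Gamma> \<and> x \<in> \<Gamma> \<and> open_in_Rn n U \<and> x \<in> U \<longrightarrow>
        (Q n \<Lambda> \<Gamma> x \<longleftrightarrow> Q n (\<Lambda> \<inter> U) (\<Gamma> \<inter> U) x))"

definition definable_condition ::
  "(nat \<Rightarrow> evec set set) \<Rightarrow> smoothness \<Rightarrow> condition \<Rightarrow> bool" where
  "definable_condition D q Q \<longleftrightarrow>
     (\<forall>n \<Lambda> \<Gamma>. adjacent q n \<Lambda> \<Gamma> \<and> \<Lambda> \<in> D n \<and> \<Gamma> \<in> D n \<longrightarrow> {x \<in> \<Gamma>. Q n \<Lambda> \<Gamma> x} \<in> D n)"

definition generic_condition ::
  "(nat \<Rightarrow> evec set set) \<Rightarrow> smoothness \<Rightarrow> condition \<Rightarrow> bool" where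
  "generic_condition D q Q \<longleftrightarrow>
     (\<forall>n \<Lambda> \<Gamma>. adjacent q n \<Lambda> \<Gamma> \<and> \<Lambda> \<in> D n \<and> \<Gamma> \<in> D n \<longrightarrow>
        top_of_set \<Gamma> interior_of (top_of_set \<Gamma> closure_of {x \<in> \<Gamma>. \<not> Q n \<Lambda> \<Gamma> x}) = {})"

definition diffeo_invariant ::
  "(nat \<Rightarrow> evec set set) \<Rightarrow> smoothness \<Rightarrow> condition \<Rightarrow> bool" where
  "diffeo_invariant D q Q \<longleftrightarrow>
     (\<forall>n U W \<phi> \<Lambda> \<Gamma> x.
        Cq_diffeo q n U W \<phi> \<and> graph_on n \<phi> U \<in> D (n + n) \<and>
        adjacent q n \<Lambda> \<Gamma> \<and> \<Lambda> \<subseteq> U \<and> \<Gamma> \<subseteq> U \<and> x \<in> \<Gamma> \<longrightarrow>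
        (Q n \<Lambda> \<Gamma> x \<longleftrightarrow> Q n (\<phi> ` \<Lambda>) (\<phi> ` \<Gamma>) (\<phi> x)))"

definition projection_property :: "smoothness \<Rightarrow> condition \<Rightarrow> bool" where
  "projection_property q Q \<longleftrightarrow>
     (\<forall>n m f A X.
        stratification q n A X \<and> weakly_lipschitz q n m f A X \<and>
        Q_stratification q Q (n + m) (graph_on n f A) (graph_stratification n f X) \<longrightarrow>
        Q_stratification q Q n A X)"

definition lifting_property :: "smoothness \<Rightarrow> condition \<Rightarrow> bool" where
  "lifting_property q Q \<longleftrightarrow>
     (\<forall>n m f \<Lambda> \<Gamma> M N.
        adjacent q n \<Lambda> \<Gamma> \<and> f ` (\<Lambda> \<union> \<Gamma>) \<subseteq> Rn m \<and> locally_lipschitz_on (\<Lambda> \<union> \<Gamma>) f \<and>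
        Cq_on q n \<Lambda> f \<and> Cq_on q n \<Gamma> f \<and>
        adjacent q n M N \<and> (M \<subseteq> \<Lambda> \<or> M \<subseteq> \<Gamma>) \<and> (N \<subseteq> \<Lambda> \<or> N \<subseteq> \<Gamma>) \<and>
        satisfied Q n M N \<and> satisfied Q (n + m) (graph_on n f \<Lambda>) (graph_on n f \<Gamma>) \<longrightarrow>
        satisfied Q (n + m) (graph_on n f M) (graph_on n f N))"

definition WL_condition :: "(nat \<Rightarrow> evec set set) \<Rightarrow> smoothness \<Rightarrow> condition \<Rightarrow> bool" where
  "WL_condition D q Q \<longleftrightarrow>
     local_condition q Q \<and>
     definable_condition D q Q \<and>
     generic_condition D q Q \<and>
     diffeo_invariant D q Q \<and>
     projection_property q Q \<and>
     lifting_property q Q"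

end

(*
  By compactness of Grassmannians, Whitney (B) at a says that the direction of x - y is within e of
  the tangent space of M at y for all x in N and y in M near a, for every e > 0. In this form the
  condition is visibly first-order, and it is transported by maps that are strictly differentiable
  (in particular C^1) with respect to the strata; this gives locality, invariance, the projection and
  the lifting property.

  For genericity, suppose that the condition fails on a nonempty open part of Gamma. A cell in the set
  of failure is open in Gamma and is parametrized by an open subset V of R^d, with a coordinate
  projection as inverse. The points of Lambda where the condition fails by at least e accumulate
  there, so a cell decomposition of R^d x R x R^n provides a C^1 wing (u, t) |-> P u + g u t of such
  points, where |g u t| = t. After a further cell decomposition the signs of the partial derivatives
  of g minus small constants are constant. As |g| = t, integration shows that the derivatives in u and
  the difference of the derivative in t and g / t are small. So the wing is nearly a cone over Gamma,
  whose points satisfy the condition up to e, a contradiction.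
*)
theory Submission
  imports Defs
begin

section \<open>The spaces \<open>Rn n\<close>\<close>

text \<open>The condition compares two moving points x in N and y in M, so differentiability at the
  fixed point a cannot transport it. Strict differentiability bounds the error on f x - f y by a
  multiple of |x - y|, and it makes sense on the union of two strata, which need not be a
  submanifold. In genericity the obstacle is uniformity. Arbitrary secants are reduced to those
  joining b in \<Lambda> with the point a of \<Gamma> that has the same d coordinates; the remaining
  part of x - y is nearly tangent to \<Gamma>, which is why the first alternative in
  \<open>bad\<close> compares tangent spaces, as in Whitney's condition (A). The constant e of a
  failure depends on the point, so e is made the last coordinate of a box in R^(d+1): a box
  compatible with the definable set of pairs (u, e) lies in it as soon as it meets it, and one e
  serves for an open set of u. Derivatives of a wing enter definable sets through difference
  quotients only. Compatibility then turns a strict inequality at one point of a box into the weak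
  inequality at all its points, and this is enough for integration.\<close>

lift_definition unitv :: "nat \<Rightarrow> evec" is "\<lambda>i j. if j = i then 1 else 0"
  by simp

lift_definition vdrop :: "nat \<Rightarrow> evec \<Rightarrow> evec" is "\<lambda>n x i. x (n + i)"
proof -
  fix n and x :: "nat \<Rightarrow> real"
  assume "finite {i. x i \<noteq> 0}"
  then have "finite ((\<lambda>i. n + i) -` {i. x i \<noteq> 0})"
    by (rule finite_vimageI) auto
  then show "finite {i. x (n + i) \<noteq> 0}" by (simp add: vimage_def)
qed

lift_definition select :: "nat \<Rightarrow> (nat \<Rightarrow> real) \<Rightarrow> evec" is "\<lambda>n f i. if i < n then f i else 0"
  subgoal for n f by (rule finite_subset[of _ "{..n}"]) (auto split: if_splits)
  done

lemma coord_unitv [simp]: "coord (unitv i) j = (if j = i then 1 else 0)"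
  and coord_vdrop [simp]: "coord (vdrop n x) j = coord x (n + j)"
  and coord_select [simp]: "coord (select n f) j = (if j < n then f j else 0)"
  and coord_vtrunc [simp]: "coord (vtrunc n x) j = (if j < n then coord x j else 0)"
  and coord_vjoin [simp]: "coord (vjoin n x y) j = (if j < n then coord x j else coord y (j - n))"
  and coord_vsnoc [simp]:
    "coord (vsnoc n x t) j = (if j < n then coord x j else if j = n then t else 0)"
  by (transfer; simp)+

lemma coord_sum [simp]: "coord (sum f A) i = (\<Sum>a\<in>A. coord (f a) i)"
  by (induction A rule: infinite_finite_induct) auto

lemma inner_unitv [simp]: "inner (unitv i) x = coord x i" "inner x (unitv i) = coord x i"
proof -
  show "inner (unitv i) x = coord x i"
    by (subst inner_evec_superset[of "{i}"]) auto
  then show "inner x (unitv i) = coord x i" by (simp add: inner_commute)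
qed

lemma norm_unitv [simp]: "norm (unitv i) = 1"
  by (simp add: norm_eq_sqrt_inner)

lemma bounded_linear_coord: "bounded_linear (\<lambda>x. coord x i)"
  using bounded_linear_inner_left[of "unitv i"] by simp

lemma abs_coord_le_norm: "\<bar>coord x i\<bar> \<le> norm x"
  using Cauchy_Schwarz_ineq2[of x "unitv i"] by simp

lemma continuous_on_coord [continuous_intros]:
  "continuous_on S f \<Longrightarrow> continuous_on S (\<lambda>x. coord (f x) i)"
  by (rule bounded_linear.continuous_on[OF bounded_linear_coord])

lemma Rn_iff: "x \<in> Rn n \<longleftrightarrow> (\<forall>i\<ge>n. coord x i = 0)"
  by (simp add: Rn_def)

lemma subspace_Rn [simp]: "subspace (Rn n)"
  by (simp add: subspace_def Rn_def)

lemma Rn_intros [intro, simp]: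
  "0 \<in> Rn n"
  "x \<in> Rn n \<Longrightarrow> y \<in> Rn n \<Longrightarrow> x + y \<in> Rn n"
  "x \<in> Rn n \<Longrightarrow> y \<in> Rn n \<Longrightarrow> x - y \<in> Rn n"
  "x \<in> Rn n \<Longrightarrow> r *\<^sub>R x \<in> Rn n"
  "vtrunc n z \<in> Rn n"
  "select n f \<in> Rn n"
  "z \<in> Rn (n + k) \<Longrightarrow> vdrop n z \<in> Rn k"
  "x \<in> Rn n \<Longrightarrow> y \<in> Rn k \<Longrightarrow> vjoin n x y \<in> Rn (n + k)"
  "vsnoc n z t \<in> Rn (Suc n)"
  by (auto simp: Rn_def)

lemma unitv_in_Rn [simp]: "unitv i \<in> Rn n \<longleftrightarrow> i < n"
  by (auto simp: Rn_def not_less)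

lemma Rn_mono: "m \<le> n \<Longrightarrow> Rn m \<subseteq> Rn n"
  by (auto simp: Rn_def)

lemma sum_in_Rn [intro]: "(\<And>a. a \<in> A \<Longrightarrow> f a \<in> Rn n) \<Longrightarrow> sum f A \<in> Rn n"
  by (rule subspace_sum) auto

lemma closed_Rn [simp]: "closed (Rn n)"
proof -
  have "Rn n = (\<Inter>i\<in>{n..}. {x. coord x i = 0})" by (auto simp: Rn_def)
  moreover have "closed {x. coord x i = 0}" for i
    by (intro closed_Collect_eq continuous_intros)
  ultimately show ?thesis by auto
qed

lemma Rn_0: "Rn 0 = {0}"
  by (auto simp: Rn_def intro!: evec_eqI)

lemma vtrunc_id [simp]: "x \<in> Rn n \<Longrightarrow> vtrunc n x = x"
  by (intro evec_eqI) (auto simp: Rn_def)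

lemma vjoin_vtrunc_vdrop [simp]: "vjoin n (vtrunc n x) (vdrop n x) = x"
  by (intro evec_eqI) auto

lemma vtrunc_vjoin [simp]: "x \<in> Rn n \<Longrightarrow> vtrunc n (vjoin n x y) = x"
  by (intro evec_eqI) (auto simp: Rn_def)

lemma vdrop_vjoin [simp]: "vdrop n (vjoin n x y) = y"
  by (intro evec_eqI) auto

lemma vtrunc_vtrunc: "m \<le> n \<Longrightarrow> vtrunc m (vtrunc n x) = vtrunc m x"
  by (intro evec_eqI) auto

lemma vtrunc_vsnoc [simp]: "x \<in> Rn n \<Longrightarrow> vtrunc n (vsnoc n x t) = x"
  by (intro evec_eqI) (auto simp: Rn_def)

lemma vsnoc_vtrunc: "z \<in> Rn (Suc n) \<Longrightarrow> vsnoc n (vtrunc n z) (coord z n) = z"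
  by (intro evec_eqI) (auto simp: Rn_def)

lemma vsnoc_inject [simp]:
  "x \<in> Rn n \<Longrightarrow> y \<in> Rn n \<Longrightarrow> vsnoc n x s = vsnoc n y t \<longleftrightarrow> x = y \<and> s = t"
proof -
  assume "x \<in> Rn n" "y \<in> Rn n"
  moreover have "coord (vsnoc n x s) n = s" "coord (vsnoc n y t) n = t" by auto
  ultimately show ?thesis by (metis vtrunc_vsnoc)
qed

lemma vsnoc_eq: "vsnoc n x t = vtrunc n x + t *\<^sub>R unitv n"
  by (intro evec_eqI) auto

lemma vjoin_eq: "vjoin n x y = vtrunc n x + vjoin n 0 y"
  by (intro evec_eqI) auto

lemma Rn_expand: "x \<in> Rn n \<Longrightarrow> x = (\<Sum>i<n. coord x i *\<^sub>R unitv i)"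
  by (intro evec_eqI) (auto simp: Rn_def if_distrib cong: if_cong)

lemma select_expand: "select n f = (\<Sum>i<n. f i *\<^sub>R unitv i)"
  by (intro evec_eqI) (auto simp: if_distrib cong: if_cong)

lemma norm_le_sum_coord: "x \<in> Rn n \<Longrightarrow> norm x \<le> (\<Sum>i<n. \<bar>coord x i\<bar>)"
proof -
  assume "x \<in> Rn n"
  then have "norm x = norm (\<Sum>i<n. coord x i *\<^sub>R unitv i)" using Rn_expand by metis
  also have "\<dots> \<le> (\<Sum>i<n. norm (coord x i *\<^sub>R unitv i))" by (rule norm_sum)
  finally show ?thesis by simp
qed

lemma inner_Rn: "x \<in> Rn n \<Longrightarrow> inner x y = (\<Sum>i<n. coord x i * coord y i)"
  by (rule inner_evec_superset) (auto simp: Rn_def intro: leI)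

lemma norm_vtrunc_le: "norm (vtrunc n x) \<le> norm x"
proof -
  define S where "S = {..<n} \<union> {i. coord x i \<noteq> 0}"
  have S: "finite S" by (simp add: S_def)
  have "inner (vtrunc n x) (vtrunc n x) = (\<Sum>i\<in>S. coord (vtrunc n x) i * coord (vtrunc n x) i)"
    by (rule inner_evec_superset[OF S]) (auto simp: S_def)
  also have "\<dots> \<le> (\<Sum>i\<in>S. coord x i * coord x i)"
    by (intro sum_mono) auto
  also have "\<dots> = inner x x"
    by (rule inner_evec_superset[OF S, symmetric]) (auto simp: S_def)
  finally show ?thesis by (simp add: norm_eq_sqrt_inner)
qed

lemma bounded_linear_vtrunc: "bounded_linear (vtrunc n)"
  by (rule bounded_linear_intro[of _ 1]) (auto intro!: evec_eqI norm_vtrunc_le)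

lemma inner_vjoin:
  assumes "x \<in> Rn n"
  shows "inner (vjoin n x y) (vjoin n x' y') = inner x x' + inner y y'"
proof -
  define S where "S = {i. coord y i \<noteq> 0}"
  have "inner (vjoin n x y) (vjoin n x' y')
      = (\<Sum>i\<in>{..<n} \<union> (\<lambda>i. n + i) ` S. coord (vjoin n x y) i * coord (vjoin n x' y') i)"
  proof (rule inner_evec_superset)
    show "{i. coord (vjoin n x y) i \<noteq> 0} \<subseteq> {..<n} \<union> (\<lambda>i. n + i) ` S"
    proof
      fix i assume "i \<in> {i. coord (vjoin n x y) i \<noteq> 0}"
      then show "i \<in> {..<n} \<union> (\<lambda>i. n + i) ` S"
        by (cases "i < n") (auto simp: S_def intro!: image_eqI[of _ _ "i - n"])
    qed
  qed (simp add: S_def)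
  also have "\<dots> = (\<Sum>i<n. coord (vjoin n x y) i * coord (vjoin n x' y') i)
      + (\<Sum>i\<in>(\<lambda>i. n + i) ` S. coord (vjoin n x y) i * coord (vjoin n x' y') i)"
    by (rule sum.union_disjoint) (auto simp: S_def)
  also have "(\<Sum>i<n. coord (vjoin n x y) i * coord (vjoin n x' y') i) = inner x x'"
    using assms by (simp add: inner_Rn)
  also have "(\<Sum>i\<in>(\<lambda>i. n + i) ` S. coord (vjoin n x y) i * coord (vjoin n x' y') i) = inner y y'"
    by (subst sum.reindex) (auto simp: S_def inner_evec_def)
  finally show ?thesis .
qed

lemma norm_vjoin: "x \<in> Rn n \<Longrightarrow> norm (vjoin n x y) = sqrt ((norm x)\<^sup>2 + (norm y)\<^sup>2)"
  by (simp add: norm_eq_sqrt_inner inner_vjoin)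

lemma norm_vjoin_bounds:
  assumes "x \<in> Rn n"
  shows "norm x \<le> norm (vjoin n x y)" "norm y \<le> norm (vjoin n x y)"
    "norm (vjoin n x y) \<le> norm x + norm y"
  using assms by (auto simp: norm_vjoin real_le_rsqrt intro: real_le_lsqrt sqrt_sum_squares_le_sum)

lemma vjoin_diff: "vjoin n x y - vjoin n x' y' = vjoin n (x - x') (y - y')"
  by (intro evec_eqI) auto

lemma bounded_linear_vjoin_right: "bounded_linear (vjoin n 0)"
  by (rule bounded_linear_intro[of _ 1]) (auto intro!: evec_eqI simp: norm_vjoin)

lemma norm_vdrop_le: "norm (vdrop n x) \<le> norm x"
  using norm_vjoin_bounds(2)[of "vtrunc n x" n "vdrop n x"] by simp

lemma bounded_linear_vdrop: "bounded_linear (vdrop n)"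
  by (rule bounded_linear_intro[of _ 1]) (auto intro!: evec_eqI norm_vdrop_le)

lemma vtrunc_diff: "vtrunc n (x - y) = vtrunc n x - vtrunc n y"
  by (intro evec_eqI) auto

text \<open>The ambient space \<open>evec\<close> is infinite-dimensional and its closed balls are
  not compact, so compactness has to come from finitely many coordinates: a cube is the continuous
  image of a cube of one dimension less times an interval.\<close>

lemma compact_Rn_cball: "compact {x \<in> Rn n. norm x \<le> r}"
proof -
  have cube: "compact {x \<in> Rn n. \<forall>i<n. \<bar>coord x i\<bar> \<le> r}" (is "compact (?Q n)") for n
  proof (induction n)
    case 0
    have "{x \<in> Rn 0. \<forall>i<0. \<bar>coord x i\<bar> \<le> r} = {0}" by (auto simp: Rn_0)
    then show ?case by simp
  next
    case (Suc n)
    have "compact ((\<lambda>(x, t). x + t *\<^sub>R unitv n) ` (?Q n \<times> {-r..r}))"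
      by (intro compact_continuous_image compact_Times Suc)
        (auto intro!: continuous_intros simp: case_prod_unfold)
    also have "(\<lambda>(x, t). x + t *\<^sub>R unitv n) ` (?Q n \<times> {-r..r}) = ?Q (Suc n)"
    proof (intro equalityI subsetI)
      fix z assume z: "z \<in> ?Q (Suc n)"
      have "z = vtrunc n z + coord z n *\<^sub>R unitv n"
        using z by (metis (no_types, lifting) mem_Collect_eq vsnoc_eq vsnoc_vtrunc vtrunc_vtrunc order_refl)
      moreover have "vtrunc n z \<in> ?Q n" "coord z n \<in> {-r..r}"
        using z by (auto simp: abs_le_iff minus_le_iff)
      ultimately show "z \<in> (\<lambda>(x, t). x + t *\<^sub>R unitv n) ` (?Q n \<times> {-r..r})"
        by (intro image_eqI[of _ _ "(vtrunc n z, coord z n)"]) auto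
    qed (auto simp: Rn_def less_Suc_eq)
    finally show ?case .
  qed
  have "{x \<in> Rn n. norm x \<le> r} = {x \<in> Rn n. \<forall>i<n. \<bar>coord x i\<bar> \<le> r} \<inter> cball 0 r"
    using abs_coord_le_norm order_trans by fastforce
  then show ?thesis using cube by (simp add: compact_Int_closed)
qed

lemma Rn_bounded_convergent_subseq:
  assumes "\<And>k. x k \<in> Rn n" "\<And>k. norm (x k) \<le> r"
  obtains l s where "l \<in> Rn n" "norm l \<le> r" "strict_mono (s :: nat \<Rightarrow> nat)" "(x \<circ> s) \<longlonglongrightarrow> l"
  using compact_Rn_cball[of n r] assms unfolding compact_def by (metis (no_types, lifting) mem_Collect_eq)

text \<open>A linear map on \<open>evec\<close> may be unbounded; on \<open>Rn n\<close> the finite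
  basis gives a bound. Stated through the values on unit vectors, it later turns continuity of a
  derivative in each single direction into continuity in norm.\<close>

lemma linear_bound_Rn:
  fixes f :: "evec \<Rightarrow> 'b::real_normed_vector"
  assumes "linear f" "x \<in> Rn n"
  shows "norm (f x) \<le> (\<Sum>i<n. norm (f (unitv i))) * norm x"
proof -
  have "f x = f (\<Sum>i<n. coord x i *\<^sub>R unitv i)" using Rn_expand[OF assms(2)] by simp
  also have "\<dots> = (\<Sum>i<n. coord x i *\<^sub>R f (unitv i))"
    by (simp add: linear_sum[OF assms(1)] linear_scale[OF assms(1)])
  also have "norm \<dots> \<le> (\<Sum>i<n. norm x * norm (f (unitv i)))"
    by (intro sum_norm_le) (auto intro: mult_right_mono abs_coord_le_norm)
  finally show ?thesis by (simp add: sum_distrib_left mult.commute)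
qed

lemma span_unitv: "span (unitv ` {..<n}) = Rn n"
proof
  show "span (unitv ` {..<n}) \<subseteq> Rn n" by (rule span_minimal) auto
  show "Rn n \<subseteq> span (unitv ` {..<n})"
  proof
    fix x assume "x \<in> Rn n"
    moreover have "(\<Sum>i<n. coord x i *\<^sub>R unitv i) \<in> span (unitv ` {..<n})"
      by (intro span_sum span_scale span_base) auto
    ultimately show "x \<in> span (unitv ` {..<n})" using Rn_expand by metis
  qed
qed

lemma inj_unitv: "inj unitv"
  by (rule injI) (metis coord_unitv one_neq_zero)

lemma independent_unitv: "independent (unitv ` A)"
proof (rule pairwise_orthogonal_independent)
  show "pairwise orthogonal (unitv ` A)"
    by (auto simp: pairwise_def orthogonal_def)
  show "0 \<notin> unitv ` A" by (auto dest: arg_cong[where f=norm])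
qed

lemma continuous_on_vtrunc [continuous_intros]:
  "continuous_on S f \<Longrightarrow> continuous_on S (\<lambda>x. vtrunc n (f x))"
  by (rule bounded_linear.continuous_on[OF bounded_linear_vtrunc])

section \<open>Strict differentiability\<close>

text \<open>Unlike the classes \<open>Cq_on\<close>, strict differentiability makes sense on arbitrary sets, passes to
  subsets, and needs no extension of the map to an open set.\<close>

definition sdiff ::
  "'a::real_normed_vector set \<Rightarrow> ('a \<Rightarrow> 'b::real_normed_vector) \<Rightarrow> 'a \<Rightarrow> ('a \<Rightarrow> 'b) \<Rightarrow> bool" where
  "sdiff S f a A \<longleftrightarrow> bounded_linear A \<and>
     (\<forall>e>0. \<exists>d>0. \<forall>x\<in>S \<inter> ball a d. \<forall>y\<in>S \<inter> ball a d.
        norm (f x - f y - A (x - y)) \<le> e * norm (x - y))"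

definition sC1 :: "'a::real_normed_vector set \<Rightarrow> ('a \<Rightarrow> 'b::real_normed_vector) \<Rightarrow> bool" where
  "sC1 S f \<longleftrightarrow> (\<forall>a\<in>S. \<exists>A. sdiff S f a A)"

lemma sdiff_bounded_linear: "sdiff S f a A \<Longrightarrow> bounded_linear A"
  by (simp add: sdiff_def)

lemma sdiffE:
  assumes "sdiff S f a A" "e > 0"
  obtains d where "d > 0" "\<And>x y. x \<in> S \<Longrightarrow> y \<in> S \<Longrightarrow> dist a x < d \<Longrightarrow> dist a y < d \<Longrightarrow>
    norm (f x - f y - A (x - y)) \<le> e * norm (x - y)"
  using assms unfolding sdiff_def by (metis IntI mem_ball)

lemma sdiffI:
  assumes "bounded_linear A"
    and "\<And>e. e > 0 \<Longrightarrow> \<exists>d>0. \<forall>x\<in>S. \<forall>y\<in>S. dist a x < d \<longrightarrow> dist a y < d \<longrightarrow>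
      norm (f x - f y - A (x - y)) \<le> e * norm (x - y)"
  shows "sdiff S f a A"
  unfolding sdiff_def
proof (intro conjI allI impI)
  fix e :: real assume "e > 0"
  from assms(2)[OF this] obtain d where "d > 0" "\<forall>x\<in>S. \<forall>y\<in>S. dist a x < d \<longrightarrow> dist a y < d \<longrightarrow>
      norm (f x - f y - A (x - y)) \<le> e * norm (x - y)" by blast
  then show "\<exists>d>0. \<forall>x\<in>S \<inter> ball a d. \<forall>y\<in>S \<inter> ball a d.
      norm (f x - f y - A (x - y)) \<le> e * norm (x - y)"
    by (intro exI[of _ d]) auto
qed (rule assms(1))

lemma sdiff_subset: "sdiff S f a A \<Longrightarrow> T \<subseteq> S \<Longrightarrow> sdiff T f a A"
  unfolding sdiff_def
  by (elim conjE, intro conjI allI impI, assumption) (drule spec, drule mp, assumption, erule ex_forward, auto)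

lemma sC1_subset: "sC1 S f \<Longrightarrow> T \<subseteq> S \<Longrightarrow> sC1 T f"
  unfolding sC1_def using sdiff_subset by blast

lemma sdiff_cong:
  assumes "sdiff S f a A" "\<And>x. x \<in> S \<Longrightarrow> f x = g x"
  shows "sdiff S g a A"
  using assms unfolding sdiff_def by simp

lemma sC1_cong: "sC1 S f \<Longrightarrow> (\<And>x. x \<in> S \<Longrightarrow> f x = g x) \<Longrightarrow> sC1 S g"
  unfolding sC1_def using sdiff_cong by metis

lemma sdiff_local:
  assumes "sdiff (S \<inter> U) f a A" "open U" "a \<in> U"
  shows "sdiff S f a A"
proof (rule sdiffI)
  fix e :: real assume "e > 0"
  then obtain d where d: "d > 0" "\<And>x y. x \<in> S \<inter> U \<Longrightarrow> y \<in> S \<inter> U \<Longrightarrow> dist a x < d \<Longrightarrow>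
      dist a y < d \<Longrightarrow> norm (f x - f y - A (x - y)) \<le> e * norm (x - y)"
    using sdiffE[OF assms(1)] by metis
  obtain r where r: "r > 0" "ball a r \<subseteq> U" using assms open_contains_ball by blast
  show "\<exists>d>0. \<forall>x\<in>S. \<forall>y\<in>S. dist a x < d \<longrightarrow> dist a y < d \<longrightarrow>
      norm (f x - f y - A (x - y)) \<le> e * norm (x - y)"
    using d r by (intro exI[of _ "min d r"]) (auto simp: subset_iff)
qed (use assms sdiff_bounded_linear in blast)

lemma sdiff_has_derivative: "sdiff S f a A \<Longrightarrow> a \<in> S \<Longrightarrow> (f has_derivative A) (at a within S)"
  unfolding has_derivative_within_alt
proof (intro conjI allI impI)
  fix e :: real assume f: "sdiff S f a A" and a: "a \<in> S" and e: "e > 0"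
  obtain d where "d > 0" "\<And>x y. x \<in> S \<Longrightarrow> y \<in> S \<Longrightarrow> dist a x < d \<Longrightarrow> dist a y < d \<Longrightarrow>
    norm (f x - f y - A (x - y)) \<le> e * norm (x - y)" using sdiffE[OF f e] by blast
  with a show "\<exists>d>0. \<forall>y\<in>S. norm (y - a) < d \<longrightarrow> norm (f y - f a - A (y - a)) \<le> e * norm (y - a)"
    by (intro exI[of _ d]) (auto simp: dist_norm norm_minus_commute)
qed (rule sdiff_bounded_linear)

lemma sC1_continuous_on: "sC1 S f \<Longrightarrow> continuous_on S f"
  unfolding sC1_def continuous_on_eq_continuous_within
  using sdiff_has_derivative has_derivative_continuous by blast

lemma sdiff_lipschitz:
  assumes "sdiff S f a A"
  obtains K d where "K > 0" "d > 0" "\<And>x y. x \<in> S \<Longrightarrow> y \<in> S \<Longrightarrow> dist a x < d \<Longrightarrow> dist a y < d \<Longrightarrow>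
    norm (f x - f y) \<le> K * norm (x - y)"
proof -
  obtain K where K: "K > 0" "\<And>x. norm (A x) \<le> norm x * K"
    using bounded_linear.pos_bounded[OF sdiff_bounded_linear[OF assms]] by blast
  obtain d where d: "d > 0" "\<And>x y. x \<in> S \<Longrightarrow> y \<in> S \<Longrightarrow> dist a x < d \<Longrightarrow> dist a y < d \<Longrightarrow>
    norm (f x - f y - A (x - y)) \<le> 1 * norm (x - y)" by (rule sdiffE[OF assms zero_less_one]) blast
  have "norm (f x - f y) \<le> (K + 1) * norm (x - y)"
    if "x \<in> S" "y \<in> S" "dist a x < d" "dist a y < d" for x y
    using d(2)[OF that] K(2)[of "x - y"] norm_triangle_ineq2[of "f x - f y" "A (x - y)"]
    by (simp add: algebra_simps)
  then show ?thesis using that[of "K + 1" d] K d by auto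
qed

lemma sdiff_bounded_linear_self: "bounded_linear A \<Longrightarrow> sdiff S A a A"
  by (intro sdiffI) (auto simp: bounded_linear.linear linear_diff intro: exI[of _ 1])

lemma sdiff_const: "sdiff S (\<lambda>x. c) a (\<lambda>x. 0)"
  by (intro sdiffI) (auto intro: exI[of _ 1])

lemma sdiff_compose:
  assumes f: "sdiff S f a A" and g: "sdiff T g (f a) B" and "f ` S \<subseteq> T" "a \<in> S"
  shows "sdiff S (\<lambda>x. g (f x)) a (\<lambda>x. B (A x))"
proof (rule sdiffI)
  show "bounded_linear (\<lambda>x. B (A x))"
    using bounded_linear_compose[OF sdiff_bounded_linear[OF g] sdiff_bounded_linear[OF f]] .
  fix e :: real assume e: "e > 0"
  obtain K d where K: "K > 0" "d > 0" "\<And>x y. x \<in> S \<Longrightarrow> y \<in> S \<Longrightarrow> dist a x < d \<Longrightarrow> dist a y < d \<Longrightarrow>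
    norm (f x - f y) \<le> K * norm (x - y)" using sdiff_lipschitz[OF f] by metis
  obtain L where L: "L > 0" "\<And>x. norm (B x) \<le> norm x * L"
    using bounded_linear.pos_bounded[OF sdiff_bounded_linear[OF g]] by blast
  obtain d1 where d1: "d1 > 0" "\<And>x y. x \<in> T \<Longrightarrow> y \<in> T \<Longrightarrow> dist (f a) x < d1 \<Longrightarrow>
      dist (f a) y < d1 \<Longrightarrow> norm (g x - g y - B (x - y)) \<le> e / (2 * K) * norm (x - y)"
    using sdiffE[OF g, of "e / (2 * K)"] e K by (metis divide_pos_pos mult_pos_pos zero_less_numeral)
  obtain d2 where d2: "d2 > 0" "\<And>x y. x \<in> S \<Longrightarrow> y \<in> S \<Longrightarrow> dist a x < d2 \<Longrightarrow> dist a y < d2 \<Longrightarrow>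
      norm (f x - f y - A (x - y)) \<le> e / (2 * L) * norm (x - y)"
    using sdiffE[OF f, of "e / (2 * L)"] e L by (metis divide_pos_pos mult_pos_pos zero_less_numeral)
  have lin: "linear B" using g sdiff_bounded_linear bounded_linear.linear by blast
  define d' where "d' = min (min d d2) (d1 / K)"
  have *: "norm (g (f x) - g (f y) - B (A (x - y))) \<le> e * norm (x - y)"
    if "x \<in> S" "y \<in> S" "dist a x < d'" "dist a y < d'" for x y
  proof -
    have near: "dist (f a) (f z) < d1" if "z \<in> S" "dist a z < d'" for z
    proof -
      have "norm (f a - f z) \<le> K * norm (a - z)"
        using that K assms(4) by (intro K(3)) (auto simp: d'_def)
      also have "\<dots> < d1" using that K by (simp add: d'_def dist_norm field_simps)
      finally show ?thesis by (simp add: dist_norm)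
    qed
    have "norm (g (f x) - g (f y) - B (f x - f y)) \<le> e / (2 * K) * norm (f x - f y)"
      using that near assms(3) by (intro d1(2)) auto
    also have "\<dots> \<le> e / (2 * K) * (K * norm (x - y))"
      using that K e by (intro mult_left_mono K(3)) (auto simp: d'_def)
    also have "\<dots> = e / 2 * norm (x - y)" using K by simp
    finally have 1: "norm (g (f x) - g (f y) - B (f x - f y)) \<le> e / 2 * norm (x - y)" .
    have "norm (B (f x - f y - A (x - y))) \<le> norm (f x - f y - A (x - y)) * L" by (rule L)
    also have "\<dots> \<le> e / (2 * L) * norm (x - y) * L"
      using that L by (intro mult_right_mono d2(2)) (auto simp: d'_def)
    also have "\<dots> = e / 2 * norm (x - y)" using L by simp
    finally have 2: "norm (B (f x - f y) - B (A (x - y))) \<le> e / 2 * norm (x - y)"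
      by (simp add: linear_diff[OF lin])
    show ?thesis
      using norm_triangle_le[OF add_mono[OF 1 2]] by (simp add: field_simps)
  qed
  have "d' > 0" using d1 d2 K by (simp add: d'_def)
  with * show "\<exists>d>0. \<forall>x\<in>S. \<forall>y\<in>S. dist a x < d \<longrightarrow> dist a y < d \<longrightarrow>
      norm (g (f x) - g (f y) - B (A (x - y))) \<le> e * norm (x - y)" by blast
qed

lemma sC1_compose: "sC1 S f \<Longrightarrow> sC1 T g \<Longrightarrow> f ` S \<subseteq> T \<Longrightarrow> sC1 S (\<lambda>x. g (f x))"
  unfolding sC1_def by (metis image_subset_iff sdiff_compose)

lemma sC1_bounded_linear: "bounded_linear A \<Longrightarrow> sC1 S A"
  unfolding sC1_def using sdiff_bounded_linear_self by blast

lemma sC1_const: "sC1 S (\<lambda>x. c)"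
  unfolding sC1_def using sdiff_const by blast

lemma sdiff_add:
  assumes f: "sdiff S f a A" and g: "sdiff S g a B"
  shows "sdiff S (\<lambda>x. f x + g x) a (\<lambda>x. A x + B x)"
proof (rule sdiffI)
  show "bounded_linear (\<lambda>x. A x + B x)"
    using f g by (intro bounded_linear_add) (auto simp: sdiff_def)
  fix e :: real assume "e > 0"
  then have e: "e / 2 > 0" by simp
  obtain d1 where d1: "d1 > 0" "\<And>x y. x \<in> S \<Longrightarrow> y \<in> S \<Longrightarrow> dist a x < d1 \<Longrightarrow> dist a y < d1 \<Longrightarrow>
      norm (f x - f y - A (x - y)) \<le> e / 2 * norm (x - y)" using sdiffE[OF f e] by metis
  obtain d2 where d2: "d2 > 0" "\<And>x y. x \<in> S \<Longrightarrow> y \<in> S \<Longrightarrow> dist a x < d2 \<Longrightarrow> dist a y < d2 \<Longrightarrow>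
      norm (g x - g y - B (x - y)) \<le> e / 2 * norm (x - y)" using sdiffE[OF g e] by metis
  have "norm (f x + g x - (f y + g y) - (A (x - y) + B (x - y))) \<le> e * norm (x - y)"
    if "x \<in> S" "y \<in> S" "dist a x < min d1 d2" "dist a y < min d1 d2" for x y
    using norm_triangle_le[OF add_mono[OF d1(2)[of x y] d2(2)[of x y]]] that
    by (simp add: field_simps)
  then show "\<exists>d>0. \<forall>x\<in>S. \<forall>y\<in>S. dist a x < d \<longrightarrow> dist a y < d \<longrightarrow>
      norm (f x + g x - (f y + g y) - (A (x - y) + B (x - y))) \<le> e * norm (x - y)"
    using d1(1) d2(1) by (intro exI[of _ "min d1 d2"]) auto
qed

lemma sC1_add: "sC1 S f \<Longrightarrow> sC1 S g \<Longrightarrow> sC1 S (\<lambda>x. f x + g x)"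
  unfolding sC1_def using sdiff_add by blast

lemma sC1_linear_image: "bounded_linear B \<Longrightarrow> sC1 S f \<Longrightarrow> sC1 S (\<lambda>x. B (f x))"
  using sC1_compose[OF _ sC1_bounded_linear[of B UNIV]] by auto

lemma sC1_sum: "(\<And>i. i \<in> I \<Longrightarrow> sC1 S (f i)) \<Longrightarrow> sC1 S (\<lambda>x. \<Sum>i\<in>I. f i x)"
  by (induction I rule: infinite_finite_induct) (auto intro: sC1_const sC1_add)

text \<open>Values in \<open>Rn m\<close> are sums of finitely many coordinates times constant
  vectors, which reduces vector-valued maps to real-valued ones.\<close>

lemma sC1_coordwise:
  assumes "\<And>i. i < m \<Longrightarrow> sC1 S (\<lambda>x. coord (f x) i)" "f ` S \<subseteq> Rn m"
  shows "sC1 S f"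
proof (rule sC1_cong)
  show "sC1 S (\<lambda>x. \<Sum>i<m. coord (f x) i *\<^sub>R unitv i)"
    using assms by (intro sC1_sum sC1_linear_image[OF bounded_linear_scaleR_left]) auto
  show "(\<Sum>i<m. coord (f x) i *\<^sub>R unitv i) = f x" if "x \<in> S" for x
    using that assms(2) by (intro Rn_expand[symmetric]) auto
qed

lemma sdiff_mult:
  fixes f g :: "'a::real_normed_vector \<Rightarrow> real"
  assumes f: "sdiff S f a A" and g: "sdiff S g a B" and a: "a \<in> S"
  shows "sdiff S (\<lambda>x. f x * g x) a (\<lambda>h. f a * B h + g a * A h)"
proof (rule sdiffI)
  have A: "bounded_linear A" and B: "bounded_linear B" using f g by (auto simp: sdiff_def)
  then show "bounded_linear (\<lambda>h. f a * B h + g a * A h)"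
    by (intro bounded_linear_add bounded_linear_const_mult)
  obtain K where K: "K > 0" "\<And>x. norm (A x) \<le> norm x * K"
    using bounded_linear.pos_bounded[OF A] by blast
  obtain L where L: "L > 0" "\<And>x. norm (B x) \<le> norm x * L"
    using bounded_linear.pos_bounded[OF B] by blast
  fix e :: real assume e: "e > 0"
  \<comment> \<open>\<open>C\<close> dominates \<open>f x\<close> and \<open>g y\<close> near
    \<open>a\<close> as well as the norms of \<open>A\<close> and \<open>B\<close>. The error of the
    product splits into four terms, each at most C e' |x - y|, hence the 4 in
    \<open>e'\<close>.\<close>
  define C where "C = \<bar>f a\<bar> + \<bar>g a\<bar> + 1 + K + L"
  have C: "C > 0" using K L by (simp add: C_def)
  define e' where "e' = min 1 (e / (4 * C))"
  have e': "e' > 0" "e' \<le> 1" "4 * (C * e') \<le> e" using e C by (auto simp: e'_def min_def field_simps)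
  obtain d1 where d1: "d1 > 0" "\<And>x y. x \<in> S \<Longrightarrow> y \<in> S \<Longrightarrow> dist a x < d1 \<Longrightarrow> dist a y < d1 \<Longrightarrow>
      norm (f x - f y - A (x - y)) \<le> e' * norm (x - y)" using sdiffE[OF f e'(1)] by metis
  obtain d2 where d2: "d2 > 0" "\<And>x y. x \<in> S \<Longrightarrow> y \<in> S \<Longrightarrow> dist a x < d2 \<Longrightarrow> dist a y < d2 \<Longrightarrow>
      norm (g x - g y - B (x - y)) \<le> e' * norm (x - y)" using sdiffE[OF g e'(1)] by metis
  obtain d3 where d3: "d3 > 0" "\<And>x. x \<in> S \<Longrightarrow> dist x a < d3 \<Longrightarrow> dist (f x) (f a) < e'"
    using has_derivative_continuous[OF sdiff_has_derivative[OF f a]] e'(1)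
    unfolding continuous_within_eps_delta by metis
  obtain d4 where d4: "d4 > 0" "\<And>x. x \<in> S \<Longrightarrow> dist x a < d4 \<Longrightarrow> dist (g x) (g a) < e'"
    using has_derivative_continuous[OF sdiff_has_derivative[OF g a]] e'(1)
    unfolding continuous_within_eps_delta by metis
  define d where "d = min (min d1 d2) (min d3 d4)"
  have "norm (f x * g x - f y * g y - (f a * B (x - y) + g a * A (x - y))) \<le> e * norm (x - y)"
    if xy: "x \<in> S" "y \<in> S" "dist a x < d" "dist a y < d" for x y
  proof -
    define N where "N = norm (x - y)"
    have fa: "\<bar>f x - f a\<bar> \<le> e'" using d3(2)[of x] xy by (auto simp: d_def dist_real_def dist_commute)
    have ga: "\<bar>g y - g a\<bar> \<le> e'" using d4(2)[of y] xy by (auto simp: d_def dist_real_def dist_commute)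
    have f1: "\<bar>f x\<bar> \<le> C" and g1: "\<bar>g y\<bar> \<le> C"
      using fa ga e'(2) K L by (auto simp: C_def abs_le_iff)
    have KC: "K \<le> C" "L \<le> C" using K L by (auto simp: C_def)
    have t1: "\<bar>f x * (g x - g y - B (x - y))\<bar> \<le> C * (e' * N)"
      unfolding abs_mult using f1 d2(2)[of x y] xy C
      by (intro mult_mono) (auto simp: d_def N_def)
    have t2: "\<bar>g y * (f x - f y - A (x - y))\<bar> \<le> C * (e' * N)"
      unfolding abs_mult using g1 d1(2)[of x y] xy C
      by (intro mult_mono) (auto simp: d_def N_def)
    have "\<bar>B (x - y)\<bar> \<le> C * N" "\<bar>A (x - y)\<bar> \<le> C * N"
      using L(2)[of "x - y"] K(2)[of "x - y"] mult_left_mono[OF KC(1), of N] mult_left_mono[OF KC(2), of N]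
      by (auto simp: N_def mult.commute)
    then have t3: "\<bar>(f x - f a) * B (x - y)\<bar> \<le> e' * (C * N)"
      and t4: "\<bar>(g y - g a) * A (x - y)\<bar> \<le> e' * (C * N)"
      unfolding abs_mult using fa ga e'(1) by (auto intro!: mult_mono)
    have "f x * g x - f y * g y - (f a * B (x - y) + g a * A (x - y))
      = f x * (g x - g y - B (x - y)) + g y * (f x - f y - A (x - y))
        + (f x - f a) * B (x - y) + (g y - g a) * A (x - y)"
      by (simp add: algebra_simps)
    then have "norm (f x * g x - f y * g y - (f a * B (x - y) + g a * A (x - y)))
        \<le> 4 * (C * e') * N"
      using t1 t2 t3 t4 by (simp add: algebra_simps)
    also have "\<dots> \<le> e * N" using e' by (intro mult_right_mono) (auto simp: N_def)
    finally show ?thesis by (simp add: N_def)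
  qed
  moreover have "d > 0" using d1 d2 d3 d4 by (simp add: d_def)
  ultimately show "\<exists>d>0. \<forall>x\<in>S. \<forall>y\<in>S. dist a x < d \<longrightarrow> dist a y < d \<longrightarrow>
      norm (f x * g x - f y * g y - (f a * B (x - y) + g a * A (x - y))) \<le> e * norm (x - y)"
    by blast
qed

lemma sC1_mult:
  fixes f g :: "'a::real_normed_vector \<Rightarrow> real"
  shows "sC1 S f \<Longrightarrow> sC1 S g \<Longrightarrow> sC1 S (\<lambda>x. f x * g x)"
  unfolding sC1_def using sdiff_mult by blast

lemma sC1_power:
  fixes f :: "'a::real_normed_vector \<Rightarrow> real"
  shows "sC1 S f \<Longrightarrow> sC1 S (\<lambda>x. f x ^ k)"
  by (induction k) (auto intro: sC1_const sC1_mult)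

lemma sC1_prod:
  fixes f :: "'i \<Rightarrow> 'a::real_normed_vector \<Rightarrow> real"
  shows "(\<And>i. i \<in> I \<Longrightarrow> sC1 S (f i)) \<Longrightarrow> sC1 S (\<lambda>x. \<Prod>i\<in>I. f i x)"
  by (induction I rule: infinite_finite_induct) (auto intro: sC1_const sC1_mult)

text \<open>On \<open>S\<close> only increments in \<open>Rn n\<close> occur, so the derivative may
  be replaced by one that ignores the other coordinates and whose size is thereby controlled on all
  of \<open>evec\<close>.\<close>

lemma sdiff_vtrunc:
  assumes "sdiff S f a A" "S \<subseteq> Rn n"
  shows "sdiff S f a (\<lambda>h. A (vtrunc n h))"
proof -
  have "vtrunc n (x - y) = x - y" if "x \<in> S" "y \<in> S" for x y
    using that assms(2) by (intro vtrunc_id Rn_intros) auto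
  then show ?thesis
    using assms(1) bounded_linear_compose[OF _ bounded_linear_vtrunc] unfolding sdiff_def by auto
qed

lemma open_in_Rn_ball:
  assumes "open_in_Rn n U" "a \<in> U"
  obtains r where "r > 0" "\<And>x. x \<in> Rn n \<Longrightarrow> dist a x < r \<Longrightarrow> x \<in> U"
  using assms unfolding openin_contains_ball by (metis Int_iff mem_ball subsetD)

text \<open>Termwise differentiation by splitting off a tail: the summands and their derivatives
  share the Lipschitz majorant \<open>M k\<close>, so the tail contributes a small multiple of |x -
  y| uniformly, while the finite head is strictly differentiable.\<close>

lemma sdiff_series:
  assumes T: "\<And>k. sdiff S (T k) a (A k)"
    and Tb: "\<And>k x y. x \<in> S \<Longrightarrow> y \<in> S \<Longrightarrow> norm (T k x - T k y) \<le> M k * norm (x - y)"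
    and Ab: "\<And>k h. norm (A k h) \<le> M k * norm h" and M: "summable M"
    and f: "\<And>x. x \<in> S \<Longrightarrow> (\<lambda>k. T k x) sums (f x :: real)"
  shows "sdiff S f a (\<lambda>h. \<Sum>k. A k h)"
proof (rule sdiffI)
  have M0: "0 \<le> M k" if "h \<noteq> 0" for k and h :: 'a
    using order_trans[OF norm_ge_zero Ab, of k h] that by (simp add: zero_le_mult_iff)
  have sA: "summable (\<lambda>k. A k h)" for h
    by (rule summable_comparison_test'[of "\<lambda>k. M k * norm h" 0]) (use M Ab in \<open>auto intro: summable_mult2\<close>)
  have lin: "linear (A k)" for k
    using T sdiff_bounded_linear bounded_linear.linear by blast
  show "bounded_linear (\<lambda>h. \<Sum>k. A k h)"
  proof (rule bounded_linear_intro[of _ "suminf M"])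
    show "(\<Sum>k. A k (x + y)) = (\<Sum>k. A k x) + (\<Sum>k. A k y)" for x y
      using suminf_add[OF sA sA] by (simp add: linear_add[OF lin])
    show "(\<Sum>k. A k (r *\<^sub>R x)) = r *\<^sub>R (\<Sum>k. A k x)" for r x
      using suminf_mult[OF sA] by (simp add: linear_scale[OF lin])
    fix h
    have "norm (\<Sum>k. A k h) \<le> (\<Sum>k. M k * norm h)"
      by (rule norm_suminf_le) (use Ab M in \<open>auto intro: summable_mult2\<close>)
    then show "norm (\<Sum>k. A k h) \<le> norm h * suminf M"
      using suminf_mult2[OF M, of "norm h"] by (simp add: mult.commute)
  qed
  fix e :: real assume e: "e > 0"
  \<comment> \<open>Each tail term has norm at most 2 M k |x - y|, so a tail of \<open>M\<close>
    below e / 4 costs e / 2; the head takes the other half.\<close>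
  obtain N where "norm (suminf (\<lambda>i. M (i + N))) < e / 4"
    using suminf_exist_split[of "e / 4" M] e M by auto
  then have N: "suminf (\<lambda>i. M (i + N)) \<le> e / 4" by simp
  have fin: "sdiff S (\<lambda>x. \<Sum>k<m. T k x) a (\<lambda>h. \<Sum>k<m. A k h)" for m
    by (induction m) (auto intro: sdiff_const sdiff_add T)
  obtain d where d: "d > 0" "\<And>x y. x \<in> S \<Longrightarrow> y \<in> S \<Longrightarrow> dist a x < d \<Longrightarrow> dist a y < d \<Longrightarrow>
    norm ((\<Sum>k<N. T k x) - (\<Sum>k<N. T k y) - (\<Sum>k<N. A k (x - y))) \<le> e / 2 * norm (x - y)"
    using sdiffE[OF fin, of "e / 2" N] e by (metis half_gt_zero)
  have "norm (f x - f y - (\<Sum>k. A k (x - y))) \<le> e * norm (x - y)"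
    if xy: "x \<in> S" "y \<in> S" "dist a x < d" "dist a y < d" for x y
  proof -
    define t where "t k = T k x - T k y - A k (x - y)" for k
    have t: "t sums (f x - f y - (\<Sum>k. A k (x - y)))"
      unfolding t_def using f[OF xy(1)] f[OF xy(2)] summable_sums[OF sA] by (intro sums_diff)
    have tb: "norm (t k) \<le> 2 * norm (x - y) * M k" for k
      unfolding t_def using Tb[OF xy(1,2), of k] Ab[of k "x - y"]
        norm_triangle_ineq4[of "T k x - T k y" "A k (x - y)"] by (simp add: mult_ac)
    have Ms: "summable (\<lambda>i. 2 * norm (x - y) * M (i + N))"
      using M by (intro summable_mult) (simp add: summable_iff_shift)
    have "f x - f y - (\<Sum>k. A k (x - y)) = (\<Sum>k. t (k + N)) + (\<Sum>k<N. t k)"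
      using suminf_split_initial_segment[OF sums_summable[OF t], of N] sums_unique[OF t] by simp
    moreover have "norm (\<Sum>k. t (k + N)) \<le> (\<Sum>k. 2 * norm (x - y) * M (k + N))"
      by (rule norm_suminf_le[OF _ Ms]) (rule tb)
    moreover have "(\<Sum>k. 2 * norm (x - y) * M (k + N)) \<le> e / 2 * norm (x - y)"
      using M mult_left_mono[OF N, of "2 * norm (x - y)"]
      by (subst suminf_mult) (auto simp: summable_iff_shift)
    moreover have "norm (\<Sum>k<N. t k) \<le> e / 2 * norm (x - y)"
      using d(2)[OF xy] unfolding t_def by (simp add: sum_subtractf)
    ultimately show ?thesis
      using norm_triangle_ineq[of "\<Sum>k. t (k + N)" "\<Sum>k<N. t k"] by (simp add: field_simps)
  qed
  then show "\<exists>d>0. \<forall>x\<in>S. \<forall>y\<in>S. dist a x < d \<longrightarrow> dist a y < d \<longrightarrow>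
      norm (f x - f y - (\<Sum>k. A k (x - y))) \<le> e * norm (x - y)" using d(1) by blast
qed

text \<open>Testing along \<open>a + t *\<^sub>R h\<close> for small t shows that the strict
  derivative inherits the Lipschitz constant of the map. This supplies the majorant of the
  derivatives in \<open>sdiff_series\<close>.\<close>

lemma sdiff_derivative_bound:
  assumes T: "sdiff S T a A" and a: "a \<in> S" and h: "\<And>t. 0 < t \<Longrightarrow> t < r \<Longrightarrow> a + t *\<^sub>R h \<in> S" and "r > 0"
    and b: "\<And>x. x \<in> S \<Longrightarrow> norm (T x - T a) \<le> M * norm (x - a)"
  shows "norm (A h) \<le> M * norm h"
proof (rule field_le_epsilon)
  fix e :: real assume e: "e > 0"
  define e' where "e' = e / (norm h + 1)"
  have e': "e' > 0" "e' * norm h \<le> e"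
    using e by (auto simp: e'_def field_simps add_pos_nonneg)
  obtain d where d: "d > 0" "\<And>x y. x \<in> S \<Longrightarrow> y \<in> S \<Longrightarrow> dist a x < d \<Longrightarrow> dist a y < d \<Longrightarrow>
    norm (T x - T y - A (x - y)) \<le> e' * norm (x - y)" using sdiffE[OF T e'(1)] by metis
  define t where "t = min r (d / (norm h + 1)) / 2"
  have nh: "norm h + 1 > 0" by (simp add: add_nonneg_pos)
  have t: "t > 0" "t < r" using d \<open>r > 0\<close> nh by (auto simp: t_def)
  have "t * (norm h + 1) < d"
  proof -
    have "t * (norm h + 1) \<le> d / (norm h + 1) / 2 * (norm h + 1)"
      using nh unfolding t_def by (intro mult_right_mono divide_right_mono min.cobounded2) auto
    also have "\<dots> = d / 2 * ((norm h + 1) / (norm h + 1))" by (simp only: times_divide_eq_left times_divide_eq_right divide_divide_eq_left mult.commute)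
    also have "\<dots> < d" using d nh by simp
    finally show ?thesis .
  qed
  then have th: "t * norm h < d" using t by (simp add: algebra_simps)
  have S: "a + t *\<^sub>R h \<in> S" using h t by blast
  have "norm (T (a + t *\<^sub>R h) - T a - A (t *\<^sub>R h)) \<le> e' * norm (t *\<^sub>R h)"
    using d(2)[OF S a] th t d(1) by (simp add: dist_norm)
  moreover have "norm (T (a + t *\<^sub>R h) - T a) \<le> M * norm (t *\<^sub>R h)" using b[OF S] by simp
  moreover have "A (t *\<^sub>R h) = t *\<^sub>R A h"
    using T sdiff_bounded_linear bounded_linear.linear linear_scale by blast
  ultimately have "norm (t *\<^sub>R A h) \<le> (M + e') * norm (t *\<^sub>R h)"
    using norm_triangle_sub[of "t *\<^sub>R A h" "T (a + t *\<^sub>R h) - T a"] by (simp add: norm_minus_commute algebra_simps)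
  then have "t * norm (A h) \<le> t * ((M + e') * norm h)" using t by (simp add: mult_ac)
  then have "norm (A h) \<le> (M + e') * norm h" using t by (simp only: mult_le_cancel_left_pos)
  then show "norm (A h) \<le> M * norm h + e" using e' by (simp add: algebra_simps)
qed


section \<open>Maps of class \<open>Cq\<close> are strictly differentiable\<close>

lemma Ck_on_imp_continuous_on: "Ck_on k n U f \<Longrightarrow> continuous_on U f"
  by (cases k) (auto intro: has_derivative_continuous_on)

text \<open>Mean value inequality for f minus its derivative at a, on a ball of \<open>Rn n\<close>
  (a convex set) so small that the derivative varies there by at most e in norm.\<close>

lemma Ck_on_Suc_imp_sC1:
  assumes U: "open_in_Rn n U" and f: "Ck_on (Suc k) n U f"
  shows "sC1 U f"
  unfolding sC1_def
proof
  fix a assume a: "a \<in> U"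
  have URn: "U \<subseteq> Rn n" using U openin_imp_subset by blast
  obtain f' where f': "\<And>x. x \<in> U \<Longrightarrow> (f has_derivative f' x) (at x within U)"
    and "\<And>v. v \<in> Rn n \<Longrightarrow> Ck_on k n U (\<lambda>x. f' x v)" using f by auto
  then have cont: "continuous_on U (\<lambda>x. f' x (unitv i))" if "i < n" for i
    using that by (intro Ck_on_imp_continuous_on[of k n]) auto
  \<comment> \<open>\<open>f' x\<close> is determined only on \<open>Rn n\<close>; truncating the
    argument fixes a derivative whose difference from the one at \<open>a\<close> can be bounded in
    all directions.\<close>
  define A where "A x = (\<lambda>h. f' x (vtrunc n h))" for x
  have blA: "bounded_linear (A x)" if "x \<in> U" for x
    unfolding A_def using f'[OF that]
    by (intro bounded_linear_compose[OF _ bounded_linear_vtrunc]) (auto dest: has_derivative_bounded_linear)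
  have A: "(f has_derivative A x) (at x within U)" if "x \<in> U" for x
  proof -
    have "vtrunc n (y - x) = y - x" if "y \<in> U" for y
      using that \<open>x \<in> U\<close> URn by (intro vtrunc_id Rn_intros) auto
    then show ?thesis
      using f'[OF that] blA[OF that] unfolding has_derivative_within_alt A_def by auto
  qed
  have "sdiff U f a (A a)"
  proof (rule sdiffI[OF blA[OF a]])
    fix e :: real assume e: "e > 0"
    \<comment> \<open>This bound is used once for each of the n unit vectors; n + 1 instead of n
      avoids division by zero.\<close>
    define e' where "e' = e / (real n + 1)"
    have e': "e' > 0" using e by (simp add: e'_def)
    have "\<exists>d>0. \<forall>x\<in>U. dist x a < d \<longrightarrow> norm (f' x (unitv i) - f' a (unitv i)) < e'" if "i < n" for i
      using cont[OF that] a e' unfolding continuous_on_iff dist_norm by metis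
    then obtain D where D: "\<And>i. i < n \<Longrightarrow> D i > 0"
      "\<And>i x. i < n \<Longrightarrow> x \<in> U \<Longrightarrow> dist x a < D i \<Longrightarrow> norm (f' x (unitv i) - f' a (unitv i)) < e'"
      by metis
    obtain r where r: "r > 0" "\<And>x. x \<in> Rn n \<Longrightarrow> dist a x < r \<Longrightarrow> x \<in> U"
      using open_in_Rn_ball[OF U a] by blast
    define d where "d = Min (insert r (D ` {..<n}))"
    have d: "d > 0" "d \<le> r" "\<And>i. i < n \<Longrightarrow> d \<le> D i"
      using D(1) r(1) by (auto simp: d_def)
    define B where "B = Rn n \<inter> ball a d"
    have BU: "B \<subseteq> U" using r d by (auto simp: B_def)
    have "convex B" unfolding B_def by (intro convex_Int subspace_imp_convex[OF subspace_Rn] convex_ball)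
    have bnd: "norm (A x h - A a h) \<le> e * norm h" if "x \<in> B" for x h
    proof -
      have lin: "linear (\<lambda>h. f' x h - f' a h)"
        using f' that BU a by (intro bounded_linear.linear bounded_linear_sub has_derivative_bounded_linear) auto
      have "(\<Sum>i<n. norm (f' x (unitv i) - f' a (unitv i))) \<le> (\<Sum>i<n. e')"
        using that BU d(3) by (intro sum_mono less_imp_le D(2)) (force simp: B_def dist_commute)+
      also have "\<dots> \<le> e" using e by (simp add: e'_def field_simps)
      finally have "(\<Sum>i<n. norm (f' x (unitv i) - f' a (unitv i))) * norm (vtrunc n h) \<le> e * norm h"
        using e norm_vtrunc_le by (intro mult_mono) auto
      then show ?thesis
        using linear_bound_Rn[OF lin, of "vtrunc n h" n] unfolding A_def by simp
    qed
    have *: "norm ((f x - A a x) - (f y - A a y)) \<le> e * norm (x - y)" if "x \<in> B" "y \<in> B" for x y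
    proof (rule differentiable_bound[OF \<open>convex B\<close> _ _ that])
      show "((\<lambda>x. f x - A a x) has_derivative (\<lambda>h. A z h - A a h)) (at z within B)" if "z \<in> B" for z
        using that BU blA[OF a]
        by (intro has_derivative_diff has_derivative_subset[OF A] bounded_linear_imp_has_derivative) auto
      show "onorm (\<lambda>h. A z h - A a h) \<le> e" if "z \<in> B" for z
        using bnd[OF that] e by (intro onorm_bound) auto
    qed
    have "norm (f x - f y - A a (x - y)) \<le> e * norm (x - y)" if "x \<in> B" "y \<in> B" for x y
    proof -
      have eq: "f x - f y - A a (x - y) = (f x - A a x) - (f y - A a y)"
        unfolding linear_diff[OF bounded_linear.linear[OF blA[OF a]]] by simp
      show ?thesis by (subst eq) (rule *[OF that])
    qed
    then show "\<exists>d>0. \<forall>x\<in>U. \<forall>y\<in>U. dist a x < d \<longrightarrow> dist a y < d \<longrightarrow>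
        norm (f x - f y - A a (x - y)) \<le> e * norm (x - y)"
      using d(1) URn by (intro exI[of _ d]) (auto simp: B_def subset_iff)
  qed
  then show "\<exists>A. sdiff U f a A" by blast
qed

section \<open>Power series in several variables\<close>

lemma countable_multi_indices: "countable {\<alpha> :: nat \<Rightarrow> nat. \<forall>i\<ge>n. \<alpha> i = 0}"
proof -
  have "inj_on (\<lambda>\<alpha>. map \<alpha> [0..<n]) {\<alpha> :: nat \<Rightarrow> nat. \<forall>i\<ge>n. \<alpha> i = 0}"
  proof (rule inj_onI)
    fix \<alpha> \<beta> :: "nat \<Rightarrow> nat"
    assume *: "\<alpha> \<in> {\<alpha>. \<forall>i\<ge>n. \<alpha> i = 0}" "\<beta> \<in> {\<alpha>. \<forall>i\<ge>n. \<alpha> i = 0}"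
      "map \<alpha> [0..<n] = map \<beta> [0..<n]"
    have "\<alpha> i = \<beta> i" for i using * by (cases "i < n") auto
    then show "\<alpha> = \<beta>" by blast
  qed
  then show ?thesis by (rule countableI')
qed

text \<open>After rescaling by r = \<rho> / 2 all variables lie in [-1, 1], and the monomials differ
  by at most the degree s times D / r. Working at half the radius pays for the degree, since s r^s
  \<le> (2 r)^s = \<rho>^s.\<close>

lemma monomial_diff_bound:
  fixes \<alpha> :: "nat \<Rightarrow> nat" and x y :: "nat \<Rightarrow> real"
  assumes \<rho>: "\<rho> > 0" and x: "\<And>i. i < n \<Longrightarrow> \<bar>x i\<bar> \<le> \<rho> / 2" and y: "\<And>i. i < n \<Longrightarrow> \<bar>y i\<bar> \<le> \<rho> / 2"
    and xy: "\<And>i. i < n \<Longrightarrow> \<bar>x i - y i\<bar> \<le> D" and D: "D \<ge> 0"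
  shows "\<bar>(\<Prod>i<n. x i ^ \<alpha> i) - (\<Prod>i<n. y i ^ \<alpha> i)\<bar> \<le> (\<Prod>i<n. \<rho> ^ \<alpha> i) * (2 / \<rho>) * D"
proof -
  define r where "r = \<rho> / 2"
  have r: "r > 0" using \<rho> by (simp add: r_def)
  define s where "s = (\<Sum>i<n. \<alpha> i)"
  define u where "u i = x i / r" for i
  define v where "v i = y i / r" for i
  have uv: "\<bar>u i\<bar> \<le> 1" "\<bar>v i\<bar> \<le> 1" if "i < n" for i
    using x[OF that] y[OF that] r by (auto simp: u_def v_def r_def[symmetric] field_simps)
  have "\<bar>(\<Prod>i<n. u i ^ \<alpha> i) - (\<Prod>i<n. v i ^ \<alpha> i)\<bar> \<le> (\<Sum>i<n. \<bar>u i ^ \<alpha> i - v i ^ \<alpha> i\<bar>)"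
    using norm_prod_diff[of "{..<n}" "\<lambda>i. u i ^ \<alpha> i" "\<lambda>i. v i ^ \<alpha> i"] uv
    by (simp add: power_abs power_le_one)
  also have "\<dots> \<le> (\<Sum>i<n. real (\<alpha> i) * (D / r))"
  proof (rule sum_mono)
    fix i assume "i \<in> {..<n}"
    then have i: "i < n" by simp
    have "\<bar>u i ^ \<alpha> i - v i ^ \<alpha> i\<bar> \<le> real (\<alpha> i) * \<bar>u i - v i\<bar>"
      using norm_power_diff[of "u i" "v i" "\<alpha> i"] uv[OF i] by simp
    also have "\<bar>u i - v i\<bar> \<le> D / r"
      using xy[OF i] r by (simp add: u_def v_def diff_divide_distrib[symmetric] divide_right_mono)
    finally show "\<bar>u i ^ \<alpha> i - v i ^ \<alpha> i\<bar> \<le> real (\<alpha> i) * (D / r)" by (simp add: mult_left_mono)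
  qed
  also have "\<dots> = real s * (D / r)" by (simp only: s_def sum_distrib_right of_nat_sum)
  finally have 1: "\<bar>(\<Prod>i<n. u i ^ \<alpha> i) - (\<Prod>i<n. v i ^ \<alpha> i)\<bar> \<le> real s * (D / r)" .
  have scale: "(\<Prod>i<n. z i ^ \<alpha> i) = r ^ s * (\<Prod>i<n. (z i / r) ^ \<alpha> i)" for z
    using r by (simp add: s_def power_divide prod_dividef power_sum)
  have "\<bar>(\<Prod>i<n. x i ^ \<alpha> i) - (\<Prod>i<n. y i ^ \<alpha> i)\<bar>
      = r ^ s * \<bar>(\<Prod>i<n. u i ^ \<alpha> i) - (\<Prod>i<n. v i ^ \<alpha> i)\<bar>"
    using r by (simp add: scale[of x] scale[of y] u_def v_def right_diff_distrib[symmetric] abs_mult)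
  also have "\<dots> \<le> r ^ s * (real s * (D / r))" using 1 r by (intro mult_left_mono) auto
  also have "\<dots> = r ^ s * real s * (D / r)" by simp
  also have "\<dots> \<le> (\<Prod>i<n. \<rho> ^ \<alpha> i) * (D / r)"
  proof (rule mult_right_mono)
    have "r ^ s * real s \<le> r ^ s * 2 ^ s"
      using r of_nat_less_two_power[of s, where 'a = real] by (intro mult_left_mono) auto
    also have "\<dots> = \<rho> ^ s" by (simp add: r_def power_mult_distrib[symmetric] del: power_divide)
    finally show "r ^ s * real s \<le> (\<Prod>i<n. \<rho> ^ \<alpha> i)" by (simp add: s_def power_sum)
  qed (use D r in simp)
  finally show ?thesis by (simp add: r_def mult_ac)
qed

text \<open>Absolute convergence at one point \<open>p\<close>, whose first n coordinates exceed
  those of \<open>a\<close> by \<rho>, gives a summable majorant for the Lipschitz constants of all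
  terms on the ball of radius \<rho> / 2. The series can then be differentiated term by
  term.\<close>

lemma real_analytic_on_imp_sC1:
  fixes f :: "evec \<Rightarrow> real"
  assumes U: "open_in_Rn n U" and f: "real_analytic_on n U f"
  shows "sC1 U f"
  unfolding sC1_def
proof
  fix a assume a: "a \<in> U"
  have URn: "U \<subseteq> Rn n" using U openin_imp_subset by blast
  define I where "I = {\<alpha> :: nat \<Rightarrow> nat. \<forall>i\<ge>n. \<alpha> i = 0}"
  obtain r c where r: "r > 0" and c: "\<And>x. x \<in> U \<Longrightarrow> dist a x < r \<Longrightarrow>
      ((\<lambda>\<alpha>. (\<Prod>i<n. (coord x i - coord a i) ^ \<alpha> i) * c \<alpha>) has_sum f x) I"
  proof -
    obtain r c where "r > 0" "\<forall>x\<in>U \<inter> ball a r.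
        ((\<lambda>\<alpha>. (\<Prod>i<n. (coord x i - coord a i) ^ \<alpha> i) *\<^sub>R c \<alpha>) has_sum f x) I"
      using bspec[OF f[unfolded real_analytic_on_def] a] unfolding I_def by blast
    then show ?thesis by (intro that[of r c]) auto
  qed
  obtain r' where r': "r' > 0" "\<And>x. x \<in> Rn n \<Longrightarrow> dist a x < r' \<Longrightarrow> x \<in> U"
    using open_in_Rn_ball[OF U a] by blast
  \<comment> \<open>A vector with n entries \<rho> has norm at most n \<rho>, so this choice keeps
    \<open>p\<close> both in the ball of convergence and in \<open>U\<close>.\<close>
  define \<rho> where "\<rho> = min r r' / (real n + 1)"
  have \<rho>: "\<rho> > 0" using r r' by (simp add: \<rho>_def)
  define p where "p = a + \<rho> *\<^sub>R (\<Sum>i<n. unitv i)"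
  have "norm (\<Sum>i<n. unitv i) \<le> real n" using norm_sum[of unitv "{..<n}"] by simp
  then have "\<rho> * norm (\<Sum>i<n. unitv i) \<le> \<rho> * real n" using \<rho> by simp
  also have "\<dots> < min r r'"
  proof -
    define m where "m = min r r'"
    have "m > 0" using r r' by (simp add: m_def)
    then show ?thesis unfolding \<rho>_def m_def[symmetric] by (simp add: field_simps)
  qed
  finally have p: "p \<in> Rn n" "dist a p < r" "dist a p < r'"
    using a URn \<rho> Rn_intros(2)[of a n "\<rho> *\<^sub>R (\<Sum>i<n. unitv i)"]
      Rn_intros(4)[OF sum_in_Rn[of "{..<n}" unitv n]] by (auto simp: p_def dist_norm)
  have pa: "coord p i - coord a i = \<rho>" if "i < n" for i using that by (simp add: p_def)
  have "((\<lambda>\<alpha>. (\<Prod>i<n. (coord p i - coord a i) ^ \<alpha> i) * c \<alpha>) has_sum f p) I"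
    using p r' by (intro c) auto
  moreover have "(\<Prod>i<n. (coord p i - coord a i) ^ \<alpha> i) = (\<Prod>i<n. \<rho> ^ \<alpha> i)" for \<alpha>
    by (intro prod.cong) (auto simp: pa)
  ultimately have "((\<lambda>\<alpha>. (\<Prod>i<n. \<rho> ^ \<alpha> i) * c \<alpha>) has_sum f p) I" by simp
  then have "(\<lambda>\<alpha>. norm ((\<Prod>i<n. \<rho> ^ \<alpha> i) * c \<alpha>)) summable_on I"
    by (rule summable_on_iff_abs_summable_on_real[THEN iffD1, OF has_sum_imp_summable])
  note sm = has_sum_infsum[OF this, unfolded real_norm_def]
  have cI: "countable I" unfolding I_def by (rule countable_multi_indices)
  define N where "N = to_nat_on I ` I"
  \<comment> \<open>Turns a sum over multi-indices into a series over the naturals; numbers that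
    code no multi-index get the term 0.\<close>
  define seq where "seq g = (\<lambda>k. if k \<in> N then g (from_nat_into I k) else (0::real))" for g
  have to_seq: "seq g sums l" if "(g has_sum l) I" for g l
  proof -
    have "((\<lambda>\<alpha>. (g \<circ> from_nat_into I) (to_nat_on I \<alpha>)) has_sum l) I"
      by (rule has_sum_cong[THEN iffD1, OF _ that]) (use cI in simp)
    then have "((g \<circ> from_nat_into I) has_sum l) N"
      unfolding N_def using has_sum_reindex[OF inj_on_to_nat_on[OF cI], of "g \<circ> from_nat_into I" l]
      by (simp add: o_def)
    then have "(seq g has_sum l) UNIV"
      by (rule has_sum_cong_neutral[THEN iffD1, rotated -1]) (auto simp: seq_def)
    then show ?thesis by (rule has_sum_imp_sums)
  qed
  define M where "M = seq (\<lambda>\<alpha>. \<bar>(\<Prod>i<n. \<rho> ^ \<alpha> i) * c \<alpha>\<bar> * (2 / \<rho>))"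
  have M: "summable M"
    unfolding M_def by (rule sums_summable, rule to_seq, rule has_sum_cmult_left, rule sm)
  have M0: "M k \<ge> 0" for k unfolding M_def seq_def using \<rho> by auto
  define T where "T k x = seq (\<lambda>\<alpha>. (\<Prod>i<n. (coord x i - coord a i) ^ \<alpha> i) * c \<alpha>) k" for k x
  define Q where "Q = Rn n \<inter> ball a (\<rho> / 2)"
  have "\<rho> \<le> min r r'"
  proof -
    define m where "m = min r r'"
    have "m > 0" using r r' by (simp add: m_def)
    then show ?thesis unfolding \<rho>_def m_def[symmetric] by (simp add: field_simps)
  qed
  then have QU: "x \<in> U" "dist a x < r" if "x \<in> Q" for x
    using that r' \<rho> by (auto simp: Q_def)
  have aQ: "a \<in> Q" using a URn \<rho> by (auto simp: Q_def)
  have Tf: "(\<lambda>k. T k x) sums f x" if "x \<in> Q" for x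
    unfolding T_def using to_seq[OF c] QU[OF that] by simp
  have Tb: "norm (T k x - T k y) \<le> M k * norm (x - y)" if "x \<in> Q" "y \<in> Q" for k x y
  proof (cases "k \<in> N")
    case True
    define \<alpha> where "\<alpha> = from_nat_into I k"
    have near: "\<bar>coord z i - coord a i\<bar> \<le> \<rho> / 2" if "z \<in> Q" for z i
      using that abs_coord_le_norm[of "z - a" i] by (auto simp: Q_def dist_norm norm_minus_commute)
    have "\<bar>(\<Prod>i<n. (coord x i - coord a i) ^ \<alpha> i) - (\<Prod>i<n. (coord y i - coord a i) ^ \<alpha> i)\<bar>
        \<le> (\<Prod>i<n. \<rho> ^ \<alpha> i) * (2 / \<rho>) * norm (x - y)"
      using abs_coord_le_norm[of "x - y"] by (intro monomial_diff_bound near that \<rho>) auto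
    then have "\<bar>((\<Prod>i<n. (coord x i - coord a i) ^ \<alpha> i) - (\<Prod>i<n. (coord y i - coord a i) ^ \<alpha> i)) * c \<alpha>\<bar>
        \<le> (\<Prod>i<n. \<rho> ^ \<alpha> i) * (2 / \<rho>) * norm (x - y) * \<bar>c \<alpha>\<bar>"
      unfolding abs_mult by (rule mult_right_mono) simp
    moreover have "(\<Prod>i<n. \<rho> ^ \<alpha> i) \<ge> 0" using \<rho> by (intro prod_nonneg) auto
    ultimately show ?thesis
      using True by (simp add: T_def M_def seq_def \<alpha>_def[symmetric] algebra_simps abs_mult)
  qed (simp add: T_def M_def seq_def)
  have "\<exists>A. sdiff Q (T k) a A" for k
  proof -
    have "sC1 Q (\<lambda>x. (coord x i - coord a i))" for i
      using sC1_add[OF sC1_bounded_linear[OF bounded_linear_coord] sC1_const[of Q "- coord a i"]] by simp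
    then have "sC1 Q (T k)"
      unfolding T_def seq_def
      by (cases "k \<in> N") (auto intro!: sC1_const sC1_mult sC1_prod sC1_power)
    then show ?thesis using aQ unfolding sC1_def by blast
  qed
  then obtain A where A: "\<And>k. sdiff Q (T k) a (A k)" by metis
  \<comment> \<open>The Lipschitz bound can be tested only in directions along which one stays in
    \<open>Q\<close>, that is, in \<open>Rn n\<close>; hence the truncation.\<close>
  have Ab: "norm (A k (vtrunc n h)) \<le> M k * norm h" for k h
  proof -
    have "norm (A k (vtrunc n h)) \<le> M k * norm (vtrunc n h)"
    proof (rule sdiff_derivative_bound[OF A aQ])
      show "a + t *\<^sub>R vtrunc n h \<in> Q" if "0 < t" "t < \<rho> / 2 / (norm (vtrunc n h) + 1)" for t
      proof -
        have "t * (norm (vtrunc n h) + 1) < \<rho> / 2"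
          using that by (simp add: field_simps add_pos_nonneg)
        then have "t * norm (vtrunc n h) < \<rho> / 2" using that by (simp add: algebra_simps)
        then show ?thesis using aQ that by (auto simp: Q_def dist_norm)
      qed
      show "0 < \<rho> / 2 / (norm (vtrunc n h) + 1)" using \<rho> by (simp add: add_nonneg_pos)
    qed (use Tb aQ in auto)
    also have "\<dots> \<le> M k * norm h" using M0 norm_vtrunc_le by (intro mult_left_mono)
    finally show ?thesis .
  qed
  have "sdiff Q f a (\<lambda>h. \<Sum>k. A k (vtrunc n h))"
    using Tb Ab M Tf by (intro sdiff_series[where T = T and M = M] sdiff_vtrunc A) (auto simp: Q_def)
  then have "sdiff (U \<inter> ball a (\<rho> / 2)) f a (\<lambda>h. \<Sum>k. A k (vtrunc n h))"
    using URn by (elim sdiff_subset) (auto simp: Q_def)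
  then show "\<exists>A. sdiff U f a A" using \<rho> by (blast intro: sdiff_local[OF _ open_ball] centre_in_ball[THEN iffD2] half_gt_zero)
qed

lemma real_analytic_on_linear_image:
  assumes "real_analytic_on n U f" "bounded_linear A"
  shows "real_analytic_on n U (\<lambda>x. A (f x))"
  unfolding real_analytic_on_def
proof
  fix a assume "a \<in> U"
  then obtain r c where r: "r > 0" and c: "\<And>x. x \<in> U \<inter> ball a r \<Longrightarrow>
      ((\<lambda>\<alpha>. (\<Prod>i<n. (coord x i - coord a i) ^ \<alpha> i) *\<^sub>R c \<alpha>) has_sum f x) {\<alpha>. \<forall>i\<ge>n. \<alpha> i = 0}"
    using bspec[OF assms(1)[unfolded real_analytic_on_def] \<open>a \<in> U\<close>] by blast
  have "((\<lambda>\<alpha>. (\<Prod>i<n. (coord x i - coord a i) ^ \<alpha> i) *\<^sub>R A (c \<alpha>)) has_sum A (f x)) {\<alpha>. \<forall>i\<ge>n. \<alpha> i = 0}"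
    if "x \<in> U \<inter> ball a r" for x
    using has_sum_bounded_linear[OF assms(2) c[OF that]]
    by (simp add: o_def linear_scale[OF bounded_linear.linear[OF assms(2)]])
  then show "\<exists>r>0. \<exists>c. \<forall>x\<in>U \<inter> ball a r. ((\<lambda>\<alpha>. (\<Prod>i<n. (coord x i - coord a i) ^ \<alpha> i) *\<^sub>R c \<alpha>)
      has_sum A (f x)) {\<alpha>. \<forall>i\<ge>n. \<alpha> i = 0}"
    using r by (intro exI[of _ r] conjI exI[of _ "\<lambda>\<alpha>. A (c \<alpha>)"]) auto
qed

text \<open>Coordinatewise, since \<open>evec\<close> is not complete: the termwise derivative of an \<open>evec\<close>-valued
  power series converges only after projection to some \<open>Rn m\<close>.\<close>

lemma Cq_on_open_imp_sC1_linear: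
  fixes A :: "'a::real_normed_vector \<Rightarrow> real"
  assumes "Cq_on_open q n U f" "open_in_Rn n U" "q \<noteq> C_fin 0" "bounded_linear A"
  shows "sC1 U (\<lambda>x. A (f x))"
proof (cases q)
  case (C_fin k)
  then obtain j where "k = Suc j" using assms by (cases k) auto
  then have "Ck_on (Suc j) n U f" using assms C_fin by (simp del: Ck_on.simps)
  then show ?thesis using assms Ck_on_Suc_imp_sC1 sC1_linear_image by blast
next
  case C_inf
  then have "Ck_on (Suc 0) n U f" using assms(1) by (simp del: Ck_on.simps)
  then show ?thesis using assms Ck_on_Suc_imp_sC1 sC1_linear_image by blast
next
  case C_omega
  then have "real_analytic_on n U (\<lambda>x. A (f x))"
    using assms by (intro real_analytic_on_linear_image[of n U f A]) auto
  then show ?thesis by (rule real_analytic_on_imp_sC1[OF assms(2)])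
qed

lemma Cq_on_imp_sC1_linear:
  fixes A :: "'a::real_normed_vector \<Rightarrow> real"
  assumes "Cq_on q n S f" "q \<noteq> C_fin 0" "bounded_linear A" "S \<subseteq> Rn n"
  shows "sC1 S (\<lambda>x. A (f x))"
  unfolding sC1_def
proof
  fix a assume a: "a \<in> S"
  then obtain U F where U: "open_in_Rn n U" "a \<in> U" "Cq_on_open q n U F" "\<forall>y\<in>S \<inter> U. F y = f y"
    using assms(1) unfolding Cq_on_def by blast
  obtain O' where O': "open O'" "U = Rn n \<inter> O'" using U(1) by (auto simp: openin_open)
  have "sC1 U (\<lambda>x. A (F x))" using Cq_on_open_imp_sC1_linear[OF U(3,1) assms(2,3)] .
  then obtain B where "sdiff U (\<lambda>x. A (F x)) a B" using U(2) unfolding sC1_def by blast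
  then have "sdiff (S \<inter> U) (\<lambda>x. A (F x)) a B" by (rule sdiff_subset) auto
  then have "sdiff (S \<inter> U) (\<lambda>x. A (f x)) a B" by (rule sdiff_cong) (use U(4) in auto)
  then have "sdiff (S \<inter> O') (\<lambda>x. A (f x)) a B"
    by (rule sdiff_subset) (use O' assms(4) in auto)
  then show "\<exists>A'. sdiff S (\<lambda>x. A (f x)) a A'"
    using sdiff_local[OF _ O'(1)] O'(2) U(2) by blast
qed

lemma Cq_on_imp_sC1:
  assumes "Cq_on q n S f" "q \<noteq> C_fin 0" "S \<subseteq> Rn n" "f ` S \<subseteq> Rn m"
  shows "sC1 S f"
  using Cq_on_imp_sC1_linear[OF assms(1,2) bounded_linear_coord assms(3)] assms(4) by (intro sC1_coordwise)

lemma Cq_on_real_imp_sC1: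
  fixes f :: "evec \<Rightarrow> real"
  assumes "Cq_on q n S f" "q \<noteq> C_fin 0" "S \<subseteq> Rn n"
  shows "sC1 S f"
  using Cq_on_imp_sC1_linear[OF assms(1,2) bounded_linear_ident assms(3)] .

lemma Cq_diffeo_sC1:
  assumes "Cq_diffeo q n U W \<phi>" "q \<noteq> C_fin 0"
  shows "sC1 U \<phi>" "sC1 W (inv_into U \<phi>)"
proof -
  note d = assms(1)[unfolded Cq_diffeo_def]
  have UW: "U \<subseteq> Rn n" "W \<subseteq> Rn n" using d openin_imp_subset by blast+
  have im: "\<phi> ` U = W" "inv_into U \<phi> ` W = U"
    using d bij_betw_inv_into by (auto simp: bij_betw_def)
  show "sC1 U \<phi>"
    using d UW im Cq_on_open_imp_sC1_linear[OF _ _ assms(2) bounded_linear_coord]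
    by (intro sC1_coordwise[where m = n]) auto
  show "sC1 W (inv_into U \<phi>)"
    using d UW im Cq_on_open_imp_sC1_linear[OF _ _ assms(2) bounded_linear_coord]
    by (intro sC1_coordwise[where m = n]) auto
qed

section \<open>Tangent spaces\<close>

lemma tangent_spaceI:
  assumes "0 < e" "\<And>t. \<bar>t\<bar> < e \<Longrightarrow> \<gamma> t \<in> M" "\<gamma> 0 = b" "(\<gamma> has_vector_derivative v) (at 0)"
  shows "v \<in> tangent_space M b"
  using assms unfolding tangent_space_def by blast

lemma tangent_spaceE:
  assumes "v \<in> tangent_space M b"
  obtains \<gamma> e where "0 < e" "\<And>t. \<bar>t\<bar> < e \<Longrightarrow> \<gamma> t \<in> M" "\<gamma> 0 = b" "(\<gamma> has_vector_derivative v) (at 0)"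
  using assms unfolding tangent_space_def by blast

lemma tangent_space_mono: "M \<subseteq> N \<Longrightarrow> tangent_space M b \<subseteq> tangent_space N b"
  unfolding tangent_space_def by blast

lemma tangent_space_limit:
  assumes "(\<gamma> has_vector_derivative v) (at (0::real))"
  shows "((\<lambda>t. (\<gamma> t - \<gamma> 0) /\<^sub>R t) \<longlongrightarrow> v) (at 0)"
proof (rule LIM_I)
  fix e :: real assume e: "0 < e"
  then obtain d where d: "d > 0" "\<And>y. norm (y - 0) < d \<Longrightarrow>
      norm (\<gamma> y - \<gamma> 0 - (y - 0) *\<^sub>R v) \<le> e / 2 * norm (y - 0)"
    using assms unfolding has_vector_derivative_def has_derivative_at_alt by (meson half_gt_zero)
  have "norm ((\<gamma> t - \<gamma> 0) /\<^sub>R t - v) < e" if t: "t \<noteq> 0" "norm (t - 0) < d" for t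
  proof -
    have "(\<gamma> t - \<gamma> 0) /\<^sub>R t - v = (\<gamma> t - \<gamma> 0 - t *\<^sub>R v) /\<^sub>R t"
      using t(1) by (simp add: scaleR_diff_right)
    moreover have "inverse \<bar>t\<bar> * norm (\<gamma> t - \<gamma> 0 - t *\<^sub>R v) \<le> inverse \<bar>t\<bar> * (e / 2 * \<bar>t\<bar>)"
      using d(2)[OF t(2)] by (intro mult_left_mono) auto
    moreover have "inverse \<bar>t\<bar> * (e / 2 * \<bar>t\<bar>) = e / 2" using t(1) by simp
    ultimately show ?thesis using e by (simp del: times_divide_eq_left times_divide_eq_right)
  qed
  with d(1) show "\<exists>s>0. \<forall>x. x \<noteq> 0 \<and> norm (x - 0) < s \<longrightarrow> norm ((\<gamma> x - \<gamma> 0) /\<^sub>R x - v) < e" by blast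
qed

lemma tangent_space_scaleR:
  assumes "v \<in> tangent_space M b"
  shows "r *\<^sub>R v \<in> tangent_space M b"
proof -
  obtain \<gamma> e where g: "0 < e" "\<And>t. \<bar>t\<bar> < e \<Longrightarrow> \<gamma> t \<in> M" "\<gamma> 0 = b" "(\<gamma> has_vector_derivative v) (at 0)"
    using tangent_spaceE[OF assms] by metis
  have "((\<lambda>t. \<gamma> (r * t)) has_vector_derivative r *\<^sub>R v) (at 0)"
  proof -
    have "((\<lambda>t. r * t) has_vector_derivative r) (at 0)"
      unfolding has_real_derivative_iff_has_vector_derivative[symmetric]
      by (auto intro!: derivative_eq_intros)
    then show ?thesis
      using vector_diff_chain_at[of "\<lambda>t. r * t" r 0 \<gamma> v] g(4) by (simp add: o_def)
  qed
  moreover have "\<gamma> (r * t) \<in> M" if "\<bar>t\<bar> < e / (\<bar>r\<bar> + 1)" for t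
  proof (rule g(2))
    have "\<bar>r\<bar> * \<bar>t\<bar> \<le> (\<bar>r\<bar> + 1) * \<bar>t\<bar>" by (simp add: mult_right_mono)
    also have "\<dots> < e" using that by (simp add: field_simps)
    finally show "\<bar>r * t\<bar> < e" by (simp add: abs_mult)
  qed
  ultimately show ?thesis
    using g(1,3) by (intro tangent_spaceI[of "e / (\<bar>r\<bar> + 1)" "\<lambda>t. \<gamma> (r * t)"]) auto
qed

lemma tangent_space_0: "b \<in> M \<Longrightarrow> 0 \<in> tangent_space M b"
  by (rule tangent_spaceI[of 1 "\<lambda>t. b"]) auto

lemma tangent_space_Int_open:
  assumes "open U" "b \<in> U"
  shows "tangent_space (M \<inter> U) b = tangent_space M b"
proof
  show "tangent_space M b \<subseteq> tangent_space (M \<inter> U) b"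
  proof
    fix v assume "v \<in> tangent_space M b"
    then obtain \<gamma> e where g: "0 < e" "\<And>t. \<bar>t\<bar> < e \<Longrightarrow> \<gamma> t \<in> M" "\<gamma> 0 = b" "(\<gamma> has_vector_derivative v) (at 0)"
      using tangent_spaceE by metis
    have "\<gamma> \<midarrow>0\<rightarrow> b"
      using has_vector_derivative_continuous[OF g(4)] g(3) by (simp add: continuous_within)
    then have "\<forall>\<^sub>F t in at 0. \<gamma> t \<in> U" using assms topological_tendstoD by blast
    then obtain d where d: "d > 0" "\<And>t. t \<noteq> 0 \<Longrightarrow> \<bar>t\<bar> < d \<Longrightarrow> \<gamma> t \<in> U"
      unfolding eventually_at by (auto simp: dist_real_def)
    have "\<gamma> t \<in> M \<inter> U" if "\<bar>t\<bar> < min d e" for t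
      using that g(2)[of t] d(2)[of t] g(3) assms(2) by (cases "t = 0") auto
    then show "v \<in> tangent_space (M \<inter> U) b"
      using g d(1) by (intro tangent_spaceI[of "min d e" \<gamma>]) auto
  qed
qed (intro tangent_space_mono Int_lower1)

text \<open>The increment estimate holds along a curve in M and passes to the limit of its
  difference quotients. With error 0 this gives uniqueness of the derivative on tangent vectors,
  with \<open>F\<close> zero it bounds the derivative by a Lipschitz constant, and otherwise it
  compares the derivative at \<open>b\<close> with the strict derivative at a nearby point.\<close>

lemma tangent_space_bound:
  assumes v: "v \<in> tangent_space M b" and F: "bounded_linear F" and "d > 0"
    and f: "\<And>x. x \<in> M \<Longrightarrow> dist b x < d \<Longrightarrow> norm (f x - f b - F (x - b)) \<le> e * norm (x - b)"
    and f': "(f has_derivative f') (at b within M)"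
  shows "norm (f' v - F v) \<le> e * norm v"
proof -
  obtain \<gamma> r where g: "0 < r" "\<And>t. \<bar>t\<bar> < r \<Longrightarrow> \<gamma> t \<in> M" "\<gamma> 0 = b" "(\<gamma> has_vector_derivative v) (at 0)"
    using tangent_spaceE[OF v] by metis
  have lim: "((\<lambda>t. (\<gamma> t - b) /\<^sub>R t) \<longlongrightarrow> v) (at 0)" using tangent_space_limit[OF g(4)] g(3) by simp
  \<comment> \<open>The curve is known to stay in M only on S, so the chain rule is applied within
    this neighbourhood of 0 and the restriction is removed afterwards.\<close>
  define S where "S = {-r<..<r}"
  have gS: "\<gamma> ` S \<subseteq> M" using g(2) by (auto simp: S_def abs_less_iff)
  have "((\<lambda>t. f (\<gamma> t)) has_vector_derivative f' v) (at 0 within S)"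
  proof -
    have "(f has_derivative f') (at (\<gamma> 0) within \<gamma> ` S)"
      using has_derivative_subset[OF f' gS] g(3) by simp
    moreover have "(\<gamma> has_derivative (\<lambda>t. t *\<^sub>R v)) (at 0 within S)"
      using g(4) has_vector_derivative_def has_derivative_at_withinI by blast
    ultimately have "((\<lambda>t. f (\<gamma> t)) has_derivative (\<lambda>t. f' (t *\<^sub>R v))) (at 0 within S)"
      using has_derivative_in_compose by blast
    then show ?thesis
      unfolding has_vector_derivative_def
      using linear_scale[OF has_derivative_linear[OF f']] by simp
  qed
  moreover have at: "at 0 within S = at 0"
    by (rule at_within_open) (use g(1) in \<open>auto simp: S_def\<close>)
  ultimately have "((\<lambda>t. f (\<gamma> t)) has_vector_derivative f' v) (at 0)"
    by (simp only: at)
  from tangent_space_limit[OF this]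
  have lim2: "((\<lambda>t. (f (\<gamma> t) - f b) /\<^sub>R t) \<longlongrightarrow> f' v) (at 0)" by (simp only: g(3))
  have "\<gamma> \<midarrow>0\<rightarrow> b"
    using has_vector_derivative_continuous[OF g(4)] g(3) by (simp add: continuous_within)
  then have ev: "\<forall>\<^sub>F t in at 0. dist b (\<gamma> t) < d"
    using \<open>d > 0\<close> by (auto dest!: tendstoD simp: dist_commute)
  have "\<forall>\<^sub>F t in at 0. \<bar>t\<bar> < r" unfolding eventually_at using g(1) by (auto simp: dist_real_def)
  with ev have le: "\<forall>\<^sub>F t in at 0. norm ((f (\<gamma> t) - f b) /\<^sub>R t - F ((\<gamma> t - b) /\<^sub>R t))
      \<le> e * norm ((\<gamma> t - b) /\<^sub>R t)"
  proof eventually_elim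
    case (elim t)
    have "norm (f (\<gamma> t) - f b - F (\<gamma> t - b)) \<le> e * norm (\<gamma> t - b)"
      using elim g(2) by (intro f) auto
    then have *: "\<bar>inverse t\<bar> * norm (f (\<gamma> t) - f b - F (\<gamma> t - b)) \<le> \<bar>inverse t\<bar> * (e * norm (\<gamma> t - b))"
      by (intro mult_left_mono) auto
    have eq: "(f (\<gamma> t) - f b) /\<^sub>R t - F ((\<gamma> t - b) /\<^sub>R t) = (f (\<gamma> t) - f b - F (\<gamma> t - b)) /\<^sub>R t"
      unfolding linear_scale[OF bounded_linear.linear[OF F]] by (simp only: scaleR_diff_right)
    show ?case unfolding eq norm_scaleR using * by (simp only: mult.left_commute)
  qed
  have l1: "((\<lambda>t. norm ((f (\<gamma> t) - f b) /\<^sub>R t - F ((\<gamma> t - b) /\<^sub>R t))) \<longlongrightarrow> norm (f' v - F v)) (at 0)"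
    by (rule tendsto_norm[OF tendsto_diff[OF lim2 bounded_linear.tendsto[OF F lim]]])
  have l2: "((\<lambda>t. e * norm ((\<gamma> t - b) /\<^sub>R t)) \<longlongrightarrow> e * norm v) (at 0)"
    by (rule tendsto_mult_left[OF tendsto_norm[OF lim]])
  show ?thesis by (rule tendsto_le[OF _ l2 l1 le]) simp
qed

lemma tangent_space_image_subset:
  assumes F: "(F has_derivative F') (at b within M)" and "F ` M \<subseteq> N" and v: "v \<in> tangent_space M b"
  shows "F' v \<in> tangent_space N (F b)"
proof -
  obtain \<gamma> r where g: "0 < r" "\<And>t. \<bar>t\<bar> < r \<Longrightarrow> \<gamma> t \<in> M" "\<gamma> 0 = b" "(\<gamma> has_vector_derivative v) (at 0)"
    using tangent_spaceE[OF v] by metis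
  define S where "S = {-r<..<r}"
  have gS: "\<gamma> ` S \<subseteq> M" using g(2) by (auto simp: S_def abs_less_iff)
  have "(F has_derivative F') (at (\<gamma> 0) within \<gamma> ` S)"
    using has_derivative_subset[OF F gS] g(3) by simp
  moreover have "(\<gamma> has_derivative (\<lambda>t. t *\<^sub>R v)) (at 0 within S)"
    using g(4) has_vector_derivative_def has_derivative_at_withinI by blast
  ultimately have "((\<lambda>t. F (\<gamma> t)) has_derivative (\<lambda>t. F' (t *\<^sub>R v))) (at 0 within S)"
    using has_derivative_in_compose by blast
  moreover have at: "at 0 within S = at 0"
    by (rule at_within_open) (use g(1) in \<open>auto simp: S_def\<close>)
  ultimately have "((\<lambda>t. F (\<gamma> t)) has_vector_derivative F' v) (at 0)"
    unfolding has_vector_derivative_def at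
    using linear_scale[OF has_derivative_linear[OF F]] by simp
  then show ?thesis using g assms(2) by (intro tangent_spaceI[of r "\<lambda>t. F (\<gamma> t)"]) auto
qed

text \<open>Derivatives within M are not unique as linear maps, so F' and G' need not be inverse to
  each other. On tangent vectors they are, by \<open>tangent_space_bound\<close> with error 0
  applied to the identity map.\<close>

lemma
  assumes F: "(F has_derivative F') (at b within M)" and G: "(G has_derivative G') (at (F b) within F ` M)"
    and GF: "\<And>x. x \<in> M \<Longrightarrow> G (F x) = x" and b: "b \<in> M"
  shows tangent_space_left_inverse: "v \<in> tangent_space M b \<Longrightarrow> G' (F' v) = v"
    and tangent_space_image: "tangent_space (F ` M) (F b) = F' ` tangent_space M b"
proof -
  have id: "((\<lambda>x. x) has_derivative (\<lambda>h. h)) (at b within M)" by simp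
  have "((\<lambda>x. G (F x)) has_derivative (\<lambda>h. G' (F' h))) (at b within M)"
    using has_derivative_in_compose[OF F G] .
  then have id2: "((\<lambda>x. x) has_derivative (\<lambda>h. G' (F' h))) (at b within M)"
    by (rule has_derivative_transform_within[OF _ zero_less_one b]) (use GF in auto)
  show inv: "G' (F' v) = v" if "v \<in> tangent_space M b" for v
    using tangent_space_bound[OF that bounded_linear_ident zero_less_one _ id2, of 0] by simp
  have FG: "F (G y) = y" if "y \<in> F ` M" for y using that GF by auto
  have GM: "G ` F ` M \<subseteq> M" using GF by auto
  have "(F has_derivative F') (at (G (F b)) within G ` F ` M)"
    using has_derivative_subset[OF F GM] GF[OF b] by simp
  from has_derivative_in_compose[OF G this]
  have id3: "((\<lambda>x. x) has_derivative (\<lambda>h. F' (G' h))) (at (F b) within F ` M)"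
    by (rule has_derivative_transform_within[OF _ zero_less_one imageI[OF b]]) (use FG in auto)
  have inv': "F' (G' w) = w" if "w \<in> tangent_space (F ` M) (F b)" for w
    using tangent_space_bound[OF that bounded_linear_ident zero_less_one _ id3, of 0] by simp
  show "tangent_space (F ` M) (F b) = F' ` tangent_space M b"
  proof (intro equalityI subsetI)
    fix w assume w: "w \<in> tangent_space (F ` M) (F b)"
    then have "G' w \<in> tangent_space M (G (F b))" using tangent_space_image_subset[OF G GM] by blast
    then show "w \<in> F' ` tangent_space M b" using inv'[OF w] GF[OF b] by (metis image_eqI)
  qed (use tangent_space_image_subset[OF F order_refl] in auto)
qed

lemma tangent_space_subset_Rn:
  assumes "M \<subseteq> Rn n"
  shows "tangent_space M b \<subseteq> Rn n"
proof
  fix v assume "v \<in> tangent_space M b"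
  then obtain \<gamma> r where g: "0 < r" "\<And>t. \<bar>t\<bar> < r \<Longrightarrow> \<gamma> t \<in> M" "\<gamma> 0 = b" "(\<gamma> has_vector_derivative v) (at 0)"
    using tangent_spaceE by metis
  have "\<forall>\<^sub>F t in at 0. (\<gamma> t - \<gamma> 0) /\<^sub>R t \<in> Rn n"
  proof -
    have "(\<gamma> t - \<gamma> 0) /\<^sub>R t \<in> Rn n" if "\<bar>t\<bar> < r" for t
      using g(2)[OF that] g(2)[of 0] g(1) assms by (intro Rn_intros) auto
    then show ?thesis unfolding eventually_at using g(1) by (auto simp: dist_real_def)
  qed
  then show "v \<in> Rn n"
    by (rule Lim_in_closed_set[OF closed_Rn _ trivial_limit_at tangent_space_limit[OF g(4)]])
qed

text \<open>Short straight segments through \<open>u\<close> stay in the set; the minimum covers the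
  case of an \<open>Rn d\<close> larger than the ambient space.\<close>

lemma tangent_space_open:
  assumes "open_in_Rn n U" "u \<in> U" "u \<in> Rn d"
  shows "tangent_space (U \<inter> Rn d) u = Rn (min d n)"
proof
  have UR: "U \<subseteq> Rn n" using assms(1) openin_imp_subset by blast
  then have "U \<inter> Rn d \<subseteq> Rn (min d n)" by (auto simp: min_def)
  then show "tangent_space (U \<inter> Rn d) u \<subseteq> Rn (min d n)" by (rule tangent_space_subset_Rn)
  show "Rn (min d n) \<subseteq> tangent_space (U \<inter> Rn d) u"
  proof
    fix v assume v: "v \<in> Rn (min d n)"
    then have v': "v \<in> Rn d" "v \<in> Rn n" using Rn_mono by (meson min.cobounded1 min.cobounded2 subsetD)+
    obtain r where r: "r > 0" "\<And>x. x \<in> Rn n \<Longrightarrow> dist u x < r \<Longrightarrow> x \<in> U"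
      using open_in_Rn_ball[OF assms(1,2)] by blast
    show "v \<in> tangent_space (U \<inter> Rn d) u"
    proof (rule tangent_spaceI)
      show "0 < r / (norm v + 1)" using r by (simp add: add_nonneg_pos)
      show "((\<lambda>t. u + t *\<^sub>R v) has_vector_derivative v) (at 0)"
        by (auto intro!: derivative_eq_intros)
      fix t assume "\<bar>t\<bar> < r / (norm v + 1)"
      moreover have "norm v + 1 > 0" by (simp add: add_nonneg_pos)
      ultimately have "\<bar>t\<bar> * (norm v + 1) < r" by (simp only: pos_less_divide_eq)
      then have "\<bar>t\<bar> * norm v < r" by (simp add: algebra_simps)
      then show "u + t *\<^sub>R v \<in> U \<inter> Rn d"
        using UR assms(2,3) v' by (auto intro!: r(2) simp: dist_norm)
    qed auto
  qed
qed

lemma image_Rn_grassmannian: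
  assumes F: "linear F" and FR: "F ` V \<subseteq> Rn m" and V: "V \<in> grassmannian d n" and inj: "inj_on F V"
  shows "F ` V \<in> grassmannian d m"
proof -
  have V': "subspace V" "dim V = d" using V by (auto simp: grassmannian_def)
  obtain B where B: "B \<subseteq> V" "independent B" "V \<subseteq> span B" "card B = d"
    using basis_exists[of V] V' by metis
  have sp: "span B = V" using B V' by (metis span_minimal subset_antisym)
  have "independent (F ` B)"
    using linear_independent_injective_image[OF F B(2)] inj sp by simp
  moreover have "span (F ` B) = F ` V" using linear_span_image[OF F] sp by simp
  moreover have "card (F ` B) = d"
    using B inj by (metis card_image inj_on_subset)
  ultimately have "dim (F ` V) = d" by (metis dim_eq_card_independent dim_span)
  then show ?thesis
    using FR linear_subspace_image[OF F V'(1)] by (simp add: grassmannian_def)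
qed

lemma Rn_grassmannian: "d \<le> n \<Longrightarrow> Rn d \<in> grassmannian d n"
proof -
  assume "d \<le> n"
  have "dim (Rn d) = card (unitv ` {..<d})"
    using dim_eq_card_independent[OF independent_unitv] by (metis dim_span span_unitv)
  also have "\<dots> = d" by (subst card_image) (auto intro: inj_on_subset[OF inj_unitv])
  finally show ?thesis using Rn_mono[OF \<open>d \<le> n\<close>] by (simp add: grassmannian_def)
qed

lemma tangent_space_image_grassmannian:
  assumes T: "tangent_space M b \<in> grassmannian d n" and "F ` M \<subseteq> Rn m"
    and F: "(F has_derivative F') (at b within M)" and G: "(G has_derivative G') (at (F b) within F ` M)"
    and GF: "\<And>x. x \<in> M \<Longrightarrow> G (F x) = x" and b: "b \<in> M"
  shows "tangent_space (F ` M) (F b) \<in> grassmannian d m"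
proof -
  have im: "tangent_space (F ` M) (F b) = F' ` tangent_space M b"
    by (rule tangent_space_image[OF F G _ b]) (rule GF)
  have "F' ` tangent_space M b \<in> grassmannian d m"
  proof (rule image_Rn_grassmannian[OF _ _ T])
    show "F' ` tangent_space M b \<subseteq> Rn m"
      using tangent_space_subset_Rn[OF assms(2), of "F b"] unfolding im .
    show "inj_on F' (tangent_space M b)"
      using tangent_space_left_inverse[OF F G GF b] by (metis inj_onI)
  qed (use F has_derivative_linear in blast)
  then show ?thesis by (simp add: im)
qed

section \<open>Submanifolds\<close>

text \<open>The chart domain is written as the trace of an open subset of \<open>evec\<close>, so
  that closures and tangent spaces can be localized. The last clause describes the manifold by a
  closed condition, which is what survives passage to limits.\<close>

lemma submanifold_chart:
  assumes M: "submanifold q n d M" and "q \<noteq> C_fin 0" and a: "a \<in> M"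
  obtains O' W \<phi> \<psi> where "open O'" "a \<in> O'" "open_in_Rn n W" "sC1 (Rn n \<inter> O') \<phi>" "sC1 W \<psi>"
    "\<phi> ` (Rn n \<inter> O') = W" "\<psi> ` W = Rn n \<inter> O'" "\<And>x. x \<in> Rn n \<inter> O' \<Longrightarrow> \<psi> (\<phi> x) = x"
    "\<And>x. x \<in> W \<Longrightarrow> \<phi> (\<psi> x) = x" "M \<inter> O' = {x \<in> Rn n \<inter> O'. \<phi> x \<in> Rn d}"
proof -
  obtain U W \<phi> where U: "a \<in> U" "Cq_diffeo q n U W \<phi>" "\<phi> ` (M \<inter> U) = W \<inter> Rn d"
    using M a unfolding submanifold_def by blast
  note d = U(2)[unfolded Cq_diffeo_def]
  obtain O' where O': "open O'" "U = Rn n \<inter> O'" using d by (auto simp: openin_open)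
  have MR: "M \<subseteq> Rn n" using M by (simp add: submanifold_def)
  define \<psi> where "\<psi> = inv_into U \<phi>"
  have bij: "inj_on \<phi> U" "\<phi> ` U = W" "\<psi> ` W = U"
    using d bij_betw_inv_into by (auto simp: bij_betw_def \<psi>_def)
  have inv: "\<psi> (\<phi> x) = x" if "x \<in> U" for x using that bij(1) by (simp add: \<psi>_def)
  have inv': "\<phi> (\<psi> x) = x" if "x \<in> W" for x using that bij(2) by (simp add: \<psi>_def f_inv_into_f)
  have "M \<inter> O' = {x \<in> U. \<phi> x \<in> Rn d}"
  proof (intro equalityI subsetI)
    fix x assume "x \<in> {x \<in> U. \<phi> x \<in> Rn d}"
    then have x: "x \<in> U" "\<phi> x \<in> \<phi> ` (M \<inter> U)" using U(3) bij(2) by auto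
    then have "x \<in> M" using bij(1) by (metis IntD1 IntD2 image_iff inj_onD)
    then show "x \<in> M \<inter> O'" using x O' by auto
  qed (use MR O' U(3) in auto)
  moreover have "sC1 U \<phi>" "sC1 W \<psi>"
    using Cq_diffeo_sC1[OF U(2) assms(2)] by (auto simp: \<psi>_def)
  ultimately show ?thesis
    using that[of O' W \<phi> \<psi>] O' U(1) d bij inv inv' by simp
qed

lemma submanifold_tangent_space:
  assumes M: "submanifold q n d M" and "q \<noteq> C_fin 0" and a: "a \<in> M"
  shows "tangent_space M a \<in> grassmannian d n"
proof -
  obtain O' W \<phi> \<psi> where c: "open O'" "a \<in> O'" "open_in_Rn n W" "sC1 (Rn n \<inter> O') \<phi>" "sC1 W \<psi>"
    "\<phi> ` (Rn n \<inter> O') = W" "\<psi> ` W = Rn n \<inter> O'" "\<And>x. x \<in> Rn n \<inter> O' \<Longrightarrow> \<psi> (\<phi> x) = x"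
    "\<And>x. x \<in> W \<Longrightarrow> \<phi> (\<psi> x) = x" "M \<inter> O' = {x \<in> Rn n \<inter> O'. \<phi> x \<in> Rn d}"
    by (rule submanifold_chart[OF assms]) (rule that)
  have dn: "d \<le> n" and MR: "M \<subseteq> Rn n" using M by (auto simp: submanifold_def)
  define w where "w = \<phi> a"
  have w: "w \<in> W \<inter> Rn d" "\<psi> w = a" using c a MR by (auto simp: w_def)
  have im: "\<psi> ` (W \<inter> Rn d) = M \<inter> O'"
    unfolding c(10)
  proof (intro equalityI subsetI)
    fix x assume x: "x \<in> {x \<in> Rn n \<inter> O'. \<phi> x \<in> Rn d}"
    then show "x \<in> \<psi> ` (W \<inter> Rn d)" using c(6,8) by (intro image_eqI[of _ _ "\<phi> x"]) auto
  qed (use c(7,9) in auto)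
  obtain A where A: "sdiff W \<psi> w A" using c(5) w(1) unfolding sC1_def by auto
  obtain B where B: "sdiff (Rn n \<inter> O') \<phi> a B" using c(2,4) a MR unfolding sC1_def by auto
  have "tangent_space (\<psi> ` (W \<inter> Rn d)) (\<psi> w) \<in> grassmannian d n"
  proof (rule tangent_space_image_grassmannian)
    show "tangent_space (W \<inter> Rn d) w \<in> grassmannian d n"
      using tangent_space_open[OF c(3), of w d] w(1) Rn_grassmannian[OF dn] dn by (simp add: min_absorb1)
    show "(\<psi> has_derivative A) (at w within W \<inter> Rn d)"
      using sdiff_has_derivative[OF sdiff_subset[OF A]] w(1) by auto
    show "(\<phi> has_derivative B) (at (\<psi> w) within \<psi> ` (W \<inter> Rn d))"
      unfolding im w(2)
      by (rule sdiff_has_derivative[OF sdiff_subset[OF B]]) (use a c(2) MR in blast)+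
    show "\<psi> ` (W \<inter> Rn d) \<subseteq> Rn n" unfolding im using MR by blast
    show "\<phi> (\<psi> x) = x" if "x \<in> W \<inter> Rn d" for x using that c(9) by blast
  qed (rule w(1))
  then show ?thesis
    unfolding im w(2) tangent_space_Int_open[OF c(1,2)] .
qed

text \<open>The tangent space as a tangent cone; this description is first-order definable.\<close>

lemma submanifold_tangent_space_iff:
  assumes M: "submanifold q n d M" and "q \<noteq> C_fin 0" and a: "a \<in> M" and v: "v \<in> Rn n"
  shows "v \<in> tangent_space M a \<longleftrightarrow>
    (\<forall>e>0. \<exists>\<delta>>0. \<forall>t. 0 < t \<longrightarrow> t < \<delta> \<longrightarrow> (\<exists>y\<in>M. norm (y - a - t *\<^sub>R v) \<le> e * t))"
    (is "_ \<longleftrightarrow> ?R")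
proof
  assume "v \<in> tangent_space M a"
  then obtain \<gamma> r where g: "0 < r" "\<And>t. \<bar>t\<bar> < r \<Longrightarrow> \<gamma> t \<in> M" "\<gamma> 0 = a" "(\<gamma> has_vector_derivative v) (at 0)"
    using tangent_spaceE by metis
  show ?R
  proof (intro allI impI)
    fix e :: real assume "e > 0"
    then obtain d' where d': "d' > 0" "\<And>y. norm (y - 0) < d' \<Longrightarrow>
        norm (\<gamma> y - \<gamma> 0 - (y - 0) *\<^sub>R v) \<le> e * norm (y - 0)"
      using g(4) unfolding has_vector_derivative_def has_derivative_at_alt by blast
    show "\<exists>\<delta>>0. \<forall>t. 0 < t \<longrightarrow> t < \<delta> \<longrightarrow> (\<exists>y\<in>M. norm (y - a - t *\<^sub>R v) \<le> e * t)"
    proof (intro exI[of _ "min r d'"] conjI allI impI)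
      fix t assume "0 < t" "t < min r d'"
      then show "\<exists>y\<in>M. norm (y - a - t *\<^sub>R v) \<le> e * t"
        using g(2)[of t] d'(2)[of t] g(3) by (intro bexI[of _ "\<gamma> t"]) auto
    qed (use g(1) d'(1) in auto)
  qed
next
  assume R: ?R
  obtain O' W \<phi> \<psi> where c: "open O'" "a \<in> O'" "open_in_Rn n W" "sC1 (Rn n \<inter> O') \<phi>" "sC1 W \<psi>"
    "\<phi> ` (Rn n \<inter> O') = W" "\<psi> ` W = Rn n \<inter> O'" "\<And>x. x \<in> Rn n \<inter> O' \<Longrightarrow> \<psi> (\<phi> x) = x"
    "\<And>x. x \<in> W \<Longrightarrow> \<phi> (\<psi> x) = x" "M \<inter> O' = {x \<in> Rn n \<inter> O'. \<phi> x \<in> Rn d}"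
    by (rule submanifold_chart[OF M assms(2) a]) (rule that)
  have dn: "d \<le> n" and MR: "M \<subseteq> Rn n" using M by (auto simp: submanifold_def)
  have aU: "a \<in> Rn n \<inter> O'" and wd: "\<phi> a \<in> Rn d" using a c(2,10) MR by auto
  obtain B where B: "sdiff (Rn n \<inter> O') \<phi> a B" using c(4) aU unfolding sC1_def by auto
  have linB: "linear B" using B sdiff_bounded_linear bounded_linear.linear by blast
  have w: "\<phi> a \<in> W" using c(6) aU by auto
  obtain A where A: "sdiff W \<psi> (\<phi> a) A" using c(5) w unfolding sC1_def by auto
  obtain r where r: "r > 0" "ball a r \<subseteq> O'" using c(1,2) open_contains_ball by blast
  \<comment> \<open>Chart images of the points of M near a + t v lie in \<open>Rn d\<close>, so
    their difference quotients, also in \<open>Rn d\<close>, approximate B v. Closedness puts B v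
    into \<open>Rn d\<close>, where every vector is tangent, and A carries it back to v.\<close>
  have near: "\<exists>y \<in> Rn d. norm (B v - y) \<le> e" if e: "e > 0" for e
  proof -
    obtain K where K: "K > 0" "\<And>x. norm (B x) \<le> norm x * K"
      using bounded_linear.pos_bounded[OF sdiff_bounded_linear[OF B]] by blast
    \<comment> \<open>\<open>e1\<close> measures how well y approximates a + t v, an error
      multiplied by K under B; \<open>e2\<close> measures the linearization of the chart. Each costs
      e t / 2, and \<open>e1\<close> at most 1 gives |y - a| \<le> t (|v| + 1).\<close>
    define e1 where "e1 = min 1 (e / (2 * K))"
    have e1: "e1 > 0" "e1 \<le> 1" "e1 * K \<le> e / 2" using e K by (auto simp: e1_def min_def field_simps)
    define e2 where "e2 = e / (2 * (norm v + 1))"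
    have nv: "norm v + 1 > 0" by (simp add: add_nonneg_pos)
    have e2: "e2 > 0" "e2 * (norm v + 1) = e / 2"
    proof -
      define m where "m = norm v + 1"
      have "m > 0" using nv by (simp add: m_def)
      then show "e2 > 0" "e2 * (norm v + 1) = e / 2"
        unfolding e2_def m_def[symmetric] using e by auto
    qed
    obtain d1 where d1: "d1 > 0" "\<And>t. 0 < t \<Longrightarrow> t < d1 \<Longrightarrow> \<exists>y\<in>M. norm (y - a - t *\<^sub>R v) \<le> e1 * t"
      using R e1(1) by blast
    obtain d2 where d2: "d2 > 0" "\<And>x y. x \<in> Rn n \<inter> O' \<Longrightarrow> y \<in> Rn n \<inter> O' \<Longrightarrow> dist a x < d2 \<Longrightarrow> dist a y < d2 \<Longrightarrow>
      norm (\<phi> x - \<phi> y - B (x - y)) \<le> e2 * norm (x - y)" using sdiffE[OF B e2(1)] by metis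
    define m where "m = min d2 r"
    have m: "m > 0" using d2(1) r(1) by (simp add: m_def)
    define k where "k = m / (norm v + 1)"
    have k: "k > 0" "k * (norm v + 1) = m" using m nv by (auto simp: k_def)
    define t where "t = min d1 k / 2"
    have t: "0 < t" "t < d1" "t < k" using d1(1) k(1) by (auto simp: t_def min_def)
    then have tm: "t * (norm v + 1) < m" using mult_strict_right_mono[OF t(3) nv] k(2) by simp
    obtain y where y: "y \<in> M" "norm (y - a - t *\<^sub>R v) \<le> e1 * t" using d1(2) t by blast
    have "norm (y - a) \<le> norm (t *\<^sub>R v) + norm (y - a - t *\<^sub>R v)"
      using norm_triangle_ineq[of "t *\<^sub>R v" "y - a - t *\<^sub>R v"] by simp
    also have "\<dots> \<le> t * norm v + 1 * t" using t y(2) mult_right_mono[OF e1(2), of t] by (simp only: norm_scaleR) linarith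
    finally have ya: "norm (y - a) \<le> t * (norm v + 1)" by (simp add: algebra_simps)
    then have yd: "dist a y < d2" "dist a y < r" using tm by (auto simp: dist_norm norm_minus_commute m_def)
    have yU: "y \<in> Rn n \<inter> O'" using y(1) MR yd(2) r(2) by auto
    have "\<phi> y \<in> Rn d" using y(1) yU c(10) by auto
    have 1: "norm (\<phi> y - \<phi> a - B (y - a)) \<le> e / 2 * t"
    proof -
      have "norm (\<phi> y - \<phi> a - B (y - a)) \<le> e2 * norm (y - a)"
        by (rule d2(2)[OF yU aU yd(1)]) (simp add: d2(1))
      also have "\<dots> \<le> e2 * (t * (norm v + 1))" using ya e2(1) by simp
      also have "\<dots> = e / 2 * t" using e2(2) by (metis mult.assoc mult.commute)
      finally show ?thesis .
    qed
    have "norm (B (y - a - t *\<^sub>R v)) \<le> e1 * t * K"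
      using K(2)[of "y - a - t *\<^sub>R v"] mult_right_mono[OF y(2), of K] K(1) by linarith
    also have "\<dots> \<le> e / 2 * t" using mult_right_mono[OF e1(3), of t] t by (simp add: mult_ac)
    finally have 2: "norm (B (y - a) - t *\<^sub>R B v) \<le> e / 2 * t"
      by (simp add: linear_diff[OF linB] linear_scale[OF linB])
    have "norm (t *\<^sub>R B v - (\<phi> y - \<phi> a)) \<le> e * t"
    proof -
      have "norm ((\<phi> y - \<phi> a - B (y - a)) + (B (y - a) - t *\<^sub>R B v)) \<le> e / 2 * t + e / 2 * t"
        using norm_triangle_ineq add_mono[OF 1 2] by (rule order_trans)
      moreover have "(\<phi> y - \<phi> a - B (y - a)) + (B (y - a) - t *\<^sub>R B v) = - (t *\<^sub>R B v - (\<phi> y - \<phi> a))"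
        by simp
      ultimately show ?thesis by (simp only: norm_minus_cancel)
    qed
    then have "inverse t * norm (t *\<^sub>R B v - (\<phi> y - \<phi> a)) \<le> inverse t * (e * t)"
      using t by (intro mult_left_mono) auto
    moreover have "B v - (\<phi> y - \<phi> a) /\<^sub>R t = (t *\<^sub>R B v - (\<phi> y - \<phi> a)) /\<^sub>R t"
      using t by (simp add: scaleR_diff_right)
    moreover have "inverse t * (e * t) = e" "\<bar>inverse t\<bar> = inverse t" using t by auto
    ultimately have "norm (B v - (\<phi> y - \<phi> a) /\<^sub>R t) \<le> e" by (simp only: norm_scaleR)
    then show ?thesis using \<open>\<phi> y \<in> Rn d\<close> wd by (intro bexI[of _ "(\<phi> y - \<phi> a) /\<^sub>R t"]) auto
  qed
  have Bv: "B v \<in> Rn d"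
  proof -
    have "B v \<in> closure (Rn d)"
      unfolding closure_approachable
    proof (intro allI impI)
      fix e :: real assume "e > 0"
      then obtain y where "y \<in> Rn d" "norm (B v - y) \<le> e / 2" using near[of "e / 2"] by auto
      then show "\<exists>y\<in>Rn d. dist y (B v) < e" using \<open>e > 0\<close>
        by (intro bexI[of _ y]) (auto simp: dist_norm norm_minus_commute)
    qed
    then show ?thesis by simp
  qed
  have wt: "B v \<in> tangent_space (W \<inter> Rn d) (\<phi> a)"
    using tangent_space_open[OF c(3) w wd] Bv dn by (simp add: min_absorb1)
  have "A (B v) \<in> tangent_space (M \<inter> O') (\<psi> (\<phi> a))"
  proof (rule tangent_space_image_subset[OF _ _ wt])
    show "(\<psi> has_derivative A) (at (\<phi> a) within W \<inter> Rn d)"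
      using sdiff_has_derivative[OF sdiff_subset[OF A]] w wd by auto
    show "\<psi> ` (W \<inter> Rn d) \<subseteq> M \<inter> O'"
      unfolding c(10)
    proof
      fix x assume "x \<in> \<psi> ` (W \<inter> Rn d)"
      then obtain z where "z \<in> W" "z \<in> Rn d" "x = \<psi> z" by blast
      then show "x \<in> {x \<in> Rn n \<inter> O'. \<phi> x \<in> Rn d}" using c(7) c(9)[of z] by auto
    qed
  qed
  moreover have "A (B v) = v"
  proof (rule tangent_space_left_inverse[of \<phi> B a "Rn n \<inter> O'" \<psi> A])
    show "v \<in> tangent_space (Rn n \<inter> O') a"
    proof -
      have "open_in_Rn n (Rn n \<inter> O')" using c(1) by (rule openin_open_Int)
      moreover have "Rn n \<inter> O' \<inter> Rn n = Rn n \<inter> O'" by blast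
      ultimately show ?thesis using tangent_space_open[of n "Rn n \<inter> O'" a n] aU v by simp
    qed
    show "(\<psi> has_derivative A) (at (\<phi> a) within \<phi> ` (Rn n \<inter> O'))"
      using sdiff_has_derivative[OF A w] by (simp only: c(6))
    show "(\<phi> has_derivative B) (at a within Rn n \<inter> O')" by (rule sdiff_has_derivative[OF B aU])
  qed (use c(8) aU in blast)+
  ultimately show "v \<in> tangent_space M a"
    by (simp only: c(8)[OF aU] tangent_space_Int_open[OF c(1,2)])
qed

text \<open>In a chart M is the preimage of the closed set \<open>Rn d\<close>, so M is locally
  closed. This later excludes one of the four positions of M and N in the lifting property.\<close>

lemma submanifold_open_in_closure:
  assumes M: "submanifold q n d M" and "q \<noteq> C_fin 0" and a: "a \<in> M"
  obtains O' where "open O'" "a \<in> O'" "closure M \<inter> O' \<subseteq> M"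
proof -
  obtain O' W \<phi> \<psi> where c: "open O'" "a \<in> O'" "open_in_Rn n W" "sC1 (Rn n \<inter> O') \<phi>" "sC1 W \<psi>"
    "\<phi> ` (Rn n \<inter> O') = W" "\<psi> ` W = Rn n \<inter> O'" "\<And>x. x \<in> Rn n \<inter> O' \<Longrightarrow> \<psi> (\<phi> x) = x"
    "\<And>x. x \<in> W \<Longrightarrow> \<phi> (\<psi> x) = x" "M \<inter> O' = {x \<in> Rn n \<inter> O'. \<phi> x \<in> Rn d}"
    by (rule submanifold_chart[OF assms]) (rule that)
  have MR: "M \<subseteq> Rn n" using M by (auto simp: submanifold_def)
  have "closure M \<inter> O' \<subseteq> M"
  proof
    fix x assume x: "x \<in> closure M \<inter> O'"
    then have "x \<in> closure (M \<inter> O')"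
      using open_Int_closure_subset[OF c(1), of M] by (auto simp: Int_commute)
    then obtain s where s: "\<And>k::nat. s k \<in> M \<inter> O'" "s \<longlonglongrightarrow> x"
      unfolding closure_sequential by blast
    have xU: "x \<in> Rn n \<inter> O'"
      using x closure_minimal[OF MR closed_Rn] by auto
    have sU: "s k \<in> Rn n \<inter> O'" "\<phi> (s k) \<in> Rn d" for k
      using s(1)[of k] MR unfolding c(10) by auto
    have lim: "(\<lambda>k. \<phi> (s k)) \<longlonglongrightarrow> \<phi> x"
      by (rule continuous_on_tendsto_compose[OF sC1_continuous_on[OF c(4)] s(2) xU])
         (rule always_eventually, rule allI, rule sU(1))
    have "\<phi> x \<in> Rn d"
      by (rule closed_sequentially[OF closed_Rn _ lim]) (rule sU(2))
    then show "x \<in> M" using xU c(10) by auto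
  qed
  then show ?thesis using that c(1,2) by blast
qed

section \<open>Compactness of Grassmannians\<close>

definition orthonormal :: "nat \<Rightarrow> (nat \<Rightarrow> evec) \<Rightarrow> bool" where
  "orthonormal d e \<longleftrightarrow> (\<forall>i<d. \<forall>j<d. inner (e i) (e j) = (if i = j then 1 else 0))"

lemma orthonormal_norm: "orthonormal d e \<Longrightarrow> i < d \<Longrightarrow> norm (e i) = 1"
  by (simp add: orthonormal_def norm_eq_sqrt_inner)

text \<open>The vectors that satisfy the formula form a subspace containing every
  \<open>e j\<close>.\<close>

lemma orthonormal_expand:
  assumes e: "orthonormal d e" and x: "x \<in> span (e ` {..<d})"
  shows "x = (\<Sum>i<d. inner x (e i) *\<^sub>R e i)"
proof -
  define P where "P x = (\<Sum>i<d. inner x (e i) *\<^sub>R e i)" for x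
  have "P (c *\<^sub>R x) = c *\<^sub>R P x" "P (x + y) = P x + P y" "P 0 = 0" for c x y
    by (simp_all add: P_def scaleR_sum_right inner_add_left scaleR_add_left sum.distrib)
  then have "subspace {x. x = P x}" by (auto intro!: subspaceI)
  then have "subspace {x. x = (\<Sum>i<d. inner x (e i) *\<^sub>R e i)}" by (simp only: P_def)
  moreover have "e ` {..<d} \<subseteq> {x. x = (\<Sum>i<d. inner x (e i) *\<^sub>R e i)}"
  proof
    fix x assume "x \<in> e ` {..<d}"
    then obtain j where j: "j < d" "x = e j" by auto
    have "(\<Sum>i<d. inner x (e i) *\<^sub>R e i) = (\<Sum>i<d. if i = j then e i else 0)"
      using e j by (intro sum.cong) (auto simp: orthonormal_def)
    then show "x \<in> {x. x = (\<Sum>i<d. inner x (e i) *\<^sub>R e i)}" using j by simp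
  qed
  ultimately have "span (e ` {..<d}) \<subseteq> {x. x = (\<Sum>i<d. inner x (e i) *\<^sub>R e i)}"
    using span_minimal by blast
  then show ?thesis using x by blast
qed

lemma dim_orthonormal:
  assumes "orthonormal d e"
  shows "dim (span (e ` {..<d})) = d"
proof -
  have inj: "inj_on e {..<d}"
    by (rule inj_onI) (metis assms lessThan_iff orthonormal_def zero_neq_one)
  have "independent (e ` {..<d})"
  proof (rule pairwise_orthogonal_independent)
    show "pairwise orthogonal (e ` {..<d})"
      using assms by (auto simp: pairwise_def orthogonal_def orthonormal_def)
    show "0 \<notin> e ` {..<d}" using orthonormal_norm[OF assms] by force
  qed
  then have "dim (e ` {..<d}) = card (e ` {..<d})" by (rule dim_eq_card_independent)
  then show ?thesis using inj by (simp add: card_image)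
qed

lemma Gram_Schmidt:
  assumes "finite B" "independent B"
  shows "\<exists>e. orthonormal (card B) e \<and> span (e ` {..<card B}) = span B"
  using assms
proof (induction B)
  case empty
  show ?case by (intro exI[of _ "\<lambda>_. 0"]) (simp add: orthonormal_def)
next
  case (insert b B)
  define d where "d = card B"
  have ind: "independent B" "b \<notin> span B"
    using insert.prems insert.hyps by (auto simp: independent_insert)
  obtain e where e: "orthonormal d e" "span (e ` {..<d}) = span B"
    using insert.IH[OF ind(1)] unfolding d_def by blast
  define p where "p = (\<Sum>i<d. inner b (e i) *\<^sub>R e i)"
  define c where "c = b - p"
  have eB: "e i \<in> span B" if "i < d" for i
    using span_base[of "e i" "e ` {..<d}"] that unfolding e(2) by blast
  have pB: "p \<in> span B" unfolding p_def using eB by (intro span_sum span_scale) auto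
  then have c0: "c \<noteq> 0" using ind(2) by (auto simp: c_def)
  have orth: "inner c (e j) = 0" if "j < d" for j
  proof -
    have "inner p (e j) = (\<Sum>i<d. if i = j then inner b (e i) else 0)"
      unfolding p_def inner_sum_left using e(1) that by (intro sum.cong) (auto simp: orthonormal_def)
    then show ?thesis using that by (simp add: c_def inner_diff_left)
  qed
  define f where "f i = (if i = d then c /\<^sub>R norm c else e i)" for i
  have "inner (c /\<^sub>R norm c) (c /\<^sub>R norm c) = (norm (c /\<^sub>R norm c))\<^sup>2"
    by (simp only: power2_norm_eq_inner)
  then have c1: "inner (c /\<^sub>R norm c) (c /\<^sub>R norm c) = 1" using c0 by simp
  have "orthonormal (Suc d) f"
    unfolding orthonormal_def
  proof (intro allI impI)
    fix i j assume "i < Suc d" "j < Suc d"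
    then consider "i = d" "j = d" | "i < d" "j = d" | "i = d" "j < d" | "i < d" "j < d"
      by (auto simp: less_Suc_eq)
    then show "inner (f i) (f j) = (if i = j then 1 else 0)"
    proof cases
      case 1
      then show ?thesis unfolding f_def using c1 by (simp only: if_True simp_thms refl)
    qed (use orth e(1) in \<open>auto simp: f_def orthonormal_def inner_commute[of _ c]\<close>)
  qed
  moreover have "span (f ` {..<Suc d}) = span (insert b B)"
  proof (rule subset_antisym)
    have BB: "span B \<subseteq> span (insert b B)" by (intro span_mono) auto
    have fB: "f i \<in> span (insert b B)" if "i < Suc d" for i
    proof (cases "i = d")
      case True
      have "c \<in> span (insert b B)" unfolding c_def
        using pB BB by (intro span_diff) (auto intro: span_base)
      then show ?thesis using True by (simp add: f_def span_scale)
    next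
      case False
      then show ?thesis using eB that BB by (auto simp: f_def)
    qed
    then show "span (f ` {..<Suc d}) \<subseteq> span (insert b B)"
      by (intro span_minimal) auto
    have fi: "f i \<in> span (f ` {..<Suc d})" if "i < Suc d" for i using that by (intro span_base) auto
    have "e ` {..<d} \<subseteq> span (f ` {..<Suc d})"
    proof
      fix x assume "x \<in> e ` {..<d}"
      then obtain i where i: "i < d" "x = e i" by auto
      then have "x = f i" by (simp add: f_def)
      then show "x \<in> span (f ` {..<Suc d})" using fi[of i] i by simp
    qed
    then have Bf: "span B \<subseteq> span (f ` {..<Suc d})"
      unfolding e(2)[symmetric] by (intro span_minimal) auto
    have "c \<in> span (f ` {..<Suc d})"
    proof -
      have "norm c *\<^sub>R f d = c" using c0 by (simp add: f_def)
      moreover have "norm c *\<^sub>R f d \<in> span (f ` {..<Suc d})" by (intro span_scale fi) simp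
      ultimately show ?thesis by simp
    qed
    then have "c + p \<in> span (f ` {..<Suc d})" using pB Bf by (intro span_add) auto
    then have "b \<in> span (f ` {..<Suc d})" by (simp add: c_def)
    moreover have "B \<subseteq> span (f ` {..<Suc d})" using Bf span_superset by blast
    ultimately show "span (insert b B) \<subseteq> span (f ` {..<Suc d})"
      by (intro span_minimal) auto
  qed
  ultimately show ?case using insert.hyps by (intro exI[of _ f]) (simp add: d_def)
qed

lemma grassmannian_orthonormal:
  assumes V: "V \<in> grassmannian d n"
  obtains e where "orthonormal d e" "V = span (e ` {..<d})" "\<And>i. i < d \<Longrightarrow> e i \<in> Rn n"
proof -
  have V': "subspace V" "V \<subseteq> Rn n" "dim V = d" using V by (auto simp: grassmannian_def)
  obtain B where B: "B \<subseteq> V" "independent B" "V \<subseteq> span B" "card B = d"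
    using basis_exists[of V] V'(3) by metis
  have "B \<subseteq> span (unitv ` {..<n})" using B(1) V'(2) by (simp add: span_unitv)
  then have "finite B" using independent_span_bound[OF _ B(2)] by blast
  then obtain e where e: "orthonormal d e" "span (e ` {..<d}) = span B"
    using Gram_Schmidt[OF _ B(2)] B(4) by blast
  have sp: "span B = V" using B V'(1) by (metis span_minimal subset_antisym)
  moreover have "e i \<in> Rn n" if "i < d" for i
    using span_base[of "e i" "e ` {..<d}"] that V'(2) unfolding e(2) sp by blast
  ultimately show ?thesis using that[of e] e by simp
qed

lemma orthonormal_grassmannian:
  "orthonormal d e \<Longrightarrow> (\<And>i. i < d \<Longrightarrow> e i \<in> Rn n) \<Longrightarrow> span (e ` {..<d}) \<in> grassmannian d n"
  unfolding grassmannian_def using dim_orthonormal span_minimal[of "e ` {..<d}" "Rn n"] by auto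

text \<open>V is the fixed-point set of its orthogonal projection, which is continuous.\<close>

lemma closed_grassmannian:
  assumes "V \<in> grassmannian d n"
  shows "closed V"
proof -
  obtain e where e: "orthonormal d e" "V = span (e ` {..<d})"
    using grassmannian_orthonormal[OF assms] by metis
  have "V = {x. x = (\<Sum>i<d. inner x (e i) *\<^sub>R e i)}"
  proof (intro equalityI subsetI)
    fix x assume "x \<in> V" then show "x \<in> {x. x = (\<Sum>i<d. inner x (e i) *\<^sub>R e i)}"
      using orthonormal_expand[OF e(1), of x] unfolding e(2) by simp
  next
    fix x assume "x \<in> {x. x = (\<Sum>i<d. inner x (e i) *\<^sub>R e i)}"
    then have x: "x = (\<Sum>i<d. inner x (e i) *\<^sub>R e i)" by simp
    have "(\<Sum>i<d. inner x (e i) *\<^sub>R e i) \<in> V"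
      unfolding e(2) by (intro span_sum span_scale span_base) auto
    then show "x \<in> V" using x by simp
  qed
  moreover have "closed {x. x = (\<Sum>i<d. inner x (e i) *\<^sub>R e i)}"
    by (intro closed_Collect_eq continuous_intros)
  ultimately show ?thesis by simp
qed

section \<open>The gap metric and limits of subspaces\<close>

lemma infdist_le_norm: "subspace W \<Longrightarrow> infdist v W \<le> norm v"
  using infdist_le[OF subspace_0, of W v] by (simp add: dist_norm)

lemma gap_commute: "gap V W = gap W V"
  by (simp add: gap_def max.commute)

lemma infdist_le_gap:
  assumes "subspace W" "v \<in> V" "norm v \<le> 1"
  shows "infdist v W \<le> gap V W"
proof -
  have "infdist v W \<le> (SUP v\<in>V \<inter> cball 0 1. infdist v W)"
  proof (rule cSUP_upper)
    show "bdd_above ((\<lambda>v. infdist v W) ` (V \<inter> cball 0 1))"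
      by (rule bdd_aboveI2[of _ _ 1]) (use infdist_le_norm[OF assms(1)] in \<open>fastforce intro: order_trans\<close>)
  qed (use assms in auto)
  then show ?thesis by (simp add: gap_def)
qed

lemma gap_le:
  assumes "subspace V" "subspace W" "\<And>v. v \<in> V \<Longrightarrow> norm v \<le> 1 \<Longrightarrow> infdist v W \<le> c"
    "\<And>w. w \<in> W \<Longrightarrow> norm w \<le> 1 \<Longrightarrow> infdist w V \<le> c"
  shows "gap V W \<le> c"
proof -
  have "V \<inter> cball 0 1 \<noteq> {}" "W \<inter> cball 0 1 \<noteq> {}" using assms(1,2) subspace_0 by fastforce+
  then show ?thesis unfolding gap_def using assms(3,4) by (auto intro!: cSUP_least)
qed

text \<open>Homogeneity extends the estimate from the unit ball. The strict bound on the gap leaves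
  room for an infimum that is not assumed to be attained.\<close>

lemma gap_approx:
  assumes V: "subspace V" and W: "subspace W" and v: "v \<in> V" and g: "gap V W < c"
  obtains w where "w \<in> W" "norm (v - w) \<le> c * norm v"
proof (cases "v = 0")
  case True
  then show ?thesis using that[of 0] subspace_0[OF W] by simp
next
  case False
  define u where "u = v /\<^sub>R norm v"
  have "infdist u W \<le> gap V W"
    using V v False by (intro infdist_le_gap W) (auto simp: u_def subspace_scale)
  then have "infdist u W < c" using g by simp
  moreover have "W \<noteq> {}" using W subspace_0 by blast
  ultimately obtain w where w: "w \<in> W" "dist u w < c"
    by (auto simp: infdist_def cINF_less_iff bdd_below.I2)
  have "v - norm v *\<^sub>R w = norm v *\<^sub>R (u - w)"
    using False by (simp add: u_def scaleR_diff_right)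
  then have "norm (v - norm v *\<^sub>R w) = norm v * norm (u - w)" by simp
  also have "\<dots> \<le> norm v * c" using w(2) by (intro mult_left_mono) (auto simp: dist_norm)
  finally show ?thesis using that[of "norm v *\<^sub>R w"] w(1) W by (simp add: subspace_scale mult.commute)
qed

text \<open>Replacing each \<open>e i\<close> in the expansion of v by \<open>l i\<close> gives a
  point of the other span, and the coefficients have absolute value at most 1.\<close>

lemma infdist_orthonormal:
  assumes e: "orthonormal d e" and v: "v \<in> span (e ` {..<d})" "norm v \<le> 1"
  shows "infdist v (span (l ` {..<d})) \<le> (\<Sum>i<d. norm (e i - l i))"
proof -
  define w where "w = (\<Sum>i<d. inner v (e i) *\<^sub>R l i)"
  have "w \<in> span (l ` {..<d})"
    unfolding w_def by (intro span_sum span_scale span_base) auto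
  then have "infdist v (span (l ` {..<d})) \<le> dist v w" by (rule infdist_le)
  also have "v - w = (\<Sum>i<d. inner v (e i) *\<^sub>R (e i - l i))"
    using orthonormal_expand[OF e v(1)] by (simp add: w_def scaleR_diff_right sum_subtractf)
  then have "dist v w = norm (\<Sum>i<d. inner v (e i) *\<^sub>R (e i - l i))" by (simp add: dist_norm)
  also have "\<dots> \<le> (\<Sum>i<d. norm (e i - l i))"
  proof (rule sum_norm_le)
    fix i assume "i \<in> {..<d}"
    then have "\<bar>inner v (e i)\<bar> \<le> 1 * 1"
      using Cauchy_Schwarz_ineq2[of v "e i"] orthonormal_norm[OF e, of i] v(2) by auto
    then show "norm (inner v (e i) *\<^sub>R (e i - l i)) \<le> norm (e i - l i)"
      using mult_right_mono[of "\<bar>inner v (e i)\<bar>" 1 "norm (e i - l i)"] by simp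
  qed
  finally show ?thesis .
qed

lemma frames_convergent_subseq:
  fixes e :: "nat \<Rightarrow> nat \<Rightarrow> evec"
  assumes "\<And>k i. i < d \<Longrightarrow> e k i \<in> Rn n" "\<And>k i. i < d \<Longrightarrow> norm (e k i) \<le> 1"
  shows "\<exists>s l. strict_mono (s :: nat \<Rightarrow> nat) \<and> (\<forall>i<d. l i \<in> Rn n \<and> (\<lambda>k. e (s k) i) \<longlonglongrightarrow> l i)"
  using assms
proof (induction d)
  case 0
  show ?case by (intro exI[of _ id]) (simp add: strict_mono_def)
next
  case (Suc d)
  have "\<exists>s l. strict_mono (s :: nat \<Rightarrow> nat) \<and> (\<forall>i<d. l i \<in> Rn n \<and> (\<lambda>k. e (s k) i) \<longlonglongrightarrow> l i)"
    by (rule Suc.IH) (use Suc.prems in auto)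
  then obtain s l where s: "strict_mono (s :: nat \<Rightarrow> nat)"
    "\<And>i. i < d \<Longrightarrow> l i \<in> Rn n" "\<And>i. i < d \<Longrightarrow> (\<lambda>k. e (s k) i) \<longlonglongrightarrow> l i" by blast
  obtain l' s' where s': "l' \<in> Rn n" "strict_mono (s' :: nat \<Rightarrow> nat)" "((\<lambda>k. e (s k) d) \<circ> s') \<longlonglongrightarrow> l'"
    by (rule Rn_bounded_convergent_subseq[of "\<lambda>k. e (s k) d" n 1]) (auto intro: Suc.prems that)
  show ?case
  proof (intro exI[of _ "s \<circ> s'"] exI[of _ "l(d := l')"] conjI allI impI)
    show "strict_mono (s \<circ> s')" using s(1) s'(2) by (rule strict_mono_o)
    fix i assume i: "i < Suc d"
    show "(l(d := l')) i \<in> Rn n" using s(2) s'(1) i by (simp add: less_Suc_eq) blast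
    show "(\<lambda>k. e ((s \<circ> s') k) i) \<longlonglongrightarrow> (l(d := l')) i"
    proof (cases "i = d")
      case True then show ?thesis using s'(3) by (simp add: o_def)
    next
      case False
      then show ?thesis
        using LIMSEQ_subseq_LIMSEQ[OF s(3)[of i] s'(2)] i by (simp add: o_def)
    qed
  qed
qed

text \<open>Orthonormal frames of the V k converge along a subsequence. Orthonormality survives in
  the limit, so the dimension does not drop, and the gap is at most the sum of the distances of the
  frame vectors.\<close>

lemma grassmannian_compact:
  assumes V: "\<And>k. V k \<in> grassmannian d n"
  obtains s T where "strict_mono (s :: nat \<Rightarrow> nat)" "grassmannian_lim d n (V \<circ> s) T"
proof -
  have "\<exists>e. orthonormal d e \<and> V k = span (e ` {..<d}) \<and> (\<forall>i<d. e i \<in> Rn n)" for k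
    using grassmannian_orthonormal[OF V[of k]] by metis
  then obtain e where e: "\<And>k. orthonormal d (e k)" "\<And>k. V k = span (e k ` {..<d})"
    "\<And>k i. i < d \<Longrightarrow> e k i \<in> Rn n" by metis
  obtain s l where s: "strict_mono (s :: nat \<Rightarrow> nat)"
    "\<And>i. i < d \<Longrightarrow> l i \<in> Rn n" "\<And>i. i < d \<Longrightarrow> (\<lambda>k. e (s k) i) \<longlonglongrightarrow> l i"
    using frames_convergent_subseq[of d e n] e(3) orthonormal_norm[OF e(1)] by (metis order_refl)
  have l: "orthonormal d l"
    unfolding orthonormal_def
  proof (intro allI impI)
    fix i j assume ij: "i < d" "j < d"
    have "(\<lambda>k. inner (e (s k) i) (e (s k) j)) \<longlonglongrightarrow> inner (l i) (l j)"
      by (rule tendsto_inner[OF s(3)[OF ij(1)] s(3)[OF ij(2)]])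
    moreover have "(\<lambda>k. inner (e (s k) i) (e (s k) j)) = (\<lambda>k. if i = j then 1 else 0)"
      using e(1) ij by (auto simp: orthonormal_def)
    ultimately show "inner (l i) (l j) = (if i = j then 1 else 0)"
      using LIMSEQ_unique tendsto_const by metis
  qed
  define T where "T = span (l ` {..<d})"
  have T: "T \<in> grassmannian d n" unfolding T_def using l s(2) by (rule orthonormal_grassmannian)
  have bound: "gap (V (s k)) T \<le> (\<Sum>i<d. norm (e (s k) i - l i))" for k
  proof (rule gap_le)
    show "infdist v T \<le> (\<Sum>i<d. norm (e (s k) i - l i))" if "v \<in> V (s k)" "norm v \<le> 1" for v
      using infdist_orthonormal[OF e(1)[of "s k"], of v l] that unfolding e(2) T_def by blast
    show "infdist v (V (s k)) \<le> (\<Sum>i<d. norm (e (s k) i - l i))" if "v \<in> T" "norm v \<le> 1" for v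
      using infdist_orthonormal[OF l, of v "e (s k)"] that unfolding e(2) T_def
      by (simp add: norm_minus_commute)
  qed (simp_all add: T_def e(2))
  have pos: "0 \<le> gap (V (s k)) T" for k
  proof -
    have "0 \<le> infdist 0 T" by (rule infdist_nonneg)
    also have "\<dots> \<le> gap (V (s k)) T"
      by (rule infdist_le_gap) (simp_all add: T_def e(2) span_zero)
    finally show ?thesis .
  qed
  have lim0: "(\<lambda>k. \<Sum>i<d. norm (e (s k) i - l i)) \<longlonglongrightarrow> 0"
    by (rule tendsto_null_sum) (rule tendsto_norm_zero, rule LIM_zero, rule s(3), simp)
  have "(\<lambda>k. gap (V (s k)) T) \<longlonglongrightarrow> 0"
    by (rule tendsto_sandwich[OF always_eventually always_eventually tendsto_const lim0])
       (auto intro: pos bound)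
  then show ?thesis
    using that[OF s(1), of T] V T unfolding grassmannian_lim_def by (simp add: o_def)
qed

section \<open>The Whitney (B) condition without limits\<close>

definition whitney_eps :: "evec set \<Rightarrow> evec set \<Rightarrow> evec \<Rightarrow> bool" where
  "whitney_eps M N a \<longleftrightarrow>
     (\<forall>e>0. \<exists>d>0. \<forall>x\<in>N. \<forall>y\<in>M. dist a x < d \<longrightarrow> dist a y < d \<longrightarrow>
        (\<exists>w\<in>tangent_space M y. norm (x - y - w) \<le> e * norm (x - y)))"

lemma whitney_epsE:
  assumes "whitney_eps M N a" "e > 0"
  obtains d where "d > 0" "\<And>x y. x \<in> N \<Longrightarrow> y \<in> M \<Longrightarrow> dist a x < d \<Longrightarrow> dist a y < d \<Longrightarrow>
    \<exists>w\<in>tangent_space M y. norm (x - y - w) \<le> e * norm (x - y)"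
  using assms unfolding whitney_eps_def by blast

lemma grassmannian_lim_gap:
  assumes "grassmannian_lim d n V T" "e > 0"
  shows "\<forall>\<^sub>F k in sequentially. gap (V k) T < e"
  using assms unfolding grassmannian_lim_def by (auto dest: order_tendstoD)

text \<open>A vector of L is close to a multiple of a secant, this to the same multiple of a tangent
  vector of M, and this to a vector of T. Since T is closed, arbitrarily small errors
  suffice.\<close>

lemma whitney_eps_imp_whitney_B:
  assumes W: "whitney_eps M N a"
  shows "whitney_B n M N a"
  unfolding whitney_B_def
proof (intro allI impI, elim conjE)
  fix a' b' :: "nat \<Rightarrow> evec" and L T d
  assume ab: "\<forall>\<nu>. a' \<nu> \<in> N" "\<forall>\<nu>. b' \<nu> \<in> M" "a' \<longlonglongrightarrow> a" "b' \<longlonglongrightarrow> a"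
    and L: "grassmannian_lim 1 n (\<lambda>\<nu>. span {a' \<nu> - b' \<nu>}) L"
    and T: "grassmannian_lim d n (\<lambda>\<nu>. tangent_space M (b' \<nu>)) T"
  have sL: "subspace L" and sT: "subspace T" and cT: "closed T"
    using L T closed_grassmannian unfolding grassmannian_lim_def grassmannian_def by auto
  have sM: "subspace (tangent_space M (b' k))" for k
    using T unfolding grassmannian_lim_def grassmannian_def by auto
  show "L \<subseteq> T"
  proof
    fix u assume u: "u \<in> L"
    \<comment> \<open>The three errors are at most e |u|, 2 e |u| and 4 e |u|; the constant 17
      leaves slack.\<close>
    have near: "\<exists>x\<in>T. norm (u - x) \<le> 17 * e * norm u" if e: "0 < e" "e < 1" for e
    proof -
      obtain r where r: "r > 0" "\<And>x y. x \<in> N \<Longrightarrow> y \<in> M \<Longrightarrow> dist a x < r \<Longrightarrow> dist a y < r \<Longrightarrow>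
        \<exists>w\<in>tangent_space M y. norm (x - y - w) \<le> e * norm (x - y)"
        using whitney_epsE[OF W e(1)] by blast
      have "\<forall>\<^sub>F k in sequentially. dist (a' k) a < r" "\<forall>\<^sub>F k in sequentially. dist (b' k) a < r"
        using ab(3,4) r(1) by (auto dest: tendstoD)
      then have "\<forall>\<^sub>F k in sequentially. dist (a' k) a < r \<and> dist (b' k) a < r
          \<and> gap (span {a' k - b' k}) L < e \<and> gap (tangent_space M (b' k)) T < e"
        using grassmannian_lim_gap[OF L e(1)] grassmannian_lim_gap[OF T e(1)]
        by (intro eventually_conj)
      then obtain k where k: "dist (a' k) a < r" "dist (b' k) a < r"
        "gap (span {a' k - b' k}) L < e" "gap (tangent_space M (b' k)) T < e"
        using eventually_happens'[OF sequentially_bot] by blast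
      define z where "z = a' k - b' k"
      obtain w where w: "w \<in> tangent_space M (b' k)" "norm (z - w) \<le> e * norm z"
        using r(2)[of "a' k" "b' k"] ab(1,2) k(1,2) unfolding z_def by (auto simp: dist_commute)
      obtain s where s: "s \<in> span {z}" "norm (u - s) \<le> e * norm u"
        using gap_approx[OF sL subspace_span u] k(3) unfolding z_def gap_commute[of _ L] by blast
      obtain c where c: "s = c *\<^sub>R z" using s(1) by (auto simp: span_singleton)
      have cw: "c *\<^sub>R w \<in> tangent_space M (b' k)" using w(1) by (rule tangent_space_scaleR)
      obtain x where x: "x \<in> T" "norm (c *\<^sub>R w - x) \<le> e * norm (c *\<^sub>R w)"
        using gap_approx[OF sM sT cw k(4)] by blast
      have eu: "e * norm u \<le> norm u" using e by (simp add: mult_left_le_one_le)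
      have s2: "norm s \<le> 2 * norm u"
        using s(2) eu norm_triangle_sub[of s u] by (simp add: norm_minus_commute)
      have "s - c *\<^sub>R w = c *\<^sub>R (z - w)" by (simp add: c scaleR_diff_right)
      then have "norm (s - c *\<^sub>R w) \<le> \<bar>c\<bar> * (e * norm z)" using w(2) by (simp add: mult_left_mono)
      also have "\<dots> = e * norm s" by (simp add: c)
      finally have sw: "norm (s - c *\<^sub>R w) \<le> e * norm s" .
      have es: "e * norm s \<le> 2 * (e * norm u)" using mult_left_mono[OF s2, of e] e by simp
      have w4: "norm (c *\<^sub>R w) \<le> 4 * norm u"
        using sw es eu s2 norm_triangle_sub[of "c *\<^sub>R w" s] by (simp add: norm_minus_commute)
      have ew: "e * norm (c *\<^sub>R w) \<le> 4 * (e * norm u)" using mult_left_mono[OF w4, of e] e by simp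
      have "norm (u - x) \<le> norm (u - s) + (norm (s - c *\<^sub>R w) + norm (c *\<^sub>R w - x))"
        using norm_triangle_ineq[of "u - s" "s - x"] norm_triangle_ineq[of "s - c *\<^sub>R w" "c *\<^sub>R w - x"] by simp
      also have "\<dots> \<le> 17 * e * norm u"
      proof -
        have "0 \<le> e * norm u" using e by simp
        then show ?thesis using s(2) sw es x(2) ew unfolding mult.assoc by linarith
      qed
      finally show ?thesis using x(1) by blast
    qed
    have "u \<in> closure T"
      unfolding closure_approachable
    proof (intro allI impI)
      fix r :: real assume r: "r > 0"
      define m where "m = norm u + 1"
      have m: "m > 0" by (simp add: m_def add_nonneg_pos)
      \<comment> \<open>The 34 is twice 17, so the error is at most half of r, hence below it;
        \<open>m\<close> exceeds |u| so that it is positive even for u = 0.\<close>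
      define e where "e = min (1/2) (r / (34 * m))"
      have e: "0 < e" "e < 1" using r m by (auto simp: e_def)
      have "e * (34 * m) \<le> r / (34 * m) * (34 * m)"
        using m by (intro mult_right_mono) (auto simp: e_def)
      then have em: "34 * (e * m) \<le> r" using m by simp
      obtain x where x: "x \<in> T" "norm (u - x) \<le> 17 * e * norm u" using near[OF e] by blast
      have "e * norm u \<le> e * m" using e by (simp add: m_def)
      then have "norm (u - x) < r" using x(2) em r by simp
      then show "\<exists>y\<in>T. dist y u < r" using x(1) by (auto simp: dist_norm norm_minus_commute)
    qed
    then show "u \<in> T" using cT by simp
  qed
qed

lemma LIMSEQ_dist_inverse:
  assumes "\<And>k. dist a (x k) < inverse (real (Suc k))"
  shows "x \<longlonglongrightarrow> a"
proof (rule metric_tendsto_imp_tendsto[OF LIMSEQ_inverse_real_of_nat], rule always_eventually, rule allI)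
  fix k show "dist (x k) a \<le> dist (inverse (real (Suc k))) 0"
    using assms[of k] by (simp add: dist_commute)
qed

text \<open>Pairs of points violating the estimate for some fixed e at radii 1 / (k + 1) have, by
  compactness, a subsequence whose secants converge to a line L and whose tangent spaces converge to
  some T'. Then L lies in T', which puts a tangent vector closer to a secant than the violation
  permits.\<close>

lemma whitney_B_imp_whitney_eps:
  assumes T: "\<And>y. y \<in> M \<Longrightarrow> tangent_space M y \<in> grassmannian d n"
    and "M \<subseteq> Rn n" "N \<subseteq> Rn n" and B: "whitney_B n M N a"
  shows "whitney_eps M N a"
proof (rule ccontr)
  assume "\<not> whitney_eps M N a"
  then obtain e where e: "e > 0" and neg: "\<And>r. r > 0 \<Longrightarrow> \<exists>x\<in>N. \<exists>y\<in>M. dist a x < r \<and> dist a y < r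
      \<and> (\<forall>w\<in>tangent_space M y. e * norm (x - y) < norm (x - y - w))"
    unfolding whitney_eps_def by (auto simp: not_le)
  have "\<exists>x y. x \<in> N \<and> y \<in> M \<and> dist a x < inverse (real (Suc k)) \<and> dist a y < inverse (real (Suc k))
      \<and> (\<forall>w\<in>tangent_space M y. e * norm (x - y) < norm (x - y - w))" for k
    using neg[of "inverse (real (Suc k))"] by force
  then obtain a' b' where ab: "\<And>k. a' k \<in> N" "\<And>k. b' k \<in> M"
    "\<And>k. dist a (a' k) < inverse (real (Suc k))" "\<And>k. dist a (b' k) < inverse (real (Suc k))"
    "\<And>k w. w \<in> tangent_space M (b' k) \<Longrightarrow> e * norm (a' k - b' k) < norm (a' k - b' k - w)"
    by metis
  have lim: "a' \<longlonglongrightarrow> a" "b' \<longlonglongrightarrow> a"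
    using LIMSEQ_dist_inverse[OF ab(3)] LIMSEQ_dist_inverse[OF ab(4)] .
  \<comment> \<open>The vector w = 0 is tangent, and the strict violation for it excludes a secant
    of length 0; hence the secants span lines.\<close>
  have ne: "a' k \<noteq> b' k" for k using ab(5)[OF tangent_space_0[OF ab(2)], of k] by auto
  have sec: "span {a' k - b' k} \<in> grassmannian 1 n" for k
  proof -
    have "a' k - b' k \<in> Rn n" using ab(1,2) assms(2,3) by (intro Rn_intros) auto
    then have "span {a' k - b' k} \<subseteq> Rn n" by (intro span_minimal) auto
    moreover have "dim (span {a' k - b' k}) = 1"
      using ne[of k] dim_eq_card_independent[of "{a' k - b' k}"] by (simp add: dim_span)
    ultimately show ?thesis by (simp add: grassmannian_def)
  qed
  obtain s1 T' where s1: "strict_mono (s1 :: nat \<Rightarrow> nat)" "grassmannian_lim d n ((\<lambda>k. tangent_space M (b' k)) \<circ> s1) T'"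
    by (rule grassmannian_compact[of "\<lambda>k. tangent_space M (b' k)" d n]) (auto intro: T ab(2))
  obtain s2 L where s2: "strict_mono (s2 :: nat \<Rightarrow> nat)" "grassmannian_lim 1 n ((\<lambda>k. span {a' (s1 k) - b' (s1 k)}) \<circ> s2) L"
    by (rule grassmannian_compact[of "\<lambda>k. span {a' (s1 k) - b' (s1 k)}" 1 n]) (rule sec, rule that)
  define s where "s k = s1 (s2 k)" for k
  have "strict_mono s" using strict_mono_o[OF s1(1) s2(1)] by (simp add: s_def[abs_def] o_def)
  then have lim': "(\<lambda>k. a' (s k)) \<longlonglongrightarrow> a" "(\<lambda>k. b' (s k)) \<longlonglongrightarrow> a"
    using LIMSEQ_subseq_LIMSEQ[OF lim(1)] LIMSEQ_subseq_LIMSEQ[OF lim(2)] by (auto simp: o_def)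
  have L: "grassmannian_lim 1 n (\<lambda>k. span {a' (s k) - b' (s k)}) L" using s2(2) by (simp add: o_def s_def)
  have T': "grassmannian_lim d n (\<lambda>k. tangent_space M (b' (s k))) T'"
    using s1(2) LIMSEQ_subseq_LIMSEQ[OF _ s2(1), of "\<lambda>k. gap (tangent_space M (b' (s1 k))) T'" 0]
    unfolding grassmannian_lim_def by (simp add: o_def s_def)
  have "L \<subseteq> T'"
    using B[unfolded whitney_B_def, rule_format, of "\<lambda>k. a' (s k)" "\<lambda>k. b' (s k)" L d T'] ab(1,2) lim' L T'
    by blast
  \<comment> \<open>Passing from the secant z to L costs at most \<eta> |z|, and from there to the
    tangent space of M at most 2 \<eta> |z|, together within e |z|.\<close>
  define \<eta> where "\<eta> = min (1/2) (e / 6)"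
  have \<eta>: "0 < \<eta>" "\<eta> \<le> 1/2" "6 * \<eta> \<le> e" using e by (auto simp: \<eta>_def)
  have "\<forall>\<^sub>F k in sequentially. gap (span {a' (s k) - b' (s k)}) L < \<eta> \<and> gap (tangent_space M (b' (s k))) T' < \<eta>"
    by (intro eventually_conj grassmannian_lim_gap[OF L \<eta>(1)] grassmannian_lim_gap[OF T' \<eta>(1)])
  then obtain k where k: "gap (span {a' (s k) - b' (s k)}) L < \<eta>" "gap (tangent_space M (b' (s k))) T' < \<eta>"
    using eventually_happens'[OF sequentially_bot] by blast
  have sub: "subspace L" "subspace T'" "subspace (tangent_space M (b' (s k)))"
    using L T' unfolding grassmannian_lim_def grassmannian_def by auto
  define z where "z = a' (s k) - b' (s k)"
  have "z \<in> span {a' (s k) - b' (s k)}" unfolding z_def by (intro span_base) simp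
  then obtain l where l: "l \<in> L" "norm (z - l) \<le> \<eta> * norm z"
    using gap_approx[OF subspace_span sub(1) _ k(1)] by blast
  obtain t where t: "t \<in> tangent_space M (b' (s k))" "norm (l - t) \<le> \<eta> * norm l"
    using gap_approx[OF sub(2,3) _ k(2)[unfolded gap_commute[of _ T']], of l] l(1) \<open>L \<subseteq> T'\<close> by blast
  have "\<eta> * norm z \<le> norm z" using mult_right_mono[of \<eta> 1 "norm z"] \<eta> by simp
  then have l2: "norm l \<le> 2 * norm z"
    using l(2) norm_triangle_sub[of l z] by (simp add: norm_minus_commute)
  have "norm (z - t) \<le> norm (z - l) + norm (l - t)"
    using norm_triangle_ineq[of "z - l" "l - t"] by simp
  also have "\<dots> \<le> 3 * (\<eta> * norm z)"
  proof -
    have "\<eta> * norm l \<le> \<eta> * (2 * norm z)" using l2 \<eta>(1) by (intro mult_left_mono) auto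
    then have "\<eta> * norm l \<le> 2 * (\<eta> * norm z)" by (simp only: mult.left_commute)
    then show ?thesis using l(2) t(2) by linarith
  qed
  also have "\<dots> \<le> e * norm z"
  proof -
    have "6 * \<eta> * norm z \<le> e * norm z" using \<eta>(3) by (rule mult_right_mono) simp
    moreover have "0 \<le> \<eta> * norm z" using \<eta>(1) by simp
    ultimately show ?thesis unfolding mult.assoc by linarith
  qed
  finally show False using ab(5)[OF t(1)] unfolding z_def by simp
qed

lemma whitney_B_iff_whitney_eps:
  assumes "\<And>y. y \<in> M \<Longrightarrow> tangent_space M y \<in> grassmannian d n" "M \<subseteq> Rn n" "N \<subseteq> Rn n"
  shows "whitney_B n M N a \<longleftrightarrow> whitney_eps M N a"
  using whitney_B_imp_whitney_eps[OF assms] whitney_eps_imp_whitney_B by blast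

section \<open>Locality and invariance under diffeomorphisms\<close>

lemma whitney_eps_Int_open:
  assumes U: "open U" "a \<in> U"
  shows "whitney_eps (M \<inter> U) (N \<inter> U) a \<longleftrightarrow> whitney_eps M N a"
proof -
  obtain r where r: "r > 0" "\<And>x. dist a x < r \<Longrightarrow> x \<in> U"
    using U open_contains_ball by (metis mem_ball subsetD)
  show ?thesis
  proof
    assume W: "whitney_eps M N a"
    show "whitney_eps (M \<inter> U) (N \<inter> U) a"
      unfolding whitney_eps_def
    proof (intro allI impI)
      fix e :: real assume "e > 0"
      then obtain d where d: "d > 0" "\<And>x y. x \<in> N \<Longrightarrow> y \<in> M \<Longrightarrow> dist a x < d \<Longrightarrow> dist a y < d \<Longrightarrow>
        \<exists>w\<in>tangent_space M y. norm (x - y - w) \<le> e * norm (x - y)" using whitney_epsE[OF W] by blast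
      then show "\<exists>d>0. \<forall>x\<in>N \<inter> U. \<forall>y\<in>M \<inter> U. dist a x < d \<longrightarrow> dist a y < d \<longrightarrow>
          (\<exists>w\<in>tangent_space (M \<inter> U) y. norm (x - y - w) \<le> e * norm (x - y))"
        using tangent_space_Int_open[OF U(1), of _ M] by (intro exI[of _ d]) auto
    qed
  next
    assume W: "whitney_eps (M \<inter> U) (N \<inter> U) a"
    show "whitney_eps M N a"
      unfolding whitney_eps_def
    proof (intro allI impI)
      fix e :: real assume "e > 0"
      then obtain d where d: "d > 0" "\<And>x y. x \<in> N \<inter> U \<Longrightarrow> y \<in> M \<inter> U \<Longrightarrow> dist a x < d \<Longrightarrow> dist a y < d \<Longrightarrow>
        \<exists>w\<in>tangent_space (M \<inter> U) y. norm (x - y - w) \<le> e * norm (x - y)" using whitney_epsE[OF W] by blast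
      show "\<exists>d>0. \<forall>x\<in>N. \<forall>y\<in>M. dist a x < d \<longrightarrow> dist a y < d \<longrightarrow>
          (\<exists>w\<in>tangent_space M y. norm (x - y - w) \<le> e * norm (x - y))"
      proof (intro exI[of _ "min d r"] conjI ballI impI)
        fix x y assume xy: "x \<in> N" "y \<in> M" "dist a x < min d r" "dist a y < min d r"
        then have "x \<in> U" "y \<in> U" using r(2) by auto
        then show "\<exists>w\<in>tangent_space M y. norm (x - y - w) \<le> e * norm (x - y)"
          using d(2)[of x y] xy tangent_space_Int_open[OF U(1), of y M] by auto
      qed (use d(1) r(1) in auto)
    qed
  qed
qed

text \<open>The strict derivative A at \<open>a\<close> controls the image of a secant, whereas a
  tangent vector at y is moved by the derivative F' at y. By \<open>tangent_space_bound\<close> the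
  two differ little on tangent vectors. The inverse G enters through its Lipschitz constant, which
  compares |x - y| with |F x - F y|.\<close>

lemma whitney_eps_image:
  assumes a: "a \<in> M \<union> N" and F: "sdiff (M \<union> N) F a A" and G: "sdiff (F ` (M \<union> N)) G (F a) B"
    and GF: "\<And>x. x \<in> M \<union> N \<Longrightarrow> G (F x) = x" and FM: "sC1 M F" and W: "whitney_eps M N a"
  shows "whitney_eps (F ` M) (F ` N) (F a)"
  unfolding whitney_eps_def
proof (intro allI impI)
  fix e :: real assume e: "e > 0"
  have linA: "linear A" using F sdiff_bounded_linear bounded_linear.linear by blast
  obtain K r where K: "K > 0" "r > 0" "\<And>x y. x \<in> F ` (M \<union> N) \<Longrightarrow> y \<in> F ` (M \<union> N) \<Longrightarrow> dist (F a) x < r \<Longrightarrow> dist (F a) y < r \<Longrightarrow> norm (G x - G y) \<le> K * norm (x - y)"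
    using sdiff_lipschitz[OF G] by metis
  obtain L where L: "L > 0" "\<And>x. norm (A x) \<le> norm x * L"
    using bounded_linear.pos_bounded[OF sdiff_bounded_linear[OF F]] by blast
  \<comment> \<open>In units of \<eta> |x - y|: 1 for the linearization of F on the secant, 2 for
    replacing A by F' on w, whose norm is at most 2 |x - y|, and L for A on x - y - w. The factor K
    passes from |x - y| to |F x - F y|.\<close>
  define C where "C = K * (3 + L)"
  have C: "C > 0" using K L by (simp add: C_def)
  define \<eta> where "\<eta> = min 1 (e / C)"
  have \<eta>: "0 < \<eta>" "\<eta> \<le> 1" using e C by (auto simp: \<eta>_def)
  have "\<eta> * C \<le> e / C * C" using C by (intro mult_right_mono) (auto simp: \<eta>_def)
  then have \<eta>C: "\<eta> * C \<le> e" using C by simp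
  obtain d1 where d1: "d1 > 0" "\<And>x y. x \<in> M \<union> N \<Longrightarrow> y \<in> M \<union> N \<Longrightarrow> dist a x < d1 \<Longrightarrow> dist a y < d1 \<Longrightarrow>
    norm (F x - F y - A (x - y)) \<le> \<eta> * norm (x - y)" using sdiffE[OF F \<eta>(1)] by metis
  obtain d2 where d2: "d2 > 0" "\<And>x y. x \<in> N \<Longrightarrow> y \<in> M \<Longrightarrow> dist a x < d2 \<Longrightarrow> dist a y < d2 \<Longrightarrow>
    \<exists>w\<in>tangent_space M y. norm (x - y - w) \<le> \<eta> * norm (x - y)" using whitney_epsE[OF W \<eta>(1)] by blast
  define d where "d = min r (min d1 d2 / K)"
  have d: "d > 0" "d \<le> r" using d1 d2 K by (auto simp: d_def)
  have Kd: "K * d \<le> min d1 d2"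
  proof -
    have "K * d \<le> K * (min d1 d2 / K)" using K by (intro mult_left_mono) (auto simp: d_def)
    then show ?thesis using K by simp
  qed
  have near_preimage: "dist a z < d1" "dist a z < d2" if z: "z \<in> M \<union> N" "dist (F a) (F z) < d" for z
  proof -
    have "norm (G (F a) - G (F z)) \<le> K * norm (F a - F z)" using a z d K(2) by (intro K(3)) auto
    also have "\<dots> < K * d" using z(2) K(1) by (simp add: dist_norm)
    finally have "dist a z < min d1 d2" using Kd GF[OF a] GF[OF z(1)] by (simp add: dist_norm)
    then show "dist a z < d1" "dist a z < d2" by auto
  qed
  have main: "\<exists>w\<in>tangent_space (F ` M) (F y). norm (F x - F y - w) \<le> e * norm (F x - F y)"
    if xy: "x \<in> N" "y \<in> M" "dist (F a) (F x) < d" "dist (F a) (F y) < d" for x y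
  proof -
    have inMN: "x \<in> M \<union> N" "y \<in> M \<union> N" using xy by auto
    note near = near_preimage[OF inMN(1) xy(3)] near_preimage[OF inMN(2) xy(4)]
    obtain w where w: "w \<in> tangent_space M y" "norm (x - y - w) \<le> \<eta> * norm (x - y)"
      using d2(2)[OF xy(1,2) near(2,4)] by blast
    obtain F' where F': "(F has_derivative F') (at y within M)"
      using FM xy(2) sdiff_has_derivative unfolding sC1_def by blast
    have "norm (F' w - A w) \<le> \<eta> * norm w"
    proof (rule tangent_space_bound[OF w(1) sdiff_bounded_linear[OF F] _ _ F'])
      show "0 < d1 - dist a y" using near by simp
      fix z assume z: "z \<in> M" "dist y z < d1 - dist a y"
      then have "dist a z < d1" using dist_triangle[of a z y] by simp
      then show "norm (F z - F y - A (z - y)) \<le> \<eta> * norm (z - y)"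
        using z near xy by (intro d1(2)) auto
    qed
    moreover have "norm w \<le> 2 * norm (x - y)"
    proof -
      have "\<eta> * norm (x - y) \<le> 1 * norm (x - y)" using \<eta> by (intro mult_right_mono) auto
      then show ?thesis using w(2) norm_triangle_sub[of w "x - y"] by (simp add: norm_minus_commute)
    qed
    ultimately have "norm (F' w - A w) \<le> \<eta> * (2 * norm (x - y))"
      using mult_left_mono[of "norm w" "2 * norm (x - y)" \<eta>] \<eta>(1) by linarith
    then have t1: "norm (A w - F' w) \<le> 2 * (\<eta> * norm (x - y))"
      by (simp only: norm_minus_commute mult.left_commute)
    have t2: "norm (F x - F y - A (x - y)) \<le> \<eta> * norm (x - y)"
      using inMN near by (intro d1(2)) auto
    have "norm (A (x - y - w)) \<le> norm (x - y - w) * L" by (rule L)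
    also have "\<dots> \<le> \<eta> * norm (x - y) * L" using w(2) L(1) by (intro mult_right_mono) auto
    finally have t3: "norm (A (x - y) - A w) \<le> L * (\<eta> * norm (x - y))"
      by (simp only: linear_diff[OF linA] mult.commute)
    have "F x - F y - F' w = (F x - F y - A (x - y)) + ((A (x - y) - A w) + (A w - F' w))" by simp
    then have "norm (F x - F y - F' w) \<le> norm (F x - F y - A (x - y)) + (norm (A (x - y) - A w) + norm (A w - F' w))"
      by (metis (no_types, lifting) add_left_mono norm_triangle_ineq order_trans)
    also have "\<dots> \<le> (3 + L) * (\<eta> * norm (x - y))"
      using t1 t2 t3 unfolding distrib_right by linarith
    also have "\<dots> \<le> (3 + L) * (\<eta> * (K * norm (F x - F y)))"
    proof -
      have "norm (G (F x) - G (F y)) \<le> K * norm (F x - F y)"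
        using inMN xy d by (intro K(3)) auto
      then have "norm (x - y) \<le> K * norm (F x - F y)" using GF inMN by simp
      then show ?thesis using \<eta>(1) L(1) by (intro mult_left_mono) auto
    qed
    also have "\<dots> = \<eta> * C * norm (F x - F y)" by (simp add: C_def)
    also have "\<dots> \<le> e * norm (F x - F y)" using \<eta>C by (intro mult_right_mono) auto
    finally have "norm (F x - F y - F' w) \<le> e * norm (F x - F y)" .
    then show ?thesis
      using tangent_space_image_subset[OF F' order_refl w(1)] by blast
  qed
  show "\<exists>d>0. \<forall>x\<in>F ` N. \<forall>y\<in>F ` M. dist (F a) x < d \<longrightarrow> dist (F a) y < d \<longrightarrow>
      (\<exists>w\<in>tangent_space (F ` M) y. norm (x - y - w) \<le> e * norm (x - y))"
    using d(1) main by (intro exI[of _ d]) auto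
qed

lemma local_condition_whitney_B:
  assumes "q \<noteq> C_fin 0"
  shows "local_condition q whitney_B"
  unfolding local_condition_def
proof (intro allI impI, elim conjE)
  fix n \<Lambda> \<Gamma> x U
  assume adj: "adjacent q n \<Lambda> \<Gamma>" and x: "x \<in> \<Gamma>" "x \<in> U" and U: "open_in_Rn n U"
  obtain d where \<Lambda>: "submanifold q n d \<Lambda>" using adj by (auto simp: adjacent_def is_submanifold_def)
  have R: "\<Lambda> \<subseteq> Rn n" "\<Gamma> \<subseteq> Rn n"
    using adj by (auto simp: adjacent_def is_submanifold_def submanifold_def)
  obtain O' where O': "open O'" "U = Rn n \<inter> O'" using U by (auto simp: openin_open)
  have UO: "\<Lambda> \<inter> U = \<Lambda> \<inter> O'" "\<Gamma> \<inter> U = \<Gamma> \<inter> O'" using R O'(2) by auto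
  have T: "tangent_space \<Lambda> y \<in> grassmannian d n" if "y \<in> \<Lambda>" for y
    using submanifold_tangent_space[OF \<Lambda> assms that] .
  have "whitney_B n (\<Lambda> \<inter> O') (\<Gamma> \<inter> O') x \<longleftrightarrow> whitney_eps (\<Lambda> \<inter> O') (\<Gamma> \<inter> O') x"
    using T R tangent_space_Int_open[OF O'(1), of _ \<Lambda>] by (intro whitney_B_iff_whitney_eps) auto
  moreover have "whitney_B n \<Lambda> \<Gamma> x \<longleftrightarrow> whitney_eps \<Lambda> \<Gamma> x"
    by (rule whitney_B_iff_whitney_eps[OF T R])
  ultimately show "whitney_B n \<Lambda> \<Gamma> x \<longleftrightarrow> whitney_B n (\<Lambda> \<inter> U) (\<Gamma> \<inter> U) x"
    using whitney_eps_Int_open[OF O'(1), of x \<Lambda> \<Gamma>] x(2) O'(2) unfolding UO by simp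
qed

text \<open>Both \<phi> and its inverse are strictly differentiable, so
  \<open>whitney_eps_image\<close> applies in either direction.\<close>

lemma diffeo_invariant_whitney_B:
  assumes "q \<noteq> C_fin 0"
  shows "diffeo_invariant D q whitney_B"
  unfolding diffeo_invariant_def
proof (intro allI impI, elim conjE)
  fix n U W \<phi> \<Lambda> \<Gamma> x
  assume \<phi>: "Cq_diffeo q n U W \<phi>" and adj: "adjacent q n \<Lambda> \<Gamma>"
    and sub: "\<Lambda> \<subseteq> U" "\<Gamma> \<subseteq> U" and x: "x \<in> \<Gamma>"
  obtain d where \<Lambda>: "submanifold q n d \<Lambda>" using adj by (auto simp: adjacent_def is_submanifold_def)
  have R: "\<Lambda> \<subseteq> Rn n" "\<Gamma> \<subseteq> Rn n"
    using adj by (auto simp: adjacent_def is_submanifold_def submanifold_def)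
  have T: "tangent_space \<Lambda> y \<in> grassmannian d n" if "y \<in> \<Lambda>" for y
    using submanifold_tangent_space[OF \<Lambda> assms that] .
  define \<psi> where "\<psi> = inv_into U \<phi>"
  have bij: "inj_on \<phi> U" "\<phi> ` U = W" using \<phi> by (auto simp: Cq_diffeo_def bij_betw_def)
  have WR: "W \<subseteq> Rn n" using \<phi> openin_imp_subset by (auto simp: Cq_diffeo_def)
  have inv: "\<psi> (\<phi> y) = y" if "y \<in> U" for y using that bij(1) by (simp add: \<psi>_def)
  have c: "sC1 U \<phi>" "sC1 W \<psi>" using Cq_diffeo_sC1[OF \<phi> assms] by (auto simp: \<psi>_def)
  have der: "\<exists>A. sdiff S \<phi> y A" if "y \<in> U" "S \<subseteq> U" for S y
    using c(1) that sdiff_subset unfolding sC1_def by blast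
  have der': "\<exists>A. sdiff S \<psi> y A" if "y \<in> W" "S \<subseteq> W" for S y
    using c(2) that sdiff_subset unfolding sC1_def by blast
  have imW: "\<phi> ` S \<subseteq> W" if "S \<subseteq> U" for S using that bij(2) by auto
  \<comment> \<open>The equivalence of the two forms of the condition asks only for tangent spaces
    of constant dimension; for the image of \<Lambda> these are obtained as images under the
    derivative.\<close>
  have T': "tangent_space (\<phi> ` \<Lambda>) y \<in> grassmannian d n" if y: "y \<in> \<phi> ` \<Lambda>" for y
  proof -
    obtain z where z: "z \<in> \<Lambda>" "y = \<phi> z" using y by blast
    have zU: "z \<in> U" using z sub by auto
    have zW: "\<phi> z \<in> W" using zU bij(2) by auto
    obtain A where A: "sdiff \<Lambda> \<phi> z A" using der[OF zU sub(1)] by blast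
    obtain B where B: "sdiff (\<phi> ` \<Lambda>) \<psi> (\<phi> z) B" using der'[OF zW imW[OF sub(1)]] by blast
    show ?thesis
      unfolding z(2)
    proof (rule tangent_space_image_grassmannian[OF T[OF z(1)] _ sdiff_has_derivative[OF A z(1)]
          sdiff_has_derivative[OF B imageI[OF z(1)]] _ z(1)])
      show "\<phi> ` \<Lambda> \<subseteq> Rn n" using imW[OF sub(1)] WR by (rule subset_trans)
      show "\<psi> (\<phi> y) = y" if "y \<in> \<Lambda>" for y using inv that sub by auto
    qed
  qed
  have R': "\<phi> ` \<Lambda> \<subseteq> Rn n" "\<phi> ` \<Gamma> \<subseteq> Rn n" using imW[OF sub(1)] imW[OF sub(2)] WR by blast+
  have LG: "\<Lambda> \<union> \<Gamma> \<subseteq> U" using sub by auto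
  have im: "\<psi> ` \<phi> ` S = S" if "S \<subseteq> U" for S
  proof -
    have "\<psi> (\<phi> y) = y" if "y \<in> S" for y using inv that \<open>S \<subseteq> U\<close> by auto
    then show ?thesis by (simp add: image_image)
  qed
  have xU: "x \<in> U" and xW: "\<phi> x \<in> W" using x sub bij(2) by auto
  have "whitney_eps \<Lambda> \<Gamma> x \<longleftrightarrow> whitney_eps (\<phi> ` \<Lambda>) (\<phi> ` \<Gamma>) (\<phi> x)"
  proof
    obtain A where A: "sdiff (\<Lambda> \<union> \<Gamma>) \<phi> x A" using der[OF xU LG] by blast
    obtain B where B: "sdiff (\<phi> ` (\<Lambda> \<union> \<Gamma>)) \<psi> (\<phi> x) B" using der'[OF xW imW[OF LG]] by blast
    show "whitney_eps (\<phi> ` \<Lambda>) (\<phi> ` \<Gamma>) (\<phi> x)" if "whitney_eps \<Lambda> \<Gamma> x"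
      by (rule whitney_eps_image[OF _ A B _ sC1_subset[OF c(1) sub(1)] that]) (use x inv LG in auto)
  next
    have eq: "\<phi> ` \<Lambda> \<union> \<phi> ` \<Gamma> = \<phi> ` (\<Lambda> \<union> \<Gamma>)" by (rule image_Un[symmetric])
    obtain B where B: "sdiff (\<phi> ` \<Lambda> \<union> \<phi> ` \<Gamma>) \<psi> (\<phi> x) B"
      using der'[OF xW imW[OF LG]] unfolding eq by blast
    obtain A where A: "sdiff (\<psi> ` (\<phi> ` \<Lambda> \<union> \<phi> ` \<Gamma>)) \<phi> (\<psi> (\<phi> x)) A"
      using der[OF xU LG] unfolding eq im[OF LG] inv[OF xU] by blast
    assume W: "whitney_eps (\<phi> ` \<Lambda>) (\<phi> ` \<Gamma>) (\<phi> x)"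
    have "whitney_eps (\<psi> ` \<phi> ` \<Lambda>) (\<psi> ` \<phi> ` \<Gamma>) (\<psi> (\<phi> x))"
    proof (rule whitney_eps_image[OF _ B A _ sC1_subset[OF c(2) imW[OF sub(1)]] W])
      show "\<phi> (\<psi> y) = y" if y: "y \<in> \<phi> ` \<Lambda> \<union> \<phi> ` \<Gamma>" for y
      proof -
        obtain z where "z \<in> U" "y = \<phi> z" using y sub by auto
        then show ?thesis using inv by simp
      qed
    qed (use x in auto)
    then show "whitney_eps \<Lambda> \<Gamma> x" using im[OF sub(1)] im[OF sub(2)] inv[OF xU] by simp
  qed
  then show "whitney_B n \<Lambda> \<Gamma> x \<longleftrightarrow> whitney_B n (\<phi> ` \<Lambda>) (\<phi> ` \<Gamma>) (\<phi> x)"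
    using whitney_B_iff_whitney_eps[OF T R, of x] whitney_B_iff_whitney_eps[OF T' R', of "\<phi> x"] by simp
qed

section \<open>The projection and lifting properties\<close>

abbreviation graph_map :: "nat \<Rightarrow> (evec \<Rightarrow> evec) \<Rightarrow> evec \<Rightarrow> evec" where
  "graph_map n f x \<equiv> vjoin n x (f x)"

lemma sdiff_graph_map:
  assumes "sdiff S f a A"
  shows "sdiff S (graph_map n f) a (\<lambda>h. vjoin n h (A h))"
proof -
  have "sdiff S (\<lambda>x. vjoin n 0 (f x)) a (\<lambda>h. vjoin n 0 (A h))"
  proof (cases "a \<in> S")
    case True
    show ?thesis
      by (rule sdiff_compose[OF assms sdiff_bounded_linear_self[OF bounded_linear_vjoin_right, of UNIV]]) (use True in auto)
  next
    case False
    show ?thesis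
    proof (rule sdiffI)
      show "bounded_linear (\<lambda>h. vjoin n 0 (A h))"
        by (rule bounded_linear_compose[OF bounded_linear_vjoin_right sdiff_bounded_linear[OF assms]])
      fix e :: real assume "e > 0"
      then obtain d where "d > 0" "\<And>x y. x \<in> S \<Longrightarrow> y \<in> S \<Longrightarrow> dist a x < d \<Longrightarrow> dist a y < d \<Longrightarrow>
        norm (f x - f y - A (x - y)) \<le> e * norm (x - y)" using sdiffE[OF assms] by metis
      then show "\<exists>d>0. \<forall>x\<in>S. \<forall>y\<in>S. dist a x < d \<longrightarrow> dist a y < d \<longrightarrow>
        norm (vjoin n 0 (f x) - vjoin n 0 (f y) - vjoin n 0 (A (x - y))) \<le> e * norm (x - y)"
        by (intro exI[of _ d]) (auto simp: vjoin_diff norm_vjoin)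
    qed
  qed
  from sdiff_add[OF sdiff_bounded_linear_self[OF bounded_linear_vtrunc, of S n a] this]
  show ?thesis unfolding vjoin_eq[symmetric] .
qed

lemma sC1_graph_map: "sC1 S f \<Longrightarrow> sC1 S (graph_map n f)"
  unfolding sC1_def using sdiff_graph_map by blast

lemma graph_tangent_space:
  assumes "sdiff M f y A" "y \<in> M" "M \<subseteq> Rn n"
  shows "tangent_space (graph_on n f M) (graph_map n f y) = (\<lambda>h. vjoin n h (A h)) ` tangent_space M y"
  unfolding graph_on_def
  by (rule tangent_space_image[OF sdiff_has_derivative[OF sdiff_graph_map[OF assms(1)] assms(2)]
        bounded_linear_imp_has_derivative[OF bounded_linear_vtrunc[of n]] _ assms(2)])
     (use assms(3) in auto)

lemma graph_tangent_space_grassmannian: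
  assumes "tangent_space M y \<in> grassmannian d n" "sC1 M f" "y \<in> M" "M \<subseteq> Rn n" "f ` M \<subseteq> Rn m"
  shows "tangent_space (graph_on n f M) (graph_map n f y) \<in> grassmannian d (n + m)"
proof -
  obtain A where A: "sdiff M f y A" using assms(2,3) unfolding sC1_def by blast
  show ?thesis
    unfolding graph_on_def
    by (rule tangent_space_image_grassmannian[OF assms(1) _ sdiff_has_derivative[OF sdiff_graph_map[OF A] assms(3)]
          bounded_linear_imp_has_derivative[OF bounded_linear_vtrunc[of n]] _ assms(3)])
       (use assms(4,5) in auto)
qed

lemma graph_on_subset_Rn: "M \<subseteq> Rn n \<Longrightarrow> f ` M \<subseteq> Rn m \<Longrightarrow> graph_on n f M \<subseteq> Rn (n + m)"
  unfolding graph_on_def by auto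

lemma whitney_B_graph_iff:
  assumes "submanifold q n d M" "q \<noteq> C_fin 0" "sC1 M f" "f ` M \<subseteq> Rn m" "N \<subseteq> Rn n" "f ` N \<subseteq> Rn m"
  shows "whitney_B (n + m) (graph_on n f M) (graph_on n f N) b
    \<longleftrightarrow> whitney_eps (graph_on n f M) (graph_on n f N) b"
proof (rule whitney_B_iff_whitney_eps)
  have MR: "M \<subseteq> Rn n" using assms(1) by (simp add: submanifold_def)
  show "graph_on n f M \<subseteq> Rn (n + m)" "graph_on n f N \<subseteq> Rn (n + m)"
    using graph_on_subset_Rn[OF MR assms(4)] graph_on_subset_Rn[OF assms(5,6)] .
  fix z assume "z \<in> graph_on n f M"
  then obtain y where y: "y \<in> M" "z = graph_map n f y" by (auto simp: graph_on_def)
  show "tangent_space (graph_on n f M) z \<in> grassmannian d (n + m)"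
    unfolding y(2)
    by (rule graph_tangent_space_grassmannian[OF submanifold_tangent_space[OF assms(1,2) y(1)] assms(3) y(1) MR assms(4)])
qed

lemma graph_map_dist:
  assumes "x \<in> Rn n" "y \<in> Rn n"
  shows "norm (x - y) \<le> norm (graph_map n f x - graph_map n f y)"
    "norm (graph_map n f x - graph_map n f y) \<le> norm (x - y) + norm (f x - f y)"
  using norm_vjoin_bounds[of "x - y" n "f x - f y"] assms by (auto simp: vjoin_diff)

text \<open>If no constant worked near a, pairs with quotient above k + 1 could be chosen at
  distance 1 / (k + 1), and the limsup along this sequence would be infinite.\<close>

lemma weakly_lipschitz_bound:
  assumes "weakly_lipschitz q n m f A X" "\<Lambda> \<in> X" "\<Gamma> \<in> X" "\<Gamma> \<subseteq> closure \<Lambda> - \<Lambda>" "a \<in> \<Gamma>"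
  obtains C r where "C > 0" "r > 0" "\<And>x y. x \<in> \<Gamma> \<Longrightarrow> y \<in> \<Lambda> \<Longrightarrow> dist a x < r \<Longrightarrow> dist a y < r \<Longrightarrow>
    norm (f x - f y) \<le> C * norm (x - y)"
proof (rule ccontr)
  assume no: "\<not> thesis"
  have "\<exists>x y. x \<in> \<Gamma> \<and> y \<in> \<Lambda> \<and> dist a x < inverse (real (Suc k)) \<and> dist a y < inverse (real (Suc k))
      \<and> real (Suc k) * norm (x - y) < norm (f x - f y)" for k
  proof (rule ccontr)
    assume "\<not> ?thesis"
    then show False
      using no that[of "real (Suc k)" "inverse (real (Suc k))"] by (force simp: not_less)
  qed
  then obtain a' b' where ab: "\<And>k. a' k \<in> \<Gamma>" "\<And>k. b' k \<in> \<Lambda>"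
    "\<And>k. dist a (a' k) < inverse (real (Suc k))" "\<And>k. dist a (b' k) < inverse (real (Suc k))"
    "\<And>k. real (Suc k) * norm (a' k - b' k) < norm (f (a' k) - f (b' k))" by metis
  note lim = LIMSEQ_dist_inverse[OF ab(3)] LIMSEQ_dist_inverse[OF ab(4)]
  have "limsup (\<lambda>\<nu>. ereal (norm (f (a' \<nu>) - f (b' \<nu>)) / norm (a' \<nu> - b' \<nu>))) < \<infinity>"
    using assms ab(1,2) lim unfolding weakly_lipschitz_def by blast
  then obtain c :: nat where c: "limsup (\<lambda>\<nu>. ereal (norm (f (a' \<nu>) - f (b' \<nu>)) / norm (a' \<nu> - b' \<nu>))) < ereal (real c)"
    using less_PInf_Ex_of_nat by auto
  then have "\<forall>\<^sub>F k in sequentially. ereal (norm (f (a' k) - f (b' k)) / norm (a' k - b' k)) < ereal (real c)"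
    by (rule Limsup_lessD)
  from eventually_conj[OF this eventually_ge_at_top[of c]]
  have "\<forall>\<^sub>F k in sequentially. norm (f (a' k) - f (b' k)) / norm (a' k - b' k) < real c \<and> k \<ge> c" by simp
  then obtain k where k: "norm (f (a' k) - f (b' k)) / norm (a' k - b' k) < real c" "k \<ge> c"
    using eventually_happens'[OF sequentially_bot] by blast
  \<comment> \<open>The strata are disjoint, so the quotient has a positive denominator and is not
    the default value 0.\<close>
  have "a' k \<noteq> b' k" using ab(1,2)[of k] assms(4) by auto
  then have "norm (f (a' k) - f (b' k)) < real c * norm (a' k - b' k)"
    using k(1) by (simp add: pos_divide_less_eq)
  also have "\<dots> \<le> real (Suc k) * norm (a' k - b' k)" using k(2) by (intro mult_right_mono) auto
  finally show False using ab(5)[of k] by simp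
qed

text \<open>The projection \<open>vtrunc n\<close> takes tangent vectors of the graph to tangent
  vectors of \<Lambda> without increasing norms, and the weak Lipschitz bound makes a secant of the
  graph at most 1 + C times as long as its projection.\<close>

lemma projection_property_whitney_B:
  assumes q: "q \<noteq> C_fin 0"
  shows "projection_property q whitney_B"
  unfolding projection_property_def
proof (intro allI impI, elim conjE)
  fix n m f A X
  assume X: "stratification q n A X" and f: "weakly_lipschitz q n m f A X"
    and G: "Q_stratification q whitney_B (n + m) (graph_on n f A) (graph_stratification n f X)"
  show "Q_stratification q whitney_B n A X"
    unfolding Q_stratification_def satisfied_def
  proof (intro conjI X ballI impI)
    fix \<Lambda> \<Gamma> a assume \<Lambda>X: "\<Lambda> \<in> X" and \<Gamma>X: "\<Gamma> \<in> X" and cl: "\<Gamma> \<subseteq> closure \<Lambda> - \<Lambda>" and a: "a \<in> \<Gamma>"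
    obtain d where \<Lambda>: "submanifold q n d \<Lambda>" using X \<Lambda>X unfolding stratification_def by blast
    obtain d' where \<Gamma>: "submanifold q n d' \<Gamma>" using X \<Gamma>X unfolding stratification_def by blast
    have R: "\<Lambda> \<subseteq> Rn n" "\<Gamma> \<subseteq> Rn n" using \<Lambda> \<Gamma> by (auto simp: submanifold_def)
    have sub: "\<Lambda> \<subseteq> A" "\<Gamma> \<subseteq> A" using X \<Lambda>X \<Gamma>X unfolding stratification_def partition_on_def by auto
    have fR: "f ` \<Lambda> \<subseteq> Rn m" "f ` \<Gamma> \<subseteq> Rn m" using f sub unfolding weakly_lipschitz_def by auto
    have c1: "sC1 \<Lambda> f" "sC1 \<Gamma> f"
      using f \<Lambda>X \<Gamma>X Cq_on_imp_sC1[OF _ q] R fR unfolding weakly_lipschitz_def by auto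
    let ?F = "graph_map n f"
    \<comment> \<open>The hypothesis on the graphs concerns only pairs in frontier position; the
      weak Lipschitz bound makes f y converge to f x as y in \<Lambda> approaches x in \<Gamma>, so
      the position is inherited.\<close>
    have adj: "graph_on n f \<Gamma> \<subseteq> closure (graph_on n f \<Lambda>) - graph_on n f \<Lambda>"
    proof
      fix z assume "z \<in> graph_on n f \<Gamma>"
      then obtain x where x: "x \<in> \<Gamma>" "z = ?F x" by (auto simp: graph_on_def)
      obtain C r where C: "C > 0" "r > 0" "\<And>z y. z \<in> \<Gamma> \<Longrightarrow> y \<in> \<Lambda> \<Longrightarrow> dist x z < r \<Longrightarrow> dist x y < r \<Longrightarrow>
        norm (f z - f y) \<le> C * norm (z - y)" using weakly_lipschitz_bound[OF f \<Lambda>X \<Gamma>X cl x(1)] by metis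
      have "z \<in> closure (graph_on n f \<Lambda>)"
        unfolding closure_approachable
      proof (intro allI impI)
        fix e :: real assume e: "e > 0"
        have "x \<in> closure \<Lambda>" using x cl by auto
        then obtain y where y: "y \<in> \<Lambda>" "dist y x < min r (e / (1 + C))"
          using C e unfolding closure_approachable by (metis min_less_iff_conj divide_pos_pos add_pos_pos zero_less_one)
        have "norm (?F x - ?F y) \<le> norm (x - y) + norm (f x - f y)"
          using x y R by (intro graph_map_dist(2)) auto
        also have "\<dots> \<le> (1 + C) * norm (x - y)"
          using C(3)[OF x(1) y(1)] y(2) C(2) by (simp add: dist_commute algebra_simps)
        also have "\<dots> < e" using y(2) C by (simp add: dist_norm norm_minus_commute pos_less_divide_eq mult.commute)
        finally show "\<exists>w\<in>graph_on n f \<Lambda>. dist w z < e"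
          using y(1) x(2) by (auto simp: graph_on_def dist_norm norm_minus_commute intro!: bexI[of _ y])
      qed
      moreover have "z \<notin> graph_on n f \<Lambda>"
      proof
        assume "z \<in> graph_on n f \<Lambda>"
        then obtain y where y: "y \<in> \<Lambda>" "?F x = ?F y" using x by (auto simp: graph_on_def)
        then have "vtrunc n (?F x) = vtrunc n (?F y)" by simp
        then show False using x y R cl by (metis DiffD2 subsetD vtrunc_vjoin)
      qed
      ultimately show "z \<in> closure (graph_on n f \<Lambda>) - graph_on n f \<Lambda>" by blast
    qed
    have "whitney_B (n + m) (graph_on n f \<Lambda>) (graph_on n f \<Gamma>) (?F a)"
      using G adj \<Lambda>X \<Gamma>X a unfolding Q_stratification_def satisfied_def graph_stratification_def graph_on_def by blast
    then have W: "whitney_eps (graph_on n f \<Lambda>) (graph_on n f \<Gamma>) (?F a)"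
      using whitney_B_graph_iff[OF \<Lambda> q c1(1) fR(1) R(2) fR(2)] by simp
    obtain C r where C: "C > 0" "r > 0" "\<And>x y. x \<in> \<Gamma> \<Longrightarrow> y \<in> \<Lambda> \<Longrightarrow> dist a x < r \<Longrightarrow> dist a y < r \<Longrightarrow>
      norm (f x - f y) \<le> C * norm (x - y)" using weakly_lipschitz_bound[OF f \<Lambda>X \<Gamma>X cl a] by metis
    have "whitney_eps \<Lambda> \<Gamma> a"
      unfolding whitney_eps_def
    proof (intro allI impI)
      fix e :: real assume e: "e > 0"
      have e': "e / (1 + C) > 0" using e C(1) by simp
      obtain d where d: "d > 0" "\<And>x y. x \<in> graph_on n f \<Gamma> \<Longrightarrow> y \<in> graph_on n f \<Lambda> \<Longrightarrow>
          dist (?F a) x < d \<Longrightarrow> dist (?F a) y < d \<Longrightarrow>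
        \<exists>w\<in>tangent_space (graph_on n f \<Lambda>) y. norm (x - y - w) \<le> e / (1 + C) * norm (x - y)"
        using whitney_epsE[OF W e'] by metis
      have "continuous_on \<Gamma> (graph_map n f)" by (rule sC1_continuous_on[OF sC1_graph_map[OF c1(2)]])
      then obtain r2 where r2: "r2 > 0" "\<And>x. x \<in> \<Gamma> \<Longrightarrow> dist x a < r2 \<Longrightarrow> dist (?F x) (?F a) < d"
        using a d(1) unfolding continuous_on_iff by metis
      \<comment> \<open>The constant C compares values on \<Gamma> with values on \<Lambda> only. It
        brings the graph point of y near that of a, which needs d / (1 + C); for x, which lies in
        \<Gamma> like a, continuity of f on \<Gamma> is used instead and gives
        \<open>r2\<close>.\<close>
      define r3 where "r3 = Min {r, r2, d / (1 + C)}"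
      have r3: "r3 > 0" "r3 \<le> r" "r3 \<le> r2" "r3 \<le> d / (1 + C)" using C r2(1) d(1) by (auto simp: r3_def)
      show "\<exists>d>0. \<forall>x\<in>\<Gamma>. \<forall>y\<in>\<Lambda>. dist a x < d \<longrightarrow> dist a y < d \<longrightarrow>
          (\<exists>w\<in>tangent_space \<Lambda> y. norm (x - y - w) \<le> e * norm (x - y))"
      proof (intro exI[of _ r3] conjI ballI impI r3(1))
        fix x y assume xy: "x \<in> \<Gamma>" "y \<in> \<Lambda>" "dist a x < r3" "dist a y < r3"
        have "dist (?F a) (?F x) < d" using r2(2)[of x] xy r3 by (simp add: dist_commute)
        moreover have "dist (?F a) (?F y) < d"
        proof -
          have "norm (?F a - ?F y) \<le> norm (a - y) + norm (f a - f y)"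
            using a xy R by (intro graph_map_dist(2)) auto
          also have "\<dots> \<le> (1 + C) * norm (a - y)"
            using C(3)[OF a xy(2)] xy(4) r3(2) C(2) by (simp add: algebra_simps)
          also have "\<dots> < d"
          proof -
            have "norm (a - y) < d / (1 + C)" using xy(4) r3(4) by (simp add: dist_norm)
            then show ?thesis using C(1) by (simp add: pos_less_divide_eq mult.commute)
          qed
          finally show ?thesis by (simp add: dist_norm)
        qed
        ultimately obtain w where w: "w \<in> tangent_space (graph_on n f \<Lambda>) (?F y)"
          "norm (?F x - ?F y - w) \<le> e / (1 + C) * norm (?F x - ?F y)"
          using d(2)[of "?F x" "?F y"] xy unfolding graph_on_def by blast
        have "vtrunc n ` graph_on n f \<Lambda> \<subseteq> \<Lambda>" using R by (auto simp: graph_on_def)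
        then have "vtrunc n w \<in> tangent_space \<Lambda> (vtrunc n (?F y))"
          using w(1) by (intro tangent_space_image_subset[OF bounded_linear_imp_has_derivative[OF bounded_linear_vtrunc]])
        moreover have v: "vtrunc n (?F x) = x" "vtrunc n (?F y) = y" using xy R by auto
        moreover have "norm (x - y - vtrunc n w) \<le> e * norm (x - y)"
        proof -
          have "x - y - vtrunc n w = vtrunc n (?F x - ?F y - w)" by (simp only: vtrunc_diff v)
          then have "norm (x - y - vtrunc n w) \<le> norm (?F x - ?F y - w)" by (simp only: norm_vtrunc_le)
          also note w(2)
          also have "e / (1 + C) * norm (?F x - ?F y) \<le> e / (1 + C) * ((1 + C) * norm (x - y))"
          proof (rule mult_left_mono)
            have "norm (?F x - ?F y) \<le> norm (x - y) + norm (f x - f y)"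
              using xy R by (intro graph_map_dist(2)) auto
            also have "\<dots> \<le> (1 + C) * norm (x - y)"
              using C(3)[OF xy(1,2)] xy(3,4) r3(2) by (simp add: algebra_simps)
            finally show "norm (?F x - ?F y) \<le> (1 + C) * norm (x - y)" .
          qed (use e' in simp)
          also have "\<dots> = e * norm (x - y)" using C(1) by simp
          finally show ?thesis .
        qed
        ultimately show "\<exists>w\<in>tangent_space \<Lambda> y. norm (x - y - w) \<le> e * norm (x - y)"
          by (intro bexI[of _ "vtrunc n w"]) simp_all
      qed
    qed
    then show "whitney_B n \<Lambda> \<Gamma> a" by (rule whitney_eps_imp_whitney_B)
  qed
qed

text \<open>Within one stratum the graph map is strictly differentiable with left inverse
  \<open>vtrunc n\<close>, so the condition is simply transported.\<close>

lemma whitney_eps_graph_same: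
  assumes "M \<subseteq> S" "N \<subseteq> S" "S \<subseteq> Rn n" "sC1 S f" "a \<in> N" "whitney_eps M N a"
  shows "whitney_eps (graph_on n f M) (graph_on n f N) (graph_map n f a)"
proof -
  obtain A where A: "sdiff S (graph_map n f) a A"
    using sC1_graph_map[OF assms(4)] assms(2,5) unfolding sC1_def by blast
  have A': "sdiff (M \<union> N) (graph_map n f) a A" using A by (rule sdiff_subset) (use assms in auto)
  show ?thesis
    unfolding graph_on_def
    by (rule whitney_eps_image[OF _ A' sdiff_bounded_linear_self[OF bounded_linear_vtrunc[of n]] _
          sC1_subset[OF sC1_graph_map[OF assms(4)] assms(1)] assms(6)])
       (use assms in auto)
qed

text \<open>The condition for the graphs over \<Lambda> and \<Gamma> gives w' tangent to \<Lambda>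
  with (w', D w') near the graph secant, but w' need not be tangent to M. The condition for M and N
  gives w tangent to M near x - y. Hence w' - w is small, D is bounded by the Lipschitz constant
  there, and (w, D w) is near the graph secant as well.\<close>

lemma whitney_eps_graph_pair:
  assumes M: "M \<subseteq> \<Lambda>" and N: "N \<subseteq> \<Gamma>" and R: "\<Lambda> \<subseteq> Rn n" "\<Gamma> \<subseteq> Rn n" and f: "sC1 \<Lambda> f"
    and sub: "\<And>y. y \<in> \<Lambda> \<Longrightarrow> subspace (tangent_space \<Lambda> y)"
    and lip: "locally_lipschitz_on (\<Lambda> \<union> \<Gamma>) f" and a: "a \<in> N"
    and W: "whitney_eps M N a" and WG: "whitney_eps (graph_on n f \<Lambda>) (graph_on n f \<Gamma>) (graph_map n f a)"
  shows "whitney_eps (graph_on n f M) (graph_on n f N) (graph_map n f a)"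
  unfolding whitney_eps_def
proof (intro allI impI)
  let ?F = "graph_map n f"
  fix e :: real assume e: "e > 0"
  obtain V C where V: "open V" "a \<in> V" and C: "C-lipschitz_on ((\<Lambda> \<union> \<Gamma>) \<inter> V) f"
    using lip a N unfolding locally_lipschitz_on_def by blast
  have C0: "C \<ge> 0" using C lipschitz_on_nonneg by blast
  have Cb: "norm (f x - f y) \<le> C * norm (x - y)" if "x \<in> \<Lambda> \<union> \<Gamma>" "y \<in> \<Lambda> \<union> \<Gamma>" "x \<in> V" "y \<in> V" for x y
    using lipschitz_onD[OF C, of x y] that by (simp add: dist_norm)
  obtain r where r: "r > 0" "\<And>x. dist a x < r \<Longrightarrow> x \<in> V"
    using V open_contains_ball by (metis mem_ball subsetD)
  \<comment> \<open>The product collects the error of w, which is 1, that of D w', which is 1 + C,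
    and that of D w' - D w, which is C (2 + C), all in units of \<eta> |x - y|.\<close>
  define \<eta> where "\<eta> = e / ((2 + C) * (1 + C))"
  have \<eta>: "\<eta> > 0" "\<eta> * ((2 + C) * (1 + C)) = e" using e C0 by (auto simp: \<eta>_def)
  obtain d1 where d1: "d1 > 0" "\<And>x y. x \<in> N \<Longrightarrow> y \<in> M \<Longrightarrow> dist a x < d1 \<Longrightarrow> dist a y < d1 \<Longrightarrow>
    \<exists>w\<in>tangent_space M y. norm (x - y - w) \<le> \<eta> * norm (x - y)" using whitney_epsE[OF W \<eta>(1)] by metis
  obtain d2 where d2: "d2 > 0" "\<And>x y. x \<in> graph_on n f \<Gamma> \<Longrightarrow> y \<in> graph_on n f \<Lambda> \<Longrightarrow>
      dist (?F a) x < d2 \<Longrightarrow> dist (?F a) y < d2 \<Longrightarrow>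
    \<exists>w\<in>tangent_space (graph_on n f \<Lambda>) y. norm (x - y - w) \<le> \<eta> * norm (x - y)"
    using whitney_epsE[OF WG \<eta>(1)] by metis
  define d where "d = min r (min d1 d2)"
  have d: "d > 0" "d \<le> r" "d \<le> d1" "d \<le> d2" using r(1) d1(1) d2(1) by (auto simp: d_def)
  have main: "\<exists>w\<in>tangent_space (graph_on n f M) (?F y). norm (?F x - ?F y - w) \<le> e * norm (?F x - ?F y)"
    if xy: "x \<in> N" "y \<in> M" "dist (?F a) (?F x) < d" "dist (?F a) (?F y) < d" for x y
  proof -
    have mem: "x \<in> Rn n" "y \<in> Rn n" "a \<in> Rn n" "x \<in> \<Gamma>" "y \<in> \<Lambda>" using xy a M N R by auto
    have ax: "dist a x < d" using graph_map_dist(1)[OF mem(3,1), of f] xy(3) by (simp add: dist_norm)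
    have ay: "dist a y < d" using graph_map_dist(1)[OF mem(3,2), of f] xy(4) by (simp add: dist_norm)
    have V': "x \<in> V" "y \<in> V" using r(2) ax ay d(2) by auto
    obtain w where w: "w \<in> tangent_space M y" "norm (x - y - w) \<le> \<eta> * norm (x - y)"
      using d1(2)[OF xy(1,2)] ax ay d(3) by auto
    obtain D where D: "sdiff \<Lambda> f y D" using f mem(5) unfolding sC1_def by blast
    have linD: "linear D" using D sdiff_bounded_linear bounded_linear.linear by blast
    \<comment> \<open>\<open>tangent_space_bound\<close> with the zero map and error C. The bound
      holds only on tangent vectors of \<Lambda>, so w' - w has to be one; this is where the
      subspace property is used.\<close>
    have DC: "norm (D v) \<le> C * norm v" if v: "v \<in> tangent_space \<Lambda> y" for v
    proof -
      obtain s where s: "s > 0" "\<And>z. dist y z < s \<Longrightarrow> z \<in> V"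
        using V(1) V'(2) open_contains_ball by (metis mem_ball subsetD)
      have "norm (D v - 0) \<le> C * norm v"
        by (rule tangent_space_bound[OF v bounded_linear_zero s(1) _ sdiff_has_derivative[OF D mem(5)]])
           (use Cb mem(5) V'(2) s(2) in auto)
      then show ?thesis by simp
    qed
    have "\<exists>w\<in>tangent_space (graph_on n f \<Lambda>) (?F y). norm (?F x - ?F y - w) \<le> \<eta> * norm (?F x - ?F y)"
      using mem(4,5) xy(3,4) d(4) by (intro d2(2)) (auto simp: graph_on_def)
    then obtain w' where w': "w' \<in> tangent_space \<Lambda> y"
      "norm (?F x - ?F y - vjoin n w' (D w')) \<le> \<eta> * norm (?F x - ?F y)"
      unfolding graph_tangent_space[OF D mem(5) R(1)] by blast
    have wL: "w \<in> tangent_space \<Lambda> y" using w(1) tangent_space_mono[OF M] by blast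
    have wR: "w \<in> Rn n" "w' \<in> Rn n" using wL w'(1) tangent_space_subset_Rn[OF R(1)] by blast+
    define z where "z = norm (x - y)"
    have fz: "norm (?F x - ?F y) \<le> (1 + C) * z"
      using graph_map_dist(2)[OF mem(1,2), of f] Cb[of x y] mem V' by (simp add: z_def algebra_simps)
    have "\<eta> * norm (?F x - ?F y) \<le> \<eta> * ((1 + C) * z)" using fz \<eta>(1) by (intro mult_left_mono) auto
    moreover have "?F x - ?F y - vjoin n w' (D w') = vjoin n (x - y - w') (f x - f y - D w')"
      by (simp only: vjoin_diff)
    moreover have xyw: "x - y - w' \<in> Rn n" using mem wR by auto
    ultimately have b: "norm (x - y - w') \<le> \<eta> * ((1 + C) * z)" "norm (f x - f y - D w') \<le> \<eta> * ((1 + C) * z)"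
      using w'(2) norm_vjoin_bounds(1)[OF xyw, of "f x - f y - D w'"]
        norm_vjoin_bounds(2)[OF xyw, of "f x - f y - D w'"] by auto
    have "norm (w' - w) \<le> norm (x - y - w) + norm (x - y - w')"
      using norm_triangle_ineq4[of "x - y - w" "x - y - w'"] by simp
    also have "\<dots> \<le> \<eta> * z + \<eta> * ((1 + C) * z)" using w(2) b(1) by (simp add: z_def)
    finally have ww: "norm (w' - w) \<le> \<eta> * ((2 + C) * z)" by (simp add: algebra_simps)
    have "w' - w \<in> tangent_space \<Lambda> y" using sub[OF mem(5)] w'(1) wL by (rule subspace_diff)
    then have "norm (D (w' - w)) \<le> C * norm (w' - w)" by (rule DC)
    also have "\<dots> \<le> C * (\<eta> * ((2 + C) * z))" using ww C0 by (rule mult_left_mono)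
    finally have Dww: "norm (D w' - D w) \<le> C * (\<eta> * ((2 + C) * z))" by (simp only: linear_diff[OF linD])
    have "norm (f x - f y - D w) \<le> norm (f x - f y - D w') + norm (D w' - D w)"
      using norm_triangle_ineq[of "f x - f y - D w'" "D w' - D w"] by simp
    also have "\<dots> \<le> \<eta> * ((1 + C) * z) + C * (\<eta> * ((2 + C) * z))" using b(2) Dww by (rule add_mono)
    finally have fD: "norm (f x - f y - D w) \<le> \<eta> * ((1 + C) * z) + C * (\<eta> * ((2 + C) * z))" .
    have "?F x - ?F y - vjoin n w (D w) = vjoin n (x - y - w) (f x - f y - D w)"
      by (simp only: vjoin_diff)
    then have "norm (?F x - ?F y - vjoin n w (D w)) \<le> norm (x - y - w) + norm (f x - f y - D w)"
      using norm_vjoin_bounds(3)[of "x - y - w" n] mem wR by auto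
    also have "\<dots> \<le> \<eta> * z + (\<eta> * ((1 + C) * z) + C * (\<eta> * ((2 + C) * z)))"
      using w(2) fD by (simp add: z_def)
    also have "\<dots> = \<eta> * ((2 + C) * (1 + C)) * z" by (simp add: algebra_simps)
    also have "\<dots> \<le> e * norm (?F x - ?F y)"
      unfolding \<eta>(2) z_def using graph_map_dist(1)[OF mem(1,2), of f] e by (intro mult_left_mono) auto
    finally have fin: "norm (?F x - ?F y - vjoin n w (D w)) \<le> e * norm (?F x - ?F y)" .
    have "M \<subseteq> Rn n" using M R(1) by auto
    then have "vjoin n w (D w) \<in> tangent_space (graph_on n f M) (?F y)"
      using graph_tangent_space[OF sdiff_subset[OF D M] xy(2)] w(1) by blast
    with fin show ?thesis by blast
  qed
  show "\<exists>d>0. \<forall>x\<in>graph_on n f N. \<forall>y\<in>graph_on n f M. dist (?F a) x < d \<longrightarrow> dist (?F a) y < d \<longrightarrow>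
      (\<exists>w\<in>tangent_space (graph_on n f M) y. norm (x - y - w) \<le> e * norm (x - y))"
    unfolding graph_on_def using d(1) main unfolding graph_on_def by (intro exI[of _ d]) auto
qed

text \<open>If M and N lie in the same stratum, the graph map transports the condition; if M lies in
  \<Lambda> and N in \<Gamma>, both hypotheses are combined; the reverse position contradicts the
  frontier relation.\<close>

lemma lifting_property_whitney_B:
  assumes q: "q \<noteq> C_fin 0"
  shows "lifting_property q whitney_B"
  unfolding lifting_property_def
proof (intro allI impI, elim conjE)
  fix n m f \<Lambda> \<Gamma> M N
  assume adj: "adjacent q n \<Lambda> \<Gamma>" and fR: "f ` (\<Lambda> \<union> \<Gamma>) \<subseteq> Rn m" and lip: "locally_lipschitz_on (\<Lambda> \<union> \<Gamma>) f"
    and C: "Cq_on q n \<Lambda> f" "Cq_on q n \<Gamma> f" and adj': "adjacent q n M N"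
    and MN: "M \<subseteq> \<Lambda> \<or> M \<subseteq> \<Gamma>" "N \<subseteq> \<Lambda> \<or> N \<subseteq> \<Gamma>"
    and W: "satisfied whitney_B n M N"
    and WG: "satisfied whitney_B (n + m) (graph_on n f \<Lambda>) (graph_on n f \<Gamma>)"
  obtain d where \<Lambda>: "submanifold q n d \<Lambda>" using adj by (auto simp: adjacent_def is_submanifold_def)
  obtain d' where M: "submanifold q n d' M" using adj' by (auto simp: adjacent_def is_submanifold_def)
  have R: "\<Lambda> \<subseteq> Rn n" "\<Gamma> \<subseteq> Rn n" "M \<subseteq> Rn n" "N \<subseteq> Rn n"
    using adj adj' by (auto simp: adjacent_def is_submanifold_def submanifold_def)
  have c1: "sC1 \<Lambda> f" "sC1 \<Gamma> f"
    using fR R by (auto intro!: Cq_on_imp_sC1[OF C(1) q, of m] Cq_on_imp_sC1[OF C(2) q, of m])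
  have fM: "f ` M \<subseteq> Rn m" "f ` N \<subseteq> Rn m" using MN fR by auto
  have "whitney_eps (graph_on n f M) (graph_on n f N) (graph_map n f a)" if a: "a \<in> N" for a
  proof -
    have WMN: "whitney_eps M N a"
      using W a whitney_B_iff_whitney_eps[OF submanifold_tangent_space[OF M q] R(3,4)]
      unfolding satisfied_def by blast
    consider "M \<subseteq> \<Lambda>" "N \<subseteq> \<Lambda>" | "M \<subseteq> \<Gamma>" "N \<subseteq> \<Gamma>" | "M \<subseteq> \<Lambda>" "N \<subseteq> \<Gamma>" | "M \<subseteq> \<Gamma>" "N \<subseteq> \<Lambda>"
      using MN by blast
    then show ?thesis
    proof cases
      case 1
      show ?thesis by (rule whitney_eps_graph_same[OF 1 R(1) c1(1) a WMN])
    next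
      case 2
      show ?thesis by (rule whitney_eps_graph_same[OF 2 R(2) c1(2) a WMN])
    next
      case 3
      show ?thesis
      proof (rule whitney_eps_graph_pair[OF 3 R(1,2) c1(1) _ lip a WMN])
        show "subspace (tangent_space \<Lambda> y)" if "y \<in> \<Lambda>" for y
          using submanifold_tangent_space[OF \<Lambda> q that] by (simp add: grassmannian_def)
        have fR': "f ` \<Lambda> \<subseteq> Rn m" "f ` \<Gamma> \<subseteq> Rn m" using fR by auto
        have "graph_map n f a \<in> graph_on n f \<Gamma>" using a 3 unfolding graph_on_def by blast
        then have "whitney_B (n + m) (graph_on n f \<Lambda>) (graph_on n f \<Gamma>) (graph_map n f a)"
          by (rule bspec[OF WG[unfolded satisfied_def]])
        then show "whitney_eps (graph_on n f \<Lambda>) (graph_on n f \<Gamma>) (graph_map n f a)"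
          by (rule whitney_B_graph_iff[OF \<Lambda> q c1(1) fR'(1) R(2) fR'(2), THEN iffD1])
      qed
    next
      case 4
      \<comment> \<open>Near a the closure of \<Lambda> lies in \<Lambda>. But points of M, which
        belong to \<Gamma> and so to the closure of \<Lambda> and not to \<Lambda>, accumulate at
        a.\<close>
      have "a \<in> \<Lambda>" using a 4 by auto
      then obtain O' where O': "open O'" "a \<in> O'" "closure \<Lambda> \<inter> O' \<subseteq> \<Lambda>"
        using submanifold_open_in_closure[OF \<Lambda> q] by blast
      have "a \<in> closure M" using a adj' by (auto simp: adjacent_def)
      then have "O' \<inter> closure M \<noteq> {}" using O'(2) by blast
      then have "O' \<inter> M \<noteq> {}" using open_Int_closure_eq_empty[OF O'(1), of M] by blast
      then obtain y where "y \<in> M" "y \<in> O'" by blast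
      then have "y \<in> \<Gamma>" "y \<in> O'" using 4 by auto
      then show ?thesis using adj O'(3) by (auto simp: adjacent_def)
    qed
  qed
  then show "satisfied whitney_B (n + m) (graph_on n f M) (graph_on n f N)"
    unfolding satisfied_def
    using whitney_eps_imp_whitney_B by (auto simp: graph_on_def)
qed

section \<open>First-order definability\<close>

text \<open>The guard \<open>b \<in> M\<close> makes this a definable relation between all pairs of
  points: the first-order description of tangent vectors is valid only at points of M.\<close>

definition in_tangent_bundle :: "evec set \<Rightarrow> evec \<Rightarrow> evec \<Rightarrow> bool" where
  "in_tangent_bundle M b v \<longleftrightarrow> b \<in> M \<and> v \<in> tangent_space M b"

lemma in_tangent_bundle_bex:
  assumes "M \<subseteq> Rn n" "y \<in> M"
  shows "(\<exists>w\<in>tangent_space M y. P w) \<longleftrightarrow> (\<exists>w\<in>Rn n. in_tangent_bundle M y w \<and> P w)"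
  using assms tangent_space_subset_Rn[OF assms(1), of y] unfolding in_tangent_bundle_def by blast

context o_minimal_structure
begin

definition Def :: "nat \<Rightarrow> (evec \<Rightarrow> bool) \<Rightarrow> bool" where
  "Def N P \<longleftrightarrow> {x \<in> Rn N. P x} \<in> D N"

text \<open>Definability of a function is definability of its graph: coordinate N holds the value,
  and \<open>vtrunc N\<close> removes it from the argument.\<close>

definition dterm :: "nat \<Rightarrow> (evec \<Rightarrow> real) \<Rightarrow> bool" where
  "dterm N f \<longleftrightarrow> Def (Suc N) (\<lambda>z. coord z N = f (vtrunc N z))"

definition dvec :: "nat \<Rightarrow> nat \<Rightarrow> (evec \<Rightarrow> evec) \<Rightarrow> bool" where
  "dvec N k F \<longleftrightarrow> (\<forall>x\<in>Rn N. F x \<in> Rn k) \<and> (\<forall>i<k. dterm N (\<lambda>x. coord (F x) i))"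

section \<open>Closure of definability under logical operations and substitution\<close>

lemma D_subset_Rn: "A \<in> D n \<Longrightarrow> A \<subseteq> Rn n"
  using boolean_algebra[of n] by (auto simp: algebra_iff_Un)

lemma Rn_in_D: "Rn n \<in> D n"
  using boolean_algebra[of n] by (rule algebra.top)

lemma D_imp_Def: "A \<in> D n \<Longrightarrow> Def n (\<lambda>x. x \<in> A)"
  unfolding Def_def using D_subset_Rn[of A n] by (simp add: Collect_conj_eq Int_absorb1)

lemma Def_cong: "Def N P \<Longrightarrow> (\<And>x. x \<in> Rn N \<Longrightarrow> P x \<longleftrightarrow> Q x) \<Longrightarrow> Def N Q"
  unfolding Def_def by (metis (mono_tags, lifting) Collect_cong)

lemma Def_not: "Def N P \<Longrightarrow> Def N (\<lambda>x. \<not> P x)"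
proof -
  assume "Def N P"
  then have "Rn N - {x \<in> Rn N. P x} \<in> D N"
    using boolean_algebra[of N] unfolding Def_def algebra_iff_Un by blast
  moreover have "Rn N - {x \<in> Rn N. P x} = {x \<in> Rn N. \<not> P x}" by blast
  ultimately show ?thesis by (simp add: Def_def)
qed

lemma Def_disj: "Def N P \<Longrightarrow> Def N Q \<Longrightarrow> Def N (\<lambda>x. P x \<or> Q x)"
proof -
  assume "Def N P" "Def N Q"
  then have "{x \<in> Rn N. P x} \<union> {x \<in> Rn N. Q x} \<in> D N"
    using boolean_algebra[of N] unfolding Def_def algebra_iff_Un by blast
  moreover have "{x \<in> Rn N. P x} \<union> {x \<in> Rn N. Q x} = {x \<in> Rn N. P x \<or> Q x}" by blast
  ultimately show ?thesis by (simp add: Def_def)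
qed

lemma Def_conj: "Def N P \<Longrightarrow> Def N Q \<Longrightarrow> Def N (\<lambda>x. P x \<and> Q x)"
  using Def_not[OF Def_disj[OF Def_not Def_not, of N P Q]] by simp

lemma Def_imp: "Def N P \<Longrightarrow> Def N Q \<Longrightarrow> Def N (\<lambda>x. P x \<longrightarrow> Q x)"
  unfolding imp_conv_disj by (intro Def_disj Def_not)

lemma Def_bool: "Def N (\<lambda>x. c)"
proof -
  have "Def N (\<lambda>x. True)" using Rn_in_D by (simp add: Def_def)
  then have "Def N (\<lambda>x. \<not> True)" by (rule Def_not)
  with \<open>Def N (\<lambda>x. True)\<close> show ?thesis by (cases c) simp_all
qed

lemma Def_all_less: "(\<And>i. i < (k :: nat) \<Longrightarrow> Def N (P i)) \<Longrightarrow> Def N (\<lambda>x. \<forall>i<k. P i x)"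
proof (induction k)
  case (Suc k)
  have "Def N (\<lambda>x. (\<forall>i<k. P i x) \<and> P k x)" using Suc by (intro Def_conj) auto
  then show ?case by (rule Def_cong) (auto simp: less_Suc_eq)
qed (simp add: Def_bool)

text \<open>The left product axiom puts one free coordinate in front at a time.\<close>

lemma Def_vdrop_mem:
  assumes "A \<in> D k"
  shows "Def (N + k) (\<lambda>z. vdrop N z \<in> A)"
proof (induction N)
  case 0
  have "vdrop 0 z = z" for z by (intro evec_eqI) simp
  then show ?case using D_imp_Def[OF assms] by simp
next
  case (Suc N)
  let ?B = "{z \<in> Rn (N + k). vdrop N z \<in> A}"
  have "vprod 1 (Rn 1) ?B \<in> D (Suc (N + k))" using Suc.IH by (intro prod_left) (simp add: Def_def)
  moreover have "vprod 1 (Rn 1) ?B = {z \<in> Rn (Suc N + k). vdrop (Suc N) z \<in> A}"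
  proof (intro equalityI subsetI)
    fix z assume "z \<in> vprod 1 (Rn 1) ?B"
    then obtain x y where z: "z = vjoin 1 x y" "x \<in> Rn 1" "y \<in> Rn (N + k)" "vdrop N y \<in> A"
      unfolding vprod_def by blast
    have "vdrop (Suc N) z = vdrop N y" by (intro evec_eqI) (simp add: z(1))
    moreover have "z \<in> Rn (Suc N + k)" using Rn_intros(8)[OF z(2,3)] z(1) by simp
    ultimately show "z \<in> {z \<in> Rn (Suc N + k). vdrop (Suc N) z \<in> A}" using z(4) by simp
  next
    fix z assume z: "z \<in> {z \<in> Rn (Suc N + k). vdrop (Suc N) z \<in> A}"
    have "vdrop N (vdrop 1 z) = vdrop (Suc N) z" by (intro evec_eqI) simp
    moreover have "vdrop 1 z \<in> Rn (N + k)" using z by (intro Rn_intros(7)) simp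
    moreover have "z = vjoin 1 (vtrunc 1 z) (vdrop 1 z)" by simp
    ultimately show "z \<in> vprod 1 (Rn 1) ?B" using z unfolding vprod_def by (metis (mono_tags, lifting) Rn_intros(5) mem_Collect_eq)
  qed
  ultimately show ?case by (simp add: Def_def)
qed

lemma D_project: "A \<in> D (N + k) \<Longrightarrow> vtrunc N ` A \<in> D N"
proof (induction k arbitrary: A)
  case 0
  then show ?case using D_subset_Rn[of A N] by (simp add: subset_iff cong: image_cong)
next
  case (Suc k)
  have "vtrunc (N + k) ` A \<in> D (N + k)" using Suc.prems by (intro projection) simp
  then have "vtrunc N ` vtrunc (N + k) ` A \<in> D N" by (rule Suc.IH)
  then show ?case by (simp add: image_image vtrunc_vtrunc)
qed

lemma Def_project:
  assumes "Def (N + k) Q" "\<And>x. x \<in> Rn N \<Longrightarrow> P x \<longleftrightarrow> (\<exists>z\<in>Rn (N + k). vtrunc N z = x \<and> Q z)"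
  shows "Def N P"
proof -
  have "vtrunc N ` {z \<in> Rn (N + k). Q z} \<in> D N" using assms(1) by (intro D_project) (simp add: Def_def)
  moreover have "vtrunc N ` {z \<in> Rn (N + k). Q z} = {x \<in> Rn N. P x}" using assms(2) by auto
  ultimately show ?thesis by (simp add: Def_def)
qed

text \<open>Permuting, repeating or omitting coordinates: k new coordinates are equated with the
  chosen old ones by diagonals and then projected away.\<close>

lemma Def_select:
  assumes "A \<in> D k" "\<And>i. i < k \<Longrightarrow> \<sigma> i < N"
  shows "Def N (\<lambda>x. select k (\<lambda>i. coord x (\<sigma> i)) \<in> A)"
proof (rule Def_project)
  have "Def (N + k) (\<lambda>z. coord z (N + i) = coord z (\<sigma> i))" if "i < k" for i
    unfolding Def_def using that assms(2)[OF that] by (intro diagonal) auto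
  then show "Def (N + k) (\<lambda>z. vdrop N z \<in> A \<and> (\<forall>i<k. coord z (N + i) = coord z (\<sigma> i)))"
    by (intro Def_conj Def_vdrop_mem assms(1) Def_all_less)
  fix x assume x: "x \<in> Rn N"
  show "select k (\<lambda>i. coord x (\<sigma> i)) \<in> A \<longleftrightarrow> (\<exists>z\<in>Rn (N + k). vtrunc N z = x
      \<and> vdrop N z \<in> A \<and> (\<forall>i<k. coord z (N + i) = coord z (\<sigma> i)))" (is "?l \<longleftrightarrow> ?r")
  proof
    assume ?l
    then show ?r using x assms(2)
      by (intro bexI[of _ "vjoin N x (select k (\<lambda>i. coord x (\<sigma> i)))"]) auto
  next
    assume ?r
    then obtain z where z: "z \<in> Rn (N + k)" "vtrunc N z = x" "vdrop N z \<in> A"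
      "\<forall>i<k. coord z (N + i) = coord z (\<sigma> i)" by blast
    have "select k (\<lambda>i. coord x (\<sigma> i)) = vdrop N z"
      using z(1,2,4) assms(2) by (intro evec_eqI) (auto simp: Rn_iff)
    then show ?l using z(3) by simp
  qed
qed

lemma Def_graph:
  assumes f: "dterm M f" and "M \<le> N" "j < N"
  shows "Def N (\<lambda>z. coord z j = f (vtrunc M z))"
proof -
  let ?A = "{z \<in> Rn (Suc M). coord z M = f (vtrunc M z)}"
  \<comment> \<open>The value to be compared may be any coordinate j; the selection moves it to
    position M, where the definition of \<open>dterm\<close> expects it.\<close>
  have "Def N (\<lambda>z. select (Suc M) (\<lambda>i. coord z (if i < M then i else j)) \<in> ?A)"
    using f assms(2,3) by (intro Def_select) (auto simp: dterm_def Def_def)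
  then show ?thesis
  proof (rule Def_cong)
    fix z
    have "vtrunc M (select (Suc M) (\<lambda>i. coord z (if i < M then i else j))) = vtrunc M z"
      by (intro evec_eqI) auto
    then show "select (Suc M) (\<lambda>i. coord z (if i < M then i else j)) \<in> ?A \<longleftrightarrow> coord z j = f (vtrunc M z)"
      by simp
  qed
qed

lemma dterm_weaken: "dterm M f \<Longrightarrow> M \<le> N \<Longrightarrow> dterm N (\<lambda>z. f (vtrunc M z))"
  unfolding dterm_def[of N] using Def_graph[of M f "Suc N" N] by (auto simp: vtrunc_vtrunc)

lemma Def_subst:
  assumes "A \<in> D k" "\<And>i. i < k \<Longrightarrow> dterm N (f i)"
  shows "Def N (\<lambda>x. select k (\<lambda>i. f i x) \<in> A)"
proof (rule Def_project)
  show "Def (N + k) (\<lambda>z. vdrop N z \<in> A \<and> (\<forall>i<k. coord z (N + i) = f i (vtrunc N z)))"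
    using assms by (intro Def_conj Def_vdrop_mem Def_all_less Def_graph) auto
  fix x assume x: "x \<in> Rn N"
  show "select k (\<lambda>i. f i x) \<in> A \<longleftrightarrow> (\<exists>z\<in>Rn (N + k). vtrunc N z = x
      \<and> vdrop N z \<in> A \<and> (\<forall>i<k. coord z (N + i) = f i (vtrunc N z)))" (is "?l \<longleftrightarrow> ?r")
  proof
    assume ?l
    then show ?r using x
      by (intro bexI[of _ "vjoin N x (select k (\<lambda>i. f i x))"]) auto
  next
    assume ?r
    then obtain z where z: "z \<in> Rn (N + k)" "vtrunc N z = x" "vdrop N z \<in> A"
      "\<forall>i<k. coord z (N + i) = f i (vtrunc N z)" by blast
    have "select k (\<lambda>i. f i x) = vdrop N z"
      using z(1,2,4) by (intro evec_eqI) (auto simp: Rn_iff)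
    then show ?l using z(3) by simp
  qed
qed

section \<open>Arithmetic of definable terms\<close>

lemma dterm_coord_self: "i < N \<Longrightarrow> dterm N (\<lambda>x. coord x i)"
  unfolding dterm_def
  using diagonal[of N "Suc N" i] by (simp add: Def_def)

lemma dterm_const: "dterm N (\<lambda>x. c)"
proof -
  \<comment> \<open>A point is a degenerate interval, so the o-minimality axiom makes every real
    constant definable.\<close>
  have "{c} = \<Union>{{c}}" "is_interval {c}" using is_interval_cc[of c c] by auto
  then have "{x \<in> Rn 1. coord x 0 \<in> {c}} \<in> D 1"
    using o_minimal[of "{c}"] by (metis finite.emptyI finite.insertI singletonD)
  then have "Def (Suc N) (\<lambda>z. select 1 (\<lambda>i. coord z N) \<in> {x \<in> Rn 1. coord x 0 \<in> {c}})"
    by (intro Def_select) auto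
  then show ?thesis unfolding dterm_def by (rule Def_cong) auto
qed

lemma dterm_add:
  assumes "dterm N f" "dterm N g"
  shows "dterm N (\<lambda>x. f x + g x)"
proof -
  \<comment> \<open>The addition axiom is about three coordinates: here the two summands and
    coordinate N, which holds the value of the term.\<close>
  define h where "h i z = (if i = 0 then f (vtrunc N z) else if i = (1::nat) then g (vtrunc N z) else coord z N)" for i z
  have "dterm (Suc N) (h i)" for i
    using assms by (cases "i = 0"; cases "i = 1") (auto simp: h_def[abs_def] intro: dterm_weaken dterm_coord_self)
  then have "Def (Suc N) (\<lambda>z. select 3 (\<lambda>i. h i z) \<in> {x \<in> Rn 3. coord x 0 + coord x 1 = coord x 2})"
    by (intro Def_subst addition)
  then show ?thesis unfolding dterm_def by (rule Def_cong) (auto simp: h_def)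
qed

lemma dterm_mult:
  assumes "dterm N f" "dterm N g"
  shows "dterm N (\<lambda>x. f x * g x)"
proof -
  define h where "h i z = (if i = 0 then f (vtrunc N z) else if i = (1::nat) then g (vtrunc N z) else coord z N)" for i z
  have "dterm (Suc N) (h i)" for i
    using assms by (cases "i = 0"; cases "i = 1") (auto simp: h_def[abs_def] intro: dterm_weaken dterm_coord_self)
  then have "Def (Suc N) (\<lambda>z. select 3 (\<lambda>i. h i z) \<in> {x \<in> Rn 3. coord x 0 * coord x 1 = coord x 2})"
    by (intro Def_subst multiplication)
  then show ?thesis unfolding dterm_def by (rule Def_cong) (auto simp: h_def)
qed

lemma dterm_diff: "dterm N f \<Longrightarrow> dterm N g \<Longrightarrow> dterm N (\<lambda>x. f x - g x)"
proof -
  assume "dterm N f" "dterm N g"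
  then have "dterm N (\<lambda>x. f x + - 1 * g x)" by (intro dterm_add dterm_mult dterm_const)
  then show ?thesis by simp
qed

lemma dterm_sum: "(\<And>i. i < (k::nat) \<Longrightarrow> dterm N (f i)) \<Longrightarrow> dterm N (\<lambda>x. \<Sum>i<k. f i x)"
  by (induction k) (auto intro: dterm_const dterm_add)

lemma Def_less:
  assumes "dterm N f" "dterm N g"
  shows "Def N (\<lambda>x. f x < g x)"
proof -
  define h where "h i x = (if i = (0::nat) then f x else g x)" for i x
  have "dterm N (h i)" for i using assms by (cases "i = 0") (auto simp: h_def[abs_def])
  then have "Def N (\<lambda>x. select 2 (\<lambda>i. h i x) \<in> {x \<in> Rn 2. coord x 0 < coord x 1})"
    by (intro Def_subst order)
  then show ?thesis by (rule Def_cong) (auto simp: h_def)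
qed

lemma Def_le: "dterm N f \<Longrightarrow> dterm N g \<Longrightarrow> Def N (\<lambda>x. f x \<le> g x)"
  unfolding not_less[symmetric] by (intro Def_not Def_less)

lemma Def_eq: "dterm N f \<Longrightarrow> dterm N g \<Longrightarrow> Def N (\<lambda>x. f x = g x)"
  unfolding order_eq_iff by (intro Def_conj Def_le)

lemma Def_ex_real:
  assumes "Def (Suc N) (\<lambda>z. P (vtrunc N z) (coord z N))"
  shows "Def N (\<lambda>x. \<exists>t. P x t)"
proof (rule Def_project[of N 1])
  show "Def (N + 1) (\<lambda>z. P (vtrunc N z) (coord z N))" using assms by simp
  fix x assume x: "x \<in> Rn N"
  show "(\<exists>t. P x t) \<longleftrightarrow> (\<exists>z\<in>Rn (N + 1). vtrunc N z = x \<and> P (vtrunc N z) (coord z N))"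
  proof
    assume "\<exists>t. P x t"
    then obtain t where "P x t" by blast
    then show "\<exists>z\<in>Rn (N + 1). vtrunc N z = x \<and> P (vtrunc N z) (coord z N)"
      using x by (intro bexI[of _ "vsnoc N x t"]) auto
  qed auto
qed

lemma Def_all_real:
  assumes "Def (Suc N) (\<lambda>z. P (vtrunc N z) (coord z N))"
  shows "Def N (\<lambda>x. \<forall>t. P x t)"
proof -
  have "Def N (\<lambda>x. \<not> (\<exists>t. \<not> P x t))" by (intro Def_not Def_ex_real assms)
  then show ?thesis by simp
qed

lemma Def_bex:
  assumes "A \<in> D k" "Def (N + k) (\<lambda>z. P (vtrunc N z) (vdrop N z))"
  shows "Def N (\<lambda>x. \<exists>y\<in>A. P x y)"
proof (rule Def_project)
  show "Def (N + k) (\<lambda>z. vdrop N z \<in> A \<and> P (vtrunc N z) (vdrop N z))"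
    by (intro Def_conj assms Def_vdrop_mem)
  fix x assume x: "x \<in> Rn N"
  show "(\<exists>y\<in>A. P x y) \<longleftrightarrow> (\<exists>z\<in>Rn (N + k). vtrunc N z = x \<and> vdrop N z \<in> A \<and> P (vtrunc N z) (vdrop N z))"
  proof
    assume "\<exists>y\<in>A. P x y"
    then obtain y where y: "y \<in> A" "P x y" by blast
    have "y \<in> Rn k" using y(1) D_subset_Rn[OF assms(1)] by blast
    then show "\<exists>z\<in>Rn (N + k). vtrunc N z = x \<and> vdrop N z \<in> A \<and> P (vtrunc N z) (vdrop N z)"
      using x y by (intro bexI[of _ "vjoin N x y"]) auto
  qed auto
qed

lemma Def_ball:
  assumes "A \<in> D k" "Def (N + k) (\<lambda>z. P (vtrunc N z) (vdrop N z))"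
  shows "Def N (\<lambda>x. \<forall>y\<in>A. P x y)"
proof -
  have "Def N (\<lambda>x. \<not> (\<exists>y\<in>A. \<not> P x y))" by (intro Def_not Def_bex[OF assms(1)] assms(2))
  then show ?thesis by simp
qed

lemma dvec_add: "dvec N k F \<Longrightarrow> dvec N k G \<Longrightarrow> dvec N k (\<lambda>x. F x + G x)"
  by (auto simp: dvec_def intro: dterm_add)

lemma dvec_diff: "dvec N k F \<Longrightarrow> dvec N k G \<Longrightarrow> dvec N k (\<lambda>x. F x - G x)"
  by (auto simp: dvec_def intro: dterm_diff)

lemma dvec_scaleR: "dterm N f \<Longrightarrow> dvec N k G \<Longrightarrow> dvec N k (\<lambda>x. f x *\<^sub>R G x)"
  by (auto simp: dvec_def intro: dterm_mult)

lemma dvec_const: "c \<in> Rn k \<Longrightarrow> dvec N k (\<lambda>x. c)"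
  by (auto simp: dvec_def intro: dterm_const)

lemma dvec_vjoin:
  assumes "dvec N m F" "dvec N k G"
  shows "dvec N (m + k) (\<lambda>x. vjoin m (F x) (G x))"
  unfolding dvec_def
proof (intro conjI ballI allI impI)
  fix i assume i: "i < m + k"
  show "dterm N (\<lambda>x. coord (vjoin m (F x) (G x)) i)"
    using assms i by (cases "i < m") (auto simp: dvec_def)
qed (use assms in \<open>auto simp: dvec_def\<close>)

lemma dterm_coord_vec: "dvec N k F \<Longrightarrow> i < k \<Longrightarrow> dterm N (\<lambda>x. coord (F x) i)"
  by (simp add: dvec_def)

lemma dterm_norm:
  assumes "dvec N k F"
  shows "dterm N (\<lambda>x. norm (F x))"
  unfolding dterm_def
proof (rule Def_cong)
  have "dterm (Suc N) (\<lambda>z. coord (F (vtrunc N z)) i)" if "i < k" for i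
    using assms that by (intro dterm_weaken[where f = "\<lambda>x. coord (F x) i"] dterm_coord_vec) auto
  then show "Def (Suc N) (\<lambda>z. 0 \<le> coord z N \<and> coord z N * coord z N
      = (\<Sum>i<k. coord (F (vtrunc N z)) i * coord (F (vtrunc N z)) i))"
    by (intro Def_conj Def_le Def_eq dterm_const dterm_mult dterm_sum dterm_coord_self) auto
  fix z :: evec
  have "F (vtrunc N z) \<in> Rn k" using assms by (simp add: dvec_def)
  then have "(\<Sum>i<k. coord (F (vtrunc N z)) i * coord (F (vtrunc N z)) i) = (norm (F (vtrunc N z)))\<^sup>2"
    by (simp add: inner_Rn[symmetric] power2_norm_eq_inner)
  then show "(0 \<le> coord z N \<and> coord z N * coord z N
      = (\<Sum>i<k. coord (F (vtrunc N z)) i * coord (F (vtrunc N z)) i)) \<longleftrightarrow> coord z N = norm (F (vtrunc N z))"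
    by (simp add: power2_eq_square[symmetric]) (metis norm_ge_zero power2_eq_imp_eq)
qed

lemma Def_mem:
  assumes "A \<in> D k" "dvec N k F"
  shows "Def N (\<lambda>x. F x \<in> A)"
proof (rule Def_cong)
  show "Def N (\<lambda>x. select k (\<lambda>i. coord (F x) i) \<in> A)"
    using assms by (intro Def_subst) (auto simp: dvec_def)
  fix x assume "x \<in> Rn N"
  then have "F x \<in> Rn k" using assms(2) by (simp add: dvec_def)
  then have "select k (coord (F x)) = F x" by (intro evec_eqI) (auto simp: Rn_iff)
  then show "select k (\<lambda>i. coord (F x) i) \<in> A \<longleftrightarrow> F x \<in> A" by simp
qed

text \<open>Substitutes terms into a relation whose definability has been shown for plain variables,
  such as membership in the tangent bundle.\<close>

lemma Def_rel:
  assumes "Def (n + k) (\<lambda>z. R (vtrunc n z) (vdrop n z))" "dvec N n F" "dvec N k G"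
  shows "Def N (\<lambda>x. R (F x) (G x))"
proof (rule Def_cong)
  show "Def N (\<lambda>x. vjoin n (F x) (G x) \<in> {z \<in> Rn (n + k). R (vtrunc n z) (vdrop n z)})"
    using assms(1) unfolding Def_def[of "n + k"] by (rule Def_mem) (rule dvec_vjoin[OF assms(2,3)])
  fix x assume "x \<in> Rn N"
  then have "F x \<in> Rn n" "G x \<in> Rn k" using assms(2,3) by (auto simp: dvec_def)
  then show "vjoin n (F x) (G x) \<in> {z \<in> Rn (n + k). R (vtrunc n z) (vdrop n z)} \<longleftrightarrow> R (F x) (G x)"
    by simp
qed

lemmas Def_intros = Def_conj Def_disj Def_imp Def_not Def_less Def_le Def_eq Def_ex_real Def_all_real
  dterm_add dterm_diff dterm_mult dterm_const dvec_add dvec_diff dvec_scaleR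

section \<open>Definability of the tangent bundle and of the Whitney condition\<close>

lemma Def_tangent_bundle:
  assumes M: "submanifold q n d M" and q: "q \<noteq> C_fin 0" and MD: "M \<in> D n"
    and F: "dvec N n F" and G: "dvec N n G"
  shows "Def N (\<lambda>x. in_tangent_bundle M (F x) (G x))"
proof (rule Def_rel[OF _ F G])
  show "Def (n + n) (\<lambda>z. in_tangent_bundle M (vtrunc n z) (vdrop n z))"
  proof (rule Def_cong)
    show "Def (n + n) (\<lambda>z. vtrunc n z \<in> M \<and> (\<forall>e. 0 < e \<longrightarrow> (\<exists>\<delta>. 0 < \<delta> \<and> (\<forall>t. 0 < t \<longrightarrow> t < \<delta> \<longrightarrow>
        (\<exists>y\<in>M. norm (y - vtrunc n z - t *\<^sub>R vdrop n z) \<le> e * t)))))"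
      by (intro Def_intros Def_mem[OF MD] Def_bex[OF MD] dterm_norm[where k = n])
         (auto simp: dvec_def Rn_iff intro!: dterm_coord_self)
    fix z assume "z \<in> Rn (n + n)"
    then have "vdrop n z \<in> Rn n" by auto
    then show "(vtrunc n z \<in> M \<and> (\<forall>e. 0 < e \<longrightarrow> (\<exists>\<delta>. 0 < \<delta> \<and> (\<forall>t. 0 < t \<longrightarrow> t < \<delta> \<longrightarrow>
        (\<exists>y\<in>M. norm (y - vtrunc n z - t *\<^sub>R vdrop n z) \<le> e * t)))))
        \<longleftrightarrow> in_tangent_bundle M (vtrunc n z) (vdrop n z)"
      unfolding in_tangent_bundle_def using submanifold_tangent_space_iff[OF M q, of "vtrunc n z" "vdrop n z"] by blast
  qed
qed

lemma Def_whitney_eps: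
  assumes M: "submanifold q n d M" and q: "q \<noteq> C_fin 0" and MD: "M \<in> D n" and ND: "N \<in> D n"
  shows "Def n (\<lambda>a. whitney_eps M N a)"
proof (rule Def_cong)
  have MR: "M \<subseteq> Rn n" using M by (simp add: submanifold_def)
  show "Def n (\<lambda>a. \<forall>e. 0 < e \<longrightarrow> (\<exists>\<delta>. 0 < \<delta> \<and> (\<forall>x\<in>N. \<forall>y\<in>M. norm (a - x) < \<delta> \<longrightarrow> norm (a - y) < \<delta> \<longrightarrow>
      (\<exists>w\<in>Rn n. in_tangent_bundle M y w \<and> norm (x - y - w) \<le> e * norm (x - y)))))"
    by (intro Def_intros Def_ball[OF ND] Def_ball[OF MD] Def_bex[OF Rn_in_D]
        Def_tangent_bundle[OF M q MD] dterm_norm[where k = n])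
       (auto simp: dvec_def Rn_iff intro!: dterm_coord_self)
  fix a
  show "(\<forall>e. 0 < e \<longrightarrow> (\<exists>\<delta>. 0 < \<delta> \<and> (\<forall>x\<in>N. \<forall>y\<in>M. norm (a - x) < \<delta> \<longrightarrow> norm (a - y) < \<delta> \<longrightarrow>
      (\<exists>w\<in>Rn n. in_tangent_bundle M y w \<and> norm (x - y - w) \<le> e * norm (x - y))))) \<longleftrightarrow> whitney_eps M N a"
    unfolding whitney_eps_def dist_norm by (simp add: in_tangent_bundle_bex[OF MR] cong: ball_cong)
qed

lemma definable_condition_whitney_B:
  assumes q: "q \<noteq> C_fin 0"
  shows "definable_condition D q whitney_B"
  unfolding definable_condition_def
proof (intro allI impI, elim conjE)
  fix n \<Lambda> \<Gamma> assume adj: "adjacent q n \<Lambda> \<Gamma>" and DD: "\<Lambda> \<in> D n" "\<Gamma> \<in> D n"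
  obtain d where \<Lambda>: "submanifold q n d \<Lambda>" using adj by (auto simp: adjacent_def is_submanifold_def)
  have R: "\<Lambda> \<subseteq> Rn n" "\<Gamma> \<subseteq> Rn n" using D_subset_Rn DD by auto
  have "Def n (\<lambda>x. x \<in> \<Gamma> \<and> whitney_eps \<Lambda> \<Gamma> x)"
    by (intro Def_conj D_imp_Def DD Def_whitney_eps[OF \<Lambda> q])
  moreover have "{x \<in> Rn n. x \<in> \<Gamma> \<and> whitney_eps \<Lambda> \<Gamma> x} = {x \<in> \<Gamma>. whitney_B n \<Lambda> \<Gamma> x}"
    using R whitney_B_iff_whitney_eps[OF submanifold_tangent_space[OF \<Lambda> q] R] by auto
  ultimately show "{x \<in> \<Gamma>. whitney_B n \<Lambda> \<Gamma> x} \<in> D n" by (simp add: Def_def)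
qed

end

section \<open>Cells\<close>

lemma rgraph_on_iff:
  assumes "C \<subseteq> Rn n" "z \<in> Rn (Suc n)"
  shows "z \<in> rgraph_on n f C \<longleftrightarrow> vtrunc n z \<in> C \<and> coord z n = f (vtrunc n z)"
proof
  assume "z \<in> rgraph_on n f C"
  then obtain x where "x \<in> C" "z = vsnoc n x (f x)" by (auto simp: rgraph_on_def)
  then show "vtrunc n z \<in> C \<and> coord z n = f (vtrunc n z)" using assms(1) by auto
next
  assume z: "vtrunc n z \<in> C \<and> coord z n = f (vtrunc n z)"
  then have "z = vsnoc n (vtrunc n z) (f (vtrunc n z))" using vsnoc_vtrunc[OF assms(2)] by simp
  then show "z \<in> rgraph_on n f C" unfolding rgraph_on_def using z by (intro image_eqI) auto
qed

lemma rgraph_on_subset_Rn: "rgraph_on n f C \<subseteq> Rn (Suc n)"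
  by (auto simp: rgraph_on_def)

lemma vtrunc_rgraph_on: "C \<subseteq> Rn n \<Longrightarrow> vtrunc n ` rgraph_on n f C = C"
  by (force simp: rgraph_on_def image_image)

lemma sC1_vsnoc:
  assumes "sC1 S P" "sC1 S t"
  shows "sC1 S (\<lambda>x. vsnoc n (P x) (t x))"
  unfolding vsnoc_eq
  by (rule sC1_add[OF sC1_linear_image[OF bounded_linear_vtrunc assms(1)]
        sC1_linear_image[OF bounded_linear_scaleR_left assms(2)]])

context o_minimal_structure
begin

lemma dvec_vsnoc:
  assumes "n < N" "j < N"
  shows "dvec N (Suc n) (\<lambda>z. vsnoc n (vtrunc n z) (coord z j))"
  unfolding dvec_def
proof (intro conjI ballI allI impI)
  fix i assume "i < Suc n"
  then show "dterm N (\<lambda>x. coord (vsnoc n (vtrunc n x) (coord x j)) i)"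
    using assms by (cases "i = n") (auto intro: dterm_coord_self)
qed auto

text \<open>The graph of f is given only over C, so f is not treated as a term; its value is
  quantified over as the last coordinate of a point of the graph.\<close>

lemma Def_rgraph:
  assumes f: "rgraph_on n f C \<in> D (Suc n)" and C: "C \<subseteq> Rn n"
    and P: "Def (Suc (Suc n)) (\<lambda>z. P (vtrunc (Suc n) z) (coord z (Suc n)))"
  shows "Def (Suc n) (\<lambda>z. vtrunc n z \<in> C \<and> P z (f (vtrunc n z)))"
proof (rule Def_cong)
  show "Def (Suc n) (\<lambda>z. \<exists>s. vsnoc n (vtrunc n z) s \<in> rgraph_on n f C \<and> P z s)"
  proof (intro Def_ex_real Def_conj P)
    have "Def (Suc (Suc n)) (\<lambda>z. vsnoc n (vtrunc n z) (coord z (Suc n)) \<in> rgraph_on n f C)"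
      by (rule Def_mem[OF f dvec_vsnoc]) auto
    then show "Def (Suc (Suc n)) (\<lambda>z. vsnoc n (vtrunc n (vtrunc (Suc n) z)) (coord z (Suc n)) \<in> rgraph_on n f C)"
      by (simp add: vtrunc_vtrunc)
  qed
  fix z
  show "(\<exists>s. vsnoc n (vtrunc n z) s \<in> rgraph_on n f C \<and> P z s) \<longleftrightarrow> vtrunc n z \<in> C \<and> P z (f (vtrunc n z))"
    using rgraph_on_iff[OF C, of "vsnoc n (vtrunc n z) _" f] by (auto simp: vtrunc_vtrunc)
qed

lemma D_of_Def_rgraph:
  assumes "Def (Suc n) (\<lambda>z. vtrunc n z \<in> C \<and> coord z n = m (vtrunc n z))" "C \<subseteq> Rn n"
  shows "rgraph_on n m C \<in> D (Suc n)"
proof -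
  have "rgraph_on n m C = {z \<in> Rn (Suc n). vtrunc n z \<in> C \<and> coord z n = m (vtrunc n z)}"
    using rgraph_on_iff[OF assms(2)] rgraph_on_subset_Rn by blast
  then show ?thesis using assms(1) by (simp add: Def_def)
qed

lemma rgraph_shift:
  assumes "rgraph_on n f C \<in> D (Suc n)" "C \<subseteq> Rn n"
  shows "rgraph_on n (\<lambda>x. f x + c) C \<in> D (Suc n)"
proof (rule D_of_Def_rgraph[OF _ assms(2)], rule Def_rgraph[OF assms])
  show "Def (Suc (Suc n)) (\<lambda>z. coord (vtrunc (Suc n) z) n = coord z (Suc n) + c)"
    by (intro Def_eq dterm_add dterm_const) (auto intro: dterm_coord_self)
qed

lemma rgraph_mean:
  assumes f: "rgraph_on n f C \<in> D (Suc n)" and g: "rgraph_on n g C \<in> D (Suc n)" and C: "C \<subseteq> Rn n"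
  shows "rgraph_on n (\<lambda>x. (f x + g x) / 2) C \<in> D (Suc n)"
proof (rule D_of_Def_rgraph[OF _ C], rule Def_cong)
  \<comment> \<open>The equation of the mean is solved for g, so that each of the two functions
    enters through its own graph.\<close>
  show "Def (Suc n) (\<lambda>z. vtrunc n z \<in> C \<and> (vtrunc n z \<in> C \<and> coord z n * 2 - f (vtrunc n z) = g (vtrunc n z)))"
  proof (rule Def_rgraph[OF f C])
    let ?P = "\<lambda>z. (\<exists>s. vsnoc n (vtrunc n z) s \<in> rgraph_on n g C \<and> coord z n * 2 - coord z (Suc n) = s)"
    have "Def (Suc (Suc n)) ?P"
    proof (intro Def_ex_real Def_conj)
      have "Def (Suc (Suc (Suc n))) (\<lambda>z. vsnoc n (vtrunc n z) (coord z (Suc (Suc n))) \<in> rgraph_on n g C)"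
        by (rule Def_mem[OF g dvec_vsnoc]) auto
      then show "Def (Suc (Suc (Suc n))) (\<lambda>z. vsnoc n (vtrunc n (vtrunc (Suc (Suc n)) z)) (coord z (Suc (Suc n))) \<in> rgraph_on n g C)"
        by (simp add: vtrunc_vtrunc)
      show "Def (Suc (Suc (Suc n))) (\<lambda>z. coord (vtrunc (Suc (Suc n)) z) n * 2
          - coord (vtrunc (Suc (Suc n)) z) (Suc n) = coord z (Suc (Suc n)))"
        by (intro Def_eq dterm_diff dterm_mult dterm_const) (auto intro: dterm_coord_self)
    qed
    then show "Def (Suc (Suc n)) (\<lambda>z. vtrunc n (vtrunc (Suc n) z) \<in> C
        \<and> coord (vtrunc (Suc n) z) n * 2 - coord z (Suc n) = g (vtrunc n (vtrunc (Suc n) z)))"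
    proof (rule Def_cong)
      fix z
      show "?P z \<longleftrightarrow> vtrunc n (vtrunc (Suc n) z) \<in> C
        \<and> coord (vtrunc (Suc n) z) n * 2 - coord z (Suc n) = g (vtrunc n (vtrunc (Suc n) z))"
        using rgraph_on_iff[OF C, of "vsnoc n (vtrunc n z) _" g] by (auto simp: vtrunc_vtrunc)
    qed
  qed
qed (auto simp: field_simps)

lemma rgraph_const:
  assumes "C \<in> D n"
  shows "rgraph_on n (\<lambda>x. c) C \<in> D (Suc n)"
proof (rule D_of_Def_rgraph)
  show "Def (Suc n) (\<lambda>z. vtrunc n z \<in> C \<and> coord z n = c)"
    by (intro Def_conj Def_eq dterm_const Def_mem[OF assms])
       (auto simp: dvec_def intro: dterm_coord_self)
qed (use D_subset_Rn assms in blast)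

section \<open>Definable sections of cells\<close>

lemma cell_bound_cases:
  assumes "cell_bound D q n C c h" "q \<noteq> C_fin 0" "C \<subseteq> Rn n"
  obtains (fin) f where "sC1 C f" "rgraph_on n f C \<in> D (Suc n)" "\<And>x. x \<in> C \<Longrightarrow> h x = ereal (f x)"
    | (inf) "\<And>x. x \<in> C \<Longrightarrow> h x = c"
  using assms Cq_on_real_imp_sC1[of q n C] unfolding cell_bound_def by blast

lemma band_eq:
  assumes "C \<subseteq> Rn n"
  shows "{vsnoc n x t | x t. x \<in> C \<and> g x < ereal t \<and> ereal t < h x}
    = {z \<in> Rn (Suc n). vtrunc n z \<in> C \<and> g (vtrunc n z) < ereal (coord z n) \<and> ereal (coord z n) < h (vtrunc n z)}"
proof (intro equalityI subsetI)
  fix z assume "z \<in> {z \<in> Rn (Suc n). vtrunc n z \<in> C \<and> g (vtrunc n z) < ereal (coord z n) \<and> ereal (coord z n) < h (vtrunc n z)}"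
  then show "z \<in> {vsnoc n x t | x t. x \<in> C \<and> g x < ereal t \<and> ereal t < h x}"
    using vsnoc_vtrunc[of z n] by (intro CollectI exI[of _ "vtrunc n z"] exI[of _ "coord z n"]) auto
qed (use assms in auto)

lemma cell_in_D:
  assumes "Cq_cell D q n C" "q \<noteq> C_fin 0"
  shows "C \<in> D n"
  using assms
proof (induction rule: Cq_cell.induct)
  case point
  show ?case by (rule Rn_in_D)
next
  case (band n C g h)
  have C: "C \<in> D n" "C \<subseteq> Rn n" using band D_subset_Rn by blast+
  have memC: "Def (Suc n) (\<lambda>z. vtrunc n z \<in> C)"
    by (rule Def_mem[OF C(1)]) (auto simp: dvec_def intro: dterm_coord_self)
  have lo: "Def (Suc n) (\<lambda>z. vtrunc n z \<in> C \<and> g (vtrunc n z) < ereal (coord z n))"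
    using band.hyps(2) band.prems C(2)
  proof (cases rule: cell_bound_cases)
    case (fin f)
    have "Def (Suc n) (\<lambda>z. vtrunc n z \<in> C \<and> f (vtrunc n z) < coord z n)"
      by (rule Def_rgraph[OF fin(2) C(2)]) (intro Def_less; auto intro: dterm_coord_self)
    then show ?thesis by (rule Def_cong) (use fin(3) in auto)
  next
    case inf
    show ?thesis by (rule Def_cong[OF memC]) (use inf in auto)
  qed
  have hi: "Def (Suc n) (\<lambda>z. vtrunc n z \<in> C \<and> ereal (coord z n) < h (vtrunc n z))"
    using band.hyps(3) band.prems C(2)
  proof (cases rule: cell_bound_cases)
    case (fin f)
    have "Def (Suc n) (\<lambda>z. vtrunc n z \<in> C \<and> coord z n < f (vtrunc n z))"
      by (rule Def_rgraph[OF fin(2) C(2)]) (intro Def_less; auto intro: dterm_coord_self)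
    then show ?thesis by (rule Def_cong) (use fin(3) in auto)
  next
    case inf
    show ?thesis by (rule Def_cong[OF memC]) (use inf in auto)
  qed
  have "Def (Suc n) (\<lambda>z. vtrunc n z \<in> C \<and> g (vtrunc n z) < ereal (coord z n) \<and> ereal (coord z n) < h (vtrunc n z))"
    by (rule Def_cong[OF Def_conj[OF lo hi]]) blast
  then show ?case unfolding band_eq[OF C(2)] by (simp add: Def_def)
qed

text \<open>Definable choice in one coordinate: on a graph there is no choice; in a band take the
  midpoint, a finite bound shifted by 1 to the inside, or 0, according to which bounds are
  finite.\<close>

lemma cell_section:
  assumes E: "Cq_cell D q (Suc n) E" and q: "q \<noteq> C_fin 0"
  obtains C m where "Cq_cell D q n C" "C \<subseteq> Rn n" "vtrunc n ` E = C" "sC1 C m" "rgraph_on n m C \<in> D (Suc n)"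
    "rgraph_on n m C \<subseteq> E"
  using E
proof (cases rule: Cq_cell.cases)
  case (graph C f)
  have C: "C \<subseteq> Rn n" using cell_in_D[OF graph(2) q] D_subset_Rn by blast
  show ?thesis
    by (rule that[of C f]) (use graph C vtrunc_rgraph_on Cq_on_real_imp_sC1[OF graph(3) q C] in auto)
next
  case (band C g h)
  have CD: "C \<in> D n" using cell_in_D[OF band(2) q] .
  have C: "C \<subseteq> Rn n" using CD D_subset_Rn by blast
  have "\<exists>m. sC1 C m \<and> rgraph_on n m C \<in> D (Suc n) \<and> (\<forall>x\<in>C. g x < ereal (m x) \<and> ereal (m x) < h x)"
    using band(3) q C
  proof (cases rule: cell_bound_cases)
    case (fin f)
    note f = fin
    show ?thesis
      using band(4) q C
    proof (cases rule: cell_bound_cases)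
      case (fin f')
      have lt: "f x < f' x" if "x \<in> C" for x using band(5) f(3) fin(3) that by fastforce
      have "sC1 C (\<lambda>x. (f x + f' x) / 2)"
        by (rule sC1_linear_image[OF bounded_linear_divide sC1_add[OF f(1) fin(1)]])
      then show ?thesis
        using rgraph_mean[OF f(2) fin(2) C] f(3) fin(3) lt
        by (intro exI[of _ "\<lambda>x. (f x + f' x) / 2"]) (auto simp: field_simps)
    next
      case inf
      then show ?thesis
        using rgraph_shift[OF f(2) C, of 1] f sC1_add[OF f(1) sC1_const[of C "1::real"]]
        by (intro exI[of _ "\<lambda>x. f x + 1"]) auto
    qed
  next
    case inf
    note g = inf
    show ?thesis
      using band(4) q C
    proof (cases rule: cell_bound_cases)
      case (fin f)
      then show ?thesis
        using rgraph_shift[OF fin(2) C, of "-1"] g sC1_add[OF fin(1) sC1_const[of C "-1::real"]]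
        by (intro exI[of _ "\<lambda>x. f x + - 1"]) auto
    next
      case inf
      then show ?thesis
        using rgraph_const[OF CD, of 0] g sC1_const[of C "0::real"] by (intro exI[of _ "\<lambda>x. 0"]) auto
    qed
  qed
  then obtain m where m: "sC1 C m" "rgraph_on n m C \<in> D (Suc n)" "\<And>x. x \<in> C \<Longrightarrow> g x < ereal (m x) \<and> ereal (m x) < h x"
    by blast
  have sub: "rgraph_on n m C \<subseteq> E" unfolding band(1) rgraph_on_def using m(3) by blast
  have "vtrunc n ` E = C"
  proof
    show "vtrunc n ` E \<subseteq> C" unfolding band(1) using C by auto
    show "C \<subseteq> vtrunc n ` E" using vtrunc_rgraph_on[OF C, of m] sub by blast
  qed
  then show ?thesis using that[of C m] band(2) C m sub by blast
qed

text \<open>Definable choice in k coordinates, one at a time. Only the image \<Sigma> of the section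
  is recorded as definable; together with the projection it determines the section.\<close>

lemma cell_section_iterated:
  assumes "Cq_cell D q (p + k) E" "q \<noteq> C_fin 0"
  shows "\<exists>\<Sigma> s. \<Sigma> \<in> D (p + k) \<and> \<Sigma> \<subseteq> E \<and> sC1 (vtrunc p ` E) s \<and> s ` vtrunc p ` E = \<Sigma>
    \<and> (\<forall>z\<in>vtrunc p ` E. vtrunc p (s z) = z)"
  using assms(1)
proof (induction k arbitrary: E)
  case 0
  have E: "E \<in> D p" using cell_in_D[OF 0 assms(2)] by simp
  then have "E \<subseteq> Rn p" by (rule D_subset_Rn)
  then have "vtrunc p ` E = E" by (auto simp: image_def subset_iff)
  then show ?case using E \<open>E \<subseteq> Rn p\<close> sC1_bounded_linear[OF bounded_linear_ident, of E]
    by (intro exI[of _ E] exI[of _ "\<lambda>x. x"]) auto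
next
  case (Suc k)
  obtain C m where C: "Cq_cell D q (p + k) C" "C \<subseteq> Rn (p + k)" "vtrunc (p + k) ` E = C" "sC1 C m"
    "rgraph_on (p + k) m C \<in> D (Suc (p + k))" "rgraph_on (p + k) m C \<subseteq> E"
    using cell_section[of q "p + k" E] Suc.prems assms(2) by auto
  obtain \<Sigma> s where s0: "\<Sigma> \<in> D (p + k) \<and> \<Sigma> \<subseteq> C \<and> sC1 (vtrunc p ` C) s \<and> s ` vtrunc p ` C = \<Sigma>
    \<and> (\<forall>z\<in>vtrunc p ` C. vtrunc p (s z) = z)" using Suc.IH[OF C(1)] by (elim exE) (rule that)
  note s = s0[THEN conjunct1] s0[THEN conjunct2, THEN conjunct1]
    s0[THEN conjunct2, THEN conjunct2, THEN conjunct1]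
    s0[THEN conjunct2, THEN conjunct2, THEN conjunct2, THEN conjunct1]
    s0[THEN conjunct2, THEN conjunct2, THEN conjunct2, THEN conjunct2, THEN bspec]
  have im: "vtrunc p ` E = vtrunc p ` C"
    unfolding C(3)[symmetric] image_image by (simp add: vtrunc_vtrunc)
  define s' where "s' z = vsnoc (p + k) (s z) (m (s z))" for z
  have sC: "s z \<in> C" if "z \<in> vtrunc p ` C" for z using that s(2,4) by auto
  have \<Sigma>R: "\<Sigma> \<subseteq> Rn (p + k)" using s(2) C(2) by simp
  have "{z \<in> Rn (Suc (p + k)). vtrunc (p + k) z \<in> \<Sigma> \<and> z \<in> rgraph_on (p + k) m C} = rgraph_on (p + k) m \<Sigma>"
  proof (rule set_eqI)
    fix z
    show "z \<in> {z \<in> Rn (Suc (p + k)). vtrunc (p + k) z \<in> \<Sigma> \<and> z \<in> rgraph_on (p + k) m C}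
      \<longleftrightarrow> z \<in> rgraph_on (p + k) m \<Sigma>"
    proof (cases "z \<in> Rn (Suc (p + k))")
      case True
      then show ?thesis
        using rgraph_on_iff[OF C(2) True, of m] rgraph_on_iff[OF \<Sigma>R True, of m] s(2) by auto
    qed (use rgraph_on_subset_Rn[of "p + k" m \<Sigma>] in auto)
  qed
  moreover have "Def (Suc (p + k)) (\<lambda>z. vtrunc (p + k) z \<in> \<Sigma> \<and> z \<in> rgraph_on (p + k) m C)"
    by (intro Def_conj D_imp_Def C(5) Def_mem[OF s(1)]) (auto simp: dvec_def intro: dterm_coord_self)
  ultimately have "rgraph_on (p + k) m \<Sigma> \<in> D (p + Suc k)" by (simp add: Def_def)
  moreover have "rgraph_on (p + k) m \<Sigma> \<subseteq> E" using C(6) s(2) by (auto simp: rgraph_on_def)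
  moreover have "sC1 (vtrunc p ` E) s'"
    unfolding im s'_def
    by (rule sC1_vsnoc[OF s(3) sC1_compose[OF s(3) C(4)]]) (use sC in blast)
  moreover have "s' ` vtrunc p ` E = rgraph_on (p + k) m \<Sigma>"
    unfolding im rgraph_on_def s(4)[symmetric] s'_def image_image by (rule refl)
  moreover have "vtrunc p (s' z) = z" if "z \<in> vtrunc p ` E" for z
  proof -
    have "vtrunc p (s' z) = vtrunc p (vtrunc (p + k) (s' z))" by (simp add: vtrunc_vtrunc)
    also have "vtrunc (p + k) (s' z) = s z" unfolding s'_def using sC that C(2) im by (intro vtrunc_vsnoc) auto
    finally show ?thesis using s(5) that im by simp
  qed
  ultimately show ?case by blast
qed

section \<open>Parametrization of cells by open sets\<close>

lemma openin_less:
  fixes f g :: "'a::metric_space \<Rightarrow> real"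
  assumes "continuous_on V f" "continuous_on V g"
  shows "openin (top_of_set V) {x \<in> V. f x < g x}"
proof -
  have "openin (top_of_set V) (V \<inter> (\<lambda>x. g x - f x) -` {0<..})"
    by (rule continuous_openin_preimage_gen) (auto intro!: continuous_intros assms)
  moreover have "V \<inter> (\<lambda>x. g x - f x) -` {0<..} = {x \<in> V. f x < g x}" by auto
  ultimately show ?thesis by simp
qed

text \<open>A graph step keeps the parameters, while a band step adds the new coordinate as a
  further parameter. Thus \<sigma> lists the coordinates in which the cell is open, and reading them
  off inverts P.\<close>

lemma cell_parametrization:
  assumes "Cq_cell D q n C" "q \<noteq> C_fin 0"
  shows "\<exists>d U P \<sigma>. open_in_Rn d U \<and> P ` U = C \<and> sC1 U P \<and> (\<forall>i<d. \<sigma> i < n)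
    \<and> (\<forall>u\<in>U. select d (\<lambda>i. coord (P u) (\<sigma> i)) = u)"
  using assms
proof (induction rule: Cq_cell.induct)
  case point
  have "select 0 f = u" if "u \<in> Rn 0" for f u using that by (auto simp: Rn_0 intro!: evec_eqI)
  then show ?case
    using sC1_bounded_linear[OF bounded_linear_ident, of "Rn 0"]
    by (intro exI[of _ 0] exI[of _ "Rn 0"] exI[of _ "\<lambda>x. x"] exI[of _ id]) auto
next
  case (graph n C f)
  obtain d U P \<sigma> where IH: "open_in_Rn d U" "P ` U = C" "sC1 U P" "\<And>i. i < d \<Longrightarrow> \<sigma> i < n"
    "\<And>u. u \<in> U \<Longrightarrow> select d (\<lambda>i. coord (P u) (\<sigma> i)) = u" using graph.IH[OF graph.prems] by blast
  have C: "C \<subseteq> Rn n" using cell_in_D[OF graph.hyps(1) graph.prems] D_subset_Rn by blast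
  have f: "sC1 C f" using Cq_on_real_imp_sC1[OF graph.hyps(2) graph.prems C] .
  have "sC1 U (\<lambda>u. vsnoc n (P u) (f (P u)))"
    by (rule sC1_vsnoc[OF IH(3) sC1_compose[OF IH(3) f]]) (simp add: IH(2))
  moreover have "select d (\<lambda>i. coord (vsnoc n (P u) (f (P u))) (\<sigma> i)) = u" if "u \<in> U" for u
  proof -
    have "select d (\<lambda>i. coord (vsnoc n (P u) (f (P u))) (\<sigma> i)) = select d (\<lambda>i. coord (P u) (\<sigma> i))"
      using IH(4) by (intro evec_eqI) auto
    then show ?thesis using IH(5)[OF that] by simp
  qed
  moreover have "(\<lambda>u. vsnoc n (P u) (f (P u))) ` U = rgraph_on n f C"
    unfolding rgraph_on_def IH(2)[symmetric] image_image by (rule refl)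
  moreover have "\<forall>i<d. \<sigma> i < Suc n" using IH(4) less_SucI by blast
  ultimately show ?case using IH(1) by blast
next
  case (band n C g h)
  obtain d U P \<sigma> where IH: "open_in_Rn d U" "P ` U = C" "sC1 U P" "\<And>i. i < d \<Longrightarrow> \<sigma> i < n"
    "\<And>u. u \<in> U \<Longrightarrow> select d (\<lambda>i. coord (P u) (\<sigma> i)) = u" using band.IH[OF band.prems] by blast
  have C: "C \<subseteq> Rn n" using cell_in_D[OF band.hyps(1) band.prems] D_subset_Rn by blast
  have UR: "U \<subseteq> Rn d" using IH(1) openin_imp_subset by blast
  define V where "V = {w \<in> Rn (Suc d). vtrunc d w \<in> U}"
  have V: "open_in_Rn (Suc d) V"
  proof -
    have "openin (top_of_set (Rn (Suc d))) (Rn (Suc d) \<inter> vtrunc d -` U)"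
      by (rule continuous_openin_preimage[OF _ _ IH(1)]) (auto intro!: continuous_intros)
    moreover have "Rn (Suc d) \<inter> vtrunc d -` U = V" by (auto simp: V_def)
    ultimately show ?thesis by simp
  qed
  define P' where "P' w = vsnoc n (P (vtrunc d w)) (coord w d)" for w
  have sV: "sC1 V (vtrunc d)" "vtrunc d ` V \<subseteq> U"
    by (rule sC1_bounded_linear[OF bounded_linear_vtrunc]) (auto simp: V_def)
  have PV: "sC1 V (\<lambda>w. P (vtrunc d w))" by (rule sC1_compose[OF sV(1) IH(3) sV(2)])
  have P': "sC1 V P'"
    unfolding P'_def by (rule sC1_vsnoc[OF PV sC1_bounded_linear[OF bounded_linear_coord]])
  have cont: "continuous_on V (\<lambda>w. f (P (vtrunc d w)))" if "sC1 C f" for f :: "evec \<Rightarrow> real"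
    by (rule sC1_continuous_on[OF sC1_compose[OF PV that]]) (use sV(2) IH(2) in auto)
  have PC: "P (vtrunc d w) \<in> C" if "w \<in> V" for w using that IH(2) by (auto simp: V_def)
  have lo: "openin (top_of_set V) {w \<in> V. g (P (vtrunc d w)) < ereal (coord w d)}"
    using band.hyps(2) band.prems C
  proof (cases rule: cell_bound_cases)
    case (fin f)
    have "{w \<in> V. g (P (vtrunc d w)) < ereal (coord w d)} = {w \<in> V. f (P (vtrunc d w)) < coord w d}"
      using fin(3) PC by auto
    then show ?thesis using openin_less[OF cont[OF fin(1)], of "\<lambda>w. coord w d"]
      by (simp add: continuous_on_coord)
  next
    case inf
    then have "{w \<in> V. g (P (vtrunc d w)) < ereal (coord w d)} = V" using PC by auto
    then show ?thesis by simp
  qed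
  have hi: "openin (top_of_set V) {w \<in> V. ereal (coord w d) < h (P (vtrunc d w))}"
    using band.hyps(3) band.prems C
  proof (cases rule: cell_bound_cases)
    case (fin f)
    have "{w \<in> V. ereal (coord w d) < h (P (vtrunc d w))} = {w \<in> V. coord w d < f (P (vtrunc d w))}"
      using fin(3) PC by auto
    then show ?thesis using openin_less[OF _ cont[OF fin(1)], of "\<lambda>w. coord w d"]
      by (simp add: continuous_on_coord)
  next
    case inf
    then have "{w \<in> V. ereal (coord w d) < h (P (vtrunc d w))} = V" using PC by auto
    then show ?thesis by simp
  qed
  define U' where "U' = {w \<in> V. g (P (vtrunc d w)) < ereal (coord w d)} \<inter> {w \<in> V. ereal (coord w d) < h (P (vtrunc d w))}"
  have U': "open_in_Rn (Suc d) U'" unfolding U'_def by (rule openin_trans[OF openin_Int[OF lo hi] V])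
  have "P' ` U' = {vsnoc n x t | x t. x \<in> C \<and> g x < ereal t \<and> ereal t < h x}"
  proof (intro equalityI subsetI)
    fix z assume "z \<in> P' ` U'"
    then show "z \<in> {vsnoc n x t | x t. x \<in> C \<and> g x < ereal t \<and> ereal t < h x}"
      using PC unfolding U'_def P'_def by blast
  next
    fix z assume "z \<in> {vsnoc n x t | x t. x \<in> C \<and> g x < ereal t \<and> ereal t < h x}"
    then obtain x t where z: "z = vsnoc n x t" "x \<in> C" "g x < ereal t" "ereal t < h x" by blast
    obtain u where u: "u \<in> U" "x = P u" using z(2) IH(2) by blast
    have tr: "vtrunc d (vsnoc d u t) = u" "coord (vsnoc d u t) d = t" using u UR by auto
    then have "vsnoc d u t \<in> U'" using u z by (auto simp: U'_def V_def)
    moreover have "z = P' (vsnoc d u t)" unfolding P'_def tr using z(1) u(2) by simp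
    ultimately show "z \<in> P' ` U'" by blast
  qed
  moreover have "sC1 U' P'" by (rule sC1_subset[OF P']) (auto simp: U'_def)
  moreover have "\<forall>i<Suc d. (\<sigma>(d := n)) i < Suc n" using IH(4) less_SucI by (auto simp: less_Suc_eq)
  moreover have "select (Suc d) (\<lambda>i. coord (P' w) ((\<sigma>(d := n)) i)) = w" if w: "w \<in> U'" for w
  proof (rule evec_eqI)
    fix i
    have wV: "w \<in> V" using w by (simp add: U'_def)
    then have "coord (select d (\<lambda>i. coord (P (vtrunc d w)) (\<sigma> i))) i = coord (vtrunc d w) i"
      using IH(5)[of "vtrunc d w"] by (simp add: V_def)
    then show "coord (select (Suc d) (\<lambda>i. coord (P' w) ((\<sigma>(d := n)) i))) i = coord w i"
      using IH(4)[of i] wV unfolding P'_def V_def by (auto simp: less_Suc_eq Rn_iff split: if_splits)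
  qed
  ultimately show ?case using U' by blast
qed

text \<open>Cells are locally closed: where the parameter coordinates are close to those of x, the
  cell is contained in the image of a compact set of parameters, and this image is closed and lies
  in the cell.\<close>

lemma cell_open_in_closure:
  assumes "Cq_cell D q n C" "q \<noteq> C_fin 0" "x \<in> C"
  shows "\<exists>W. open W \<and> x \<in> W \<and> closure C \<inter> W \<subseteq> C"
proof -
  obtain d U P \<sigma> where P: "open_in_Rn d U" "P ` U = C" "sC1 U P"
    "\<And>u. u \<in> U \<Longrightarrow> select d (\<lambda>i. coord (P u) (\<sigma> i)) = u"
    using cell_parametrization[OF assms(1,2)] by blast
  define \<pi> where "\<pi> y = select d (\<lambda>i. coord y (\<sigma> i))" for y
  have cont: "continuous_on S \<pi>" for S
    unfolding \<pi>_def select_expand by (intro continuous_intros)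
  have \<pi>P: "\<pi> (P u) = u" if "u \<in> U" for u using P(4)[OF that] by (simp add: \<pi>_def)
  have UR: "U \<subseteq> Rn d" using P(1) openin_imp_subset by blast
  obtain u where u: "u \<in> U" "x = P u" using assms(3) P(2) by blast
  obtain r where r: "r > 0" "\<And>y. y \<in> Rn d \<Longrightarrow> dist u y < r \<Longrightarrow> y \<in> U"
    using open_in_Rn_ball[OF P(1) u(1)] by blast
  define K where "K = {y \<in> Rn d. norm y \<le> norm u + r} \<inter> cball u (r / 2)"
  have "compact K" unfolding K_def by (intro compact_Int_closed compact_Rn_cball closed_cball)
  have KU: "K \<subseteq> U" using r by (auto simp: K_def)
  have "compact (P ` K)"
    using \<open>compact K\<close> sC1_continuous_on[OF sC1_subset[OF P(3) KU]] by (intro compact_continuous_image)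
  then have cl: "closed (P ` K)" by (rule compact_imp_closed)
  define W where "W = {y. dist u (\<pi> y) < r / 2}"
  have "open W" unfolding W_def by (intro open_Collect_less continuous_intros cont)
  moreover have "x \<in> W" using u r(1) \<pi>P by (simp add: W_def)
  moreover have "closure C \<inter> W \<subseteq> C"
  proof -
    have "C \<inter> W \<subseteq> P ` K"
    proof
      fix y assume y: "y \<in> C \<inter> W"
      then obtain v where v: "v \<in> U" "y = P v" using P(2) by blast
      have uv: "dist u v < r / 2" using y v \<pi>P[OF v(1)] by (simp add: W_def)
      have "norm v \<le> norm u + dist u v" using norm_triangle_sub[of v u] by (simp add: dist_norm norm_minus_commute)
      then have "v \<in> K" using uv v UR r(1) by (auto simp: K_def)
      then show "y \<in> P ` K" using v by blast
    qed
    then have "closure (C \<inter> W) \<subseteq> P ` K" using cl by (rule closure_minimal)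
    moreover have "closure C \<inter> W \<subseteq> closure (C \<inter> W)"
      using open_Int_closure_subset[OF \<open>open W\<close>, of C] by (simp add: Int_commute)
    ultimately show ?thesis using KU P(2) by blast
  qed
  ultimately show ?thesis by blast
qed

end

section \<open>A finite form of the Baire category argument\<close>

lemma finite_union_closure_interior:
  assumes "finite \<C>" "openin (top_of_set \<Gamma>) G" "G \<noteq> {}" "G \<subseteq> closure (\<Union>\<C>)"
  shows "\<exists>C\<in>\<C>. \<exists>G'. openin (top_of_set \<Gamma>) G' \<and> G' \<noteq> {} \<and> G' \<subseteq> G \<and> G' \<subseteq> closure C"
  using assms
proof (induction \<C> arbitrary: G)
  case (insert C \<C>)
  show ?case
  proof (cases "G \<subseteq> closure C")
    case True
    then show ?thesis using insert.prems by blast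
  next
    case False
    obtain W where W: "open W" "G = \<Gamma> \<inter> W" using insert.prems(1) by (auto simp: openin_open)
    have "G - closure C = \<Gamma> \<inter> (W - closure C)" using W(2) by blast
    moreover have "openin (top_of_set \<Gamma>) (\<Gamma> \<inter> (W - closure C))"
      using W(1) by (intro openin_open_Int open_Diff closed_closure)
    ultimately have "openin (top_of_set \<Gamma>) (G - closure C)" by simp
    moreover have "G - closure C \<subseteq> closure (\<Union>\<C>)" using insert.prems(3) by auto
    ultimately show ?thesis using insert.IH[of "G - closure C"] False by blast
  qed
qed auto

text \<open>One of the finitely many closures contains an open part of G. Since its C is locally
  closed, C itself then contains an open, possibly smaller part.\<close>

lemma finite_union_interior:
  assumes "finite \<C>" "openin (top_of_set \<Gamma>) G" "G \<noteq> {}" "G \<subseteq> closure (\<Union>\<C>)"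
    and lc: "\<And>C x. C \<in> \<C> \<Longrightarrow> x \<in> C \<Longrightarrow> \<exists>W. open W \<and> x \<in> W \<and> closure C \<inter> W \<subseteq> C"
    and sub: "\<And>C. C \<in> \<C> \<Longrightarrow> C \<subseteq> \<Gamma>"
  obtains C G' where "C \<in> \<C>" "openin (top_of_set \<Gamma>) G'" "G' \<noteq> {}" "G' \<subseteq> G" "G' \<subseteq> C"
proof -
  obtain C G1 where C: "C \<in> \<C>" "openin (top_of_set \<Gamma>) G1" "G1 \<noteq> {}" "G1 \<subseteq> G" "G1 \<subseteq> closure C"
    using finite_union_closure_interior[OF assms(1-4)] by blast
  obtain O1 where O1: "open O1" "G1 = \<Gamma> \<inter> O1" using C(2) by (auto simp: openin_open)
  have "O1 \<inter> closure C \<noteq> {}" using C(3,5) O1(2) by blast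
  then have "O1 \<inter> C \<noteq> {}" using open_Int_closure_eq_empty[OF O1(1), of C] by blast
  then obtain y where y: "y \<in> C" "y \<in> O1" by blast
  obtain W where W: "open W" "y \<in> W" "closure C \<inter> W \<subseteq> C" using lc[OF C(1) y(1)] by blast
  show ?thesis
  proof (rule that[of C "\<Gamma> \<inter> (O1 \<inter> W)"])
    show "openin (top_of_set \<Gamma>) (\<Gamma> \<inter> (O1 \<inter> W))" using O1(1) W(1) by (intro openin_open_Int open_Int)
    show "\<Gamma> \<inter> (O1 \<inter> W) \<noteq> {}" using y W(2) sub[OF C(1)] by blast
  qed (use C O1 W in blast)+
qed

section \<open>Wings\<close>

text \<open>The box stands on the face t = 0, where a wing meets \<Gamma>. All later shrinking keeps
  this contact, which makes limits t \<longrightarrow> 0 possible.\<close>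

definition wing_box :: "nat \<Rightarrow> evec \<Rightarrow> real \<Rightarrow> real \<Rightarrow> evec set" where
  "wing_box d u r \<tau> = {z \<in> Rn (Suc d). dist u (vtrunc d z) < r \<and> 0 < coord z d \<and> coord z d < \<tau>}"

lemma wing_box_mono:
  assumes "Rn d \<inter> ball u' r' \<subseteq> ball u r" "\<tau>' \<le> \<tau>"
  shows "wing_box d u' r' \<tau>' \<subseteq> wing_box d u r \<tau>"
proof
  fix z assume z: "z \<in> wing_box d u' r' \<tau>'"
  then have "vtrunc d z \<in> Rn d \<inter> ball u' r'" by (simp add: wing_box_def)
  then have "vtrunc d z \<in> ball u r" using assms(1) by blast
  then show "z \<in> wing_box d u r \<tau>" using z assms(2) by (simp add: wing_box_def)
qed

lemma open_wing_box: "open_in_Rn (Suc d) (wing_box d u r \<tau>)"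
proof -
  have "open {z. dist u (vtrunc d z) < r \<and> 0 < coord z d \<and> coord z d < \<tau>}"
    by (intro open_Collect_conj open_Collect_less continuous_intros)
  moreover have "wing_box d u r \<tau> = Rn (Suc d) \<inter> {z. dist u (vtrunc d z) < r \<and> 0 < coord z d \<and> coord z d < \<tau>}"
    by (auto simp: wing_box_def)
  ultimately show ?thesis by (simp add: openin_open_Int)
qed

context o_minimal_structure
begin

section \<open>Boxes inside cells and sections over boxes\<close>

lemma cell_decomposition_cells:
  assumes "cell_decomposition D q n \<C>"
  shows "finite \<C>" "\<Union>\<C> = Rn n" "\<And>C. C \<in> \<C> \<Longrightarrow> Cq_cell D q n C"
    "\<And>C C'. C \<in> \<C> \<Longrightarrow> C' \<in> \<C> \<Longrightarrow> x \<in> C \<Longrightarrow> x \<in> C' \<Longrightarrow> C = C'"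
proof -
  have "finite \<C> \<and> \<Union>\<C> = Rn n \<and> (\<forall>C\<in>\<C>. Cq_cell D q n C)
    \<and> (\<forall>C\<in>\<C>. \<forall>C'\<in>\<C>. x \<in> C \<longrightarrow> x \<in> C' \<longrightarrow> C = C')"
    using assms
  proof (cases n)
    case 0
    then show ?thesis using assms Cq_cell.point by auto
  next
    case (Suc m)
    then show ?thesis using assms by (auto simp: partition_on_def disjoint_def)
  qed
  then show "finite \<C>" "\<Union>\<C> = Rn n" "\<And>C. C \<in> \<C> \<Longrightarrow> Cq_cell D q n C"
    "\<And>C C'. C \<in> \<C> \<Longrightarrow> C' \<in> \<C> \<Longrightarrow> x \<in> C \<Longrightarrow> x \<in> C' \<Longrightarrow> C = C'" by blast+
qed

lemma cell_decomposition_project: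
  "cell_decomposition D q (p + k) \<C> \<Longrightarrow> cell_decomposition D q p ((\<lambda>C. vtrunc p ` C) ` \<C>)"
proof (induction k arbitrary: \<C>)
  case 0
  then have c: "cell_decomposition D q p \<C>" by simp
  have "vtrunc p ` C = C" if "C \<in> \<C>" for C
  proof -
    have "C \<subseteq> Rn p" using cell_decomposition_cells(2)[OF c] that by blast
    then have "vtrunc p ` C = (\<lambda>x. x) ` C" by (intro image_cong) auto
    then show ?thesis by simp
  qed
  then have "(\<lambda>C. vtrunc p ` C) ` \<C> = (\<lambda>C. C) ` \<C>" by (intro image_cong) auto
  then show ?case using c by simp
next
  case (Suc k)
  then have "cell_decomposition D q (p + k) ((\<lambda>C. vtrunc (p + k) ` C) ` \<C>)" by simp
  then have "cell_decomposition D q p ((\<lambda>C. vtrunc p ` C) ` (\<lambda>C. vtrunc (p + k) ` C) ` \<C>)" by (rule Suc.IH)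
  then show ?case by (simp add: image_image vtrunc_vtrunc)
qed

text \<open>The fibre of K over u0 is a point or an interval on one side of t = 0. Either it
  contains all small positive t, or K contains no points with small positive t over u near u0: a
  positive lower bound of the fibre persists by continuity, and a cell below t = 0 has no such
  points at all.\<close>

lemma fiber_dichotomy:
  assumes K: "Cq_cell D q (Suc d) K" and q: "q \<noteq> C_fin 0" and u0: "u0 \<in> vtrunc d ` K"
    and pos: "(\<forall>z\<in>K. 0 < coord z d) \<or> (\<forall>z\<in>K. \<not> 0 < coord z d)"
  shows "(\<exists>\<tau>>0. \<forall>t. 0 < t \<and> t < \<tau> \<longrightarrow> vsnoc d u0 t \<in> K) \<or>
    (\<exists>\<rho>>0. \<forall>u\<in>vtrunc d ` K. \<forall>t. dist u0 u < \<rho> \<longrightarrow> 0 < t \<longrightarrow> t < \<rho> \<longrightarrow> vsnoc d u t \<notin> K)"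
    (is "?L \<or> ?R")
proof (cases "\<forall>z\<in>K. \<not> 0 < coord z d")
  case True
  have ?R
  proof (intro exI[of _ 1] conjI ballI allI impI notI)
    fix u t assume "0 < t" "vsnoc d u t \<in> K"
    then show False using True by (auto dest!: bspec)
  qed simp
  then show ?thesis ..
next
  case False
  then have pos: "0 < coord z d" if "z \<in> K" for z using pos that by blast
  \<comment> \<open>\<open>f\<close> stands for a lower bound of the fibres that is positive at u0;
    by continuity it stays above half of its value there.\<close>
  have stay: ?R if C: "C \<subseteq> Rn d" "vtrunc d ` K = C" and f: "sC1 C f" "f u0 > 0"
    and above: "\<And>u t. u \<in> C \<Longrightarrow> vsnoc d u t \<in> K \<Longrightarrow> f u \<le> t" for C and f :: "evec \<Rightarrow> real"
  proof -
    have "u0 \<in> C" using u0 C(2) by simp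
    then obtain \<delta> where \<delta>: "\<delta> > 0" "\<And>u. u \<in> C \<Longrightarrow> dist u u0 < \<delta> \<Longrightarrow> dist (f u) (f u0) < f u0 / 2"
      using sC1_continuous_on[OF f(1)] f(2) unfolding continuous_on_iff by (meson half_gt_zero)
    show ?R
    proof (intro exI[of _ "min \<delta> (f u0 / 2)"] conjI ballI allI impI notI)
      fix u t assume u: "u \<in> vtrunc d ` K" "dist u0 u < min \<delta> (f u0 / 2)" "t < min \<delta> (f u0 / 2)" "vsnoc d u t \<in> K"
      have "f u \<le> t" using above u C by blast
      moreover have "dist (f u) (f u0) < f u0 / 2" using \<delta>(2)[of u] u C by (simp add: dist_commute)
      ultimately show False using u(3) by (simp add: dist_real_def abs_if split: if_splits)
    qed (use \<delta>(1) f(2) in auto)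
  qed
  show ?thesis
    using K
  proof (cases rule: Cq_cell.cases)
    case (graph C f)
    have C: "C \<subseteq> Rn d" using cell_in_D[OF graph(2) q] D_subset_Rn by blast
    have im: "vtrunc d ` K = C" unfolding graph(1) by (rule vtrunc_rgraph_on[OF C])
    have uC: "u0 \<in> C" using u0 im by simp
    have "vsnoc d u0 (f u0) \<in> K" using uC unfolding graph(1) rgraph_on_def by blast
    then have "f u0 > 0" using pos by fastforce
    moreover have "f u \<le> t" if u: "u \<in> C" "vsnoc d u t \<in> K" for u t
    proof -
      obtain x where x: "x \<in> C" "vsnoc d u t = vsnoc d x (f x)" using u(2) unfolding graph(1) rgraph_on_def by blast
      then show ?thesis using u(1) C by (auto simp: subset_iff)
    qed
    ultimately have ?R using stay[OF C im Cq_on_real_imp_sC1[OF graph(3) q C]] by blast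
    then show ?thesis ..
  next
    case (band C g h)
    have C: "C \<subseteq> Rn d" using cell_in_D[OF band(2) q] D_subset_Rn by blast
    have memK: "vsnoc d u t \<in> K \<longleftrightarrow> g u < ereal t \<and> ereal t < h u" if u: "u \<in> C" for u t
    proof
      assume "vsnoc d u t \<in> K"
      then obtain x s where x: "x \<in> C" "g x < ereal s" "ereal s < h x" "vsnoc d u t = vsnoc d x s"
        unfolding band(1) by blast
      then have "u = x" "t = s" using u C by (auto simp: subset_iff)
      then show "g u < ereal t \<and> ereal t < h u" using x by simp
    next
      assume "g u < ereal t \<and> ereal t < h u"
      then show "vsnoc d u t \<in> K" using u unfolding band(1) by blast
    qed
    have ex: "\<exists>t. g u < ereal t \<and> ereal t < h u" if "u \<in> C" for u
      using ereal_dense2 band(5) that by blast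
    have im: "vtrunc d ` K = C"
    proof
      show "vtrunc d ` K \<subseteq> C" unfolding band(1) using C by auto
      show "C \<subseteq> vtrunc d ` K"
      proof
        fix u assume u: "u \<in> C"
        then obtain t where "vsnoc d u t \<in> K" using ex memK by blast
        then have "vtrunc d (vsnoc d u t) \<in> vtrunc d ` K" by (rule imageI)
        then show "u \<in> vtrunc d ` K" using u C by (simp add: subset_iff)
      qed
    qed
    have uC: "u0 \<in> C" using u0 im by simp
    obtain t0 where t0: "g u0 < ereal t0" "ereal t0 < h u0" using ex[OF uC] by blast
    then have "vsnoc d u0 t0 \<in> K" using memK[OF uC] by blast
    then have t0pos: "0 < t0" using pos by fastforce
    show ?thesis
      using band(3) q C
    proof (cases rule: cell_bound_cases)
      case (fin f)
      show ?thesis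
      proof (cases "f u0 > 0")
        case True
        have "f u \<le> t" if "u \<in> C" "vsnoc d u t \<in> K" for u t
          using memK[OF that(1), of t] that fin(3)[OF that(1)] by simp
        then have ?R using stay[OF C im fin(1) True] by blast
        then show ?thesis ..
      next
        case False
        have ?L
        proof (intro exI[of _ t0] conjI allI impI t0pos)
          fix t assume t: "0 < t \<and> t < t0"
          have "ereal t < h u0" using t t0(2) by (meson ereal_less(2) less_trans less_ereal.simps(1))
          then show "vsnoc d u0 t \<in> K" using memK[OF uC, of t] fin(3)[OF uC] False t by simp
        qed
        then show ?thesis ..
      qed
    next
      case inf
      \<comment> \<open>A fibre unbounded below would contain a t that is not positive, against the
        choice of sign.\<close>
      have "ereal (min t0 0) < h u0"
        using t0(2) le_less_trans[of "ereal (min t0 0)" "ereal t0" "h u0"] by simp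
      then have "vsnoc d u0 (min t0 0) \<in> K" using memK[OF uC, of "min t0 0"] inf[OF uC] by simp
      then have "0 < coord (vsnoc d u0 (min t0 0)) d" by (rule pos)
      then show ?thesis by simp
    qed
  qed
qed

text \<open>Over an open part of a cell D0 of R^d there are finitely many cells of R^(d+1), and
  exactly one of them, K, contains all small t over a chosen u0; the others avoid a neighbourhood of
  (u0, 0) in the region t > 0. So some box lies in K. If a cell in A projects onto K, it has a
  definable section over K; otherwise A has no point over the box. The last clause says that
  \<Sigma> contains only points of the section.\<close>

lemma wing:
  assumes adm: "admits_cell_decompositions D q" and q: "q \<noteq> C_fin 0"
    and A: "A \<in> D (Suc d + k)" and V: "open_in_Rn d V" "V \<noteq> {}"
  obtains u r \<tau> where "u \<in> Rn d" "r > 0" "\<tau> > 0" "Rn d \<inter> ball u r \<subseteq> V"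
    "(\<forall>z\<in>A. vtrunc (Suc d) z \<notin> wing_box d u r \<tau>) \<or>
     (\<exists>\<Sigma> s. \<Sigma> \<in> D (Suc d + k) \<and> \<Sigma> \<subseteq> A \<and> sC1 (wing_box d u r \<tau>) s \<and>
        (\<forall>z\<in>wing_box d u r \<tau>. s z \<in> \<Sigma> \<and> vtrunc (Suc d) (s z) = z) \<and>
        (\<forall>y\<in>\<Sigma>. y = s (vtrunc (Suc d) y)))"
proof -
  \<comment> \<open>Compatibility with this half space puts each cell of R^(d+1) on one side of t =
    0, as \<open>fiber_dichotomy\<close> demands.\<close>
  define T0 where "T0 = {z \<in> Rn (Suc d + k). 0 < coord z d}"
  have "Def (Suc d + k) (\<lambda>z. 0 < coord z d)" by (intro Def_less dterm_const dterm_coord_self) simp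
  then have "T0 \<in> D (Suc d + k)" by (simp add: T0_def Def_def)
  then have fam: "finite {A, T0} \<and> {A, T0} \<subseteq> D (Suc d + k)" using A by simp
  obtain \<C> where \<C>: "cell_decomposition D q (Suc d + k) \<C>"
    and compat: "\<forall>B\<in>{A, T0}. \<forall>C\<in>\<C>. C \<subseteq> B \<or> C \<inter> B = {}"
    using adm[unfolded admits_cell_decompositions_def, rule_format, OF fam] by blast
  define \<C>1 where "\<C>1 = (\<lambda>C. vtrunc (Suc d) ` C) ` \<C>"
  have \<C>1: "cell_decomposition D q (Suc d) \<C>1" unfolding \<C>1_def by (rule cell_decomposition_project[OF \<C>])
  define \<C>0 where "\<C>0 = (\<lambda>C. vtrunc d ` C) ` \<C>1"
  have \<C>0: "cell_decomposition D q d \<C>0" unfolding \<C>0_def by (rule cell_decomposition_project[of q d 1]) (simp add: \<C>1 del: cell_decomposition.simps)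
  note c = cell_decomposition_cells[OF \<C>] and c1 = cell_decomposition_cells[OF \<C>1] and c0 = cell_decomposition_cells[OF \<C>0]
  have VR: "V \<subseteq> Rn d" using V(1) openin_imp_subset by blast
  obtain D0 G where D0: "D0 \<in> \<C>0" and G: "open_in_Rn d G" "G \<noteq> {}" "G \<subseteq> V" "G \<subseteq> D0"
  proof (rule finite_union_interior[OF c0(1) V])
    show "V \<subseteq> closure (\<Union> \<C>0)" unfolding c0(2) using VR by simp
    show "\<exists>W. open W \<and> x \<in> W \<and> closure C \<inter> W \<subseteq> C" if "C \<in> \<C>0" "x \<in> C" for C x
      using cell_open_in_closure[OF c0(3)[OF that(1)] q that(2)] .
    show "C \<subseteq> Rn d" if "C \<in> \<C>0" for C using that c0(2) by blast
  qed (rule that)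
  obtain u0 where u0: "u0 \<in> G" using G(2) by blast
  have u0D: "u0 \<in> D0" and u0R: "u0 \<in> Rn d" using u0 G VR by auto
  obtain r0 where r0: "r0 > 0" "\<And>x. x \<in> Rn d \<Longrightarrow> dist u0 x < r0 \<Longrightarrow> x \<in> G"
    using open_in_Rn_ball[OF G(1) u0] by blast
  have pos1: "(\<forall>z\<in>K. 0 < coord z d) \<or> (\<forall>z\<in>K. \<not> 0 < coord z d)" if K: "K \<in> \<C>1" for K
  proof -
    obtain C where C: "C \<in> \<C>" "K = vtrunc (Suc d) ` C" using K unfolding \<C>1_def by blast
    have "C \<subseteq> Rn (Suc d + k)" using c(2) C(1) by blast
    moreover have "C \<subseteq> T0 \<or> C \<inter> T0 = {}" using bspec[OF bspec[OF compat, of T0] C(1)] by simp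
    ultimately have "(\<forall>z\<in>C. 0 < coord z d) \<or> (\<forall>z\<in>C. \<not> 0 < coord z d)"
      unfolding T0_def by (elim disjE) (rule disjI1, fast, rule disjI2, fast)
    then show ?thesis unfolding C(2) by auto
  qed
  \<comment> \<open>The cells over D0 that are not good avoid a neighbourhood of (u0, 0) in t > 0 by
    the dichotomy; as there are finitely many of them, their radii have a positive minimum.\<close>
  define good where "good K \<longleftrightarrow> (\<exists>\<tau>>0. \<forall>t. 0 < t \<and> t < \<tau> \<longrightarrow> vsnoc d u0 t \<in> K)" for K
  define S where "S = {K \<in> \<C>1. vtrunc d ` K = D0 \<and> \<not> good K}"
  have "finite S" unfolding S_def using c1(1) by simp
  have "\<exists>\<rho>>0. \<forall>u\<in>D0. \<forall>t. dist u0 u < \<rho> \<longrightarrow> 0 < t \<longrightarrow> t < \<rho> \<longrightarrow> vsnoc d u t \<notin> K" if "K \<in> S" for K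
  proof -
    have K: "K \<in> \<C>1" "vtrunc d ` K = D0" "\<not> good K" using that by (auto simp: S_def)
    show ?thesis
      using fiber_dichotomy[OF c1(3)[OF K(1)] q _ pos1[OF K(1)], of u0] K(3) u0D unfolding K(2) good_def by blast
  qed
  then obtain R where R: "\<And>K. K \<in> S \<Longrightarrow> R K > 0" "\<And>K u t. K \<in> S \<Longrightarrow> u \<in> D0 \<Longrightarrow> dist u0 u < R K \<Longrightarrow>
      0 < t \<Longrightarrow> t < R K \<Longrightarrow> vsnoc d u t \<notin> K" by metis
  define \<rho> where "\<rho> = Min (insert 1 (R ` S))"
  have \<rho>: "\<rho> > 0" "\<And>K. K \<in> S \<Longrightarrow> \<rho> \<le> R K"
    using R(1) \<open>finite S\<close> by (auto simp: \<rho>_def)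
  have cellof: "\<exists>K\<in>\<C>1. vsnoc d u t \<in> K \<and> vtrunc d ` K = D0" if u: "u \<in> D0" for u t
  proof -
    have uR: "u \<in> Rn d" using u D0 c0(2) by blast
    have "vsnoc d u t \<in> \<Union>\<C>1" unfolding c1(2) by simp
    then obtain K where K: "K \<in> \<C>1" "vsnoc d u t \<in> K" by blast
    have "vtrunc d (vsnoc d u t) \<in> vtrunc d ` K" using K(2) by (rule imageI)
    then have "u \<in> vtrunc d ` K" using uR by simp
    then have "vtrunc d ` K = D0" using c0(4)[of "vtrunc d ` K" D0] K(1) u D0 unfolding \<C>0_def by blast
    then show ?thesis using K by blast
  qed
  have avoid: "K \<notin> S" if "u \<in> D0" "dist u0 u < \<rho>" "0 < t" "t < \<rho>" "vsnoc d u t \<in> K" for K u t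
    using R(2)[of K u t] \<rho>(2)[of K] that by force
  obtain K where K: "K \<in> \<C>1" "vsnoc d u0 (\<rho> / 2) \<in> K" "vtrunc d ` K = D0" using cellof[OF u0D] by blast
  have "K \<notin> S" using avoid[OF u0D _ _ _ K(2)] \<rho>(1) by simp
  then have goodK: "good K" using K by (simp add: S_def)
  \<comment> \<open>Two good cells share the points over u0 with small t, and cells are
    disjoint.\<close>
  have only: "K' = K" if K': "K' \<in> \<C>1" "vtrunc d ` K' = D0" "K' \<notin> S" for K'
  proof -
    have "good K'" using K' by (simp add: S_def)
    then obtain \<tau> \<tau>' where t: "\<tau> > 0" "\<tau>' > 0" "\<And>t. 0 < t \<Longrightarrow> t < \<tau> \<Longrightarrow> vsnoc d u0 t \<in> K"
      "\<And>t. 0 < t \<Longrightarrow> t < \<tau>' \<Longrightarrow> vsnoc d u0 t \<in> K'" using goodK unfolding good_def by blast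
    have "vsnoc d u0 (min \<tau> \<tau>' / 2) \<in> K" "vsnoc d u0 (min \<tau> \<tau>' / 2) \<in> K'"
      using t(1,2) by (auto intro!: t(3,4) simp: min_def)
    then show ?thesis using c1(4)[OF K'(1) K(1)] by blast
  qed
  define r where "r = min r0 \<rho>"
  have boxK: "wing_box d u0 r \<rho> \<subseteq> K"
  proof
    fix z assume z: "z \<in> wing_box d u0 r \<rho>"
    define u where "u = vtrunc d z"
    have zu: "z = vsnoc d u (coord z d)" using z vsnoc_vtrunc[of z d] by (simp add: wing_box_def u_def)
    have b: "dist u0 u < r0" "dist u0 u < \<rho>" "0 < coord z d" "coord z d < \<rho>"
      using z by (auto simp: wing_box_def u_def r_def)
    have uD: "u \<in> D0" using r0(2)[of u] b(1) G(4) by (auto simp: u_def)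
    obtain K' where K': "K' \<in> \<C>1" "vsnoc d u (coord z d) \<in> K'" "vtrunc d ` K' = D0" using cellof[OF uD] by blast
    have "K' = K" by (rule only[OF K'(1,3) avoid[OF uD b(2-4) K'(2)]])
    then show "z \<in> K" using K'(2) zu by simp
  qed
  show ?thesis
  proof (rule that[OF u0R _ \<rho>(1)])
    show "r > 0" using r0(1) \<rho>(1) by (simp add: r_def)
    show "Rn d \<inter> ball u0 r \<subseteq> V" using r0(2) G(3) by (auto simp: r_def)
    show "(\<forall>z\<in>A. vtrunc (Suc d) z \<notin> wing_box d u0 r \<rho>) \<or>
     (\<exists>\<Sigma> s. \<Sigma> \<in> D (Suc d + k) \<and> \<Sigma> \<subseteq> A \<and> sC1 (wing_box d u0 r \<rho>) s \<and>
        (\<forall>z\<in>wing_box d u0 r \<rho>. s z \<in> \<Sigma> \<and> vtrunc (Suc d) (s z) = z) \<and>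
        (\<forall>y\<in>\<Sigma>. y = s (vtrunc (Suc d) y)))"
    proof (cases "\<exists>E\<in>\<C>. vtrunc (Suc d) ` E = K \<and> E \<subseteq> A")
      case True
      then obtain E where E: "E \<in> \<C>" "vtrunc (Suc d) ` E = K" "E \<subseteq> A" by blast
      obtain \<Sigma> s where s: "\<Sigma> \<in> D (Suc d + k) \<and> \<Sigma> \<subseteq> E \<and> sC1 K s \<and> s ` K = \<Sigma>
          \<and> (\<forall>z\<in>K. vtrunc (Suc d) (s z) = z)"
        using cell_section_iterated[OF c(3)[OF E(1)] q] unfolding E(2) by (elim exE) (rule that)
      have "\<Sigma> \<in> D (Suc d + k)" using s by (rule conjunct1)
      moreover have "\<Sigma> \<subseteq> A" using s E(3) by (meson subset_trans)
      moreover have "sC1 (wing_box d u0 r \<rho>) s" by (rule sC1_subset[OF _ boxK]) (use s in simp)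
      moreover have "\<forall>z\<in>wing_box d u0 r \<rho>. s z \<in> \<Sigma> \<and> vtrunc (Suc d) (s z) = z"
      proof
        fix z assume "z \<in> wing_box d u0 r \<rho>"
        then have "z \<in> K" using boxK by blast
        then show "s z \<in> \<Sigma> \<and> vtrunc (Suc d) (s z) = z" using s by auto
      qed
      moreover have "\<forall>y\<in>\<Sigma>. y = s (vtrunc (Suc d) y)"
      proof
        fix y assume "y \<in> \<Sigma>"
        then obtain z where "z \<in> K" "y = s z" using s by blast
        then show "y = s (vtrunc (Suc d) y)" using s by simp
      qed
      ultimately show ?thesis by (intro disjI2 exI[of _ \<Sigma>] exI[of _ s] conjI)
    next
      case False
      have "vtrunc (Suc d) z \<notin> wing_box d u0 r \<rho>" if z: "z \<in> A" for z
      proof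
        assume "vtrunc (Suc d) z \<in> wing_box d u0 r \<rho>"
        then have zK: "vtrunc (Suc d) z \<in> K" using boxK by blast
        have "z \<in> \<Union>\<C>" using z D_subset_Rn[OF A] c(2) by blast
        then obtain E where E: "E \<in> \<C>" "z \<in> E" by blast
        have "E \<subseteq> A" using compat E z by blast
        moreover have "vtrunc (Suc d) ` E = K"
          using c1(4)[of "vtrunc (Suc d) ` E" K] E K(1) zK unfolding \<C>1_def by blast
        ultimately show False using False E(1) by blast
      qed
      then show ?thesis by blast
    qed
  qed
qed

text \<open>The case k = 0 of \<open>wing\<close>, applied to one set after another. Boxes are only
  shrunk, so compatibility achieved earlier persists.\<close>

lemma wing_box_compatible:
  assumes adm: "admits_cell_decompositions D q" and q: "q \<noteq> C_fin 0"
    and "finite \<A>" "\<And>A. A \<in> \<A> \<Longrightarrow> A \<in> D (Suc d)" and V: "open_in_Rn d V" "V \<noteq> {}"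
  shows "\<exists>u r \<tau>. u \<in> Rn d \<and> r > 0 \<and> \<tau> > 0 \<and> Rn d \<inter> ball u r \<subseteq> V \<and>
    (\<forall>A\<in>\<A>. wing_box d u r \<tau> \<subseteq> A \<or> wing_box d u r \<tau> \<inter> A = {})"
  using assms(3,4)
proof (induction \<A>)
  case empty
  obtain u where u: "u \<in> V" using V(2) by blast
  obtain r where r: "r > 0" "\<And>x. x \<in> Rn d \<Longrightarrow> dist u x < r \<Longrightarrow> x \<in> V"
    using open_in_Rn_ball[OF V(1) u] by blast
  have "u \<in> Rn d" using u V(1) openin_imp_subset by blast
  then show ?case using r by (intro exI[of _ u] exI[of _ r] exI[of _ 1]) auto
next
  case (insert A \<A>)
  have "\<exists>u r \<tau>. u \<in> Rn d \<and> r > 0 \<and> \<tau> > 0 \<and> Rn d \<inter> ball u r \<subseteq> V \<and>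
    (\<forall>A\<in>\<A>. wing_box d u r \<tau> \<subseteq> A \<or> wing_box d u r \<tau> \<inter> A = {})"
    by (rule insert.IH) (rule insert.prems, erule insertI2)
  then obtain u r \<tau> where IH0: "u \<in> Rn d \<and> r > 0 \<and> \<tau> > 0 \<and> Rn d \<inter> ball u r \<subseteq> V \<and>
    (\<forall>A\<in>\<A>. wing_box d u r \<tau> \<subseteq> A \<or> wing_box d u r \<tau> \<inter> A = {})" by (elim exE) (rule that)
  then have IH: "u \<in> Rn d" "r > 0" "\<tau> > 0" "Rn d \<inter> ball u r \<subseteq> V" by simp_all
  have IH5: "wing_box d u r \<tau> \<subseteq> A \<or> wing_box d u r \<tau> \<inter> A = {}" if "A \<in> \<A>" for A
    using IH0 that by (elim conjE) (rule bspec)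
  \<comment> \<open>With no extra coordinates a section is the identity, so the two alternatives of
    \<open>wing\<close> say that the box avoids A or is contained in it.\<close>
  have A: "A \<in> D (Suc d + 0)" using insert.prems by simp
  have V': "open_in_Rn d (Rn d \<inter> ball u r)" "Rn d \<inter> ball u r \<noteq> {}"
    using IH(1,2) by (auto intro: openin_open_Int)
  obtain u' r' \<tau>' where w: "u' \<in> Rn d" "r' > 0" "\<tau>' > 0" "Rn d \<inter> ball u' r' \<subseteq> Rn d \<inter> ball u r"
    "(\<forall>z\<in>A. vtrunc (Suc d) z \<notin> wing_box d u' r' \<tau>') \<or>
     (\<exists>\<Sigma> s. \<Sigma> \<in> D (Suc d + 0) \<and> \<Sigma> \<subseteq> A \<and> sC1 (wing_box d u' r' \<tau>') s \<and>
        (\<forall>z\<in>wing_box d u' r' \<tau>'. s z \<in> \<Sigma> \<and> vtrunc (Suc d) (s z) = z) \<and>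
        (\<forall>y\<in>\<Sigma>. y = s (vtrunc (Suc d) y)))"
    by (rule wing[OF adm q A V'])
  have sub: "wing_box d u' r' (min \<tau> \<tau>') \<subseteq> wing_box d u r \<tau>" "wing_box d u' r' (min \<tau> \<tau>') \<subseteq> wing_box d u' r' \<tau>'"
    by (rule wing_box_mono; use w(4) in simp)+
  have AR: "A \<subseteq> Rn (Suc d)" using D_subset_Rn[OF A] by simp
  have "wing_box d u' r' \<tau>' \<subseteq> A \<or> wing_box d u' r' \<tau>' \<inter> A = {}"
    using w(5)
  proof
    assume "\<forall>z\<in>A. vtrunc (Suc d) z \<notin> wing_box d u' r' \<tau>'"
    then have "\<forall>z\<in>A. z \<notin> wing_box d u' r' \<tau>'" using AR by (auto simp: subset_iff)
    then show ?thesis by blast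
  next
    assume "\<exists>\<Sigma> s. \<Sigma> \<in> D (Suc d + 0) \<and> \<Sigma> \<subseteq> A \<and> sC1 (wing_box d u' r' \<tau>') s \<and>
        (\<forall>z\<in>wing_box d u' r' \<tau>'. s z \<in> \<Sigma> \<and> vtrunc (Suc d) (s z) = z) \<and> (\<forall>y\<in>\<Sigma>. y = s (vtrunc (Suc d) y))"
    then obtain \<Sigma> s where s: "\<Sigma> \<subseteq> A \<and> (\<forall>z\<in>wing_box d u' r' \<tau>'. s z \<in> \<Sigma> \<and> vtrunc (Suc d) (s z) = z)"
      by (elim exE conjE) (rule that, rule conjI)
    have "z \<in> A" if "z \<in> wing_box d u' r' \<tau>'" for z
    proof -
      have "s z \<in> A" "vtrunc (Suc d) (s z) = z" using s that by auto
      then show ?thesis using AR by (metis subsetD vtrunc_id)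
    qed
    then show ?thesis by blast
  qed
  then have "wing_box d u' r' (min \<tau> \<tau>') \<subseteq> B \<or> wing_box d u' r' (min \<tau> \<tau>') \<inter> B = {}" if "B \<in> insert A \<A>" for B
    using that IH5[of B] sub by blast
  then show ?case
    using w(1-4) IH(3,4) by (intro exI[of _ u'] exI[of _ r'] exI[of _ "min \<tau> \<tau>'"]) auto
qed

end

section \<open>Genericity\<close>

text \<open>C is a cell in \<Gamma> with parametrization P. Within the open set W all of \<Gamma>
  belongs to C, so there every tangent vector of \<Gamma> is a derivative of P.\<close>

locale patch =
  fixes n d :: nat and U :: "evec set" and P :: "evec \<Rightarrow> evec" and \<sigma> :: "nat \<Rightarrow> nat"
    and C \<Gamma> W :: "evec set"
  assumes U: "open_in_Rn d U" and PU: "P ` U = C" and P: "sC1 U P" and \<sigma>: "i < d \<Longrightarrow> \<sigma> i < n"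
    and retraction: "u \<in> U \<Longrightarrow> select d (\<lambda>i. coord (P u) (\<sigma> i)) = u"
    and C\<Gamma>: "C \<subseteq> \<Gamma>" and W: "open W" and \<Gamma>W: "\<Gamma> \<inter> W \<subseteq> C" and \<Gamma>R: "\<Gamma> \<subseteq> Rn n"
begin

definition \<pi> :: "evec \<Rightarrow> evec" where
  "\<pi> y = select d (\<lambda>i. coord y (\<sigma> i))"

text \<open>The points at which the condition fails to within \<open>e\<close>: either the tangent space of \<open>\<Lambda>\<close> is far
  from that of \<open>\<Gamma>\<close>, or it is far from the secant joining the point with its projection to \<open>\<Gamma>\<close>.\<close>

definition bad :: "evec set \<Rightarrow> real \<Rightarrow> evec \<Rightarrow> bool" where
  "bad \<Lambda> e b \<longleftrightarrow> b \<in> \<Lambda> \<and> (\<exists>a\<in>C. (\<forall>i<d. coord a (\<sigma> i) = coord b (\<sigma> i)) \<and>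
     ((\<exists>v\<in>Rn n. in_tangent_bundle \<Gamma> a v \<and> norm v \<le> 1 \<and>
         (\<forall>w\<in>Rn n. in_tangent_bundle \<Lambda> b w \<longrightarrow> e \<le> norm (v - w))) \<or>
      (\<forall>w\<in>Rn n. in_tangent_bundle \<Lambda> b w \<longrightarrow> e * norm (b - a) \<le> norm (b - a - w))))"

lemma UR: "U \<subseteq> Rn d"
  using U openin_imp_subset by blast

lemma coord_\<pi>: "coord (\<pi> y) i = (if i < d then coord y (\<sigma> i) else 0)"
  by (simp add: \<pi>_def)

lemma \<pi>_Rn [simp]: "\<pi> y \<in> Rn d"
  by (simp add: \<pi>_def)

lemma \<pi>_diff: "\<pi> (x - y) = \<pi> x - \<pi> y"
  by (intro evec_eqI) (simp add: coord_\<pi>)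

lemma norm_\<pi>: "norm (\<pi> y) \<le> real d * norm y"
proof -
  have "norm (\<pi> y) \<le> (\<Sum>i<d. \<bar>coord (\<pi> y) i\<bar>)" by (rule norm_le_sum_coord) simp
  also have "\<dots> \<le> (\<Sum>i<d. norm y)" by (intro sum_mono) (auto simp: coord_\<pi> abs_coord_le_norm)
  finally show ?thesis by simp
qed

lemma bounded_linear_\<pi>: "bounded_linear \<pi>"
  by (rule bounded_linear_intro[of _ "real d"])
     (auto intro!: evec_eqI simp: coord_\<pi> norm_\<pi> mult.commute[of _ "real d"])

lemma \<pi>P: "u \<in> U \<Longrightarrow> \<pi> (P u) = u"
  by (simp add: \<pi>_def retraction)

lemma P\<pi>:
  assumes "a \<in> C"
  shows "\<pi> a \<in> U" "P (\<pi> a) = a"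
proof -
  obtain u where "u \<in> U" "a = P u" using assms PU by blast
  then show "\<pi> a \<in> U" "P (\<pi> a) = a" using \<pi>P by auto
qed

lemma PC: "u \<in> U \<Longrightarrow> P u \<in> C"
  using PU by blast

lemma tangent_space_U: "u \<in> U \<Longrightarrow> tangent_space U u = Rn d"
  using tangent_space_open[OF U, of u d] UR by (auto simp: Int_absorb2)

lemma P_derivative:
  assumes "sdiff U P u A" "u \<in> U" "c \<in> Rn d"
  shows "A c \<in> tangent_space \<Gamma> (P u)"
proof (rule tangent_space_image_subset[OF sdiff_has_derivative[OF assms(1,2)]])
  show "P ` U \<subseteq> \<Gamma>" using PU C\<Gamma> by simp
  show "c \<in> tangent_space U u" using tangent_space_U[OF assms(2)] assms(3) by simp
qed

text \<open>Near P u the set \<Gamma> is covered by the image of P, so v = A c for some c; the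
  linear left inverse \<pi> of P recovers c from v.\<close>

lemma tangent_space_patch:
  assumes A: "sdiff U P u A" and u: "u \<in> U" "P u \<in> W" and v: "v \<in> tangent_space \<Gamma> (P u)"
  shows "v = A (\<pi> v)"
proof -
  have "v \<in> tangent_space (\<Gamma> \<inter> W) (P u)" using v tangent_space_Int_open[OF W u(2)] by simp
  then have "v \<in> tangent_space (P ` U) (P u)" using tangent_space_mono[OF \<Gamma>W] PU by blast
  moreover have der: "(P has_derivative A) (at u within U)" by (rule sdiff_has_derivative[OF A u(1)])
  have der': "(\<pi> has_derivative \<pi>) (at (P u) within P ` U)"
    by (rule bounded_linear_imp_has_derivative[OF bounded_linear_\<pi>])
  have "tangent_space (P ` U) (P u) = A ` tangent_space U u"
    by (rule tangent_space_image[OF der der' _ u(1)]) (rule \<pi>P)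
  ultimately obtain c where c: "c \<in> tangent_space U u" "v = A c" by blast
  have "\<pi> (A c) = c"
    by (rule tangent_space_left_inverse[OF der der' _ u(1) c(1)]) (rule \<pi>P)
  then show ?thesis using c(2) by simp
qed

lemma bad_mono: "bad \<Lambda> e b \<Longrightarrow> e' \<le> e \<Longrightarrow> bad \<Lambda> e' b"
proof -
  assume b: "bad \<Lambda> e b" and e: "e' \<le> e"
  have le: "e' * norm (b - a) \<le> e * norm (b - a)" for a using e by (intro mult_right_mono) auto
  obtain a where a: "a \<in> C" "\<forall>i<d. coord a (\<sigma> i) = coord b (\<sigma> i)"
    "(\<exists>v\<in>Rn n. in_tangent_bundle \<Gamma> a v \<and> norm v \<le> 1 \<and> (\<forall>w\<in>Rn n. in_tangent_bundle \<Lambda> b w \<longrightarrow> e \<le> norm (v - w))) \<or>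
      (\<forall>w\<in>Rn n. in_tangent_bundle \<Lambda> b w \<longrightarrow> e * norm (b - a) \<le> norm (b - a - w))"
    using b unfolding bad_def by blast
  from a(3) have "(\<exists>v\<in>Rn n. in_tangent_bundle \<Gamma> a v \<and> norm v \<le> 1 \<and> (\<forall>w\<in>Rn n. in_tangent_bundle \<Lambda> b w \<longrightarrow> e' \<le> norm (v - w))) \<or>
      (\<forall>w\<in>Rn n. in_tangent_bundle \<Lambda> b w \<longrightarrow> e' * norm (b - a) \<le> norm (b - a - w))"
    using e le[of a] order_trans by meson
  then show ?thesis using a(1,2) b unfolding bad_def by blast
qed

text \<open>Put a = P (\<pi> y), the point of C with the same d coordinates as y, and write x - y =
  (x - a) - (y - a). The first part is nearly a tangent vector of \<Gamma> at a, which is close to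
  the tangent space of \<Lambda> at y because y is not bad; the second part is close to it for the
  same reason.\<close>

lemma whitney_eps_if_not_bad:
  assumes sub: "\<And>y. y \<in> \<Lambda> \<Longrightarrow> subspace (tangent_space \<Lambda> y)" and \<Lambda>R: "\<Lambda> \<subseteq> Rn n"
    and u: "u \<in> U" "P u \<in> W"
    and nb: "\<And>e. e > 0 \<Longrightarrow> \<exists>\<delta>>0. \<forall>b. bad \<Lambda> e b \<longrightarrow> \<delta> \<le> dist (P u) b"
  shows "whitney_eps \<Lambda> \<Gamma> (P u)"
  unfolding whitney_eps_def
proof (intro allI impI)
  fix e :: real assume e: "e > 0"
  obtain A where A: "sdiff U P u A" using P u(1) unfolding sC1_def by blast
  obtain L rL where L: "L > 0" "rL > 0" "\<And>x y. x \<in> U \<Longrightarrow> y \<in> U \<Longrightarrow> dist u x < rL \<Longrightarrow> dist u y < rL \<Longrightarrow>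
    norm (P x - P y) \<le> L * norm (x - y)" by (rule sdiff_lipschitz[OF A]) (rule that)
  define K where "K = real d"
  have K: "K \<ge> 0" by (simp add: K_def)
  \<comment> \<open>In units of |x - y|, with |c| at most K |x - y|: the summands bound 2 |c| from
    the linearization of P, then |v|, then |y - a|.\<close>
  define M where "M = 2 * K + (L + 2) * K + (1 + L * K)"
  have M: "M > 0" using L(1) K by (simp add: M_def add_nonneg_pos add_pos_nonneg)
  define \<eta> where "\<eta> = min 1 (e / M)"
  have \<eta>: "0 < \<eta>" "\<eta> \<le> 1" using e M by (auto simp: \<eta>_def)
  have "\<eta> * M \<le> e / M * M" using M by (intro mult_right_mono) (auto simp: \<eta>_def)
  then have \<eta>M: "\<eta> * M \<le> e" using M by simp
  obtain rA where rA: "rA > 0" "\<And>x y. x \<in> U \<Longrightarrow> y \<in> U \<Longrightarrow> dist u x < rA \<Longrightarrow> dist u y < rA \<Longrightarrow>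
    norm (P x - P y - A (x - y)) \<le> \<eta> * norm (x - y)" by (rule sdiffE[OF A \<eta>(1)]) (rule that)
  obtain rb where rb: "rb > 0" "\<And>b. bad \<Lambda> \<eta> b \<Longrightarrow> rb \<le> dist (P u) b" using nb[OF \<eta>(1)] by blast
  obtain rU where rU: "rU > 0" "\<And>x. x \<in> Rn d \<Longrightarrow> dist u x < rU \<Longrightarrow> x \<in> U" using open_in_Rn_ball[OF U u(1)] by blast
  obtain rW where rW: "rW > 0" "\<And>x. dist (P u) x < rW \<Longrightarrow> x \<in> W"
    using W u(2) open_contains_ball by (metis mem_ball subsetD)
  define \<rho> where "\<rho> = min (min rL rA) rU"
  have \<rho>: "\<rho> > 0" using L rA rU by (simp add: \<rho>_def)
  have "continuous_on UNIV \<pi>" by (rule linear_continuous_on[OF bounded_linear_\<pi>])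
  then obtain r\<pi> where r\<pi>: "r\<pi> > 0" "\<And>x. dist x (P u) < r\<pi> \<Longrightarrow> dist (\<pi> x) (\<pi> (P u)) < \<rho>"
    using \<rho> unfolding continuous_on_iff by (metis UNIV_I)
  define r where "r = min (min rb rW) r\<pi>"
  have r: "r > 0" using rb rW r\<pi> by (simp add: r_def)
  have near: "\<pi> x \<in> U" "dist u (\<pi> x) < rL" "dist u (\<pi> x) < rA" if "dist (P u) x < r" for x
  proof -
    have "dist u (\<pi> x) < \<rho>" using r\<pi>(2)[of x] that \<pi>P[OF u(1)] by (simp add: r_def dist_commute)
    then show "\<pi> x \<in> U" "dist u (\<pi> x) < rL" "dist u (\<pi> x) < rA" using rU(2)[of "\<pi> x"] by (auto simp: \<rho>_def)
  qed
  show "\<exists>d>0. \<forall>x\<in>\<Gamma>. \<forall>y\<in>\<Lambda>. dist (P u) x < d \<longrightarrow> dist (P u) y < d \<longrightarrow>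
      (\<exists>w\<in>tangent_space \<Lambda> y. norm (x - y - w) \<le> e * norm (x - y))"
  proof (intro exI[of _ r] conjI ballI impI r)
    fix x y assume x: "x \<in> \<Gamma>" "dist (P u) x < r" and y: "y \<in> \<Lambda>" "dist (P u) y < r"
    have "x \<in> W" using rW(2) x(2) by (simp add: r_def)
    then have xC: "x \<in> C" using \<Gamma>W x(1) by blast
    define u1 where "u1 = \<pi> x"
    define u2 where "u2 = \<pi> y"
    define a where "a = P u2"
    note n1 = near[OF x(2), folded u1_def] and n2 = near[OF y(2), folded u2_def]
    have Pu1: "P u1 = x" using P\<pi>(2)[OF xC] by (simp add: u1_def)
    have aC: "a \<in> C" using PC[OF n2(1)] by (simp add: a_def)
    have a\<Gamma>: "a \<in> \<Gamma>" using aC C\<Gamma> by blast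
    have co: "\<forall>i<d. coord a (\<sigma> i) = coord y (\<sigma> i)"
    proof (intro allI impI)
      fix i assume "i < d"
      moreover have "\<pi> a = \<pi> y" using \<pi>P[OF n2(1)] by (simp add: a_def u2_def)
      then have "coord (\<pi> a) i = coord (\<pi> y) i" by simp
      ultimately show "coord a (\<sigma> i) = coord y (\<sigma> i)" by (simp add: coord_\<pi>)
    qed
    have nbad: "\<not> bad \<Lambda> \<eta> y" using rb(2)[of y] y(2) by (auto simp: r_def)
    have alt: "\<not> (\<exists>v\<in>Rn n. in_tangent_bundle \<Gamma> a v \<and> norm v \<le> 1 \<and> (\<forall>w\<in>Rn n. in_tangent_bundle \<Lambda> y w \<longrightarrow> \<eta> \<le> norm (v - w)))"
      "\<not> (\<forall>w\<in>Rn n. in_tangent_bundle \<Lambda> y w \<longrightarrow> \<eta> * norm (y - a) \<le> norm (y - a - w))"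
      using nbad y(1) aC co unfolding bad_def by blast+
    have approx1: "\<exists>w\<in>tangent_space \<Lambda> y. norm (v - w) \<le> \<eta>" if v: "v \<in> tangent_space \<Gamma> a" "norm v \<le> 1" for v
    proof -
      have "v \<in> Rn n" using tangent_space_subset_Rn[OF \<Gamma>R] v(1) by blast
      moreover have "in_tangent_bundle \<Gamma> a v" using v(1) a\<Gamma> by (simp add: in_tangent_bundle_def)
      ultimately obtain w where "in_tangent_bundle \<Lambda> y w" "norm (v - w) < \<eta>" using alt(1) v(2) not_le by blast
      then show ?thesis unfolding in_tangent_bundle_def by (intro bexI[of _ w]) auto
    qed
    have approx: "\<exists>w\<in>tangent_space \<Lambda> y. norm (v - w) \<le> \<eta> * norm v" if v: "v \<in> tangent_space \<Gamma> a" for v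
    proof (cases "v = 0")
      case True
      then show ?thesis using subspace_0[OF sub[OF y(1)]] by (intro bexI[of _ 0]) auto
    next
      case False
      have "inverse (norm v) *\<^sub>R v \<in> tangent_space \<Gamma> a" using v by (rule tangent_space_scaleR)
      moreover have "norm (inverse (norm v) *\<^sub>R v) \<le> 1" using False by simp
      ultimately obtain w where w: "w \<in> tangent_space \<Lambda> y" "norm (inverse (norm v) *\<^sub>R v - w) \<le> \<eta>"
        using approx1 by blast
      have "v - norm v *\<^sub>R w = norm v *\<^sub>R (inverse (norm v) *\<^sub>R v - w)"
        using False by (simp add: scaleR_diff_right)
      then have "norm (v - norm v *\<^sub>R w) = norm v * norm (inverse (norm v) *\<^sub>R v - w)" by simp
      also have "\<dots> \<le> norm v * \<eta>" using w(2) by (rule mult_left_mono) simp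
      finally show ?thesis using tangent_space_scaleR[OF w(1), of "norm v"]
        by (intro bexI[of _ "norm v *\<^sub>R w"]) (simp_all add: mult.commute)
    qed
    obtain w2 where w2: "w2 \<in> tangent_space \<Lambda> y" "norm (y - a - w2) \<le> \<eta> * norm (y - a)"
      using alt(2) unfolding in_tangent_bundle_def by (meson less_imp_le not_le)
    obtain A2 where A2: "sdiff U P u2 A2" using P n2(1) unfolding sC1_def by blast
    define c where "c = u1 - u2"
    have cR: "c \<in> Rn d" unfolding c_def u1_def u2_def by (intro Rn_intros \<pi>_Rn)
    define v where "v = A2 c"
    have vT: "v \<in> tangent_space \<Gamma> a" unfolding v_def a_def by (rule P_derivative[OF A2 n2(1) cR])
    \<comment> \<open>The derivative at u2 gives a vector that is exactly tangent at a, while the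
      derivative at u approximates the increment of P. Strict differentiability at u makes the two
      close.\<close>
    have A2A: "norm (A2 c - A c) \<le> \<eta> * norm c"
    proof (rule tangent_space_bound[OF _ sdiff_bounded_linear[OF A] _ _ sdiff_has_derivative[OF A2 n2(1)]])
      show "c \<in> tangent_space U u2" using tangent_space_U[OF n2(1)] cR by simp
      show "0 < rA - dist u u2" using n2(3) by simp
      fix z assume z: "z \<in> U" "dist u2 z < rA - dist u u2"
      then have "dist u z < rA" using dist_triangle[of u z u2] by simp
      then show "norm (P z - P u2 - A (z - u2)) \<le> \<eta> * norm (z - u2)"
        using z n2 by (intro rA(2)) auto
    qed
    define s where "s = norm (x - y)"
    have cs: "norm c \<le> K * s"
      using norm_\<pi>[of "x - y"] by (simp add: c_def u1_def u2_def \<pi>_diff K_def s_def)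
    have xa: "norm (x - a) \<le> L * norm c"
      using L(3)[OF n1(1) n2(1) n1(2) n2(2)] by (simp add: Pu1 a_def c_def)
    have "norm (x - a - A c) \<le> \<eta> * norm c"
      using rA(2)[OF n1(1) n2(1) n1(3) n2(3)] by (simp add: Pu1 a_def c_def)
    then have xav: "norm (x - a - v) \<le> 2 * (\<eta> * norm c)"
      using A2A norm_triangle_ineq4[of "x - a - A c" "v - A c"] unfolding v_def by simp
    have \<eta>c: "\<eta> * norm c \<le> 1 * norm c" using \<eta>(2) by (rule mult_right_mono) simp
    have vn: "norm v \<le> (L + 2) * norm c"
      using norm_triangle_ineq4[of "x - a" "x - a - v"] xa xav \<eta>c by (simp add: distrib_right)
    obtain w1 where w1: "w1 \<in> tangent_space \<Lambda> y" "norm (v - w1) \<le> \<eta> * norm v" using approx[OF vT] by blast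
    have ya: "norm (y - a) \<le> s + L * norm c"
      using norm_triangle_ineq4[of "x - a" "x - y"] xa by (simp add: s_def)
    have sub': "w1 - w2 \<in> tangent_space \<Lambda> y" using sub[OF y(1)] w1(1) w2(1) by (rule subspace_diff)
    have eq: "x - y - (w1 - w2) = (x - a - v) + ((v - w1) - (y - a - w2))" by simp
    have "norm (x - y - (w1 - w2)) \<le> norm (x - a - v) + (norm (v - w1) + norm (y - a - w2))"
      unfolding eq using norm_triangle_ineq[of "x - a - v" "(v - w1) - (y - a - w2)"] norm_triangle_ineq4[of "v - w1" "y - a - w2"] by linarith
    also have "\<dots> \<le> 2 * (\<eta> * norm c) + (\<eta> * norm v + \<eta> * norm (y - a))"
      using xav w1(2) w2(2) by linarith
    also have "\<dots> = \<eta> * (2 * norm c + norm v + norm (y - a))" by (simp add: algebra_simps)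
    also have "\<dots> \<le> \<eta> * (M * s)"
    proof (rule mult_left_mono)
      have "(L + 2) * norm c \<le> (L + 2) * (K * s)" using cs L(1) by (intro mult_left_mono) auto
      moreover have "L * norm c \<le> L * (K * s)" using cs L(1) by (intro mult_left_mono) auto
      ultimately have "2 * norm c + norm v + norm (y - a) \<le> 2 * (K * s) + (L + 2) * (K * s) + (s + L * (K * s))"
        using cs vn ya by linarith
      also have "\<dots> = M * s" by (simp add: M_def algebra_simps)
      finally show "2 * norm c + norm v + norm (y - a) \<le> M * s" .
    qed (use \<eta> in simp)
    also have "\<dots> = \<eta> * M * s" by simp
    also have "\<dots> \<le> e * s" using \<eta>M by (rule mult_right_mono) (simp add: s_def)
    finally show "\<exists>w\<in>tangent_space \<Lambda> y. norm (x - y - w) \<le> e * norm (x - y)"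
      using sub' by (intro bexI[of _ "w1 - w2"]) (simp_all add: s_def)
  qed
qed

text \<open>A wing over \<open>\<Gamma>\<close> whose derivatives are close to those of a cone over \<open>\<Gamma>\<close> avoids the bad points.\<close>

lemma not_bad_on_wing:
  assumes box: "z \<in> B" "open_in_Rn (Suc d) B" and BU: "vtrunc d ` B \<subseteq> U" and s: "sdiff B g z S"
    and g\<Lambda>: "\<And>y. y \<in> B \<Longrightarrow> P (vtrunc d y) + g y \<in> \<Lambda>" and gR: "\<And>y. y \<in> B \<Longrightarrow> g y \<in> Rn n"
    and g\<pi>: "\<pi> (g z) = 0" and PW: "P (vtrunc d z) \<in> W" and gz: "norm (g z) = coord z d" "coord z d > 0"
    and hor: "\<And>i j. i < d \<Longrightarrow> j < n \<Longrightarrow> \<bar>coord (S (unitv i)) j\<bar> \<le> \<eta>"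
    and ver: "\<And>j. j < n \<Longrightarrow> \<bar>coord z d * coord (S (unitv d)) j - coord (g z) j\<bar> \<le> \<eta> * coord z d"
    and \<eta>: "real (n * d) * \<eta> < e" "real n * \<eta> < e"
    and \<Lambda>R: "\<Lambda> \<subseteq> Rn n"
  shows "\<not> bad \<Lambda> e (P (vtrunc d z) + g z)"
proof
  define u where "u = vtrunc d z"
  define b where "b = P u + g z"
  have BR: "B \<subseteq> Rn (Suc d)" using box(2) openin_imp_subset by blast
  have uU: "u \<in> U" using box(1) BU by (auto simp: u_def)
  obtain A where A: "sdiff U P u A" using P uU unfolding sC1_def by blast
  have linS: "linear S" using s sdiff_bounded_linear bounded_linear.linear by blast
  have linA: "linear A" using A sdiff_bounded_linear bounded_linear.linear by blast
  have "sdiff B (\<lambda>y. P (vtrunc d y)) z (\<lambda>h. A (vtrunc d h))"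
    by (rule sdiff_compose[OF sdiff_bounded_linear_self[OF bounded_linear_vtrunc] _ BU box(1)])
       (use A in \<open>simp add: u_def\<close>)
  from sdiff_has_derivative[OF sdiff_add[OF this s] box(1)]
  have der: "((\<lambda>y. P (vtrunc d y) + g y) has_derivative (\<lambda>h. A (vtrunc d h) + S h)) (at z within B)" .
  \<comment> \<open>Differentiating the wing yields tangent vectors of \<Lambda>: A c + S c in a
    horizontal direction c, and \<open>S (unitv d)\<close> in the radial one.\<close>
  have tan: "A (vtrunc d h) + S h \<in> tangent_space \<Lambda> b" if "h \<in> Rn (Suc d)" for h
  proof -
    have "B \<inter> Rn (Suc d) = B" using BR by blast
    then have "h \<in> tangent_space B z"
      using tangent_space_open[OF box(2,1), of "Suc d"] box(1) BR that by auto
    from tangent_space_image_subset[OF der _ this, of \<Lambda>] g\<Lambda>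
    show ?thesis by (auto simp: b_def u_def)
  qed
  have SR: "S h \<in> Rn n" if "h \<in> Rn (Suc d)" for h
  proof -
    have "B \<inter> Rn (Suc d) = B" using BR by blast
    then have "h \<in> tangent_space B z"
      using tangent_space_open[OF box(2,1), of "Suc d"] box(1) BR that by auto
    from tangent_space_image_subset[OF sdiff_has_derivative[OF s box(1)] _ this, of "Rn n"] gR
    have "S h \<in> tangent_space (Rn n) (g z)" by auto
    then show ?thesis using tangent_space_subset_Rn[of "Rn n" n] by blast
  qed
  assume "bad \<Lambda> e (P (vtrunc d z) + g z)"
  then obtain a where a: "a \<in> C" "\<forall>i<d. coord a (\<sigma> i) = coord b (\<sigma> i)" and b\<Lambda>: "b \<in> \<Lambda>"
    and alt: "(\<exists>v\<in>Rn n. in_tangent_bundle \<Gamma> a v \<and> norm v \<le> 1 \<and> (\<forall>w\<in>Rn n. in_tangent_bundle \<Lambda> b w \<longrightarrow> e \<le> norm (v - w))) \<or>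
      (\<forall>w\<in>Rn n. in_tangent_bundle \<Lambda> b w \<longrightarrow> e * norm (b - a) \<le> norm (b - a - w))"
    unfolding bad_def b_def u_def by blast
  have "\<pi> a = \<pi> b" using a(2) by (intro evec_eqI) (simp add: coord_\<pi>)
  also have "\<dots> = u"
    using linear_add[OF bounded_linear.linear[OF bounded_linear_\<pi>], of "P u" "g z"] g\<pi> \<pi>P[OF uU] by (simp add: b_def)
  finally have aP: "a = P u" using P\<pi>(2)[OF a(1)] by simp
  have in_tb: "in_tangent_bundle \<Lambda> b w \<longleftrightarrow> w \<in> tangent_space \<Lambda> b" for w
    using b\<Lambda> by (simp add: in_tangent_bundle_def)
  have TR: "tangent_space \<Lambda> b \<subseteq> Rn n" by (rule tangent_space_subset_Rn[OF \<Lambda>R])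
  from alt show False
  proof
    assume "\<exists>v\<in>Rn n. in_tangent_bundle \<Gamma> a v \<and> norm v \<le> 1 \<and> (\<forall>w\<in>Rn n. in_tangent_bundle \<Lambda> b w \<longrightarrow> e \<le> norm (v - w))"
    then obtain v where v: "v \<in> tangent_space \<Gamma> a" "norm v \<le> 1"
      and far: "\<And>w. w \<in> tangent_space \<Lambda> b \<Longrightarrow> e \<le> norm (v - w)"
      using in_tb TR unfolding in_tangent_bundle_def[of \<Gamma>] by blast
    \<comment> \<open>The wing moved in the direction c = \<pi> v has velocity v + S c. Each of the
      n components of S c is a sum of d terms of size at most \<eta>, whence the factor n d.\<close>
    define c where "c = \<pi> v"
    have vA: "v = A c" unfolding c_def using tangent_space_patch[OF A uU _ v(1)[unfolded aP]] PW by (simp add: u_def)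
    have cR: "c \<in> Rn d" "c \<in> Rn (Suc d)" using Rn_mono[of d "Suc d"] by (auto simp: c_def subset_iff)
    have "A (vtrunc d c) + S c \<in> tangent_space \<Lambda> b" by (rule tan[OF cR(2)])
    then have "A c + S c \<in> tangent_space \<Lambda> b" using cR(1) by simp
    from far[OF this] have "e \<le> norm (S c)" using vA by simp
    also have "norm (S c) \<le> (\<Sum>j<n. \<bar>coord (S c) j\<bar>)" by (rule norm_le_sum_coord[OF SR[OF cR(2)]])
    also have "\<dots> \<le> (\<Sum>j<n. real d * \<eta>)"
    proof (rule sum_mono)
      fix j assume "j \<in> {..<n}"
      then have j: "j < n" by simp
      have "S c = S (\<Sum>i<d. coord c i *\<^sub>R unitv i)" using Rn_expand[OF cR(1)] by simp
      also have "\<dots> = (\<Sum>i<d. coord c i *\<^sub>R S (unitv i))"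
        by (simp add: linear_sum[OF linS] linear_scale[OF linS])
      finally have "coord (S c) j = (\<Sum>i<d. coord c i * coord (S (unitv i)) j)" by simp
      also have "\<bar>\<dots>\<bar> \<le> (\<Sum>i<d. \<bar>coord c i * coord (S (unitv i)) j\<bar>)" by (rule sum_abs)
      also have "\<dots> \<le> (\<Sum>i<d. 1 * \<eta>)"
      proof (rule sum_mono)
        fix i assume "i \<in> {..<d}"
        then have i: "i < d" by simp
        have "\<bar>coord c i\<bar> \<le> 1" using abs_coord_le_norm[of v "\<sigma> i"] v(2) i by (simp add: c_def coord_\<pi>)
        then show "\<bar>coord c i * coord (S (unitv i)) j\<bar> \<le> 1 * \<eta>"
          unfolding abs_mult using hor[OF i j] by (intro mult_mono) auto
      qed
      finally show "\<bar>coord (S c) j\<bar> \<le> real d * \<eta>" by simp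
    qed
    also have "\<dots> = real (n * d) * \<eta>" by simp
    finally show False using \<eta>(1) by simp
  next
    assume "\<forall>w\<in>Rn n. in_tangent_bundle \<Lambda> b w \<longrightarrow> e * norm (b - a) \<le> norm (b - a - w)"
    then have far: "e * norm (b - a) \<le> norm (b - a - w)" if "w \<in> tangent_space \<Lambda> b" for w
      using that TR in_tb by blast
    have ba: "b - a = g z" by (simp add: b_def aP)
    \<comment> \<open>On a cone, g would be homogeneous in t and t times the radial derivative would
      equal g; here this holds up to \<eta> t in each of the n components.\<close>
    define t where "t = coord z d"
    have "vtrunc d (unitv d) = 0" by (intro evec_eqI) simp
    then have "S (unitv d) \<in> tangent_space \<Lambda> b" using tan[of "unitv d"] linear_0[OF linA] by simp
    then have "t *\<^sub>R S (unitv d) \<in> tangent_space \<Lambda> b" by (rule tangent_space_scaleR)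
    from far[OF this] have "e * t \<le> norm (g z - t *\<^sub>R S (unitv d))" using gz(1) by (simp add: ba t_def)
    also have "\<dots> \<le> (\<Sum>j<n. \<bar>coord (g z - t *\<^sub>R S (unitv d)) j\<bar>)"
      using gR[OF box(1)] SR[of "unitv d"] by (intro norm_le_sum_coord Rn_intros) auto
    also have "\<dots> \<le> (\<Sum>j<n. \<eta> * t)"
      using ver by (intro sum_mono) (simp add: t_def abs_minus_commute)
    also have "\<dots> = real n * \<eta> * t" by simp
    also have "\<dots> < e * t" using \<eta>(2) gz(2) by (intro mult_strict_right_mono) (auto simp: t_def)
    finally show False by simp
  qed
qed

end

section \<open>One-variable estimates for the derivatives of a wing\<close>

lemma no_large_horizontal_derivative:
  fixes f f' :: "real \<Rightarrow> real"
  assumes "\<And>x. 0 \<le> x \<Longrightarrow> x \<le> l \<Longrightarrow> (f has_real_derivative f' x) (at x)"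
    "\<And>x. 0 \<le> x \<Longrightarrow> x \<le> l \<Longrightarrow> \<eta> \<le> f' x" "\<And>x. 0 \<le> x \<Longrightarrow> x \<le> l \<Longrightarrow> \<bar>f x\<bar> \<le> t" "0 < l"
  shows "\<eta> * l \<le> 2 * t"
proof -
  \<comment> \<open>A slope of at least \<eta> over a length l changes f by at least \<eta> l, while
    f stays within t of 0. For fixed l and small t this will be absurd.\<close>
  obtain x where x: "0 < x" "x < l" "f l - f 0 = (l - 0) * f' x"
    using MVT2[of 0 l f f'] assms(1,4) by blast
  have "\<eta> * l \<le> l * f' x" using assms(2)[of x] x assms(4) by (simp add: mult.commute)
  moreover have "\<bar>f 0\<bar> \<le> t" "\<bar>f l\<bar> \<le> t" using assms(3,4) by simp_all
  moreover have "f l - f 0 = l * f' x" using x(3) by simp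
  ultimately show ?thesis by linarith
qed

text \<open>The derivative of \<open>f t / t - \<eta> ln t\<close> would be nonnegative, but this function tends to infinity at 0.\<close>

lemma no_large_radial_derivative:
  fixes f f' :: "real \<Rightarrow> real"
  assumes der: "\<And>t. 0 < t \<Longrightarrow> t < \<tau> \<Longrightarrow> (f has_real_derivative f' t) (at t)"
    and ge: "\<And>t. 0 < t \<Longrightarrow> t < \<tau> \<Longrightarrow> \<eta> * t + f t \<le> t * f' t"
    and b: "\<And>t. 0 < t \<Longrightarrow> t < \<tau> \<Longrightarrow> \<bar>f t\<bar> \<le> t" and \<eta>: "0 < \<eta>" and \<tau>: "0 < \<tau>"
  shows False
proof -
  define \<psi> where "\<psi> t = f t / t - \<eta> * ln t" for t
  define t2 where "t2 = \<tau> / 2"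
  have t2: "0 < t2" "t2 < \<tau>" using \<tau> by (auto simp: t2_def)
  have \<psi>': "(\<psi> has_real_derivative (f' t * t - f t) / (t * t) - \<eta> * (1 / t)) (at t)" if "0 < t" "t < \<tau>" for t
    unfolding \<psi>_def using der[OF that] that by (auto intro!: derivative_eq_intros)
  have mono: "\<psi> t \<le> \<psi> t2" if "0 < t" "t < t2" for t
  proof (rule DERIV_nonneg_imp_nondecreasing[of t t2 \<psi>])
    show "t \<le> t2" using that by simp
    fix x assume x: "t \<le> x" "x \<le> t2"
    then have x': "0 < x" "x < \<tau>" using that t2 by auto
    have "(f' x * x - f x) / (x * x) - \<eta> * (1 / x) = (x * f' x - f x - \<eta> * x) / (x * x)"
      using x'(1) by (simp add: field_simps)
    also have "\<dots> \<ge> 0" using ge[OF x'] x'(1) by (intro divide_nonneg_pos) auto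
    finally show "\<exists>y. (\<psi> has_real_derivative y) (at x) \<and> 0 \<le> y" using \<psi>'[OF x'] by blast
  qed
  \<comment> \<open>The exponent makes -\<eta> ln t at least |\<psi> t2| + 2; as f t / t is at least
    -1, this pushes \<psi> t above \<psi> t2.\<close>
  define t where "t = min (t2 / 2) (exp (- ((\<bar>\<psi> t2\<bar> + 2) / \<eta>)))"
  have t: "0 < t" "t < t2" using t2 by (auto simp: t_def)
  have "ln t \<le> ln (exp (- ((\<bar>\<psi> t2\<bar> + 2) / \<eta>)))" using t(1) by (intro ln_mono) (auto simp: t_def)
  then have "ln t \<le> - ((\<bar>\<psi> t2\<bar> + 2) / \<eta>)" by simp
  then have "\<eta> * ln t \<le> \<eta> * - ((\<bar>\<psi> t2\<bar> + 2) / \<eta>)" using \<eta> by (intro mult_left_mono) auto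
  then have "\<eta> * ln t \<le> - (\<bar>\<psi> t2\<bar> + 2)" using \<eta> by simp
  moreover have "- 1 \<le> f t / t" using b[of t] t t2 by (simp add: field_simps abs_le_iff)
  ultimately have "\<bar>\<psi> t2\<bar> + 1 \<le> \<psi> t" by (simp add: \<psi>_def)
  then show False using mono[OF t] by simp
qed

text \<open>A strict inequality for the derivative gives the inequality for small increments, and
  this gives back the weak one. The pair replaces a formula for the derivative itself by one about
  difference quotients, at the price of the case of equality.\<close>

lemma has_real_derivative_slope:
  fixes f :: "real \<Rightarrow> real"
  assumes f: "(f has_real_derivative p) (at 0)"
  shows "Q < c * p \<Longrightarrow> \<exists>\<eta>>0. \<forall>h. 0 < h \<longrightarrow> h < \<eta> \<longrightarrow> Q * h \<le> c * (f h - f 0)"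
    and "\<eta> > 0 \<Longrightarrow> (\<And>h. 0 < h \<Longrightarrow> h < \<eta> \<Longrightarrow> Q * h \<le> c * (f h - f 0)) \<Longrightarrow> Q \<le> c * p"
proof -
  have "((\<lambda>h. (f h - f 0) / (h - 0)) \<longlongrightarrow> p) (at_right 0)"
    using f unfolding has_field_derivative_iff by (rule filterlim_mono) (auto intro: at_le)
  then have lim: "((\<lambda>h. c * ((f h - f 0) / h)) \<longlongrightarrow> c * p) (at_right 0)"
    by (intro tendsto_mult_left) simp
  show "\<exists>\<eta>>0. \<forall>h. 0 < h \<longrightarrow> h < \<eta> \<longrightarrow> Q * h \<le> c * (f h - f 0)" if "Q < c * p"
  proof -
    have "\<forall>\<^sub>F h in at_right 0. Q < c * ((f h - f 0) / h)" using lim that by (rule order_tendstoD)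
    then obtain \<eta> where \<eta>: "\<eta> > 0" "\<And>h. 0 < h \<Longrightarrow> h < \<eta> \<Longrightarrow> Q < c * ((f h - f 0) / h)"
      unfolding eventually_at_right_field by blast
    have "Q * h \<le> c * (f h - f 0)" if h: "0 < h" "h < \<eta>" for h
    proof -
      have "Q * h \<le> c * ((f h - f 0) / h) * h" using \<eta>(2)[OF h] h(1) by (intro mult_right_mono) auto
      then show ?thesis using h(1) by simp
    qed
    then show ?thesis using \<eta>(1) by blast
  qed
  assume \<eta>: "\<eta> > 0" and le: "\<And>h. 0 < h \<Longrightarrow> h < \<eta> \<Longrightarrow> Q * h \<le> c * (f h - f 0)"
  have "\<forall>\<^sub>F h in at_right 0. Q \<le> c * ((f h - f 0) / h)"
    unfolding eventually_at_right_field
  proof (intro exI[of _ \<eta>] conjI allI impI \<eta>)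
    fix h assume h: "0 < h" "h < \<eta>"
    then have "Q * h / h \<le> c * (f h - f 0) / h" using le by (intro divide_right_mono) auto
    then show "Q \<le> c * ((f h - f 0) / h)" using h(1) by simp
  qed
  then show "Q \<le> c * p" by (rule tendsto_lowerbound[OF lim]) simp
qed

lemma has_real_derivative_along_unitv:
  assumes B: "open_in_Rn m B" and z: "a + x *\<^sub>R unitv i \<in> B" and i: "i < m" and a: "a \<in> Rn m"
    and g: "sdiff B g (a + x *\<^sub>R unitv i) S"
  shows "((\<lambda>x. coord (g (a + x *\<^sub>R unitv i)) j) has_real_derivative coord (S (unitv i)) j) (at x)"
proof -
  obtain r where r: "r > 0" "\<And>y. y \<in> Rn m \<Longrightarrow> dist (a + x *\<^sub>R unitv i) y < r \<Longrightarrow> y \<in> B"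
    using open_in_Rn_ball[OF B z] by blast
  define T where "T = {x - r<..<x + r}"
  define c where "c x = a + x *\<^sub>R unitv i" for x :: real
  have cT: "c ` T \<subseteq> B"
  proof
    fix y assume "y \<in> c ` T"
    then obtain x' where x': "x' \<in> T" "y = c x'" by blast
    have "a + x *\<^sub>R unitv i - c x' = (x - x') *\<^sub>R unitv i" by (simp add: c_def scaleR_diff_left)
    then have "dist (a + x *\<^sub>R unitv i) (c x') = \<bar>x - x'\<bar>" by (simp add: dist_norm)
    then show "y \<in> B" using x' i a by (auto intro!: r(2) simp: T_def c_def)
  qed
  have at: "at x within T = at x" by (rule at_within_open) (use r(1) in \<open>auto simp: T_def\<close>)
  have "(c has_derivative (\<lambda>h. h *\<^sub>R unitv i)) (at x within T)"
    unfolding c_def by (auto intro!: derivative_eq_intros)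
  moreover have "(g has_derivative S) (at (c x) within c ` T)"
    using has_derivative_subset[OF sdiff_has_derivative[OF g z] cT] by (simp add: c_def)
  ultimately have "((\<lambda>x. g (c x)) has_derivative (\<lambda>h. S (h *\<^sub>R unitv i))) (at x within T)"
    by (rule has_derivative_in_compose)
  from bounded_linear.has_derivative[OF bounded_linear_coord this[unfolded at]]
  have "((\<lambda>x. coord (g (c x)) j) has_derivative (\<lambda>h. coord (S (h *\<^sub>R unitv i)) j)) (at x)" .
  moreover have "(\<lambda>h. coord (S (h *\<^sub>R unitv i)) j) = (*) (coord (S (unitv i)) j)"
    using linear_scale[OF bounded_linear.linear[OF sdiff_bounded_linear[OF g]]] by (auto simp: mult.commute)
  ultimately show ?thesis by (simp add: has_field_derivative_def c_def)
qed

section \<open>Definable wings and the contradiction\<close>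

context o_minimal_structure
begin

text \<open>The constant e is treated as a coordinate next to b, so that \<open>bad\<close> is
  definable in both jointly. This allows e to vary with the point later.\<close>

lemma Def_bad:
  assumes patch: "patch n d U P \<sigma> C \<Gamma> W" and q: "q \<noteq> C_fin 0"
    and \<Lambda>: "submanifold q n d1 \<Lambda>" "\<Lambda> \<in> D n" and \<Gamma>: "submanifold q n d2 \<Gamma>" "\<Gamma> \<in> D n" and C: "C \<in> D n"
    and f: "dterm N f" and F: "dvec N n F"
  shows "Def N (\<lambda>x. patch.bad n d \<sigma> C \<Gamma> \<Lambda> (f x) (F x))"
proof -
  interpret patch n d U P \<sigma> C \<Gamma> W by (rule patch)
  have "Def (Suc n) (\<lambda>z. bad \<Lambda> (coord z n) (vtrunc n z))"
    unfolding bad_def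
    by (intro Def_intros Def_mem[OF \<Lambda>(2)] Def_bex[OF C] Def_bex[OF Rn_in_D] Def_ball[OF Rn_in_D] Def_all_less
          Def_tangent_bundle[OF \<Gamma>(1) q \<Gamma>(2)] Def_tangent_bundle[OF \<Lambda>(1) q \<Lambda>(2)] dterm_norm[where k = n])
       (auto simp: dvec_def Rn_iff dest!: \<sigma> intro!: dterm_coord_self)
  then have A: "{z \<in> Rn (Suc n). bad \<Lambda> (coord z n) (vtrunc n z)} \<in> D (Suc n)" by (simp add: Def_def)
  have "dvec N (Suc n) (\<lambda>x. vsnoc n (F x) (f x))"
    unfolding dvec_def
  proof (intro conjI ballI allI impI)
    fix i assume "i < Suc n"
    then show "dterm N (\<lambda>x. coord (vsnoc n (F x) (f x)) i)"
      using f F by (cases "i = n") (auto simp: dvec_def)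
  qed auto
  from Def_mem[OF A this] show ?thesis
  proof (rule Def_cong)
    fix x assume "x \<in> Rn N"
    then have "F x \<in> Rn n" using F by (simp add: dvec_def)
    then show "vsnoc n (F x) (f x) \<in> {z \<in> Rn (Suc n). bad \<Lambda> (coord z n) (vtrunc n z)} \<longleftrightarrow> bad \<Lambda> (f x) (F x)"
      by simp
  qed
qed

text \<open>The set of the points of \<open>Rn (Suc d)\<close> at which the derivative \<open>p\<close> of the \<open>j\<close>-th component \<open>y\<close> of
  the function with graph \<open>\<Sigma>\<close> in the \<open>i\<close>-th direction satisfies \<open>t p \<ge> \<eta> t + \<kappa> y\<close>, up to points of
  equality; here \<open>t\<close> is the last coordinate and \<open>s\<close> a sign applied to \<open>y\<close> and \<open>p\<close>.\<close>

definition slope_set :: "nat \<Rightarrow> evec set \<Rightarrow> real \<Rightarrow> nat \<Rightarrow> nat \<Rightarrow> real \<Rightarrow> real \<Rightarrow> evec set" where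
  "slope_set d \<Sigma> \<eta> i j s \<kappa> = {z \<in> Rn (Suc d). \<exists>\<eta>'. 0 < \<eta>' \<and> (\<forall>h. 0 < h \<longrightarrow> h < \<eta>' \<longrightarrow>
     (\<exists>y\<in>\<Sigma>. \<exists>y'\<in>\<Sigma>. norm (vtrunc (Suc d) y - z) \<le> 0 \<and> norm (vtrunc (Suc d) y' - (z + h *\<^sub>R unitv i)) \<le> 0 \<and>
        (\<eta> * coord z d + \<kappa> * (s * coord y (Suc d + j))) * h
          \<le> coord z d * (s * (coord y' (Suc d + j) - coord y (Suc d + j)))))}"

lemma slope_set_in_D:
  assumes "\<Sigma> \<in> D (Suc d + n)" "i < Suc d" "j < n"
  shows "slope_set d \<Sigma> \<eta> i j s \<kappa> \<in> D (Suc d)"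
proof -
  have "Def (Suc d) (\<lambda>z. \<exists>\<eta>'. 0 < \<eta>' \<and> (\<forall>h. 0 < h \<longrightarrow> h < \<eta>' \<longrightarrow>
     (\<exists>y\<in>\<Sigma>. \<exists>y'\<in>\<Sigma>. norm (vtrunc (Suc d) y - z) \<le> 0 \<and> norm (vtrunc (Suc d) y' - (z + h *\<^sub>R unitv i)) \<le> 0 \<and>
        (\<eta> * coord z d + \<kappa> * (s * coord y (Suc d + j))) * h
          \<le> coord z d * (s * (coord y' (Suc d + j) - coord y (Suc d + j))))))"
    using assms(2,3)
    by (intro Def_intros Def_bex[OF assms(1)] dterm_norm[where k = "Suc d"] dvec_const)
       (auto simp: dvec_def Rn_iff intro!: dterm_coord_self)
  then show ?thesis by (simp add: slope_set_def Def_def)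
qed

lemma slope_set_derivative:
  fixes \<eta> \<kappa> sg :: real and j :: nat
  assumes B: "open_in_Rn (Suc d) B" and \<Sigma>: "\<And>y. y \<in> B \<Longrightarrow> s y \<in> \<Sigma> \<and> vtrunc (Suc d) (s y) = y"
    "\<And>y. y \<in> \<Sigma> \<Longrightarrow> y = s (vtrunc (Suc d) y)"
    and z: "z \<in> B" and S: "sdiff B (\<lambda>y. vdrop (Suc d) (s y)) z S" and i: "i < Suc d"
  defines "l \<equiv> \<eta> * coord z d + \<kappa> * (sg * coord (vdrop (Suc d) (s z)) j)"
    and "p \<equiv> coord z d * (sg * coord (S (unitv i)) j)"
  shows "l < p \<Longrightarrow> z \<in> slope_set d \<Sigma> \<eta> i j sg \<kappa>" "z \<in> slope_set d \<Sigma> \<eta> i j sg \<kappa> \<Longrightarrow> l \<le> p"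
proof -
  define f where "f h = coord (vdrop (Suc d) (s (z + h *\<^sub>R unitv i))) j" for h
  have zR: "z \<in> Rn (Suc d)" using z B openin_imp_subset by blast
  have der: "(f has_real_derivative coord (S (unitv i)) j) (at 0)"
    unfolding f_def
    by (rule has_real_derivative_along_unitv[OF B _ i zR]) (use z S in auto)
  have f0: "f 0 = coord (vdrop (Suc d) (s z)) j" by (simp add: f_def)
  have p: "p = (coord z d * sg) * coord (S (unitv i)) j" by (simp add: p_def)
  obtain r where r: "r > 0" "\<And>y. y \<in> Rn (Suc d) \<Longrightarrow> dist z y < r \<Longrightarrow> y \<in> B"
    using open_in_Rn_ball[OF B z] by blast
  show "z \<in> slope_set d \<Sigma> \<eta> i j sg \<kappa>" if lp: "l < p"
  proof -
    obtain \<eta>' where \<eta>': "\<eta>' > 0" "\<And>h. 0 < h \<Longrightarrow> h < \<eta>' \<Longrightarrow> l * h \<le> (coord z d * sg) * (f h - f 0)"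
      using has_real_derivative_slope(1)[OF der lp[unfolded p]] by blast
    have "\<exists>y\<in>\<Sigma>. \<exists>y'\<in>\<Sigma>. norm (vtrunc (Suc d) y - z) \<le> 0 \<and> norm (vtrunc (Suc d) y' - (z + h *\<^sub>R unitv i)) \<le> 0 \<and>
        (\<eta> * coord z d + \<kappa> * (sg * coord y (Suc d + j))) * h
          \<le> coord z d * (sg * (coord y' (Suc d + j) - coord y (Suc d + j)))"
      if h: "0 < h" "h < min \<eta>' r" for h
    proof -
      have zh: "z + h *\<^sub>R unitv i \<in> B" using h zR i by (intro r(2)) (auto simp: dist_norm)
      define y' where "y' = s (z + h *\<^sub>R unitv i)"
      have mem: "s z \<in> \<Sigma>" "y' \<in> \<Sigma>" using \<Sigma>(1) z zh by (auto simp: y'_def)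
      have "norm (vtrunc (Suc d) (s z) - z) \<le> 0" using \<Sigma>(1)[OF z] by simp
      moreover have "norm (vtrunc (Suc d) y' - (z + h *\<^sub>R unitv i)) \<le> 0"
        using \<Sigma>(1)[OF zh] by (simp add: y'_def)
      moreover have "(\<eta> * coord z d + \<kappa> * (sg * coord (s z) (Suc d + j))) * h
          \<le> coord z d * (sg * (coord y' (Suc d + j) - coord (s z) (Suc d + j)))"
        using \<eta>'(2)[of h] h unfolding l_def f_def y'_def by (simp add: mult.assoc)
      ultimately have "\<exists>y'\<in>\<Sigma>. norm (vtrunc (Suc d) (s z) - z) \<le> 0 \<and> norm (vtrunc (Suc d) y' - (z + h *\<^sub>R unitv i)) \<le> 0 \<and>
        (\<eta> * coord z d + \<kappa> * (sg * coord (s z) (Suc d + j))) * h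
          \<le> coord z d * (sg * (coord y' (Suc d + j) - coord (s z) (Suc d + j)))"
        by (intro bexI[OF _ mem(2)] conjI)
      then show ?thesis by (rule bexI[OF _ mem(1)])
    qed
    then show ?thesis unfolding slope_set_def using zR \<eta>'(1) r(1)
      by (intro CollectI conjI exI[of _ "min \<eta>' r"]) auto
  qed
  assume "z \<in> slope_set d \<Sigma> \<eta> i j sg \<kappa>"
  then obtain \<eta>' where \<eta>': "\<eta>' > 0" "\<And>h. 0 < h \<Longrightarrow> h < \<eta>' \<Longrightarrow>
     \<exists>y\<in>\<Sigma>. \<exists>y'\<in>\<Sigma>. norm (vtrunc (Suc d) y - z) \<le> 0 \<and> norm (vtrunc (Suc d) y' - (z + h *\<^sub>R unitv i)) \<le> 0 \<and>
        (\<eta> * coord z d + \<kappa> * (sg * coord y (Suc d + j))) * h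
          \<le> coord z d * (sg * (coord y' (Suc d + j) - coord y (Suc d + j)))"
    unfolding slope_set_def by blast
  have "l * h \<le> (coord z d * sg) * (f h - f 0)" if h: "0 < h" "h < \<eta>'" for h
  proof -
    obtain y y' where y: "y \<in> \<Sigma>" "y' \<in> \<Sigma>" "norm (vtrunc (Suc d) y - z) \<le> 0" "norm (vtrunc (Suc d) y' - (z + h *\<^sub>R unitv i)) \<le> 0"
      "(\<eta> * coord z d + \<kappa> * (sg * coord y (Suc d + j))) * h
          \<le> coord z d * (sg * (coord y' (Suc d + j) - coord y (Suc d + j)))"
      using \<eta>'(2)[OF h] by blast
    have "vtrunc (Suc d) y = z" "vtrunc (Suc d) y' = z + h *\<^sub>R unitv i" using y(3,4) by auto
    then have "y = s z" "y' = s (z + h *\<^sub>R unitv i)" using \<Sigma>(2)[OF y(1)] \<Sigma>(2)[OF y(2)] by auto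
    then show ?thesis using y(5) unfolding l_def f_def by (simp add: mult.assoc)
  qed
  from has_real_derivative_slope(2)[OF der \<eta>'(1) this] show "l \<le> p" unfolding p by simp
qed

text \<open>Take a smaller box compatible with the slope sets for every direction, component and
  sign. A bound violated at one of its points is violated, weakly, at all of them: along a
  horizontal segment at tiny height, or along a whole vertical segment down to t = 0. Both
  contradict the one-variable estimates because |g| = t. Hence any point of the smaller box serves
  as witness.\<close>

lemma wing_derivative_bounds:
  assumes adm: "admits_cell_decompositions D q" and q: "q \<noteq> C_fin 0" and \<Sigma>D: "\<Sigma> \<in> D (Suc d + n)"
    and u1: "u1 \<in> Rn d" "r1 > 0" "\<tau>1 > 0" and \<eta>: "\<eta> > 0"
  defines "B \<equiv> wing_box d u1 r1 \<tau>1"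
  assumes \<Sigma>: "\<And>y. y \<in> B \<Longrightarrow> s y \<in> \<Sigma> \<and> vtrunc (Suc d) (s y) = y" "\<And>y. y \<in> \<Sigma> \<Longrightarrow> y = s (vtrunc (Suc d) y)"
    and S: "\<And>z. z \<in> B \<Longrightarrow> sdiff B (\<lambda>y. vdrop (Suc d) (s y)) z (S z)"
    and small: "\<And>z. z \<in> B \<Longrightarrow> norm (vdrop (Suc d) (s z)) = coord z d"
  shows "\<exists>z\<in>B. (\<forall>i<d. \<forall>j<n. \<bar>coord (S z (unitv i)) j\<bar> \<le> \<eta>) \<and>
    (\<forall>j<n. \<bar>coord z d * coord (S z (unitv d)) j - coord (vdrop (Suc d) (s z)) j\<bar> \<le> \<eta> * coord z d)"
proof -
  let ?g = "\<lambda>y. vdrop (Suc d) (s y)"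
  \<comment> \<open>In the radial direction the quantity to be bounded is t times the derivative
    minus the component of g itself; in horizontal directions it is the derivative alone.\<close>
  define \<kappa> where "\<kappa> i = (if i = d then 1 else 0 :: real)" for i
  define \<A> where "\<A> = (\<lambda>(i, j, sg). slope_set d \<Sigma> \<eta> i j sg (\<kappa> i)) ` ({..<Suc d} \<times> {..<n} \<times> {1, -1})"
  have V1: "open_in_Rn d (Rn d \<inter> ball u1 r1)" "Rn d \<inter> ball u1 r1 \<noteq> {}"
    using u1 by (auto intro: openin_open_Int)
  have "\<exists>u r \<tau>. u \<in> Rn d \<and> r > 0 \<and> \<tau> > 0 \<and> Rn d \<inter> ball u r \<subseteq> Rn d \<inter> ball u1 r1 \<and>
    (\<forall>A\<in>\<A>. wing_box d u r \<tau> \<subseteq> A \<or> wing_box d u r \<tau> \<inter> A = {})"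
    by (rule wing_box_compatible[OF adm q _ _ V1]) (auto simp: \<A>_def intro: slope_set_in_D[OF \<Sigma>D])
  then obtain u r \<tau>2 where w0: "u \<in> Rn d \<and> r > 0 \<and> \<tau>2 > 0 \<and> Rn d \<inter> ball u r \<subseteq> Rn d \<inter> ball u1 r1 \<and>
    (\<forall>A\<in>\<A>. wing_box d u r \<tau>2 \<subseteq> A \<or> wing_box d u r \<tau>2 \<inter> A = {})" by (elim exE) (rule that)
  then have w: "u \<in> Rn d" "r > 0" "\<tau>2 > 0" "Rn d \<inter> ball u r \<subseteq> Rn d \<inter> ball u1 r1" by simp_all
  define \<tau> where "\<tau> = min \<tau>1 \<tau>2"
  define B2 where "B2 = wing_box d u r \<tau>"
  have \<tau>: "\<tau> > 0" using w(3) u1(3) by (simp add: \<tau>_def)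
  have B2B: "B2 \<subseteq> B" unfolding B2_def B_def by (rule wing_box_mono) (use w(4) in \<open>auto simp: \<tau>_def\<close>)
  have B2': "B2 \<subseteq> wing_box d u r \<tau>2" unfolding B2_def by (rule wing_box_mono) (auto simp: \<tau>_def)
  have openB: "open_in_Rn (Suc d) B" unfolding B_def by (rule open_wing_box)
  have BR: "B \<subseteq> Rn (Suc d)" using openB openin_imp_subset by blast
  have tpos: "coord z d > 0" if "z \<in> B" for z using that by (simp add: B_def wing_box_def)
  have compat: "B2 \<subseteq> slope_set d \<Sigma> \<eta> i j sg (\<kappa> i) \<or> B2 \<inter> slope_set d \<Sigma> \<eta> i j sg (\<kappa> i) = {}"
    if "i < Suc d" "j < n" "sg \<in> {1, -1}" for i j sg
  proof -
    have "slope_set d \<Sigma> \<eta> i j sg (\<kappa> i) \<in> \<A>" unfolding \<A>_def using that by force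
    then show ?thesis using w0 B2' by blast
  qed
  have everywhere: "\<eta> * coord z' d + \<kappa> i * (sg * coord (?g z') j) \<le> coord z' d * (sg * coord (S z' (unitv i)) j)"
    if z: "z \<in> B2" and lt: "\<eta> * coord z d + \<kappa> i * (sg * coord (?g z) j) < coord z d * (sg * coord (S z (unitv i)) j)"
      and z': "z' \<in> B2" and ij: "i < Suc d" "j < n" "sg \<in> {1, -1}" for z z' i j sg
  proof -
    have zB: "z \<in> B" "z' \<in> B" using z z' B2B by auto
    have "z \<in> slope_set d \<Sigma> \<eta> i j sg (\<kappa> i)" 
      by (rule slope_set_derivative(1)[OF openB _ _ zB(1) S[OF zB(1)] ij(1) lt]) (erule \<Sigma>)+
    then have "z' \<in> slope_set d \<Sigma> \<eta> i j sg (\<kappa> i)" using compat[OF ij] z z' by blast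
    then show ?thesis
      by (rule slope_set_derivative(2)[OF openB _ _ zB(2) S[OF zB(2)] ij(1), rotated -1]) (erule \<Sigma>)+
  qed
  have line: "vsnoc d u t + x *\<^sub>R unitv i \<in> B2" if "i < d" "0 < t" "t < \<tau>" "0 \<le> x" "x < r" for i t x
  proof -
    have "vtrunc d (vsnoc d u t + x *\<^sub>R unitv i) = u + x *\<^sub>R unitv i"
      using that(1) w(1) by (intro evec_eqI) (auto simp: Rn_iff)
    then show ?thesis using that by (auto simp: B2_def wing_box_def dist_norm)
  qed
  have vert: "vsnoc d u 0 + t *\<^sub>R unitv d = vsnoc d u t" for t by (intro evec_eqI) auto
  have vertB: "vsnoc d u t \<in> B2" if "0 < t" "t < \<tau>" for t
    using that w(1,2) by (simp add: B2_def wing_box_def)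
  have sg_abs: "\<bar>sg * a\<bar> = \<bar>a\<bar>" if "sg \<in> {1, -1}" for sg a :: real using that by auto
  have gsmall: "\<bar>coord (?g z) j\<bar> \<le> coord z d" if "z \<in> B" for z j
    using abs_coord_le_norm[of "?g z" j] small[OF that] by simp
  have hor: "\<not> \<eta> * coord z d < coord z d * (sg * coord (S z (unitv i)) j)"
    if z: "z \<in> B2" and ij: "i < d" "j < n" "sg \<in> {1, -1}" for z i j sg
  proof
    assume lt: "\<eta> * coord z d < coord z d * (sg * coord (S z (unitv i)) j)"
    have ki: "\<kappa> i = 0" using ij(1) by (simp add: \<kappa>_def)
    have ge: "\<eta> \<le> sg * coord (S z' (unitv i)) j" if z': "z' \<in> B2" for z'
    proof -
      have "coord z' d * \<eta> \<le> coord z' d * (sg * coord (S z' (unitv i)) j)"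
        using everywhere[OF z _ z', of i sg j] lt ij ki by (simp add: mult.commute)
      moreover have "coord z' d > 0" using tpos z' B2B by blast
      ultimately show ?thesis by (simp only: mult_le_cancel_left_pos)
    qed
    define l where "l = r / 2"
    \<comment> \<open>The quarter gives 4 t \<le> \<eta> l, which excludes \<eta> l \<le> 2
      t.\<close>
    define t where "t = min (\<tau> / 2) (\<eta> * l / 4)"
    have l: "0 < l" "l < r" using w(2) by (auto simp: l_def)
    have t: "0 < t" "t < \<tau>" "4 * t \<le> \<eta> * l" using \<tau> \<eta> l by (auto simp: t_def)
    have mem: "vsnoc d u t + x *\<^sub>R unitv i \<in> B2" if "0 \<le> x" "x \<le> l" for x
      using line[OF ij(1) t(1,2)] that l by simp
    have "\<eta> * l \<le> 2 * t"
    proof (rule no_large_horizontal_derivative[of l "\<lambda>x. sg * coord (?g (vsnoc d u t + x *\<^sub>R unitv i)) j"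
          "\<lambda>x. sg * coord (S (vsnoc d u t + x *\<^sub>R unitv i) (unitv i)) j"])
      fix x assume x: "0 \<le> x" "x \<le> l"
      have xB: "vsnoc d u t + x *\<^sub>R unitv i \<in> B" using mem[OF x] B2B by blast
      show "((\<lambda>x. sg * coord (?g (vsnoc d u t + x *\<^sub>R unitv i)) j) has_real_derivative
          sg * coord (S (vsnoc d u t + x *\<^sub>R unitv i) (unitv i)) j) (at x)"
        by (rule DERIV_cmult, rule has_real_derivative_along_unitv[OF openB xB _ _ S[OF xB]]) (use ij in auto)
      show "\<eta> \<le> sg * coord (S (vsnoc d u t + x *\<^sub>R unitv i) (unitv i)) j" by (rule ge[OF mem[OF x]])
      have "coord (vsnoc d u t + x *\<^sub>R unitv i) d = t" using ij(1) by simp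
      then show "\<bar>sg * coord (?g (vsnoc d u t + x *\<^sub>R unitv i)) j\<bar> \<le> t"
        using gsmall[OF xB, of j] sg_abs[OF ij(3)] by metis
    qed (rule l(1))
    then show False using t by simp
  qed
  have ver: "\<not> \<eta> * coord z d + sg * coord (?g z) j < coord z d * (sg * coord (S z (unitv d)) j)"
    if z: "z \<in> B2" and ij: "j < n" "sg \<in> {1, -1}" for z j sg
  proof
    assume lt: "\<eta> * coord z d + sg * coord (?g z) j < coord z d * (sg * coord (S z (unitv d)) j)"
    have kd: "\<kappa> d = 1" by (simp add: \<kappa>_def)
    show False
    proof (rule no_large_radial_derivative[of \<tau> "\<lambda>t. sg * coord (?g (vsnoc d u t)) j"
          "\<lambda>t. sg * coord (S (vsnoc d u t) (unitv d)) j" \<eta>])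
      fix t assume t: "0 < t" "t < \<tau>"
      have tB: "vsnoc d u t \<in> B" using vertB[OF t] B2B by blast
      have ct: "coord (vsnoc d u t) d = t" by simp
      show "((\<lambda>t. sg * coord (?g (vsnoc d u t)) j) has_real_derivative sg * coord (S (vsnoc d u t) (unitv d)) j) (at t)"
        using DERIV_cmult[OF has_real_derivative_along_unitv[OF openB, of "vsnoc d u 0" t d ?g "S (vsnoc d u t)" j], of sg]
          tB S[OF tB] unfolding vert by simp
      show "\<eta> * t + sg * coord (?g (vsnoc d u t)) j \<le> t * (sg * coord (S (vsnoc d u t) (unitv d)) j)"
        using everywhere[OF z _ vertB[OF t], of d sg j] lt ij kd ct by simp
      show "\<bar>sg * coord (?g (vsnoc d u t)) j\<bar> \<le> t" using gsmall[OF tB, of j] sg_abs[OF ij(2)] ct by metis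
    qed (use \<eta> \<tau> in auto)
  qed
  define z where "z = vsnoc d u (\<tau> / 2)"
  have z: "z \<in> B2" unfolding z_def using \<tau> by (intro vertB) auto
  have zB: "z \<in> B" using z B2B by blast
  have "\<bar>coord (S z (unitv i)) j\<bar> \<le> \<eta>" if "i < d" "j < n" for i j
  proof -
    have le: "sg * coord (S z (unitv i)) j \<le> \<eta>" if "sg \<in> {1, -1}" for sg
    proof -
      have "coord z d * (sg * coord (S z (unitv i)) j) \<le> coord z d * \<eta>"
        using hor[OF z \<open>i < d\<close> \<open>j < n\<close> that] by (simp add: mult.commute)
      then show ?thesis using tpos[OF zB] by (simp only: mult_le_cancel_left_pos)
    qed
    show ?thesis using le[of 1] le[of "-1"] by simp
  qed
  moreover have "\<bar>coord z d * coord (S z (unitv d)) j - coord (?g z) j\<bar> \<le> \<eta> * coord z d" if "j < n" for j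
    using ver[OF z that, of 1] ver[OF z that, of "-1"] by simp
  ultimately show ?thesis using zB by blast
qed


text \<open>The bad points near the patch are described by triples (u, t, y), where u are the
  parameters of the base point a, y = b - a is the offset and t = |y|. A section of this set over a
  box is the wing.\<close>

lemma patch_wing:
  assumes adm: "admits_cell_decompositions D q" and q: "q \<noteq> C_fin 0"
    and patch: "patch n d U P \<sigma> C \<Gamma> W"
    and \<Lambda>: "submanifold q n d1 \<Lambda>" "\<Lambda> \<in> D n" and \<Gamma>: "submanifold q n d2 \<Gamma>" "\<Gamma> \<in> D n" and C: "C \<in> D n"
    and disj: "\<Lambda> \<inter> \<Gamma> = {}" and V: "open_in_Rn d V" "V \<noteq> {}" "V \<subseteq> U"
    and bad: "\<And>u \<delta>. u \<in> V \<Longrightarrow> \<delta> > 0 \<Longrightarrow> \<exists>b. patch.bad n d \<sigma> C \<Gamma> \<Lambda> e b \<and> dist (P u) b < \<delta>"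
  obtains u r \<tau> \<Sigma> s where "u \<in> Rn d" "r > 0" "\<tau> > 0" "Rn d \<inter> ball u r \<subseteq> V" "\<Sigma> \<in> D (Suc d + n)"
    "sC1 (wing_box d u r \<tau>) s"
    "\<And>z. z \<in> wing_box d u r \<tau> \<Longrightarrow> s z \<in> \<Sigma> \<and> vtrunc (Suc d) (s z) = z"
    "\<And>y. y \<in> \<Sigma> \<Longrightarrow> y = s (vtrunc (Suc d) y)"
    "\<And>z. z \<in> wing_box d u r \<tau> \<Longrightarrow> norm (vdrop (Suc d) (s z)) = coord z d"
    "\<And>z. z \<in> wing_box d u r \<tau> \<Longrightarrow> patch.\<pi> d \<sigma> (vdrop (Suc d) (s z)) = 0"
    "\<And>z. z \<in> wing_box d u r \<tau> \<Longrightarrow> patch.bad n d \<sigma> C \<Gamma> \<Lambda> e (P (vtrunc d z) + vdrop (Suc d) (s z))"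
proof -
  interpret patch n d U P \<sigma> C \<Gamma> W by (rule patch)
  \<comment> \<open>The fibre of A over (u, t) consists of the offsets y of length t, orthogonal to
    the d parameter coordinates, for which the point over u moved by y is bad.\<close>
  define A where "A = {z \<in> Rn (Suc d + n). \<exists>a\<in>C. (\<forall>i<d. coord a (\<sigma> i) = coord z i) \<and>
    (\<forall>i<d. coord (vdrop (Suc d) z) (\<sigma> i) = 0) \<and> norm (vdrop (Suc d) z) = coord z d \<and> bad \<Lambda> e (a + vdrop (Suc d) z)}"
  have "Def (Suc d + n) (\<lambda>z. \<exists>a\<in>C. (\<forall>i<d. coord a (\<sigma> i) = coord z i) \<and>
    (\<forall>i<d. coord (vdrop (Suc d) z) (\<sigma> i) = 0) \<and> norm (vdrop (Suc d) z) = coord z d \<and> bad \<Lambda> e (a + vdrop (Suc d) z))"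
    by (intro Def_intros Def_bex[OF C] Def_all_less dterm_norm[where k = n] Def_bad[OF patch q \<Lambda> \<Gamma> C])
       (auto simp: dvec_def Rn_iff \<sigma> trans_less_add1 intro!: dterm_coord_self)
  then have AD: "A \<in> D (Suc d + n)" by (simp add: A_def Def_def)
  obtain u r \<tau> where w: "u \<in> Rn d" "r > 0" "\<tau> > 0" "Rn d \<inter> ball u r \<subseteq> V"
    "(\<forall>z\<in>A. vtrunc (Suc d) z \<notin> wing_box d u r \<tau>) \<or>
     (\<exists>\<Sigma> s. \<Sigma> \<in> D (Suc d + n) \<and> \<Sigma> \<subseteq> A \<and> sC1 (wing_box d u r \<tau>) s \<and>
        (\<forall>z\<in>wing_box d u r \<tau>. s z \<in> \<Sigma> \<and> vtrunc (Suc d) (s z) = z) \<and>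
        (\<forall>y\<in>\<Sigma>. y = s (vtrunc (Suc d) y)))"
    by (rule wing[OF adm q AD V(1,2)])
  have uV: "u \<in> V" using w(1,2,4) by auto
  have uU: "u \<in> U" using uV V(3) by blast
  \<comment> \<open>Bad points accumulate at P u, and the triple of one close enough lies over the
    box, so \<open>wing\<close> yields a section.\<close>
  have met: "\<not> (\<forall>z\<in>A. vtrunc (Suc d) z \<notin> wing_box d u r \<tau>)"
  proof
    assume none: "\<forall>z\<in>A. vtrunc (Suc d) z \<notin> wing_box d u r \<tau>"
    have "continuous_on U P" by (rule sC1_continuous_on[OF P])
    then obtain r2 where r2: "r2 > 0" "\<And>v. v \<in> U \<Longrightarrow> dist v u < r2 \<Longrightarrow> dist (P v) (P u) < \<tau> / 2"
      using uU w(3) unfolding continuous_on_iff by (meson half_gt_zero)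
    define m where "m = min r r2"
    have m: "m > 0" using w(2) r2(1) by (simp add: m_def)
    \<comment> \<open>The map \<pi> enlarges norms by at most d, so the parameters of b stay within
      m of u. The length of the offset splits into the displacement of the base point and the
      distance from P u to b, each below \<tau> / 2.\<close>
    define \<delta> where "\<delta> = min (\<tau> / 2) (m / (real d + 1))"
    have \<delta>: "\<delta> > 0" using w(3) m by (simp add: \<delta>_def)
    obtain b where b: "bad \<Lambda> e b" "dist (P u) b < \<delta>" using bad[OF uV \<delta>] by blast
    obtain a where a: "a \<in> C" "\<forall>i<d. coord a (\<sigma> i) = coord b (\<sigma> i)" and b\<Lambda>: "b \<in> \<Lambda>"
      using b(1) unfolding bad_def by blast
    define v where "v = \<pi> b"
    have \<pi>a: "\<pi> a = v" unfolding v_def using a(2) by (intro evec_eqI) (simp add: coord_\<pi>)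
    have v: "v \<in> U" "P v = a" using P\<pi>[OF a(1)] \<pi>a by auto
    have "norm (\<pi> (P u - b)) \<le> real d * norm (P u - b)" by (rule norm_\<pi>)
    also have "\<dots> \<le> (real d + 1) * norm (P u - b)" by (intro mult_right_mono) auto
    also have "\<dots> < (real d + 1) * (m / (real d + 1))"
      using b(2) by (intro mult_strict_left_mono) (auto simp: dist_norm \<delta>_def)
    finally have uv: "dist u v < m" using \<pi>P[OF uU] by (simp add: \<pi>_diff v_def dist_norm)
    define y where "y = b - a"
    have "dist a b \<le> dist (P v) (P u) + dist (P u) b" using dist_triangle[of "P v" b "P u"] v(2) by simp
    also have "\<dots> < \<tau> / 2 + \<tau> / 2"
      using r2(2)[OF v(1)] uv b(2) by (intro add_strict_mono) (auto simp: m_def \<delta>_def dist_commute)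
    finally have y\<tau>: "norm y < \<tau>" by (simp add: y_def dist_norm norm_minus_commute)
    have "a \<in> \<Gamma>" using a(1) C\<Gamma> by blast
    \<comment> \<open>Disjointness of \<Lambda> and \<Gamma> gives t > 0, so that the triple lies
      over the open box and not over its bottom face.\<close>
    then have y0: "norm y > 0" using b\<Lambda> disj by (auto simp: y_def)
    have vR: "v \<in> Rn d" using v(1) UR by blast
    have "a \<in> Rn n" "b \<in> Rn n" using D_subset_Rn[OF \<Lambda>(2)] b\<Lambda> \<Gamma>R \<open>a \<in> \<Gamma>\<close> by auto
    then have yR: "y \<in> Rn n" by (simp add: y_def)
    define z where "z = vjoin (Suc d) (vsnoc d v (norm y)) y"
    have zR: "z \<in> Rn (Suc d + n)" unfolding z_def by (rule Rn_intros(8)[OF Rn_intros(9) yR])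
    have z1: "vtrunc (Suc d) z = vsnoc d v (norm y)" unfolding z_def by (rule vtrunc_vjoin[OF Rn_intros(9)])
    have z2: "vdrop (Suc d) z = y" unfolding z_def by (rule vdrop_vjoin)
    have z3: "coord z d = norm y" by (simp add: z_def)
    have z4: "coord a (\<sigma> i) = coord z i" if "i < d" for i
    proof -
      have "coord (\<pi> a) i = coord v i" using \<pi>a by simp
      then show ?thesis using that by (simp add: coord_\<pi> z_def)
    qed
    have z5: "coord y (\<sigma> i) = 0" if "i < d" for i using a(2) that by (simp add: y_def)
    have "a + y = b" by (simp add: y_def)
    then have "bad \<Lambda> e (a + vdrop (Suc d) z)" using b(1) z2 by simp
    then have "z \<in> A" unfolding A_def using zR z2 z3 z4 z5 by (intro CollectI conjI bexI[OF _ a(1)]) auto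
    moreover have "vtrunc (Suc d) z \<in> wing_box d u r \<tau>"
      unfolding z1 using vR uv y0 y\<tau> by (simp add: wing_box_def m_def)
    ultimately show False using none by blast
  qed
  have "\<exists>\<Sigma> s. \<Sigma> \<in> D (Suc d + n) \<and> \<Sigma> \<subseteq> A \<and> sC1 (wing_box d u r \<tau>) s \<and>
        (\<forall>z\<in>wing_box d u r \<tau>. s z \<in> \<Sigma> \<and> vtrunc (Suc d) (s z) = z) \<and>
        (\<forall>y\<in>\<Sigma>. y = s (vtrunc (Suc d) y))" by (rule mp[OF disj_imp[THEN iffD1, OF w(5)] met])
  then obtain \<Sigma> s where \<Sigma>0: "\<Sigma> \<in> D (Suc d + n) \<and> \<Sigma> \<subseteq> A \<and> sC1 (wing_box d u r \<tau>) s \<and>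
        (\<forall>z\<in>wing_box d u r \<tau>. s z \<in> \<Sigma> \<and> vtrunc (Suc d) (s z) = z) \<and>
        (\<forall>y\<in>\<Sigma>. y = s (vtrunc (Suc d) y))" by (elim exE) (rule that)
  note \<Sigma> = \<Sigma>0[THEN conjunct1] \<Sigma>0[THEN conjunct2, THEN conjunct1]
    \<Sigma>0[THEN conjunct2, THEN conjunct2, THEN conjunct1]
    \<Sigma>0[THEN conjunct2, THEN conjunct2, THEN conjunct2, THEN conjunct1, THEN bspec]
    \<Sigma>0[THEN conjunct2, THEN conjunct2, THEN conjunct2, THEN conjunct2, THEN bspec]
  have facts: "norm (vdrop (Suc d) (s z)) = coord z d \<and> \<pi> (vdrop (Suc d) (s z)) = 0 \<and>
      bad \<Lambda> e (P (vtrunc d z) + vdrop (Suc d) (s z))" if z: "z \<in> wing_box d u r \<tau>" for z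
  proof -
    have sz: "s z \<in> A" "vtrunc (Suc d) (s z) = z" using \<Sigma>(4)[OF z] \<Sigma>(2) by auto
    have cz: "coord (s z) i = coord z i" if "i < Suc d" for i
    proof -
      have "coord (vtrunc (Suc d) (s z)) i = coord z i" using sz(2) by simp
      then show ?thesis using that by simp
    qed
    obtain a where a: "a \<in> C" "\<And>i. i < d \<Longrightarrow> coord a (\<sigma> i) = coord (s z) i"
      "\<And>i. i < d \<Longrightarrow> coord (vdrop (Suc d) (s z)) (\<sigma> i) = 0" "norm (vdrop (Suc d) (s z)) = coord (s z) d"
      "bad \<Lambda> e (a + vdrop (Suc d) (s z))" using sz(1) unfolding A_def by blast
    have "\<pi> a = vtrunc d z" using a(2) cz by (intro evec_eqI) (simp add: coord_\<pi>)
    then have "P (vtrunc d z) = a" using P\<pi>(2)[OF a(1)] by simp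
    moreover have "\<pi> (vdrop (Suc d) (s z)) = 0" using a(3) by (intro evec_eqI) (simp only: coord_\<pi> coord_simps if_cancel split: if_split, simp)
    ultimately show ?thesis using a(4,5) cz[of d] by simp
  qed
  show ?thesis
    by (rule that[OF w(1-4) \<Sigma>(1) \<Sigma>(3)]) (use \<Sigma>(4,5) facts in \<open>simp_all only: simp_thms\<close>)
qed

text \<open>Failure on an open part of \<Gamma> is localized to a patch and made uniform in e. The
  resulting wing consists of bad points, but a point where its derivatives are conelike cannot be
  bad.\<close>

lemma generic_condition_whitney_B:
  assumes adm: "admits_cell_decompositions D q" and q: "q \<noteq> C_fin 0"
  shows "generic_condition D q whitney_B"
  unfolding generic_condition_def
proof (intro allI impI, elim conjE, rule ccontr)
  fix n \<Lambda> \<Gamma> assume adj: "adjacent q n \<Lambda> \<Gamma>" and DD: "\<Lambda> \<in> D n" "\<Gamma> \<in> D n"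
  obtain d1 where \<Lambda>: "submanifold q n d1 \<Lambda>" using adj by (auto simp: adjacent_def is_submanifold_def)
  obtain d2 where \<Gamma>: "submanifold q n d2 \<Gamma>" using adj by (auto simp: adjacent_def is_submanifold_def)
  have R: "\<Lambda> \<subseteq> Rn n" "\<Gamma> \<subseteq> Rn n" using D_subset_Rn DD by auto
  have disj: "\<Lambda> \<inter> \<Gamma> = {}" using adj by (auto simp: adjacent_def)
  define B0 where "B0 = {x \<in> \<Gamma>. \<not> whitney_B n \<Lambda> \<Gamma> x}"
  define G where "G = top_of_set \<Gamma> interior_of (top_of_set \<Gamma> closure_of B0)"
  assume "top_of_set \<Gamma> interior_of (top_of_set \<Gamma> closure_of {x \<in> \<Gamma>. \<not> whitney_B n \<Lambda> \<Gamma> x}) \<noteq> {}"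
  then have G: "openin (top_of_set \<Gamma>) G" "G \<noteq> {}" unfolding G_def B0_def by auto
  have "G \<subseteq> top_of_set \<Gamma> closure_of B0" unfolding G_def by (rule interior_of_subset)
  also have "\<dots> \<subseteq> closure B0"
    by (simp add: closure_of_subtopology euclidean_closure_of closure_mono le_infI2)
  finally have Gcl: "G \<subseteq> closure B0" .
  have "{x \<in> \<Gamma>. whitney_B n \<Lambda> \<Gamma> x} \<in> D n"
    using definable_condition_whitney_B[OF q] adj DD unfolding definable_condition_def by blast
  from Def_conj[OF D_imp_Def[OF DD(2)] Def_not[OF D_imp_Def[OF this]]]
  have "{x \<in> Rn n. x \<in> \<Gamma> \<and> x \<notin> {x \<in> \<Gamma>. whitney_B n \<Lambda> \<Gamma> x}} \<in> D n" by (simp add: Def_def)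
  moreover have "{x \<in> Rn n. x \<in> \<Gamma> \<and> x \<notin> {x \<in> \<Gamma>. whitney_B n \<Lambda> \<Gamma> x}} = B0" using R by (auto simp: B0_def)
  ultimately have B0D: "B0 \<in> D n" by simp
  then have fam: "finite {B0} \<and> {B0} \<subseteq> D n" by simp
  obtain \<C> where \<C>: "cell_decomposition D q n \<C>" and compat: "\<forall>B\<in>{B0}. \<forall>C\<in>\<C>. C \<subseteq> B \<or> C \<inter> B = {}"
    using adm[unfolded admits_cell_decompositions_def, rule_format, OF fam] by blast
  note c = cell_decomposition_cells[OF \<C>]
  define \<C>B where "\<C>B = {C \<in> \<C>. C \<subseteq> B0}"
  have B0sub: "B0 \<subseteq> \<Union>\<C>B"
  proof
    fix x assume x: "x \<in> B0"
    then have "x \<in> \<Union>\<C>" using c(2) R by (auto simp: B0_def)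
    then obtain K where K: "K \<in> \<C>" "x \<in> K" by blast
    then have "K \<subseteq> B0" using compat x by blast
    then show "x \<in> \<Union>\<C>B" using K by (auto simp: \<C>B_def)
  qed
  \<comment> \<open>The cells contained in the failure set are dense in G, so one of them contains a
    nonempty relatively open part G' of \<Gamma> and parametrizes \<Gamma> there.\<close>
  obtain C G' where C\<C>: "C \<in> \<C>B" and G': "openin (top_of_set \<Gamma>) G'" "G' \<noteq> {}" "G' \<subseteq> G" "G' \<subseteq> C"
  proof (rule finite_union_interior[of \<C>B, OF _ G])
    show "finite \<C>B" using c(1) by (simp add: \<C>B_def)
    show "G \<subseteq> closure (\<Union>\<C>B)" using Gcl closure_mono[OF B0sub] by (rule subset_trans)
    show "\<exists>W. open W \<and> x \<in> W \<and> closure C \<inter> W \<subseteq> C" if "C \<in> \<C>B" "x \<in> C" for C x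
      by (rule cell_open_in_closure[OF c(3) q that(2)]) (use that(1) in \<open>simp add: \<C>B_def\<close>)
    show "C \<subseteq> \<Gamma>" if "C \<in> \<C>B" for C using that by (auto simp: \<C>B_def B0_def)
  qed (rule that)
  have C: "Cq_cell D q n C" "C \<subseteq> B0" using C\<C> c(3) by (auto simp: \<C>B_def)
  have CD: "C \<in> D n" by (rule cell_in_D[OF C(1) q])
  obtain d U P \<sigma> where param: "open_in_Rn d U \<and> P ` U = C \<and> sC1 U P \<and> (\<forall>i<d. \<sigma> i < n)
    \<and> (\<forall>u\<in>U. select d (\<lambda>i. coord (P u) (\<sigma> i)) = u)"
    using cell_parametrization[OF C(1) q] by (elim exE) (rule that)
  obtain W where GW: "open W" "G' = \<Gamma> \<inter> W" using G'(1) by (auto simp: openin_open)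
  have patch: "patch n d U P \<sigma> C \<Gamma> W"
    by unfold_locales (use param GW G'(4) R(2) C(2) in \<open>auto simp: B0_def\<close>)
  interpret patch n d U P \<sigma> C \<Gamma> W by (rule patch)
  define V0 where "V0 = U \<inter> P -` W"
  have V0: "open_in_Rn d V0"
    unfolding V0_def using continuous_openin_preimage_gen[OF sC1_continuous_on[OF P] GW(1)] U by (rule openin_trans)
  have V0ne: "V0 \<noteq> {}"
  proof -
    obtain x where x: "x \<in> G'" using G'(2) by blast
    then obtain u where "u \<in> U" "x = P u" using G'(4) PU by blast
    then show ?thesis using x GW(2) by (auto simp: V0_def)
  qed
  have sub: "subspace (tangent_space \<Lambda> y)" if "y \<in> \<Lambda>" for y
    using submanifold_tangent_space[OF \<Lambda> q that] by (simp add: grassmannian_def)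
  have ex_bad: "\<exists>e>0. \<forall>\<delta>>0. \<exists>b. bad \<Lambda> e b \<and> dist (P u) b < \<delta>" if u: "u \<in> V0" for u
  proof (rule ccontr)
    assume no: "\<not> ?thesis"
    have "whitney_eps \<Lambda> \<Gamma> (P u)"
    proof (rule whitney_eps_if_not_bad[OF sub R(1)])
      show "u \<in> U" "P u \<in> W" using u by (auto simp: V0_def)
      show "\<exists>\<delta>>0. \<forall>b. bad \<Lambda> e b \<longrightarrow> \<delta> \<le> dist (P u) b" if "e > 0" for e
        using no that by (meson not_le)
    qed
    then have "whitney_B n \<Lambda> \<Gamma> (P u)" by (rule whitney_eps_imp_whitney_B)
    moreover have "P u \<in> B0" using u PC C(2) by (auto simp: V0_def)
    ultimately show False by (simp add: B0_def)
  qed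
  \<comment> \<open>The last coordinate of z plays the role of e: S consists of the pairs (u, e)
    such that points bad for e accumulate at the point of C with parameters u.\<close>
  define S where "S = {z \<in> Rn (Suc d). \<forall>\<delta>. 0 < \<delta> \<longrightarrow> (\<exists>a\<in>C. (\<forall>i<d. coord a (\<sigma> i) = coord z i) \<and>
    (\<exists>b\<in>\<Lambda>. bad \<Lambda> (coord z d) b \<and> norm (a - b) < \<delta>))}"
  have "Def (Suc d) (\<lambda>z. \<forall>\<delta>. 0 < \<delta> \<longrightarrow> (\<exists>a\<in>C. (\<forall>i<d. coord a (\<sigma> i) = coord z i) \<and>
    (\<exists>b\<in>\<Lambda>. bad \<Lambda> (coord z d) b \<and> norm (a - b) < \<delta>)))"
    by (intro Def_intros Def_bex[OF CD] Def_bex[OF DD(1)] Def_all_less dterm_norm[where k = n]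
          Def_bad[OF patch q \<Lambda> DD(1) \<Gamma> DD(2) CD])
       (auto simp: dvec_def Rn_iff \<sigma> trans_less_add1 intro!: dterm_coord_self)
  then have SD: "S \<in> D (Suc d)" by (simp add: S_def Def_def)
  have "\<exists>u r \<tau>. u \<in> Rn d \<and> r > 0 \<and> \<tau> > 0 \<and> Rn d \<inter> ball u r \<subseteq> V0 \<and>
    (\<forall>A\<in>{S}. wing_box d u r \<tau> \<subseteq> A \<or> wing_box d u r \<tau> \<inter> A = {})"
    by (rule wing_box_compatible[OF adm q _ _ V0 V0ne]) (use SD in auto)
  then obtain u0 r0 \<tau>0 where w0: "u0 \<in> Rn d" "r0 > 0" "\<tau>0 > 0" "Rn d \<inter> ball u0 r0 \<subseteq> V0"
    "wing_box d u0 r0 \<tau>0 \<subseteq> S \<or> wing_box d u0 r0 \<tau>0 \<inter> S = {}" by auto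
  define V1 where "V1 = Rn d \<inter> ball u0 r0"
  have V1: "open_in_Rn d V1" "V1 \<noteq> {}" "V1 \<subseteq> V0" using w0(1,2,4) by (auto simp: V1_def intro: openin_open_Int)
  have V1U: "V1 \<subseteq> U" using V1(3) by (auto simp: V0_def)
  have u0V: "u0 \<in> V0" using w0(1,2,4) by auto
  obtain e where e: "e > 0" "\<And>\<delta>. \<delta> > 0 \<Longrightarrow> \<exists>b. bad \<Lambda> e b \<and> dist (P u0) b < \<delta>" using ex_bad[OF u0V] by blast
  \<comment> \<open>A point bad for e is bad for every smaller constant, so e may be lowered below
    the height of the box; this shows that the box meets S.\<close>
  define e' where "e' = min e (\<tau>0 / 2)"
  have "vsnoc d u0 e' \<in> wing_box d u0 r0 \<tau>0" using w0(1-3) e(1) by (auto simp: wing_box_def e'_def)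
  moreover have "vsnoc d u0 e' \<in> S"
    unfolding S_def
  proof (intro CollectI conjI allI impI)
    fix \<delta> :: real assume "0 < \<delta>"
    then obtain b where b: "bad \<Lambda> e b" "dist (P u0) b < \<delta>" using e(2) by blast
    have "bad \<Lambda> e' b" by (rule bad_mono[OF b(1)]) (simp add: e'_def)
    moreover have "b \<in> \<Lambda>" using b(1) by (simp add: bad_def)
    ultimately have ex: "\<exists>b\<in>\<Lambda>. bad \<Lambda> (coord (vsnoc d u0 e') d) b \<and> norm (P u0 - b) < \<delta>"
      using b(2) by (intro bexI[of _ b]) (auto simp: dist_norm)
    have u0U: "u0 \<in> U" using u0V by (simp add: V0_def)
    have "coord (P u0) (\<sigma> i) = coord u0 i" if "i < d" for i
      using \<pi>P[OF u0U] coord_\<pi>[of "P u0" i] that by simp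
    then show "\<exists>a\<in>C. (\<forall>i<d. coord a (\<sigma> i) = coord (vsnoc d u0 e') i) \<and>
        (\<exists>b\<in>\<Lambda>. bad \<Lambda> (coord (vsnoc d u0 e') d) b \<and> norm (a - b) < \<delta>)"
      by (intro bexI[OF _ PC[OF u0U]] conjI ex) simp
  qed auto
  ultimately have boxS: "wing_box d u0 r0 \<tau>0 \<subseteq> S" using w0(5) by blast
  \<comment> \<open>The whole box lies in S, so any fixed constant between 0 and \<tau>0 serves for
    all parameters in V1 at once.\<close>
  define e0 where "e0 = \<tau>0 / 2"
  have e0: "e0 > 0" using w0(3) by (simp add: e0_def)
  have bad_e0: "\<exists>b. bad \<Lambda> e0 b \<and> dist (P u) b < \<delta>" if u: "u \<in> V1" and \<delta>: "\<delta> > 0" for u \<delta>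
  proof -
    have uR: "u \<in> Rn d" "u \<in> U" using u V1U by (auto simp: V1_def)
    have "vsnoc d u e0 \<in> wing_box d u0 r0 \<tau>0" using u w0(3) by (auto simp: wing_box_def V1_def e0_def)
    then have "vsnoc d u e0 \<in> S" using boxS by blast
    then obtain a b where a: "a \<in> C" "\<forall>i<d. coord a (\<sigma> i) = coord (vsnoc d u e0) i"
      and b: "bad \<Lambda> (coord (vsnoc d u e0) d) b" "norm (a - b) < \<delta>" using \<delta> unfolding S_def by blast
    have "\<pi> a = u" using a(2) uR(1) by (intro evec_eqI) (auto simp: coord_\<pi> Rn_iff)
    then have "a = P u" using P\<pi>(2)[OF a(1)] by simp
    then show ?thesis using b by (auto simp: dist_norm)
  qed
  obtain u r \<tau> \<Sigma> s where wing: "u \<in> Rn d" "r > 0" "\<tau> > 0" "Rn d \<inter> ball u r \<subseteq> V1" "\<Sigma> \<in> D (Suc d + n)"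
    "sC1 (wing_box d u r \<tau>) s"
    "\<And>z. z \<in> wing_box d u r \<tau> \<Longrightarrow> s z \<in> \<Sigma> \<and> vtrunc (Suc d) (s z) = z"
    "\<And>y. y \<in> \<Sigma> \<Longrightarrow> y = s (vtrunc (Suc d) y)"
    "\<And>z. z \<in> wing_box d u r \<tau> \<Longrightarrow> norm (vdrop (Suc d) (s z)) = coord z d"
    "\<And>z. z \<in> wing_box d u r \<tau> \<Longrightarrow> \<pi> (vdrop (Suc d) (s z)) = 0"
    "\<And>z. z \<in> wing_box d u r \<tau> \<Longrightarrow> bad \<Lambda> e0 (P (vtrunc d z) + vdrop (Suc d) (s z))"
    by (rule patch_wing[OF adm q patch \<Lambda> DD(1) \<Gamma> DD(2) CD disj V1(1,2) V1U bad_e0]) (assumption | rule that)+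
  define B where "B = wing_box d u r \<tau>"
  have "sC1 B (\<lambda>y. vdrop (Suc d) (s y))"
    unfolding B_def by (rule sC1_linear_image[OF bounded_linear_vdrop wing(6)])
  then have "\<exists>S. \<forall>z\<in>B. sdiff B (\<lambda>y. vdrop (Suc d) (s y)) z (S z)" unfolding sC1_def by metis
  then obtain S' where S': "\<And>z. z \<in> B \<Longrightarrow> sdiff B (\<lambda>y. vdrop (Suc d) (s y)) z (S' z)" by blast
  \<comment> \<open>Keeps both n d \<eta> and n \<eta>, the total errors over all components in
    \<open>not_bad_on_wing\<close>, below e0; the summand 1 covers n = 0 and makes the inequality
    strict.\<close>
  define \<eta> where "\<eta> = e0 / (real (n * d + n) + 1)"
  have pos: "real (n * d + n) + 1 > 0" by (rule add_nonneg_pos) auto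
  have \<eta>: "\<eta> > 0" unfolding \<eta>_def by (rule divide_pos_pos[OF e0 pos])
  have \<eta>e: "\<eta> * (real (n * d + n) + 1) = e0" using pos by (simp add: \<eta>_def del: of_nat_add of_nat_mult)
  have "real (n * d) * \<eta> + real n * \<eta> < e0"
    using \<eta> \<eta>e by (simp add: algebra_simps)
  moreover have "0 \<le> real (n * d) * \<eta>" "0 \<le> real n * \<eta>" using \<eta> by simp_all
  ultimately have small: "real (n * d) * \<eta> < e0" "real n * \<eta> < e0" by linarith+
  have "\<exists>z\<in>B. (\<forall>i<d. \<forall>j<n. \<bar>coord (S' z (unitv i)) j\<bar> \<le> \<eta>) \<and>
    (\<forall>j<n. \<bar>coord z d * coord (S' z (unitv d)) j - coord (vdrop (Suc d) (s z)) j\<bar> \<le> \<eta> * coord z d)"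
    unfolding B_def
    by (rule wing_derivative_bounds[OF adm q wing(5,1-3) \<eta>])
       (use wing(7-9) S' in \<open>simp_all only: B_def\<close>)
  then obtain z where z: "z \<in> B" "\<And>i j. i < d \<Longrightarrow> j < n \<Longrightarrow> \<bar>coord (S' z (unitv i)) j\<bar> \<le> \<eta>"
    "\<And>j. j < n \<Longrightarrow> \<bar>coord z d * coord (S' z (unitv d)) j - coord (vdrop (Suc d) (s z)) j\<bar> \<le> \<eta> * coord z d" by blast
  have BV: "vtrunc d y \<in> V1" if "y \<in> B" for y using that wing(4) by (auto simp: B_def wing_box_def)
  have "\<not> bad \<Lambda> e0 (P (vtrunc d z) + vdrop (Suc d) (s z))"
  proof (rule not_bad_on_wing[OF z(1) _ _ S'[OF z(1)] _ _ _ _ _ _ z(2,3) small R(1)])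
    show "open_in_Rn (Suc d) B" unfolding B_def by (rule open_wing_box)
    show "vtrunc d ` B \<subseteq> U" using BV V1U by blast
    show "P (vtrunc d y) + vdrop (Suc d) (s y) \<in> \<Lambda>" if "y \<in> B" for y
      using wing(11)[of y] that unfolding bad_def B_def by blast
    show "vdrop (Suc d) (s y) \<in> Rn n" if "y \<in> B" for y
      using wing(7)[of y] that D_subset_Rn[OF wing(5)] unfolding B_def by (intro Rn_intros(7)) blast
    show "P (vtrunc d z) \<in> W" using BV[OF z(1)] V1(3) by (auto simp: V0_def)
    show "coord z d > 0" using z(1) by (simp add: B_def wing_box_def)
  qed (use wing(9,10) z(1) in \<open>auto simp: B_def\<close>)
  then show False using wing(11)[of z] z(1) by (simp add: B_def)
qed

end

theorem corollary4p8:
  fixes D :: "nat \<Rightarrow> evec set set" and q :: smoothness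
  assumes "o_minimal_structure D"
    and "q \<noteq> C_fin 0"
    and "admits_cell_decompositions D q"
  shows "WL_condition D q whitney_B"
proof -
  interpret o_minimal_structure D by (rule assms(1))
  show ?thesis
    unfolding WL_condition_def
    using local_condition_whitney_B definable_condition_whitney_B generic_condition_whitney_B
      diffeo_invariant_whitney_B projection_property_whitney_B lifting_property_whitney_B assms(2,3)
    by blast
qed

end
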